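(* Let $\Lambda$ be a finite-dimensional basic algebra over a field $k$ with Jacobson radical $J$ satisfying $J^n=0$. Let $e_1,\ldots,e_t$ be a complete set of primitive idempotents. For each $i,j$, set $D_i=e_i\Lambda e_i/e_iJe_i$, $D_j=e_j\Lambda e_j/e_jJe_j$, $V_{ij}=e_jJ^{n-1}e_i$, $r_{ij}=\dim_{D_i}V_{ij}$. Assume that $D_j\cong k$ whenever $V_{ij}\neq 0$, and that for every $i$ with $J^{n-1}P_i\neq 0$ (where $P_i=\Lambda e_i$) there exists at least one $j$ such that $r_{ij}\ge 3$. Let $$\mathfrak A^{\mathrm{top},1}(\Lambda)=\left\{\mathcal F^{<n,\mathrm{top},1}_{ij}\right\}_{i,j}$$ denote the labelled rank-one terminal ambiguity geometry, where $\mathcal F^{<n,\mathrm{top},1}_{ij}=\varnothing$ when $V_{ij}=0$. Then $\mathfrak A^{\mathrm{top},1}(\Lambda)$ determines and is determined by the terminal species $$\mathsf{Sp}^{\mathrm{top}}(\Lambda)=\bigl(D_i,{}_{D_j}V_{ij}{}_{D_i}\bigr)_{i,j},$$ up to the standard opposite-division-algebra ambiguity for the recovered residue division algebras. Equivalently, under the stated hypotheses, the labelled rank-one terminal ambiguity geometry and the terminal species determine one another.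
   Context: Modules are finite-dimensional left $\Lambda$-modules, $n\ge 1$, $J^0=\Lambda$; the $e_h$ are orthogonal, and basic means the modules $\Lambda e_h$ are pairwise non-isomorphic. Each $D_h$ is a division algebra and $V_{ij}$ is a $(D_j,D_i)$-bimodule by multiplication; $r_{ij}$ is its dimension as a right $D_i$-module. Rank-one fibre: for $V_{ij}\ne0$ and a left $D_j$-submodule $U\subseteq V_{ij}$ with $\dim_{D_j}(V_{ij}/U)=1$, put $M_U=P_i/(W_j\oplus U)$ with $W_j=\bigoplus_{h\ne j}e_hJ^{n-1}P_i$; $\mathcal F^{<n,\mathrm{top},1}_{ij}$ is the set of isomorphism classes of the modules $M_U$. Projective geometry on the fibre when $D_j\cong k$: $[\lambda]\mapsto [M_{\ker\lambda}]$ identifies the fibre with $\mathbb P_k(V_{ij}^* )/D_i^\times$, where $V_{ij}^*=\operatorname{Hom}_k(V_{ij},k)$ and $(a\cdot\lambda)(v)=\lambda(va^{-1})$. This is identified with $\mathbb P_{D_i}(\operatorname{Hom}_{D_i}(V_{ij},D_i^* ))$ by sending $\lambda$ to the map $v\mapsto(d\mapsto\lambda(vd))$, where $D_i^*=\operatorname{Hom}_k(D_i,k)$ has bimodule structure $(a\cdot\eta)(x)=\eta(xa)$, $(\eta\cdot a)(x)=\eta(ax)$, $\operatorname{Hom}_{D_i}$ denotes right $D_i$-linear maps, and $\mathbb P_D(W)$ is the set of one-dimensional left $D$-submodules of $W$. The projective linear subspaces of $\mathbb P_D(W)$ are the subsets $\mathbb P_D(U)$, $0\neq U\subseteq W$ a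 submodule; an isomorphism of projective geometries is a bijection preserving projective linear subspaces. "Determines" means that one labelled structure (labelled by the pairs $(i,j)$ of the fixed vertex set) can be recovered up to isomorphism from the other taken up to isomorphism. The "standard opposite-division-algebra ambiguity" means that a division algebra is recovered from a projective geometry only up to replacing it by its opposite, according to whether projective spaces are built from left or right modules.
   Formalization: D_h is compared only at vertices occurring in the terminal layer. An isomorphism of geometries recovers the D_h as rings and V_ij as right modules; the full species over k is recovered if cross-ratios in k are preserved too. Without these changes the claim fails. *)

theory Defs
  imports "HOL-Algebra.Module" "HOL-Algebra.QuotRing" "HOL-Algebra.Ideal_Product"
begin

section \<open>Modules over noncommutative rings\<close>

text \<open>
  The locale \<^locale>\<open>module\<close> assumes a commutative ring of scalars.  Left modules over arbitrary
  rings use the same record; its fields \<open>mult\<close> and \<open>one\<close> are irrelevant for modules.  A right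
  \<open>R\<close>-module is a left module over \<open>opp R\<close>.
\<close>

locale lmodule = R?: ring R + M?: abelian_group M
  for R :: "('r, 'p) ring_scheme" (structure) and M :: "('r, 'm, 'q) module_scheme" (structure) +
  assumes smult_closed [simp, intro]:
      "\<lbrakk> a \<in> carrier R; x \<in> carrier M \<rbrakk> \<Longrightarrow> a \<odot>\<^bsub>M\<^esub> x \<in> carrier M"
    and smult_l_distr:
      "\<lbrakk> a \<in> carrier R; b \<in> carrier R; x \<in> carrier M \<rbrakk> \<Longrightarrow>
      (a \<oplus>\<^bsub>R\<^esub> b) \<odot>\<^bsub>M\<^esub> x = a \<odot>\<^bsub>M\<^esub> x \<oplus>\<^bsub>M\<^esub> b \<odot>\<^bsub>M\<^esub> x"
    and smult_r_distr:
      "\<lbrakk> a \<in> carrier R; x \<in> carrier M; y \<in> carrier M \<rbrakk> \<Longrightarrow>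
      a \<odot>\<^bsub>M\<^esub> (x \<oplus>\<^bsub>M\<^esub> y) = a \<odot>\<^bsub>M\<^esub> x \<oplus>\<^bsub>M\<^esub> a \<odot>\<^bsub>M\<^esub> y"
    and smult_assoc1:
      "\<lbrakk> a \<in> carrier R; b \<in> carrier R; x \<in> carrier M \<rbrakk> \<Longrightarrow>
      (a \<otimes>\<^bsub>R\<^esub> b) \<odot>\<^bsub>M\<^esub> x = a \<odot>\<^bsub>M\<^esub> (b \<odot>\<^bsub>M\<^esub> x)"
    and smult_one [simp]:
      "x \<in> carrier M \<Longrightarrow> \<one>\<^bsub>R\<^esub> \<odot>\<^bsub>M\<^esub> x = x"

definition opp :: "('r, 'm) ring_scheme \<Rightarrow> ('r, 'm) ring_scheme" where
  "opp R = R\<lparr>mult := \<lambda>x y. y \<otimes>\<^bsub>R\<^esub> x\<rparr>"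

definition division_ring :: "('r, 'm) ring_scheme \<Rightarrow> bool" where
  "division_ring R \<longleftrightarrow> ring R \<and> Units R = carrier R - {\<zero>\<^bsub>R\<^esub>}"

definition regular :: "('r, 'm) ring_scheme \<Rightarrow> ('r, 'r) module" where
  "regular R = \<lparr>carrier = carrier R, mult = mult R, one = one R, zero = zero R, add = add R,
     smult = mult R\<rparr>"

text \<open>If \<open>M\<close> is an algebra and \<open>N\<close> a two-sided ideal, this is also the quotient algebra.\<close>

definition quot_mod :: "('r, 'm, 'z) module_scheme \<Rightarrow> 'm set \<Rightarrow> ('r, 'm set) module" where
  "quot_mod M N = \<lparr>carrier = a_rcosets\<^bsub>M\<^esub> N, mult = rcoset_mult M N, one = N +>\<^bsub>M\<^esub> \<one>\<^bsub>M\<^esub>,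
     zero = N, add = set_add M, smult = \<lambda>a X. N <+>\<^bsub>M\<^esub> ((\<lambda>x. a \<odot>\<^bsub>M\<^esub> x) ` X)\<rparr>"

definition semilinear_iso ::
  "('r, 'p) ring_scheme \<Rightarrow> ('r \<Rightarrow> 's) \<Rightarrow> ('r, 'm, 'y) module_scheme \<Rightarrow> ('s, 'n, 'z) module_scheme
    \<Rightarrow> ('m \<Rightarrow> 'n) set" where
  "semilinear_iso R \<sigma> M N = {f. bij_betw f (carrier M) (carrier N)
     \<and> (\<forall>x\<in>carrier M. \<forall>y\<in>carrier M. f (x \<oplus>\<^bsub>M\<^esub> y) = f x \<oplus>\<^bsub>N\<^esub> f y)
     \<and> (\<forall>a\<in>carrier R. \<forall>x\<in>carrier M. f (a \<odot>\<^bsub>M\<^esub> x) = \<sigma> a \<odot>\<^bsub>N\<^esub> f x)}"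

definition mod_isomorphic ::
  "('r, 'p) ring_scheme \<Rightarrow> ('r, 'm, 'y) module_scheme \<Rightarrow> ('r, 'n, 'z) module_scheme \<Rightarrow> bool" where
  "mod_isomorphic R M N \<longleftrightarrow> semilinear_iso R (\<lambda>a. a) M N \<noteq> {}"

definition linear_maps ::
  "('r, 'p) ring_scheme \<Rightarrow> ('r, 'm, 'y) module_scheme \<Rightarrow> ('r, 'n, 'z) module_scheme
    \<Rightarrow> ('m \<Rightarrow> 'n) set" where
  "linear_maps R M N = {f \<in> carrier M \<rightarrow>\<^sub>E carrier N.
     (\<forall>x\<in>carrier M. \<forall>y\<in>carrier M. f (x \<oplus>\<^bsub>M\<^esub> y) = f x \<oplus>\<^bsub>N\<^esub> f y)
     \<and> (\<forall>a\<in>carrier R. \<forall>x\<in>carrier M. f (a \<odot>\<^bsub>M\<^esub> x) = a \<odot>\<^bsub>N\<^esub> f x)}"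

definition mod_basis :: "('r, 'p) ring_scheme \<Rightarrow> ('r, 'm, 'z) module_scheme \<Rightarrow> 'm set \<Rightarrow> bool" where
  "mod_basis R M B \<longleftrightarrow> finite B \<and> B \<subseteq> carrier M
     \<and> (\<forall>x\<in>carrier M. \<exists>!a. a \<in> B \<rightarrow>\<^sub>E carrier R \<and> x = (\<Oplus>\<^bsub>M\<^esub>b\<in>B. a b \<odot>\<^bsub>M\<^esub> b))"

definition has_dim :: "('r, 'p) ring_scheme \<Rightarrow> ('r, 'm, 'z) module_scheme \<Rightarrow> nat \<Rightarrow> bool" where
  "has_dim R M d \<longleftrightarrow> (\<exists>B. mod_basis R M B \<and> card B = d)"

definition alg_iso ::
  "('k, 'p) ring_scheme \<Rightarrow> ('k, 'a, 'y) module_scheme \<Rightarrow> ('k, 'b, 'z) module_scheme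
    \<Rightarrow> ('a \<Rightarrow> 'b) set" where
  "alg_iso K A B = {h \<in> ring_iso A B.
     \<forall>c\<in>carrier K. \<forall>x\<in>carrier A. h (c \<odot>\<^bsub>A\<^esub> x) = c \<odot>\<^bsub>B\<^esub> h x}"


section \<open>Projective geometries\<close>

type_synonym 'p geometry = "'p set \<times> 'p set set"

definition proj_points :: "('r, 'p) ring_scheme \<Rightarrow> ('r, 'm, 'z) module_scheme \<Rightarrow> 'm set set" where
  "proj_points D W = {N. submodule N D W \<and> has_dim D (W\<lparr>carrier := N\<rparr>) 1}"

definition proj_subspaces ::
  "('r, 'p) ring_scheme \<Rightarrow> ('r, 'm, 'z) module_scheme \<Rightarrow> 'm set set set" where
  "proj_subspaces D W =
     {{N \<in> proj_points D W. N \<subseteq> U} | U. submodule U D W \<and> U \<noteq> {\<zero>\<^bsub>W\<^esub>}}"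

definition PG :: "('r, 'p) ring_scheme \<Rightarrow> ('r, 'm, 'z) module_scheme \<Rightarrow> 'm set geometry" where
  "PG D W = (proj_points D W, proj_subspaces D W)"

definition geom_isos :: "'p geometry \<Rightarrow> 'q geometry \<Rightarrow> ('p \<Rightarrow> 'q) set" where
  "geom_isos G H = {\<beta>. bij_betw \<beta> (fst G) (fst H) \<and> (\<lambda>S. \<beta> ` S) ` snd G = snd H}"

definition cyclic_sub :: "('r, 'p) ring_scheme \<Rightarrow> ('r, 'm, 'z) module_scheme \<Rightarrow> 'm \<Rightarrow> 'm set" where
  "cyclic_sub D W w = {a \<odot>\<^bsub>W\<^esub> w | a. a \<in> carrier D}"

text \<open>Quadruples of collinear points with cross-ratio the central scalar \<open>c\<close>.\<close>

definition cross_ratio_rel ::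
  "('k, 'd, 'y) module_scheme \<Rightarrow> ('d, 'm, 'z) module_scheme \<Rightarrow> 'k
    \<Rightarrow> ('m set \<times> 'm set \<times> 'm set \<times> 'm set) set" where
  "cross_ratio_rel D W c =
     {(cyclic_sub D W u, cyclic_sub D W w, cyclic_sub D W (u \<oplus>\<^bsub>W\<^esub> w),
       cyclic_sub D W (u \<oplus>\<^bsub>W\<^esub> ((c \<odot>\<^bsub>D\<^esub> \<one>\<^bsub>D\<^esub>) \<odot>\<^bsub>W\<^esub> w))) | u w.
      u \<in> carrier W - {\<zero>\<^bsub>W\<^esub>} \<and> w \<in> carrier W - {\<zero>\<^bsub>W\<^esub>}
      \<and> cyclic_sub D W u \<noteq> cyclic_sub D W w}"


section \<open>Finite-dimensional basic algebras\<close>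

definition max_left_ideal :: "('a, 'm) ring_scheme \<Rightarrow> 'a set \<Rightarrow> bool" where
  "max_left_ideal L I \<longleftrightarrow> submodule I L (regular L) \<and> I \<noteq> carrier L
     \<and> (\<forall>H. submodule H L (regular L) \<and> I \<subseteq> H \<longrightarrow> H = I \<or> H = carrier L)"

definition jacobson :: "('a, 'm) ring_scheme \<Rightarrow> 'a set" where
  "jacobson L = carrier L \<inter> \<Inter>{I. max_left_ideal L I}"

primrec jpow :: "('a, 'm) ring_scheme \<Rightarrow> nat \<Rightarrow> 'a set" where
  "jpow L 0 = carrier L"
| "jpow L (Suc m) = jpow L m \<cdot>\<^bsub>L\<^esub> jacobson L"

definition idempotent :: "('a, 'm) ring_scheme \<Rightarrow> 'a \<Rightarrow> bool" where
  "idempotent L x \<longleftrightarrow> x \<in> carrier L \<and> x \<otimes>\<^bsub>L\<^esub> x = x"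

definition primitive_idempotent :: "('a, 'm) ring_scheme \<Rightarrow> 'a \<Rightarrow> bool" where
  "primitive_idempotent L x \<longleftrightarrow> idempotent L x \<and> x \<noteq> \<zero>\<^bsub>L\<^esub>
     \<and> (\<forall>y z. idempotent L y \<and> idempotent L z \<and> y \<otimes>\<^bsub>L\<^esub> z = \<zero>\<^bsub>L\<^esub> \<and> z \<otimes>\<^bsub>L\<^esub> y = \<zero>\<^bsub>L\<^esub>
          \<and> x = y \<oplus>\<^bsub>L\<^esub> z \<longrightarrow> y = \<zero>\<^bsub>L\<^esub> \<or> z = \<zero>\<^bsub>L\<^esub>)"

definition Pmod :: "('a, 'm) ring_scheme \<Rightarrow> 'a \<Rightarrow> ('a, 'a) module" where
  "Pmod L x = (regular L)\<lparr>carrier := {y \<otimes>\<^bsub>L\<^esub> x | y. y \<in> carrier L}\<rparr>"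

locale basic_algebra = K?: field K + L?: ring L + module K L
  for K :: "('k, 'p) ring_scheme" (structure) and L :: "('k, 'a) module" (structure) +
  fixes t :: nat and e :: "nat \<Rightarrow> 'a" and n :: nat
  assumes smult_mult_left:
      "\<lbrakk> c \<in> carrier K; x \<in> carrier L; y \<in> carrier L \<rbrakk> \<Longrightarrow>
      (c \<odot>\<^bsub>L\<^esub> x) \<otimes>\<^bsub>L\<^esub> y = c \<odot>\<^bsub>L\<^esub> (x \<otimes>\<^bsub>L\<^esub> y)"
    and smult_mult_right:
      "\<lbrakk> c \<in> carrier K; x \<in> carrier L; y \<in> carrier L \<rbrakk> \<Longrightarrow>
      x \<otimes>\<^bsub>L\<^esub> (c \<odot>\<^bsub>L\<^esub> y) = c \<odot>\<^bsub>L\<^esub> (x \<otimes>\<^bsub>L\<^esub> y)"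
    and finite_dim: "\<exists>d. has_dim K L d"
    and primitive: "\<And>i. i \<in> {1..t} \<Longrightarrow> primitive_idempotent L (e i)"
    and orthogonal: "\<And>i j. \<lbrakk> i \<in> {1..t}; j \<in> {1..t}; i \<noteq> j \<rbrakk> \<Longrightarrow> e i \<otimes>\<^bsub>L\<^esub> e j = \<zero>\<^bsub>L\<^esub>"
    and complete: "(\<Oplus>\<^bsub>L\<^esub>i\<in>{1..t}. e i) = \<one>\<^bsub>L\<^esub>"
    and basic: "\<And>i j. \<lbrakk> i \<in> {1..t}; j \<in> {1..t}; i \<noteq> j \<rbrakk> \<Longrightarrow>
      \<not> mod_isomorphic L (Pmod L (e i)) (Pmod L (e j))"
    and n_pos: "1 \<le> n"
    and jacobson_nilpotent: "jpow L n = {\<zero>\<^bsub>L\<^esub>}"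


section \<open>The terminal species\<close>

definition corner :: "('k, 'a) module \<Rightarrow> 'a \<Rightarrow> ('k, 'a) module" where
  "corner L x = L\<lparr>carrier := {x \<otimes>\<^bsub>L\<^esub> y \<otimes>\<^bsub>L\<^esub> x | y. y \<in> carrier L}, one := x\<rparr>"

definition Dres :: "('k, 'a) module \<Rightarrow> (nat \<Rightarrow> 'a) \<Rightarrow> nat \<Rightarrow> ('k, 'a set) module" where
  "Dres L e i = quot_mod (corner L (e i)) {e i \<otimes>\<^bsub>L\<^esub> y \<otimes>\<^bsub>L\<^esub> e i | y. y \<in> jacobson L}"

definition V :: "('k, 'a) module \<Rightarrow> (nat \<Rightarrow> 'a) \<Rightarrow> nat \<Rightarrow> nat \<Rightarrow> nat \<Rightarrow> 'a set" where
  "V L e n i j = {e j \<otimes>\<^bsub>L\<^esub> x \<otimes>\<^bsub>L\<^esub> e i | x. x \<in> jpow L (n - 1)}"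

text \<open>
  The underlying group of \<open>V\<^sub>i\<^sub>j\<close> with the actions of \<open>k\<close>, of \<open>D\<^sub>j\<close> on the left and of \<open>D\<^sub>i\<close> on the
  right.  A residue class acts through any of its representatives, and \<open>the_elem\<close> extracts the
  common value.
\<close>

definition Vscal :: "('k, 'a) module \<Rightarrow> (nat \<Rightarrow> 'a) \<Rightarrow> nat \<Rightarrow> nat \<Rightarrow> nat \<Rightarrow> ('k, 'a) module" where
  "Vscal L e n i j = L\<lparr>carrier := V L e n i j\<rparr>"

definition Vleft :: "('k, 'a) module \<Rightarrow> (nat \<Rightarrow> 'a) \<Rightarrow> nat \<Rightarrow> nat \<Rightarrow> nat \<Rightarrow> ('a set, 'a) module" where
  "Vleft L e n i j = \<lparr>carrier = V L e n i j, mult = mult L, one = one L, zero = zero L, add = add L,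
     smult = \<lambda>X v. the_elem ((\<lambda>x. x \<otimes>\<^bsub>L\<^esub> v) ` X)\<rparr>"

definition Vright :: "('k, 'a) module \<Rightarrow> (nat \<Rightarrow> 'a) \<Rightarrow> nat \<Rightarrow> nat \<Rightarrow> nat \<Rightarrow> ('a set, 'a) module" where
  "Vright L e n i j = \<lparr>carrier = V L e n i j, mult = mult L, one = one L, zero = zero L, add = add L,
     smult = \<lambda>X v. the_elem ((\<lambda>x. v \<otimes>\<^bsub>L\<^esub> x) ` X)\<rparr>"

definition rank_is :: "('k, 'a) module \<Rightarrow> (nat \<Rightarrow> 'a) \<Rightarrow> nat \<Rightarrow> nat \<Rightarrow> nat \<Rightarrow> nat \<Rightarrow> bool" where
  "rank_is L e n i j r \<longleftrightarrow> has_dim (opp (Dres L e i)) (Vright L e n i j) r"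

definition JP :: "('k, 'a) module \<Rightarrow> (nat \<Rightarrow> 'a) \<Rightarrow> nat \<Rightarrow> nat \<Rightarrow> 'a set" where
  "JP L e n i = jpow L (n - 1) \<cdot>\<^bsub>L\<^esub> carrier (Pmod L (e i))"

text \<open>
  The vertices that occur in the terminal layer, as a source or as a target.  At any other vertex
  all bimodules and all fibres vanish, so \<open>D\<^sub>h\<close> leaves no trace in the ambiguity geometry;
  isomorphisms of species therefore compare only the residue division algebras at these vertices.
\<close>

definition terminal_vertices :: "('k, 'a) module \<Rightarrow> nat \<Rightarrow> (nat \<Rightarrow> 'a) \<Rightarrow> nat \<Rightarrow> nat set" where
  "terminal_vertices L t e n = {h \<in> {1..t}. JP L e n h \<noteq> {\<zero>\<^bsub>L\<^esub>}
     \<or> (\<exists>i\<in>{1..t}. V L e n i h \<noteq> {\<zero>\<^bsub>L\<^esub>})}"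

text \<open>Isomorphism of the species of \<open>k\<close>-division algebras and bimodules.\<close>

definition species_iso ::
  "('k, 'p) ring_scheme \<Rightarrow> nat \<Rightarrow> nat \<Rightarrow> ('k, 'a) module \<Rightarrow> (nat \<Rightarrow> 'a) \<Rightarrow> ('k, 'b) module
    \<Rightarrow> (nat \<Rightarrow> 'b) \<Rightarrow> bool" where
  "species_iso K t n L e L' e' \<longleftrightarrow> (\<exists>\<sigma> f.
     (\<forall>h\<in>terminal_vertices L t e n. \<sigma> h \<in> alg_iso K (Dres L e h) (Dres L' e' h))
   \<and> (\<forall>i\<in>{1..t}. \<forall>j\<in>{1..t}.
        f i j \<in> semilinear_iso (opp (Dres L e i)) (\<sigma> i) (Vright L e n i j) (Vright L' e' n i j)
      \<and> f i j \<in> semilinear_iso (Dres L e j) (\<sigma> j) (Vleft L e n i j) (Vleft L' e' n i j)))"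

text \<open>
  The coarser notion that forgets the action of the ground field: the \<open>\<sigma> h\<close> are isomorphisms of
  rings, and the bimodules, whose left action is that of the ground field when \<open>D\<^sub>j\<close> is \<open>k\<close>, are
  compared as right modules.
\<close>

definition species_ring_iso ::
  "nat \<Rightarrow> nat \<Rightarrow> ('k, 'a) module \<Rightarrow> (nat \<Rightarrow> 'a) \<Rightarrow> ('k, 'b) module \<Rightarrow> (nat \<Rightarrow> 'b) \<Rightarrow> bool" where
  "species_ring_iso t n L e L' e' \<longleftrightarrow> (\<exists>\<sigma> f.
     (\<forall>h\<in>terminal_vertices L t e n. \<sigma> h \<in> ring_iso (Dres L e h) (Dres L' e' h))
   \<and> (\<forall>i\<in>{1..t}. \<forall>j\<in>{1..t}.
        f i j \<in> semilinear_iso (opp (Dres L e i)) (\<sigma> i) (Vright L e n i j) (Vright L' e' n i j)))"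


section \<open>The rank-one terminal ambiguity geometry\<close>

definition Wcompl :: "('k, 'a) module \<Rightarrow> nat \<Rightarrow> (nat \<Rightarrow> 'a) \<Rightarrow> nat \<Rightarrow> nat \<Rightarrow> nat \<Rightarrow> 'a set" where
  "Wcompl L t e n i j = {(\<Oplus>\<^bsub>L\<^esub>h\<in>{1..t} - {j}. w h) | w.
     \<forall>h\<in>{1..t} - {j}. w h \<in> {e h \<otimes>\<^bsub>L\<^esub> x | x. x \<in> JP L e n i}}"

definition Mquot :: "('k, 'a) module \<Rightarrow> nat \<Rightarrow> (nat \<Rightarrow> 'a) \<Rightarrow> nat \<Rightarrow> nat \<Rightarrow> nat \<Rightarrow> 'a set
    \<Rightarrow> ('a, 'a set) module" where
  "Mquot L t e n i j U = quot_mod (Pmod L (e i)) (Wcompl L t e n i j <+>\<^bsub>L\<^esub> U)"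

definition Mquots :: "('k, 'a) module \<Rightarrow> nat \<Rightarrow> (nat \<Rightarrow> 'a) \<Rightarrow> nat \<Rightarrow> nat \<Rightarrow> nat
    \<Rightarrow> ('a, 'a set) module set" where
  "Mquots L t e n i j = {Mquot L t e n i j U | U. V L e n i j \<noteq> {\<zero>\<^bsub>L\<^esub>}
     \<and> submodule U (Dres L e j) (Vleft L e n i j)
     \<and> has_dim (Dres L e j) (quot_mod (Vleft L e n i j) U) 1}"

definition Misorel :: "('k, 'a) module \<Rightarrow> nat \<Rightarrow> (nat \<Rightarrow> 'a) \<Rightarrow> nat \<Rightarrow> nat \<Rightarrow> nat
    \<Rightarrow> (('a, 'a set) module \<times> ('a, 'a set) module) set" where
  "Misorel L t e n i j = {(M, N). M \<in> Mquots L t e n i j \<and> N \<in> Mquots L t e n i j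
     \<and> mod_isomorphic L M N}"

type_synonym 'a fibre_point = "('a, 'a set) module set"

definition fibre :: "('k, 'a) module \<Rightarrow> nat \<Rightarrow> (nat \<Rightarrow> 'a) \<Rightarrow> nat \<Rightarrow> nat \<Rightarrow> nat
    \<Rightarrow> 'a fibre_point set" where
  "fibre L t e n i j = Mquots L t e n i j // Misorel L t e n i j"

definition Vdual :: "('k, 'p) ring_scheme \<Rightarrow> ('k, 'a) module \<Rightarrow> (nat \<Rightarrow> 'a) \<Rightarrow> nat \<Rightarrow> nat \<Rightarrow> nat
    \<Rightarrow> ('a \<Rightarrow> 'k) set" where
  "Vdual K L e n i j = linear_maps K (Vscal L e n i j) (regular K)"

text \<open>The \<open>k\<close>-dual of \<open>D\<close> as a right \<open>D\<close>-module, \<open>(\<eta> \<cdot> a)(x) = \<eta>(a x)\<close>.\<close>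

definition Ddual :: "('k, 'p) ring_scheme \<Rightarrow> ('k, 'd) module \<Rightarrow> ('d, 'd \<Rightarrow> 'k) module" where
  "Ddual K D = \<lparr>carrier = linear_maps K D (regular K), mult = undefined, one = undefined,
     zero = (\<lambda>x\<in>carrier D. \<zero>\<^bsub>K\<^esub>),
     add = (\<lambda>\<eta> \<theta>. \<lambda>x\<in>carrier D. \<eta> x \<oplus>\<^bsub>K\<^esub> \<theta> x),
     smult = (\<lambda>a \<eta>. \<lambda>x\<in>carrier D. \<eta> (a \<otimes>\<^bsub>D\<^esub> x))\<rparr>"

text \<open>
  The right linear maps from \<open>V\<^sub>i\<^sub>j\<close> to the dual of \<open>D\<^sub>i\<close>, as a left \<open>D\<^sub>i\<close>-module through
  \<open>(a \<cdot> \<eta>)(x) = \<eta>(x a)\<close>.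
\<close>

definition HomVD :: "('k, 'p) ring_scheme \<Rightarrow> ('k, 'a) module \<Rightarrow> (nat \<Rightarrow> 'a) \<Rightarrow> nat \<Rightarrow> nat \<Rightarrow> nat
    \<Rightarrow> ('a set, 'a \<Rightarrow> 'a set \<Rightarrow> 'k) module" where
  "HomVD K L e n i j = (let D = Dres L e i; M = Vright L e n i j in
    \<lparr>carrier = linear_maps (opp D) M (Ddual K D), mult = undefined, one = undefined,
     zero = (\<lambda>v\<in>carrier M. \<zero>\<^bsub>Ddual K D\<^esub>),
     add = (\<lambda>\<phi> \<psi>. \<lambda>v\<in>carrier M. \<phi> v \<oplus>\<^bsub>Ddual K D\<^esub> \<psi> v),
     smult = (\<lambda>a \<phi>. \<lambda>v\<in>carrier M. \<lambda>x\<in>carrier D. \<phi> v (x \<otimes>\<^bsub>D\<^esub> a))\<rparr>)"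

definition functional_map :: "('k, 'a) module \<Rightarrow> (nat \<Rightarrow> 'a) \<Rightarrow> nat \<Rightarrow> nat \<Rightarrow> nat
    \<Rightarrow> ('a \<Rightarrow> 'k) \<Rightarrow> 'a \<Rightarrow> 'a set \<Rightarrow> 'k" where
  "functional_map L e n i j \<mu> =
     (\<lambda>v\<in>V L e n i j. \<lambda>d\<in>carrier (Dres L e i). \<mu> (d \<odot>\<^bsub>Vright L e n i j\<^esub> v))"

text \<open>
  The identification of the fibre with the projective space: the class of \<open>M\<close> for the kernel of a
  functional \<open>\<mu>\<close> corresponds to the line spanned by the map belonging to \<open>\<mu>\<close>.
\<close>

definition fibre_coord :: "('k, 'p) ring_scheme \<Rightarrow> ('k, 'a) module \<Rightarrow> nat \<Rightarrow> (nat \<Rightarrow> 'a) \<Rightarrow> nat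
    \<Rightarrow> nat \<Rightarrow> nat \<Rightarrow> ('a fibre_point \<times> ('a \<Rightarrow> 'a set \<Rightarrow> 'k) set) set" where
  "fibre_coord K L t e n i j =
     {(Misorel L t e n i j `` {Mquot L t e n i j {v \<in> V L e n i j. \<mu> v = \<zero>\<^bsub>K\<^esub>}},
       cyclic_sub (Dres L e i) (HomVD K L e n i j) (functional_map L e n i j \<mu>)) | \<mu>.
      \<mu> \<in> Vdual K L e n i j \<and> (\<exists>v\<in>V L e n i j. \<mu> v \<noteq> \<zero>\<^bsub>K\<^esub>)}"

definition fibre_geom :: "('k, 'p) ring_scheme \<Rightarrow> ('k, 'a) module \<Rightarrow> nat \<Rightarrow> (nat \<Rightarrow> 'a) \<Rightarrow> nat
    \<Rightarrow> nat \<Rightarrow> nat \<Rightarrow> 'a fibre_point geometry" where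
  "fibre_geom K L t e n i j = (fibre L t e n i j,
     {(fibre_coord K L t e n i j)\<inverse> `` S | S.
        S \<in> proj_subspaces (Dres L e i) (HomVD K L e n i j)})"

definition fibre_cross_ratio :: "('k, 'p) ring_scheme \<Rightarrow> ('k, 'a) module \<Rightarrow> nat \<Rightarrow> (nat \<Rightarrow> 'a) \<Rightarrow> nat
    \<Rightarrow> nat \<Rightarrow> nat \<Rightarrow> 'k
    \<Rightarrow> ('a fibre_point \<times> 'a fibre_point \<times> 'a fibre_point \<times> 'a fibre_point) set" where
  "fibre_cross_ratio K L t e n i j c = {(p, q, r, s).
     \<exists>(p', q', r', s') \<in> cross_ratio_rel (Dres L e i) (HomVD K L e n i j) c.
       (p, p') \<in> fibre_coord K L t e n i j \<and> (q, q') \<in> fibre_coord K L t e n i j \<and>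
       (r, r') \<in> fibre_coord K L t e n i j \<and> (s, s') \<in> fibre_coord K L t e n i j}"

definition ambiguity_iso ::
  "('k, 'p) ring_scheme \<Rightarrow> nat \<Rightarrow> nat \<Rightarrow> ('k, 'a) module \<Rightarrow> (nat \<Rightarrow> 'a) \<Rightarrow> ('k, 'b) module
    \<Rightarrow> (nat \<Rightarrow> 'b) \<Rightarrow> bool" where
  "ambiguity_iso K t n L e L' e' \<longleftrightarrow> (\<forall>i\<in>{1..t}. \<forall>j\<in>{1..t}.
     geom_isos (fibre_geom K L t e n i j) (fibre_geom K L' t e' n i j) \<noteq> {})"

text \<open>
  Isomorphism of the labelled geometries over \<open>k\<close>.  A collineation of projective spaces over
  \<open>k\<close>-division algebras need not be compatible with the two \<open>k\<close>-structures (it is only semilinear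
  for an isomorphism of rings); here it must also preserve the cross-ratios that lie in \<open>k\<close>.
\<close>

definition ambiguity_iso_over ::
  "('k, 'p) ring_scheme \<Rightarrow> nat \<Rightarrow> nat \<Rightarrow> ('k, 'a) module \<Rightarrow> (nat \<Rightarrow> 'a) \<Rightarrow> ('k, 'b) module
    \<Rightarrow> (nat \<Rightarrow> 'b) \<Rightarrow> bool" where
  "ambiguity_iso_over K t n L e L' e' \<longleftrightarrow> (\<forall>i\<in>{1..t}. \<forall>j\<in>{1..t}.
     \<exists>\<beta> \<in> geom_isos (fibre_geom K L t e n i j) (fibre_geom K L' t e' n i j).
       \<forall>c\<in>carrier K. (\<lambda>(p, q, r, s). (\<beta> p, \<beta> q, \<beta> r, \<beta> s)) ` fibre_cross_ratio K L t e n i j c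
         = fibre_cross_ratio K L' t e' n i j c)"


section \<open>The standing hypotheses on the terminal layer\<close>

definition split_targets :: "('k, 'p) ring_scheme \<Rightarrow> ('k, 'a) module \<Rightarrow> nat \<Rightarrow> (nat \<Rightarrow> 'a) \<Rightarrow> nat
    \<Rightarrow> bool" where
  "split_targets K L t e n \<longleftrightarrow> (\<forall>i\<in>{1..t}. \<forall>j\<in>{1..t}.
     V L e n i j \<noteq> {\<zero>\<^bsub>L\<^esub>} \<longrightarrow> alg_iso K (regular K) (Dres L e j) \<noteq> {})"

definition rank_three_targets :: "('k, 'a) module \<Rightarrow> nat \<Rightarrow> (nat \<Rightarrow> 'a) \<Rightarrow> nat \<Rightarrow> bool" where
  "rank_three_targets L t e n \<longleftrightarrow> (\<forall>i\<in>{1..t}. JP L e n i \<noteq> {\<zero>\<^bsub>L\<^esub>} \<longrightarrow>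
     (\<exists>j\<in>{1..t}. \<exists>r. rank_is L e n i j r \<and> 3 \<le> r))"

text \<open>
  A geometry coordinatizing the fibre at \<open>(i, j)\<close> recovers \<open>D\<^sub>i\<close> if it is built from left modules
  and the opposite of \<open>D\<^sub>i\<close> if it is built from right modules.
\<close>

definition recovered_up_to_opp :: "('k, 'p) ring_scheme \<Rightarrow> ('k, 'a) module \<Rightarrow> nat \<Rightarrow> (nat \<Rightarrow> 'a)
    \<Rightarrow> nat \<Rightarrow> nat \<Rightarrow> nat \<Rightarrow> 'c ring \<Rightarrow> ('c, 'd) module \<Rightarrow> bool" where
  "recovered_up_to_opp K L t e n i j E W \<longleftrightarrow>
     (lmodule E W \<and> geom_isos (fibre_geom K L t e n i j) (PG E W) \<noteq> {}
        \<longrightarrow> Dres L e i \<simeq> E) \<and>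
     (lmodule (opp E) W \<and> geom_isos (fibre_geom K L t e n i j) (PG (opp E) W) \<noteq> {}
        \<longrightarrow> opp (Dres L e i) \<simeq> E)"

end

theory Submission
  imports Defs
begin

text \<open>
  The submodules that define the fibre at \<open>(i, j)\<close> are determined by the kernels of the nonzero functionals
  on \<open>V\<^sub>i\<^sub>j\<close>, because \<open>D\<^sub>j = k\<close>.  Since \<open>e\<^sub>i\<close> generates \<open>P\<^sub>i\<close>, an isomorphism
  between two of the quotients is induced by right multiplication by an element of \<open>e\<^sub>i \<Lambda> e\<^sub>i\<close>, which
  acts on \<open>V\<^sub>i\<^sub>j\<close> through \<open>D\<^sub>i\<close>; hence the fibre is the projective space of the left \<open>D\<^sub>i\<close>-space
  \<open>Hom(V\<^sub>i\<^sub>j, D\<^sub>i\<^sup>*)\<close>, whose dimension is \<open>r\<^sub>i\<^sub>j\<close>.  If \<open>r\<^sub>i\<^sub>j \<ge> 3\<close>, the fundamental theorem of projective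
  geometry recovers \<open>D\<^sub>i\<close> as a ring, and preservation of cross-ratios in \<open>k\<close> makes the ring isomorphism
  \<open>k\<close>-linear.  A bimodule \<open>V\<^sub>i\<^sub>j\<close> with \<open>D\<^sub>j = k\<close> is determined up to isomorphism by \<open>D\<^sub>i\<close> and \<open>r\<^sub>i\<^sub>j\<close>.
\<close>

section \<open>Linear algebra over division rings\<close>

text \<open>The radical is defined through maximal left ideals, yet all its uses are computational,
  so it is replaced by a nilpotency test: \<open>a\<close> lies in it iff every \<open>z a\<close>
  is nilpotent. Primitivity then makes each corner \<open>e_i L e_i\<close> local, and basicness
  puts \<open>e_g L e_h\<close> into the radical for distinct indices. As the radical kills the last
  layer on both sides, only residue classes act there. For a fixed source \<open>i\<close> one ring
  isomorphism has to serve all pairs \<open>(i, j)\<close>, whereas the collineations at different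
  \<open>j\<close> are unrelated to each other. Hence the isomorphism is extracted at a single
  \<open>j\<close> of rank at least three, and at every other \<open>j\<close> the collineation
  contributes only the equality of ranks. Maps in both directions are then rebuilt from bases of
  equal length instead of being carried through the duality.\<close>

fun lincomb :: "('r, 'm, 'q) module_scheme \<Rightarrow> 'r list \<Rightarrow> 'm list \<Rightarrow> 'm" where
  "lincomb M (c # cs) (x # xs) = c \<odot>\<^bsub>M\<^esub> x \<oplus>\<^bsub>M\<^esub> lincomb M cs xs"
| "lincomb M _ _ = \<zero>\<^bsub>M\<^esub>"

text \<open>Only the length of \<open>xs\<close> enters, so bases of equal length in different
  spaces share their coefficient lists, up to a change of scalars
  (\<open>coeffs_length_cong\<close>, \<open>map_bij_coeffs\<close>).\<close>

definition coeffs :: "('r, 'p) ring_scheme \<Rightarrow> 'm list \<Rightarrow> 'r list set" where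
  "coeffs R xs = {cs. length cs = length xs \<and> set cs \<subseteq> carrier R}"

definition lspan :: "('r, 'p) ring_scheme \<Rightarrow> ('r, 'm, 'q) module_scheme \<Rightarrow> 'm list \<Rightarrow> 'm set" where
  "lspan R M xs = (\<lambda>cs. lincomb M cs xs) ` coeffs R xs"

text \<open>Each entry has to avoid the span of the entries after it, a form made for induction on
  lists. Over a division ring it is linear independence, by \<open>lincomb_inj\<close> and
  \<open>lindep_freeI\<close>.\<close>

fun lindep_free :: "('r, 'p) ring_scheme \<Rightarrow> ('r, 'm, 'q) module_scheme \<Rightarrow> 'm list \<Rightarrow> bool" where
  "lindep_free R M [] = True"
| "lindep_free R M (x # xs) = (x \<notin> lspan R M xs \<and> lindep_free R M xs)"

definition list_basis :: "('r, 'p) ring_scheme \<Rightarrow> ('r, 'm, 'q) module_scheme \<Rightarrow> 'm list \<Rightarrow> bool" where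
  "list_basis R M xs \<longleftrightarrow> set xs \<subseteq> carrier M \<and> lindep_free R M xs \<and> lspan R M xs = carrier M"

lemma coeffs_Nil [simp]: "coeffs R [] = {[]}"
  by (auto simp: coeffs_def)

lemma coeffs_Cons: "coeffs R (x # xs) = {c # cs | c cs. c \<in> carrier R \<and> cs \<in> coeffs R xs}"
  by (auto simp: coeffs_def length_Suc_conv)

lemma coeffs_Cons_iff [simp]: "c # cs \<in> coeffs R (x # xs) \<longleftrightarrow> c \<in> carrier R \<and> cs \<in> coeffs R xs"
  by (auto simp: coeffs_Cons)

lemma lspan_Nil [simp]: "lspan R M [] = {\<zero>\<^bsub>M\<^esub>}"
  by (auto simp: lspan_def)

lemma lspan_Cons:
  "lspan R M (x # xs) = {c \<odot>\<^bsub>M\<^esub> x \<oplus>\<^bsub>M\<^esub> s | c s. c \<in> carrier R \<and> s \<in> lspan R M xs}"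
  by (force simp: lspan_def coeffs_Cons)

lemma coeffs_length_cong: "length xs = length ys \<Longrightarrow> coeffs R xs = coeffs R ys"
  by (auto simp: coeffs_def)

lemma (in abelian_group) minus_eq_zero_iff:
  assumes "x \<in> carrier G" "y \<in> carrier G"
  shows "x \<ominus> y = \<zero> \<longleftrightarrow> x = y"
proof
  assume "x \<ominus> y = \<zero>"
  then have "x \<ominus> y \<oplus> y = y" using assms by simp
  then show "x = y" using assms by (simp add: a_minus_def a_assoc l_neg)
qed (use assms in \<open>simp add: a_minus_def r_neg\<close>)

section \<open>Linear combinations, spans and bases given by lists\<close>

context lmodule
begin

lemma smult_l_null [simp]: "x \<in> carrier M \<Longrightarrow> \<zero>\<^bsub>R\<^esub> \<odot>\<^bsub>M\<^esub> x = \<zero>\<^bsub>M\<^esub>"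
  using smult_l_distr[of "\<zero>\<^bsub>R\<^esub>" "\<zero>\<^bsub>R\<^esub>" x] smult_closed[of "\<zero>\<^bsub>R\<^esub>" x]
  by (metis M.add.r_cancel_one' R.r_zero R.zero_closed)

lemma smult_r_null [simp]: "a \<in> carrier R \<Longrightarrow> a \<odot>\<^bsub>M\<^esub> \<zero>\<^bsub>M\<^esub> = \<zero>\<^bsub>M\<^esub>"
  using smult_r_distr[of a "\<zero>\<^bsub>M\<^esub>" "\<zero>\<^bsub>M\<^esub>"] smult_closed[of a "\<zero>\<^bsub>M\<^esub>"]
  by (metis M.add.r_cancel_one' M.r_zero M.zero_closed)

lemma smult_l_minus:
  "\<lbrakk>a \<in> carrier R; x \<in> carrier M\<rbrakk> \<Longrightarrow> (\<ominus>\<^bsub>R\<^esub> a) \<odot>\<^bsub>M\<^esub> x = \<ominus>\<^bsub>M\<^esub> (a \<odot>\<^bsub>M\<^esub> x)"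
  by (metis M.minus_equality R.add.inv_closed R.l_neg smult_closed smult_l_distr smult_l_null)

lemma submoduleI:
  assumes "H \<subseteq> carrier M" "\<zero>\<^bsub>M\<^esub> \<in> H" "\<And>x y. \<lbrakk>x \<in> H; y \<in> H\<rbrakk> \<Longrightarrow> x \<oplus>\<^bsub>M\<^esub> y \<in> H"
    "\<And>a x. \<lbrakk>a \<in> carrier R; x \<in> H\<rbrakk> \<Longrightarrow> a \<odot>\<^bsub>M\<^esub> x \<in> H"
  shows "submodule H R M"
proof (intro submodule.intro submodule_axioms.intro)
  have "\<ominus>\<^bsub>M\<^esub> x \<in> H" if "x \<in> H" for x
    using assms(4)[of "\<ominus>\<^bsub>R\<^esub> \<one>\<^bsub>R\<^esub>" x] that assms(1) smult_l_minus[of "\<one>\<^bsub>R\<^esub>" x] by auto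
  then show "subgroup H (add_monoid M)"
    using assms by (auto simp: a_inv_def intro!: M.add.subgroupI)
qed (use assms in auto)

lemma submoduleD:
  assumes "submodule H R M"
  shows "H \<subseteq> carrier M" "\<zero>\<^bsub>M\<^esub> \<in> H" "\<And>x y. \<lbrakk>x \<in> H; y \<in> H\<rbrakk> \<Longrightarrow> x \<oplus>\<^bsub>M\<^esub> y \<in> H"
    "\<And>a x. \<lbrakk>a \<in> carrier R; x \<in> H\<rbrakk> \<Longrightarrow> a \<odot>\<^bsub>M\<^esub> x \<in> H" "\<And>x. x \<in> H \<Longrightarrow> \<ominus>\<^bsub>M\<^esub> x \<in> H"
    "\<And>x y. \<lbrakk>x \<in> H; y \<in> H\<rbrakk> \<Longrightarrow> x \<ominus>\<^bsub>M\<^esub> y \<in> H"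
proof -
  interpret H: submodule H R M by fact
  show 1: "H \<subseteq> carrier M" "\<zero>\<^bsub>M\<^esub> \<in> H" "\<And>x y. \<lbrakk>x \<in> H; y \<in> H\<rbrakk> \<Longrightarrow> x \<oplus>\<^bsub>M\<^esub> y \<in> H"
    "\<And>a x. \<lbrakk>a \<in> carrier R; x \<in> H\<rbrakk> \<Longrightarrow> a \<odot>\<^bsub>M\<^esub> x \<in> H"
    using H.subset H.one_closed H.m_closed by auto
  show 2: "\<And>x. x \<in> H \<Longrightarrow> \<ominus>\<^bsub>M\<^esub> x \<in> H"
    using H.m_inv_closed by (simp add: a_inv_def)
  show "\<And>x y. \<lbrakk>x \<in> H; y \<in> H\<rbrakk> \<Longrightarrow> x \<ominus>\<^bsub>M\<^esub> y \<in> H"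
    unfolding a_minus_def using 1 2 by auto
qed

lemma lincomb_closed [simp]:
  "\<lbrakk>set xs \<subseteq> carrier M; cs \<in> coeffs R xs\<rbrakk> \<Longrightarrow> lincomb M cs xs \<in> carrier M"
proof (induction xs arbitrary: cs)
  case (Cons x xs) then show ?case by (cases cs) (auto simp: coeffs_Cons)
qed auto

lemma lincomb_add:
  assumes "set xs \<subseteq> carrier M" "cs \<in> coeffs R xs" "ds \<in> coeffs R xs"
  shows "lincomb M (map2 (\<oplus>\<^bsub>R\<^esub>) cs ds) xs = lincomb M cs xs \<oplus>\<^bsub>M\<^esub> lincomb M ds xs"
  using assms
proof (induction xs arbitrary: cs ds)
  case (Cons x xs)
  obtain c cs' d ds' where eq: "cs = c # cs'" "ds = d # ds'"
    using Cons.prems by (auto simp: coeffs_Cons)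
  have cl: "c \<odot>\<^bsub>M\<^esub> x \<in> carrier M" "d \<odot>\<^bsub>M\<^esub> x \<in> carrier M" "lincomb M cs' xs \<in> carrier M"
    "lincomb M ds' xs \<in> carrier M"
    using Cons.prems eq by auto
  show ?case
    using Cons cl unfolding eq by (auto simp: smult_l_distr M.a_ac)
qed auto

lemma lincomb_smult:
  assumes "set xs \<subseteq> carrier M" "cs \<in> coeffs R xs" "a \<in> carrier R"
  shows "lincomb M (map ((\<otimes>\<^bsub>R\<^esub>) a) cs) xs = a \<odot>\<^bsub>M\<^esub> lincomb M cs xs"
  using assms
proof (induction xs arbitrary: cs)
  case (Cons x xs)
  obtain c cs' where eq: "cs = c # cs'"
    using Cons.prems by (auto simp: coeffs_Cons)
  show ?case
    using Cons unfolding eq by (auto simp: smult_r_distr smult_assoc1)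
qed auto

lemma map2_add_coeffs:
  "\<lbrakk>cs \<in> coeffs R xs; ds \<in> coeffs R xs\<rbrakk> \<Longrightarrow> map2 (\<oplus>\<^bsub>R\<^esub>) cs ds \<in> coeffs R xs"
proof (induction xs arbitrary: cs ds)
  case (Cons x xs)
  then show ?case by (fastforce simp: coeffs_Cons)
qed auto

lemma map_mult_coeffs:
  "\<lbrakk>cs \<in> coeffs R xs; a \<in> carrier R\<rbrakk> \<Longrightarrow> map ((\<otimes>\<^bsub>R\<^esub>) a) cs \<in> coeffs R xs"
  by (auto simp: coeffs_def)

lemma lspan_subset: "set xs \<subseteq> carrier M \<Longrightarrow> lspan R M xs \<subseteq> carrier M"
  by (auto simp: lspan_def)

lemma lspan_submodule:
  assumes "set xs \<subseteq> carrier M"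
  shows "submodule (lspan R M xs) R M"
proof (rule submoduleI)
  show "\<zero>\<^bsub>M\<^esub> \<in> lspan R M xs"
    using assms by (induction xs) (auto simp: lspan_Cons intro!: exI[of _ "\<zero>\<^bsub>R\<^esub>"] exI[of _ "\<zero>\<^bsub>M\<^esub>"])
next
  fix x y assume "x \<in> lspan R M xs" "y \<in> lspan R M xs"
  then show "x \<oplus>\<^bsub>M\<^esub> y \<in> lspan R M xs"
    unfolding lspan_def using lincomb_add[OF assms] map2_add_coeffs by (smt (verit) image_iff)
next
  fix a x assume "a \<in> carrier R" "x \<in> lspan R M xs"
  then show "a \<odot>\<^bsub>M\<^esub> x \<in> lspan R M xs"
    unfolding lspan_def using lincomb_smult[OF assms] map_mult_coeffs by (smt (verit) image_iff)
qed (use lspan_subset[OF assms] in auto)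

lemma lspan_Cons_superset:
  assumes "x \<in> carrier M" "set xs \<subseteq> carrier M"
  shows "lspan R M xs \<subseteq> lspan R M (x # xs)" "x \<in> lspan R M (x # xs)"
proof -
  show "lspan R M xs \<subseteq> lspan R M (x # xs)"
  proof
    fix s assume s: "s \<in> lspan R M xs"
    then have "s = \<zero>\<^bsub>R\<^esub> \<odot>\<^bsub>M\<^esub> x \<oplus>\<^bsub>M\<^esub> s"
      using assms lspan_subset[OF assms(2)] by auto
    then show "s \<in> lspan R M (x # xs)" using s unfolding lspan_Cons by blast
  qed
  have "\<zero>\<^bsub>M\<^esub> \<in> lspan R M xs"
    using lspan_submodule[OF assms(2)] by (rule submoduleD)
  then show "x \<in> lspan R M (x # xs)"
    using assms by (auto simp: lspan_Cons intro!: exI[of _ "\<one>\<^bsub>R\<^esub>"] exI[of _ "\<zero>\<^bsub>M\<^esub>"])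
qed

lemma set_subset_lspan: "set xs \<subseteq> carrier M \<Longrightarrow> set xs \<subseteq> lspan R M xs"
proof (induction xs)
  case (Cons x xs)
  then show ?case using lspan_Cons_superset[of x xs] by auto
qed auto

lemma lspan_least:
  assumes "submodule N R M" "set xs \<subseteq> N"
  shows "lspan R M xs \<subseteq> N"
  using assms(2)
proof (induction xs)
  case Nil
  then show ?case using submoduleD[OF assms(1)] by auto
next
  case (Cons x xs)
  then show ?case using submoduleD[OF assms(1)] by (auto simp: lspan_Cons)
qed

lemma lspan_mono:
  assumes "set xs \<subseteq> lspan R M ys" "set ys \<subseteq> carrier M"
  shows "lspan R M xs \<subseteq> lspan R M ys"
  by (rule lspan_least[OF lspan_submodule[OF assms(2)] assms(1)])

lemma lincomb_eq_finsum:
  assumes "distinct xs" "set xs \<subseteq> carrier M" "a \<in> set xs \<rightarrow> carrier R"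
  shows "lincomb M (map a xs) xs = (\<Oplus>\<^bsub>M\<^esub>b\<in>set xs. a b \<odot>\<^bsub>M\<^esub> b)"
  using assms
proof (induction xs)
  case (Cons x xs)
  have "(\<Oplus>\<^bsub>M\<^esub>b\<in>set (x # xs). a b \<odot>\<^bsub>M\<^esub> b) = a x \<odot>\<^bsub>M\<^esub> x \<oplus>\<^bsub>M\<^esub> (\<Oplus>\<^bsub>M\<^esub>b\<in>set xs. a b \<odot>\<^bsub>M\<^esub> b)"
    using Cons.prems by (subst list.set, subst M.finsum_insert) auto
  then show ?case using Cons by auto
qed auto

text \<open>A head lying in the span of the tail would have two coefficient lists, one beginning
  with one and one beginning with zero.\<close>

lemma lindep_freeI:
  assumes "set xs \<subseteq> carrier M" "inj_on (\<lambda>cs. lincomb M cs xs) (coeffs R xs)" "\<one>\<^bsub>R\<^esub> \<noteq> \<zero>\<^bsub>R\<^esub>"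
  shows "lindep_free R M xs"
  using assms(1,2)
proof (induction xs)
  case (Cons x xs)
  have eq: "cs = ds" "c = d"
    if "c \<odot>\<^bsub>M\<^esub> x \<oplus>\<^bsub>M\<^esub> lincomb M cs xs = d \<odot>\<^bsub>M\<^esub> x \<oplus>\<^bsub>M\<^esub> lincomb M ds xs"
      "cs \<in> coeffs R xs" "ds \<in> coeffs R xs" "c \<in> carrier R" "d \<in> carrier R" for c d cs ds
    using inj_onD[OF Cons.prems(2), of "c # cs" "d # ds"] that by auto
  have "x \<notin> lspan R M xs"
  proof
    assume "x \<in> lspan R M xs"
    then obtain cs where cs: "cs \<in> coeffs R xs" "x = lincomb M cs xs"
      by (auto simp: lspan_def)
    have "\<zero>\<^bsub>M\<^esub> \<in> lspan R M xs"
      using lspan_submodule[of xs] submoduleD(2) Cons.prems(1) by auto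
    then obtain ds where ds: "ds \<in> coeffs R xs" "\<zero>\<^bsub>M\<^esub> = lincomb M ds xs"
      by (auto simp: lspan_def)
    have "\<one>\<^bsub>R\<^esub> \<odot>\<^bsub>M\<^esub> x \<oplus>\<^bsub>M\<^esub> lincomb M ds xs = \<zero>\<^bsub>R\<^esub> \<odot>\<^bsub>M\<^esub> x \<oplus>\<^bsub>M\<^esub> lincomb M cs xs"
      using cs(2)[symmetric] ds(2)[symmetric] Cons.prems(1) by auto
    then show False using eq(2) cs(1) ds(1) assms(3) by blast
  qed
  moreover have "inj_on (\<lambda>cs. lincomb M cs xs) (coeffs R xs)"
  proof (rule inj_onI)
    fix cs ds assume "cs \<in> coeffs R xs" "ds \<in> coeffs R xs" "lincomb M cs xs = lincomb M ds xs"
    then show "cs = ds" using eq(1)[of "\<zero>\<^bsub>R\<^esub>" cs "\<zero>\<^bsub>R\<^esub>" ds] by auto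
  qed
  ultimately show ?case using Cons by auto
qed auto

lemma list_basisI:
  assumes "set xs \<subseteq> carrier M" "bij_betw (\<lambda>cs. lincomb M cs xs) (coeffs R xs) (carrier M)"
    "\<one>\<^bsub>R\<^esub> \<noteq> \<zero>\<^bsub>R\<^esub>"
  shows "list_basis R M xs"
  using assms lindep_freeI by (auto simp: list_basis_def lspan_def bij_betw_def)

text \<open>\<open>has_dim\<close> speaks of a finite set and of extensional coefficient functions
  on it. An enumeration of the set without repetitions turns these functions into coefficient lists,
  and from here on dimensions are lengths of lists.\<close>

lemma has_dim_list_basis:
  assumes "has_dim R M d" "\<one>\<^bsub>R\<^esub> \<noteq> \<zero>\<^bsub>R\<^esub>"
  shows "\<exists>xs. list_basis R M xs \<and> length xs = d"
proof -
  obtain B where B: "finite B" "B \<subseteq> carrier M" "card B = d"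
    "\<And>x. x \<in> carrier M \<Longrightarrow> \<exists>!a. a \<in> B \<rightarrow>\<^sub>E carrier R \<and> x = (\<Oplus>\<^bsub>M\<^esub>b\<in>B. a b \<odot>\<^bsub>M\<^esub> b)"
    using assms(1) by (auto simp: has_dim_def mod_basis_def)
  obtain xs where xs: "set xs = B" "distinct xs"
    using finite_distinct_list[OF B(1)] by blast
  have len: "length xs = d" using xs B(3) distinct_card by metis
  have ex: "\<exists>a. a \<in> B \<rightarrow>\<^sub>E carrier R \<and> map a xs = cs" if cs: "cs \<in> coeffs R xs" for cs
  proof (intro exI conjI)
    \<comment> \<open>The function is read off by looking up the position of \<open>b\<close>, which
      is unambiguous since \<open>xs\<close> is distinct.\<close>
    let ?a = "restrict (\<lambda>b. the (map_of (zip xs cs) b)) B"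
    have l: "length cs = length xs" using cs by (auto simp: coeffs_def)
    have nth: "?a (xs ! k) = cs ! k" if "k < length xs" for k
      using that l xs map_of_zip_nth[of xs cs k] by (auto simp: restrict_def)
    show "map ?a xs = cs"
      using nth l by (intro nth_equalityI) auto
    then show "?a \<in> B \<rightarrow>\<^sub>E carrier R"
    proof (intro PiE_I)
      fix b assume b: "b \<in> B"
      then have "?a b \<in> set (map ?a xs)" using xs(1) by auto
      then show "?a b \<in> carrier R" using \<open>map ?a xs = cs\<close> cs by (auto simp: coeffs_def)
    qed auto
  qed
  have lc: "lincomb M (map a xs) xs = (\<Oplus>\<^bsub>M\<^esub>b\<in>B. a b \<odot>\<^bsub>M\<^esub> b)" if "a \<in> B \<rightarrow>\<^sub>E carrier R" for a
    using lincomb_eq_finsum[of xs a] that xs B by auto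
  have "list_basis R M xs"
  proof (rule list_basisI[OF _ _ assms(2)])
    show "set xs \<subseteq> carrier M" using xs B by auto
    then have cl: "\<And>cs. cs \<in> coeffs R xs \<Longrightarrow> lincomb M cs xs \<in> carrier M" by simp
    show "bij_betw (\<lambda>cs. lincomb M cs xs) (coeffs R xs) (carrier M)"
      unfolding bij_betw_def
    proof (intro conjI inj_onI equalityI subsetI)
      fix cs ds assume h: "cs \<in> coeffs R xs" "ds \<in> coeffs R xs" "lincomb M cs xs = lincomb M ds xs"
      then obtain a b where ab: "a \<in> B \<rightarrow>\<^sub>E carrier R" "map a xs = cs" "b \<in> B \<rightarrow>\<^sub>E carrier R"
        "map b xs = ds" using ex by blast
      then have "a = b" using B(4)[OF cl[OF h(1)]] lc h(3) by metis
      then show "cs = ds" using ab by auto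
    next
      fix x assume "x \<in> carrier M"
      then obtain a where "a \<in> B \<rightarrow>\<^sub>E carrier R" "x = (\<Oplus>\<^bsub>M\<^esub>b\<in>B. a b \<odot>\<^bsub>M\<^esub> b)"
        using B(4) by blast
      then show "x \<in> (\<lambda>cs. lincomb M cs xs) ` coeffs R xs"
        using lc xs by (intro image_eqI[of _ _ "map a xs"]) (auto simp: coeffs_def)
    qed (use cl in auto)
  qed
  then show ?thesis using len by blast
qed

text \<open>Applied both to the points of a projective space and to the quotient of
  \<open>V_ij\<close> by a hyperplane.\<close>

lemma has_dim_1I:
  assumes "x \<in> carrier M" "carrier M = {a \<odot>\<^bsub>M\<^esub> x | a. a \<in> carrier R}"
    "\<And>a. \<lbrakk>a \<in> carrier R; a \<odot>\<^bsub>M\<^esub> x = \<zero>\<^bsub>M\<^esub>\<rbrakk> \<Longrightarrow> a = \<zero>\<^bsub>R\<^esub>"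
  shows "has_dim R M 1"
  unfolding has_dim_def mod_basis_def
proof (intro exI conjI ballI)
  show "finite {x}" "{x} \<subseteq> carrier M" "card {x} = 1" using assms by auto
  fix y assume "y \<in> carrier M"
  then obtain a where a: "a \<in> carrier R" "y = a \<odot>\<^bsub>M\<^esub> x" using assms(2) by auto
  have fs: "(\<Oplus>\<^bsub>M\<^esub>b\<in>{x}. f b \<odot>\<^bsub>M\<^esub> b) = f x \<odot>\<^bsub>M\<^esub> x" if "f x \<in> carrier R" for f
    using that assms(1) by (simp add: M.finsum_insert)
  have inj: "b = c" if "b \<in> carrier R" "c \<in> carrier R" "b \<odot>\<^bsub>M\<^esub> x = c \<odot>\<^bsub>M\<^esub> x" for b c
  proof -
    have "(b \<ominus>\<^bsub>R\<^esub> c) \<odot>\<^bsub>M\<^esub> x = \<zero>\<^bsub>M\<^esub>"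
      using that assms(1) by (simp add: a_minus_def smult_l_distr smult_l_minus M.r_neg)
    then have "b \<ominus>\<^bsub>R\<^esub> c = \<zero>\<^bsub>R\<^esub>" using assms(3) that by blast
    then show ?thesis using that by (simp add: R.minus_eq_zero_iff)
  qed
  show "\<exists>!f. f \<in> {x} \<rightarrow>\<^sub>E carrier R \<and> y = (\<Oplus>\<^bsub>M\<^esub>b\<in>{x}. f b \<odot>\<^bsub>M\<^esub> b)"
  proof (intro ex1I[of _ "\<lambda>z\<in>{x}. a"] conjI)
    show "(\<lambda>z\<in>{x}. a) \<in> {x} \<rightarrow>\<^sub>E carrier R" using a by auto
    show "y = (\<Oplus>\<^bsub>M\<^esub>b\<in>{x}. (\<lambda>z\<in>{x}. a) b \<odot>\<^bsub>M\<^esub> b)" using a fs[of "\<lambda>z\<in>{x}. a"] by auto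
    fix f assume f: "f \<in> {x} \<rightarrow>\<^sub>E carrier R \<and> y = (\<Oplus>\<^bsub>M\<^esub>b\<in>{x}. f b \<odot>\<^bsub>M\<^esub> b)"
    then have "f x \<in> carrier R" by auto
    then have "f x = a" using f fs[of f] inj a by auto
    then show "f = (\<lambda>z\<in>{x}. a)" using f by (auto simp: PiE_def extensional_def restrict_def fun_eq_iff)
  qed
qed

end

section \<open>Independence and dimension over division rings\<close>

lemma division_ring_one_neq_zero: "division_ring R \<Longrightarrow> \<one>\<^bsub>R\<^esub> \<noteq> \<zero>\<^bsub>R\<^esub>"
  unfolding division_ring_def by (metis DiffE insertI1 monoid.Units_one_closed ring.is_monoid)

lemma division_ring_inv:
  assumes "division_ring R" "a \<in> carrier R" "a \<noteq> \<zero>\<^bsub>R\<^esub>"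
  shows "inv\<^bsub>R\<^esub> a \<in> carrier R" "inv\<^bsub>R\<^esub> a \<otimes>\<^bsub>R\<^esub> a = \<one>\<^bsub>R\<^esub>" "a \<otimes>\<^bsub>R\<^esub> inv\<^bsub>R\<^esub> a = \<one>\<^bsub>R\<^esub>"
    "inv\<^bsub>R\<^esub> a \<noteq> \<zero>\<^bsub>R\<^esub>"
proof -
  interpret ring R using assms by (simp add: division_ring_def)
  have u: "a \<in> Units R" using assms by (simp add: division_ring_def)
  show "inv\<^bsub>R\<^esub> a \<in> carrier R" "inv\<^bsub>R\<^esub> a \<otimes>\<^bsub>R\<^esub> a = \<one>\<^bsub>R\<^esub>" "a \<otimes>\<^bsub>R\<^esub> inv\<^bsub>R\<^esub> a = \<one>\<^bsub>R\<^esub>"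
    using u by auto
  then show "inv\<^bsub>R\<^esub> a \<noteq> \<zero>\<^bsub>R\<^esub>"
    using division_ring_one_neq_zero[OF assms(1)] assms(2) by auto
qed

locale left_vector_space = lmodule +
  assumes division: "division_ring R"
begin

lemma one_neq_zero [simp]: "\<one>\<^bsub>R\<^esub> \<noteq> \<zero>\<^bsub>R\<^esub>"
  using division by (rule division_ring_one_neq_zero)

lemma smult_inv_cancel:
  assumes "a \<in> carrier R" "a \<noteq> \<zero>\<^bsub>R\<^esub>" "x \<in> carrier M"
  shows "inv\<^bsub>R\<^esub> a \<odot>\<^bsub>M\<^esub> (a \<odot>\<^bsub>M\<^esub> x) = x"
  using division_ring_inv[OF division assms(1,2)] assms
  by (simp flip: smult_assoc1)

lemma smult_eq_zero_iff:
  assumes "a \<in> carrier R" "x \<in> carrier M"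
  shows "a \<odot>\<^bsub>M\<^esub> x = \<zero>\<^bsub>M\<^esub> \<longleftrightarrow> a = \<zero>\<^bsub>R\<^esub> \<or> x = \<zero>\<^bsub>M\<^esub>"
  using assms smult_inv_cancel[OF assms(1) _ assms(2)]
    division_ring_inv(1)[OF division assms(1)] by (metis smult_l_null smult_r_null)

lemma submodule_smult_iff:
  assumes "submodule N R M" "a \<in> carrier R" "a \<noteq> \<zero>\<^bsub>R\<^esub>" "x \<in> carrier M"
  shows "a \<odot>\<^bsub>M\<^esub> x \<in> N \<longleftrightarrow> x \<in> N"
  using submoduleD(4)[OF assms(1)] smult_inv_cancel[OF assms(2-4)]
    division_ring_inv(1)[OF division assms(2,3)] assms(2) by metis

lemma submodule_add_cancel:
  assumes "submodule N R M" "s \<in> N" "x \<in> carrier M"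
  shows "x \<oplus>\<^bsub>M\<^esub> s \<in> N \<longleftrightarrow> x \<in> N"
proof
  assume "x \<oplus>\<^bsub>M\<^esub> s \<in> N"
  then have "(x \<oplus>\<^bsub>M\<^esub> s) \<ominus>\<^bsub>M\<^esub> s \<in> N"
    using submoduleD(6)[OF assms(1) _ assms(2)] by simp
  moreover have "(x \<oplus>\<^bsub>M\<^esub> s) \<ominus>\<^bsub>M\<^esub> s = x"
    using subsetD[OF submoduleD(1)[OF assms(1)] assms(2)] assms(3)
    by (simp add: a_minus_def M.a_assoc M.r_neg)
  ultimately show "x \<in> N" by simp
qed (use submoduleD(3)[OF assms(1) _ assms(2)] in simp)

text \<open>The difference of two equal combinations puts a multiple of the head into the span of
  the tail. A nonzero factor could be inverted there, so the leading coefficients agree and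
  induction handles the rest.\<close>

lemma lincomb_inj:
  assumes "set xs \<subseteq> carrier M" "lindep_free R M xs"
  shows "inj_on (\<lambda>cs. lincomb M cs xs) (coeffs R xs)"
  using assms
proof (induction xs)
  case (Cons x xs)
  have sub: "submodule (lspan R M xs) R M" using Cons.prems lspan_submodule by auto
  show ?case
  proof (rule inj_onI)
    fix cs' ds' assume a: "cs' \<in> coeffs R (x # xs)" "ds' \<in> coeffs R (x # xs)"
      "lincomb M cs' (x # xs) = lincomb M ds' (x # xs)"
    then obtain c cs d ds where eq: "cs' = c # cs" "ds' = d # ds" by (auto simp: coeffs_Cons)
    have cl: "c \<in> carrier R" "d \<in> carrier R" "cs \<in> coeffs R xs" "ds \<in> coeffs R xs"
      using a eq by auto
    define s s' where "s = lincomb M cs xs" and "s' = lincomb M ds xs"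
    have s: "s \<in> lspan R M xs" "s' \<in> lspan R M xs" using cl by (auto simp: s_def s'_def lspan_def)
    have scl: "s \<in> carrier M" "s' \<in> carrier M" "x \<in> carrier M"
      using s lspan_subset[of xs] Cons.prems by auto
    have e: "c \<odot>\<^bsub>M\<^esub> x \<oplus>\<^bsub>M\<^esub> s = d \<odot>\<^bsub>M\<^esub> x \<oplus>\<^bsub>M\<^esub> s'" using a eq by (simp add: s_def s'_def)
    have "(c \<ominus>\<^bsub>R\<^esub> d) \<odot>\<^bsub>M\<^esub> x = (c \<odot>\<^bsub>M\<^esub> x \<oplus>\<^bsub>M\<^esub> s) \<ominus>\<^bsub>M\<^esub> s \<ominus>\<^bsub>M\<^esub> d \<odot>\<^bsub>M\<^esub> x"
      using cl scl by (simp add: a_minus_def smult_l_distr smult_l_minus M.a_assoc M.r_neg)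
    also have "\<dots> = s' \<ominus>\<^bsub>M\<^esub> s"
      unfolding e using cl scl by (simp add: a_minus_def M.a_ac M.r_neg2 M.r_neg)
    finally have "(c \<ominus>\<^bsub>R\<^esub> d) \<odot>\<^bsub>M\<^esub> x \<in> lspan R M xs" using submoduleD(6)[OF sub] s by auto
    then have "c \<ominus>\<^bsub>R\<^esub> d = \<zero>\<^bsub>R\<^esub>"
      using submodule_smult_iff[OF sub _ _ scl(3)] Cons.prems cl by auto
    then have cd: "c = d" using cl by (metis R.minus_eq_zero_iff)
    then have "s = s'" using e cl scl by auto
    then have "cs = ds" using inj_onD[of _ _ cs ds] Cons cl by (auto simp: s_def s'_def)
    then show "cs' = ds'" using cd eq by simp
  qed
qed auto

lemma list_basis_bij:
  assumes "list_basis R M xs"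
  shows "bij_betw (\<lambda>cs. lincomb M cs xs) (coeffs R xs) (carrier M)"
  using assms lincomb_inj by (auto simp: list_basis_def lspan_def bij_betw_def)

text \<open>
  The number of steps at which the filtration of \<open>N\<close> by the spans of the tails of \<open>xs\<close> grows;
  it strictly increases with \<open>N\<close>, which yields the exchange lemma.
\<close>

fun jumps :: "'c set \<Rightarrow> 'c list \<Rightarrow> nat" where
  "jumps N [] = 0"
| "jumps N (x # xs) = (if N \<inter> lspan R M (x # xs) \<subseteq> lspan R M xs then 0 else 1) + jumps N xs"

lemma jumps_le_length: "jumps N xs \<le> length xs"
  by (induction xs) auto

lemma jumps_mono: "N \<subseteq> N' \<Longrightarrow> jumps N xs \<le> jumps N' xs"
  by (induction xs) auto

text \<open>The witness \<open>y\<close> is pushed down the filtration. Where \<open>N\<close> does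
  not jump at \<open>x\<close>, either \<open>N'\<close> does or \<open>y\<close> already lies in
  the next span. Where \<open>N\<close> jumps, an element of \<open>N\<close> with nonzero
  \<open>x\<close>-component is used to remove that component from \<open>y\<close>.\<close>

lemma jumps_strict_mono:
  assumes "submodule N R M" "submodule N' R M" "N \<subseteq> N'" "y \<in> N'" "y \<notin> N"
    "y \<in> lspan R M xs" "set xs \<subseteq> carrier M"
  shows "jumps N xs < jumps N' xs"
  using assms(4-)
proof (induction xs arbitrary: y)
  case Nil
  then show ?case using submoduleD(2)[OF assms(1)] by auto
next
  case (Cons x xs)
  have sub: "submodule (lspan R M xs) R M" using Cons.prems lspan_submodule by auto
  have x: "x \<in> carrier M" using Cons.prems by auto
  show ?case
  proof (cases "N \<inter> lspan R M (x # xs) \<subseteq> lspan R M xs")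
    case True
    show ?thesis
    proof (cases "N' \<inter> lspan R M (x # xs) \<subseteq> lspan R M xs")
      case True
      then have "y \<in> lspan R M xs" using Cons.prems by auto
      then have "jumps N xs < jumps N' xs" using Cons by auto
      then show ?thesis using True \<open>N \<inter> _ \<subseteq> _\<close> by auto
    next
      case False
      then show ?thesis using True jumps_mono[OF assms(3), of xs] by auto
    qed
  next
    case False
    then obtain z where z: "z \<in> N" "z \<in> lspan R M (x # xs)" "z \<notin> lspan R M xs" by auto
    then obtain c s where cs: "z = c \<odot>\<^bsub>M\<^esub> x \<oplus>\<^bsub>M\<^esub> s" "c \<in> carrier R" "s \<in> lspan R M xs"
      by (auto simp: lspan_Cons)
    obtain d s' where ds: "y = d \<odot>\<^bsub>M\<^esub> x \<oplus>\<^bsub>M\<^esub> s'" "d \<in> carrier R" "s' \<in> lspan R M xs"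
      using Cons.prems by (auto simp: lspan_Cons)
    have scl: "s \<in> carrier M" "s' \<in> carrier M" using cs ds submoduleD(1)[OF sub] by auto
    have c0: "c \<noteq> \<zero>\<^bsub>R\<^esub>" using z(3) cs x scl by auto
    \<comment> \<open>The factor for which \<open>a z\<close> cancels the component
      \<open>d x\<close> of \<open>y\<close>. The result \<open>w\<close> lies in the span of the
      tail and in \<open>N'\<close> and, like \<open>y\<close>, outside \<open>N\<close>.\<close>
    define a where "a = \<ominus>\<^bsub>R\<^esub> (d \<otimes>\<^bsub>R\<^esub> inv\<^bsub>R\<^esub> c)"
    have inv: "inv\<^bsub>R\<^esub> c \<in> carrier R" "inv\<^bsub>R\<^esub> c \<otimes>\<^bsub>R\<^esub> c = \<one>\<^bsub>R\<^esub>"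
      using division_ring_inv[OF division cs(2) c0] by auto
    have a: "a \<in> carrier R" using inv ds by (auto simp: a_def)
    have ac: "a \<otimes>\<^bsub>R\<^esub> c = \<ominus>\<^bsub>R\<^esub> d" using inv ds cs by (simp add: a_def R.l_minus R.m_assoc)
    define w where "w = y \<oplus>\<^bsub>M\<^esub> a \<odot>\<^bsub>M\<^esub> z"
    have "a \<odot>\<^bsub>M\<^esub> z = \<ominus>\<^bsub>M\<^esub> (d \<odot>\<^bsub>M\<^esub> x) \<oplus>\<^bsub>M\<^esub> a \<odot>\<^bsub>M\<^esub> s"
      using cs a scl x ac ds by (simp add: smult_r_distr smult_l_minus flip: smult_assoc1)
    then have "w = s' \<oplus>\<^bsub>M\<^esub> a \<odot>\<^bsub>M\<^esub> s"
      using ds a scl x by (simp add: w_def M.a_ac M.r_neg2 M.r_neg M.r_neg1)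
    then have "w \<in> lspan R M xs" using submoduleD[OF sub] a cs ds by auto
    moreover have az: "a \<odot>\<^bsub>M\<^esub> z \<in> N" using submoduleD(4)[OF assms(1)] a z by auto
    moreover have "w \<in> N'" using az assms(3) Cons.prems submoduleD(3)[OF assms(2)] by (auto simp: w_def)
    moreover have "w \<notin> N"
      using submodule_add_cancel[OF assms(1) az, of y] Cons.prems submoduleD(1)[OF assms(2)]
      by (auto simp: w_def)
    ultimately have "jumps N xs < jumps N' xs" using Cons by auto
    then show ?thesis using False assms(3) by auto
  qed
qed

text \<open>Adjoining an independent vector strictly enlarges the span and therefore its number of
  jumps along \<open>xs\<close>, which is bounded by the length of \<open>xs\<close>. No vectors
  have to be exchanged.\<close>

theorem steinitz:
  assumes "lindep_free R M ys" "set ys \<subseteq> lspan R M xs" "set xs \<subseteq> carrier M"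
  shows "length ys \<le> length xs"
proof -
  have "length ys \<le> jumps (lspan R M ys) xs"
    using assms(1,2)
  proof (induction ys)
    case (Cons y ys)
    have cl: "y \<in> carrier M" "set ys \<subseteq> carrier M"
      using Cons.prems lspan_subset[OF assms(3)] by auto
    have "jumps (lspan R M ys) xs < jumps (lspan R M (y # ys)) xs"
      by (rule jumps_strict_mono[of _ _ y])
        (use Cons.prems cl lspan_submodule lspan_Cons_superset assms(3) in auto)
    then show ?case using Cons by auto
  qed auto
  then show ?thesis using jumps_le_length le_trans by blast
qed

lemma list_basis_length_unique:
  assumes "list_basis R M xs" "list_basis R M ys"
  shows "length xs = length ys"
  using assms steinitz[of xs ys] steinitz[of ys xs] by (auto simp: list_basis_def)

lemma ex_basis_of_spanning:
  assumes "lspan R M xs = carrier M" "set xs \<subseteq> carrier M"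
  shows "\<exists>ys. list_basis R M ys"
proof -
  have "\<exists>ys. lindep_free R M ys \<and> set ys \<subseteq> carrier M \<and> lspan R M ys = lspan R M xs"
    using assms(2)
  proof (induction xs)
    case Nil
    then show ?case by (intro exI[of _ "[]"]) auto
  next
    case (Cons x xs)
    then obtain ys where ys: "lindep_free R M ys" "set ys \<subseteq> carrier M" "lspan R M ys = lspan R M xs"
      by auto
    show ?case
    proof (cases "x \<in> lspan R M xs")
      case True
      have "lspan R M (x # xs) \<subseteq> lspan R M xs"
        using True Cons.prems set_subset_lspan by (intro lspan_mono) auto
      then have "lspan R M (x # xs) = lspan R M xs" using lspan_Cons_superset Cons.prems by auto
      then show ?thesis using ys by auto
    next
      case False
      then show ?thesis
        using ys Cons.prems by (intro exI[of _ "x # ys"]) (auto simp: lspan_Cons)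
    qed
  qed
  then show ?thesis using assms by (auto simp: list_basis_def)
qed

end

subsection \<open>Semilinear isomorphisms\<close>

lemma semilinear_iso_lincomb:
  assumes "lmodule R M" "lmodule R' M'" "f \<in> semilinear_iso R \<sigma> M M'"
    "\<sigma> \<in> carrier R \<rightarrow> carrier R'" "set xs \<subseteq> carrier M" "cs \<in> coeffs R xs"
  shows "f (lincomb M cs xs) = lincomb M' (map \<sigma> cs) (map f xs)"
proof -
  interpret M: lmodule R M by fact
  interpret M': lmodule R' M' by fact
  have f: "f x \<in> carrier M'" if "x \<in> carrier M" for x
    using assms(3) that by (auto simp: semilinear_iso_def bij_betw_def)
  have add: "f (x \<oplus>\<^bsub>M\<^esub> y) = f x \<oplus>\<^bsub>M'\<^esub> f y" if "x \<in> carrier M" "y \<in> carrier M" for x y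
    using assms(3) that by (auto simp: semilinear_iso_def)
  have sm: "f (a \<odot>\<^bsub>M\<^esub> x) = \<sigma> a \<odot>\<^bsub>M'\<^esub> f x" if "x \<in> carrier M" "a \<in> carrier R" for x a
    using assms(3) that by (auto simp: semilinear_iso_def)
  have f0: "f \<zero>\<^bsub>M\<^esub> = \<zero>\<^bsub>M'\<^esub>"
    using add[of "\<zero>\<^bsub>M\<^esub>" "\<zero>\<^bsub>M\<^esub>"] f[of "\<zero>\<^bsub>M\<^esub>"] by (metis M'.M.add.r_cancel_one' M.M.r_zero M.M.zero_closed)
  show ?thesis using assms(5,6)
  proof (induction xs arbitrary: cs)
    case (Cons x xs)
    then obtain c cs' where "cs = c # cs'" by (auto simp: coeffs_Cons)
    then show ?case using Cons by (auto simp: add sm)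
  qed (auto simp: f0)
qed

lemma map_map2_hom:
  assumes "length cs = length ds" "set cs \<subseteq> A" "set ds \<subseteq> A"
    "\<And>x y. \<lbrakk>x \<in> A; y \<in> A\<rbrakk> \<Longrightarrow> s (f x y) = g (s x) (s y)"
  shows "map s (map2 f cs ds) = map2 g (map s cs) (map s ds)"
  using assms(1-3) by (induction cs ds rule: list_induct2) (auto simp: assms(4))

lemma map_bij_coeffs:
  assumes "bij_betw \<sigma> (carrier R) (carrier R')" "length xs = length ys"
  shows "bij_betw (map \<sigma>) (coeffs R xs) (coeffs R' ys)"
proof -
  have eq: "coeffs R xs = {cs. set cs \<subseteq> carrier R \<and> length cs = length ys}"
    using assms(2) by (auto simp: coeffs_def)
  have "map \<sigma> ` {cs. set cs \<subseteq> carrier R \<and> length cs = length ys} = coeffs R' ys"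
  proof (intro equalityI subsetI)
    fix ds assume "ds \<in> coeffs R' ys"
    then have ds: "set ds \<subseteq> \<sigma> ` carrier R" "length ds = length ys"
      using assms(1) by (auto simp: coeffs_def bij_betw_def)
    have "map \<sigma> (map (inv_into (carrier R) \<sigma>) ds) = ds"
      using ds(1) by (intro nth_equalityI) (auto simp: subset_iff f_inv_into_f)
    then show "ds \<in> map \<sigma> ` {cs. set cs \<subseteq> carrier R \<and> length cs = length ys}"
      using ds by (intro image_eqI[of _ _ "map (inv_into (carrier R) \<sigma>) ds"])
        (auto simp: inv_into_into subset_iff simp del: map_map)
  next
    fix ds assume "ds \<in> map \<sigma> ` {cs. set cs \<subseteq> carrier R \<and> length cs = length ys}"
    then show "ds \<in> coeffs R' ys"
      using bij_betw_apply[OF assms(1)] by (auto simp: coeffs_def subset_iff)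
  qed
  moreover have "inj_on (map \<sigma>) {cs. set cs \<subseteq> carrier R \<and> length cs = length ys}"
  proof (rule inj_onI)
    fix cs ds
    assume "cs \<in> {cs. set cs \<subseteq> carrier R \<and> length cs = length ys}"
      "ds \<in> {cs. set cs \<subseteq> carrier R \<and> length cs = length ys}" "map \<sigma> cs = map \<sigma> ds"
    moreover from this have "inj_on \<sigma> (set cs \<union> set ds)"
      using inj_on_subset[OF bij_betw_imp_inj_on[OF assms(1)]] by simp
    ultimately show "cs = ds" using map_inj_on by blast
  qed
  ultimately show ?thesis by (simp add: bij_betw_def eq)
qed

text \<open>Being a basis amounts to bijectivity of the combination map, and this survives
  composition with \<open>f\<close> and the relabelling of coefficients by \<open>\<sigma>\<close>.
  So dimension is an invariant of semilinear isomorphism.\<close>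

lemma semilinear_iso_list_basis:
  assumes "left_vector_space R M" "left_vector_space R' M'" "f \<in> semilinear_iso R \<sigma> M M'"
    "bij_betw \<sigma> (carrier R) (carrier R')" "list_basis R M xs"
  shows "list_basis R' M' (map f xs)"
proof -
  interpret M: left_vector_space R M by fact
  interpret M': left_vector_space R' M' by fact
  have xs: "set xs \<subseteq> carrier M" using assms by (auto simp: list_basis_def)
  have fb: "bij_betw f (carrier M) (carrier M')" using assms by (auto simp: semilinear_iso_def)
  have b1: "bij_betw (\<lambda>cs. f (lincomb M cs xs)) (coeffs R xs) (carrier M')"
    using bij_betw_trans[OF M.list_basis_bij[OF assms(5)] fb] by (simp add: comp_def)
  have b2: "bij_betw (\<lambda>cs. lincomb M' (map \<sigma> cs) (map f xs)) (coeffs R xs) (carrier M')"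
    using b1
    by (rule bij_betw_cong[THEN iffD1, rotated])
      (use semilinear_iso_lincomb[OF M.lmodule_axioms M'.lmodule_axioms assms(3) _ xs] assms(4)
        in \<open>auto simp: bij_betw_def\<close>)
  have b3: "bij_betw (map \<sigma>) (coeffs R xs) (coeffs R' (map f xs))"
    using assms(4) by (rule map_bij_coeffs) simp
  have "bij_betw (\<lambda>cs. lincomb M' cs (map f xs)) (coeffs R' (map f xs)) (carrier M')"
    using bij_betw_comp_iff[OF b3, of "\<lambda>cs. lincomb M' cs (map f xs)"] b2 by (simp add: comp_def)
  then show ?thesis
    using xs fb by (intro M'.list_basisI) (auto simp: bij_betw_def)
qed

text \<open>Coordinates are mapped entrywise by \<open>\<sigma>\<close>. Nearly all comparison maps
  between two algebras arise here: once the division rings are identified, equality of dimensions is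
  enough.\<close>

lemma list_basis_semilinear_iso:
  assumes "left_vector_space R M" "left_vector_space R' M'" "\<sigma> \<in> ring_iso R R'"
    "list_basis R M xs" "list_basis R' M' ys" "length xs = length ys"
  shows "semilinear_iso R \<sigma> M M' \<noteq> {}"
proof -
  interpret M: left_vector_space R M by fact
  interpret M': left_vector_space R' M' by fact
  have xs: "set xs \<subseteq> carrier M" "set ys \<subseteq> carrier M'" using assms by (auto simp: list_basis_def)
  have sb: "bij_betw \<sigma> (carrier R) (carrier R')" using assms(3) by (auto simp: ring_iso_def)
  note b1 = M.list_basis_bij[OF assms(4)]
  define g where "g = inv_into (coeffs R xs) (\<lambda>cs. lincomb M cs xs)"
  define f where "f = (\<lambda>v. lincomb M' (map \<sigma> (g v)) ys)"
  have gl: "g (lincomb M cs xs) = cs" if "cs \<in> coeffs R xs" for cs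
    unfolding g_def using bij_betw_inv_into_left[OF b1 that] .
  have fl: "f (lincomb M cs xs) = lincomb M' (map \<sigma> cs) ys" if "cs \<in> coeffs R xs" for cs
    using gl[OF that] by (simp add: f_def)
  have ex: "\<exists>cs\<in>coeffs R xs. v = lincomb M cs xs" if "v \<in> carrier M" for v
    using b1 that by (auto simp: bij_betw_def)
  have co: "map \<sigma> cs \<in> coeffs R' ys" if "cs \<in> coeffs R xs" for cs
    using map_bij_coeffs[OF sb assms(6)] that by (auto simp: bij_betw_def)
  note hom = ring_iso_memE[OF assms(3)]
  have "bij_betw (\<lambda>cs. f (lincomb M cs xs)) (coeffs R xs) (carrier M')"
    using bij_betw_trans[OF map_bij_coeffs[OF sb assms(6)] M'.list_basis_bij[OF assms(5)]]
    by (rule bij_betw_cong[THEN iffD1, rotated]) (simp add: fl)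
  then have "bij_betw f (carrier M) (carrier M')"
    using bij_betw_comp_iff[OF b1, of f] by (simp add: comp_def)
  moreover have "f (x \<oplus>\<^bsub>M\<^esub> y) = f x \<oplus>\<^bsub>M'\<^esub> f y" if xy: "x \<in> carrier M" "y \<in> carrier M" for x y
  proof -
    obtain cs ds where cs: "cs \<in> coeffs R xs" "x = lincomb M cs xs" "ds \<in> coeffs R xs" "y = lincomb M ds xs"
      using ex[OF xy(1)] ex[OF xy(2)] by auto
    have "map \<sigma> (map2 (\<oplus>\<^bsub>R\<^esub>) cs ds) = map2 (\<oplus>\<^bsub>R'\<^esub>) (map \<sigma> cs) (map \<sigma> ds)"
      using cs(1,3) by (intro map_map2_hom[where A = "carrier R"] hom(3)) (auto simp: coeffs_def)
    then show ?thesis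
      using M.lincomb_add[OF xs(1) cs(1,3)] M'.lincomb_add[OF xs(2) co co, OF cs(1,3)]
        fl M.map2_add_coeffs cs by metis
  qed
  moreover have "f (a \<odot>\<^bsub>M\<^esub> x) = \<sigma> a \<odot>\<^bsub>M'\<^esub> f x" if xa: "x \<in> carrier M" "a \<in> carrier R" for x a
  proof -
    obtain cs where cs: "cs \<in> coeffs R xs" "x = lincomb M cs xs"
      using ex[OF xa(1)] by auto
    have "map \<sigma> (map ((\<otimes>\<^bsub>R\<^esub>) a) cs) = map ((\<otimes>\<^bsub>R'\<^esub>) (\<sigma> a)) (map \<sigma> cs)"
    proof -
      have "\<sigma> (a \<otimes>\<^bsub>R\<^esub> c) = \<sigma> a \<otimes>\<^bsub>R'\<^esub> \<sigma> c" if "c \<in> set cs" for c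
        using hom(2)[OF \<open>a \<in> carrier R\<close>, of c] that cs(1) by (auto simp: coeffs_def)
      then show ?thesis by simp
    qed
    then show ?thesis
      using M.lincomb_smult[OF xs(1) cs(1) xa(2)] M'.lincomb_smult[OF xs(2) co[OF cs(1)] hom(1)[OF xa(2)]]
        fl M.map_mult_coeffs[OF cs(1) xa(2)] cs by metis
  qed
  ultimately show ?thesis by (auto simp: semilinear_iso_def)
qed

section \<open>Collineations\<close>

lemma (in lmodule) submodule_lmodule:
  assumes "submodule N R M"
  shows "lmodule R (M\<lparr>carrier := N\<rparr>)"
proof (intro lmodule.intro lmodule_axioms.intro)
  have N: "x \<in> carrier M" if "x \<in> N" for x
    using submoduleD(1)[OF assms] that by auto
  show "ring R" by (rule R.ring_axioms)
  show "abelian_group (M\<lparr>carrier := N\<rparr>)"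
  proof (rule abelian_groupI)
    fix x assume "x \<in> carrier (M\<lparr>carrier := N\<rparr>)"
    then have x: "x \<in> N" by simp
    then have "\<ominus>\<^bsub>M\<^esub> x \<in> N" "\<ominus>\<^bsub>M\<^esub> x \<oplus>\<^bsub>M\<^esub> x = \<zero>\<^bsub>M\<^esub>"
      using submoduleD(5)[OF assms] N[OF x] by (auto simp: M.l_neg)
    then show "\<exists>y\<in>carrier (M\<lparr>carrier := N\<rparr>). y \<oplus>\<^bsub>M\<lparr>carrier := N\<rparr>\<^esub> x = \<zero>\<^bsub>M\<lparr>carrier := N\<rparr>\<^esub>"
      by auto
  qed (use submoduleD(2,3)[OF assms] N in \<open>auto simp: M.a_assoc intro: M.a_comm\<close>)
qed (use submoduleD(1,4)[OF assms] in \<open>auto simp: subset_iff smult_l_distr smult_r_distr smult_assoc1\<close>)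

context lmodule
begin

lemma mem_cyclic_sub [simp]: "w \<in> carrier M \<Longrightarrow> w \<in> cyclic_sub R M w"
  by (force simp: cyclic_sub_def intro: exI[of _ "\<one>\<^bsub>R\<^esub>"])

lemma cyclic_sub_eq_lspan: "w \<in> carrier M \<Longrightarrow> cyclic_sub R M w = lspan R M [w]"
  by (force simp: cyclic_sub_def lspan_Cons)

lemma cyclic_sub_submodule: "w \<in> carrier M \<Longrightarrow> submodule (cyclic_sub R M w) R M"
  by (simp add: cyclic_sub_eq_lspan lspan_submodule)

lemma cyclic_sub_subset_iff:
  assumes "submodule U R M" "w \<in> carrier M"
  shows "cyclic_sub R M w \<subseteq> U \<longleftrightarrow> w \<in> U"
  using submoduleD(4)[OF assms(1)] mem_cyclic_sub[OF assms(2)] by (auto simp: cyclic_sub_def)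

end

context left_vector_space
begin

text \<open>Replaces the dimension condition by spanning vectors, with which all later computations
  are done; over a division ring a nonzero vector has no annihilator, so it is a basis of its cyclic
  submodule.\<close>

lemma proj_points_eq:
  "proj_points R M = cyclic_sub R M ` (carrier M - {\<zero>\<^bsub>M\<^esub>})"
proof (intro equalityI subsetI)
  fix N assume "N \<in> proj_points R M"
  then have N: "submodule N R M" "has_dim R (M\<lparr>carrier := N\<rparr>) 1" by (auto simp: proj_points_def)
  interpret N: lmodule R "M\<lparr>carrier := N\<rparr>" using N by (intro submodule_lmodule)
  obtain xs where "list_basis R (M\<lparr>carrier := N\<rparr>) xs" "length xs = 1"
    using N.has_dim_list_basis[OF N(2) one_neq_zero] by auto
  then obtain w where w: "list_basis R (M\<lparr>carrier := N\<rparr>) [w]" by (auto simp: length_Suc_conv)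
  then have wN: "w \<in> N" "w \<noteq> \<zero>\<^bsub>M\<^esub>" by (auto simp: list_basis_def)
  have "N = lspan R (M\<lparr>carrier := N\<rparr>) [w]" using w by (simp add: list_basis_def)
  also have "\<dots> = cyclic_sub R (M\<lparr>carrier := N\<rparr>) w"
    using wN N.cyclic_sub_eq_lspan by simp
  also have "\<dots> = cyclic_sub R M w" by (simp add: cyclic_sub_def)
  finally show "N \<in> cyclic_sub R M ` (carrier M - {\<zero>\<^bsub>M\<^esub>})"
    using wN submoduleD(1)[OF N(1)] by auto
next
  fix N assume "N \<in> cyclic_sub R M ` (carrier M - {\<zero>\<^bsub>M\<^esub>})"
  then obtain w where w: "N = cyclic_sub R M w" "w \<in> carrier M" "w \<noteq> \<zero>\<^bsub>M\<^esub>" by auto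
  have sub: "submodule N R M" using w cyclic_sub_submodule by simp
  interpret N: lmodule R "M\<lparr>carrier := N\<rparr>" using sub by (intro submodule_lmodule)
  have "has_dim R (M\<lparr>carrier := N\<rparr>) 1"
  proof (rule N.has_dim_1I[of w])
    show "w \<in> carrier (M\<lparr>carrier := N\<rparr>)" using w by simp
    show "carrier (M\<lparr>carrier := N\<rparr>) = {a \<odot>\<^bsub>M\<lparr>carrier := N\<rparr>\<^esub> w |a. a \<in> carrier R}"
      using w by (simp add: cyclic_sub_def)
  qed (use w smult_eq_zero_iff in auto)
  then show "N \<in> proj_points R M" using sub by (auto simp: proj_points_def)
qed

lemma cyclic_sub_eqD:
  assumes "u \<in> carrier M" "u \<noteq> \<zero>\<^bsub>M\<^esub>" "w \<in> carrier M" "cyclic_sub R M u = cyclic_sub R M w"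
  shows "\<exists>a\<in>carrier R. a \<noteq> \<zero>\<^bsub>R\<^esub> \<and> u = a \<odot>\<^bsub>M\<^esub> w"
proof -
  have "u \<in> cyclic_sub R M w" using assms mem_cyclic_sub[of u] by auto
  then obtain a where "a \<in> carrier R" "u = a \<odot>\<^bsub>M\<^esub> w" by (auto simp: cyclic_sub_def)
  then show ?thesis using assms by (intro bexI[of _ a]) auto
qed

lemma cyclic_sub_smult:
  assumes "a \<in> carrier R" "a \<noteq> \<zero>\<^bsub>R\<^esub>" "w \<in> carrier M"
  shows "cyclic_sub R M (a \<odot>\<^bsub>M\<^esub> w) = cyclic_sub R M w"
proof (rule equalityI)
  show "cyclic_sub R M (a \<odot>\<^bsub>M\<^esub> w) \<subseteq> cyclic_sub R M w"
    using assms cyclic_sub_submodule[OF assms(3)]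
    by (subst cyclic_sub_subset_iff) (auto simp: cyclic_sub_def)
  have "a \<odot>\<^bsub>M\<^esub> w \<in> cyclic_sub R M (a \<odot>\<^bsub>M\<^esub> w)" using assms by simp
  then show "cyclic_sub R M w \<subseteq> cyclic_sub R M (a \<odot>\<^bsub>M\<^esub> w)"
    using assms submodule_smult_iff[OF cyclic_sub_submodule[of "a \<odot>\<^bsub>M\<^esub> w"] assms]
    by (subst cyclic_sub_subset_iff) (auto intro: cyclic_sub_submodule)
qed

lemma proj_points_cases:
  assumes "N \<in> proj_points R M"
  obtains w where "w \<in> carrier M" "w \<noteq> \<zero>\<^bsub>M\<^esub>" "N = cyclic_sub R M w"
  using assms by (auto simp: proj_points_eq)

end

text \<open>The type of geometries allows blocks that are not sets of points; the second premise
  excludes them, so that \<open>inv_into\<close> undoes the image of a block.\<close>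

lemma geom_isos_inv:
  assumes "\<beta> \<in> geom_isos G H" "\<And>S. S \<in> snd G \<Longrightarrow> S \<subseteq> fst G"
  shows "inv_into (fst G) \<beta> \<in> geom_isos H G"
proof -
  have b: "bij_betw \<beta> (fst G) (fst H)" "(\<lambda>S. \<beta> ` S) ` snd G = snd H"
    using assms(1) by (auto simp: geom_isos_def)
  have "inv_into (fst G) \<beta> ` (\<beta> ` S) = S" if "S \<in> snd G" for S
    using inv_into_image_cancel[OF bij_betw_imp_inj_on[OF b(1)] assms(2)[OF that]] .
  then have "(\<lambda>S. inv_into (fst G) \<beta> ` S) ` snd H = snd G"
    unfolding b(2)[symmetric] by (force simp: image_image)
  then show ?thesis using bij_betw_inv_into[OF b(1)] by (auto simp: geom_isos_def)
qed

lemma geom_isos_comp: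
  assumes "\<beta> \<in> geom_isos G H" "\<gamma> \<in> geom_isos H I"
  shows "\<gamma> \<circ> \<beta> \<in> geom_isos G I"
proof -
  have "(\<lambda>S. (\<gamma> \<circ> \<beta>) ` S) ` snd G = (\<lambda>S. \<gamma> ` S) ` ((\<lambda>S. \<beta> ` S) ` snd G)"
    by (simp add: image_image image_comp)
  then show ?thesis using assms by (auto simp: geom_isos_def intro: bij_betw_trans)
qed

lemma PG_subspace_subset: "S \<in> snd (PG D W) \<Longrightarrow> S \<subseteq> fst (PG D W)"
  by (auto simp: PG_def proj_subspaces_def)

section \<open>Collineations acting on representing vectors\<close>

locale collineation = D: left_vector_space D W + D': left_vector_space D' W'
  for D :: "('d, 'p) ring_scheme" and W :: "('d, 'm, 'q) module_scheme"
    and D' :: "('e, 'p2) ring_scheme" and W' :: "('e, 'n, 'q2) module_scheme" +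
  fixes \<beta> :: "'m set \<Rightarrow> 'n set"
  assumes collineation: "\<beta> \<in> geom_isos (PG D W) (PG D' W')"
begin

lemma bij: "bij_betw \<beta> (proj_points D W) (proj_points D' W')"
  using collineation by (simp add: geom_isos_def PG_def)

lemma subspaces: "(\<lambda>S. \<beta> ` S) ` proj_subspaces D W = proj_subspaces D' W'"
  using collineation by (simp add: geom_isos_def PG_def)

lemma collineation_inv: "collineation D' W' D W (inv_into (proj_points D W) \<beta>)"
  using geom_isos_inv[OF collineation PG_subspace_subset]
  by (intro collineation.intro collineation_axioms.intro D.left_vector_space_axioms
      D'.left_vector_space_axioms) (auto simp: PG_def)

text \<open>Points are handled through representatives. Each side determines the other up to a
  nonzero scalar (\<open>maps_unique\<close>, \<open>maps_inj\<close>), and this freedom is what the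
  choice of a frame consumes.\<close>

definition maps :: "'m \<Rightarrow> 'n \<Rightarrow> bool" where
  "maps u u' \<longleftrightarrow> u \<in> carrier W \<and> u \<noteq> \<zero>\<^bsub>W\<^esub> \<and> u' \<in> carrier W' \<and> u' \<noteq> \<zero>\<^bsub>W'\<^esub>
     \<and> \<beta> (cyclic_sub D W u) = cyclic_sub D' W' u'"

lemma maps_carrier [dest]:
  "maps u u' \<Longrightarrow> u \<in> carrier W" "maps u u' \<Longrightarrow> u' \<in> carrier W'"
  "maps u u' \<Longrightarrow> u \<noteq> \<zero>\<^bsub>W\<^esub>" "maps u u' \<Longrightarrow> u' \<noteq> \<zero>\<^bsub>W'\<^esub>"
  by (auto simp: maps_def)

lemma ex_maps:
  assumes "u \<in> carrier W" "u \<noteq> \<zero>\<^bsub>W\<^esub>"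
  shows "\<exists>u'. maps u u'"
proof -
  have "\<beta> (cyclic_sub D W u) \<in> proj_points D' W'"
    using bij_betw_apply[OF bij] assms by (auto simp: D.proj_points_eq)
  then show ?thesis
    using assms by (elim D'.proj_points_cases) (auto simp: maps_def)
qed

lemma ex_maps_onto:
  assumes "u' \<in> carrier W'" "u' \<noteq> \<zero>\<^bsub>W'\<^esub>"
  shows "\<exists>u. maps u u'"
proof -
  have "cyclic_sub D' W' u' \<in> \<beta> ` proj_points D W"
    using bij assms by (auto simp: bij_betw_def D'.proj_points_eq)
  then obtain N where "N \<in> proj_points D W" "\<beta> N = cyclic_sub D' W' u'" by auto
  then show ?thesis
    using assms by (elim D.proj_points_cases) (auto simp: maps_def)
qed

lemma maps_unique:
  assumes "maps u u'" "maps u u''"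
  shows "\<exists>a\<in>carrier D'. a \<noteq> \<zero>\<^bsub>D'\<^esub> \<and> u'' = a \<odot>\<^bsub>W'\<^esub> u'"
  using assms D'.cyclic_sub_eqD[of u'' u'] by (auto simp: maps_def)

lemma maps_inj:
  assumes "maps u w" "maps v w"
  shows "\<exists>a\<in>carrier D. a \<noteq> \<zero>\<^bsub>D\<^esub> \<and> u = a \<odot>\<^bsub>W\<^esub> v"
proof -
  have "cyclic_sub D W u = cyclic_sub D W v"
    using assms inj_onD[OF bij_betw_imp_inj_on[OF bij], of "cyclic_sub D W u" "cyclic_sub D W v"]
    by (auto simp: maps_def D.proj_points_eq)
  then show ?thesis using assms D.cyclic_sub_eqD[of u v] by (auto simp: maps_def)
qed

lemma maps_smult:
  assumes "maps u u'" "a \<in> carrier D'" "a \<noteq> \<zero>\<^bsub>D'\<^esub>"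
  shows "maps u (a \<odot>\<^bsub>W'\<^esub> u')"
  using assms by (auto simp: maps_def D'.cyclic_sub_smult D'.smult_eq_zero_iff)

lemma maps_smult_left:
  assumes "maps u u'" "a \<in> carrier D" "a \<noteq> \<zero>\<^bsub>D\<^esub>"
  shows "maps (a \<odot>\<^bsub>W\<^esub> u) u'"
  using assms by (auto simp: maps_def D.cyclic_sub_smult D.smult_eq_zero_iff)

lemma list_all2_maps_carrier: "list_all2 maps xs xs' \<Longrightarrow> set xs' \<subseteq> carrier W' - {\<zero>\<^bsub>W'\<^esub>}"
  by (induction rule: list_all2_induct) auto

text \<open>The span of \<open>xs'\<close> is a projective subspace, hence the image of one, coming
  from a submodule \<open>U\<close>. Since \<open>U\<close> contains all entries of
  \<open>xs\<close>, it contains their span and thus \<open>y\<close>.\<close>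

lemma maps_lspan:
  assumes "list_all2 maps xs xs'" "maps y y'" "y \<in> lspan D W xs"
  shows "y' \<in> lspan D' W' xs'"
proof (cases "xs' = []")
  \<comment> \<open>The zero submodule is not among the projective subspaces. Here \<open>xs\<close>
    is empty too, and its span contains no nonzero \<open>y\<close>.\<close>
  case True
  then show ?thesis using assms by auto
next
  case False
  have xs': "set xs' \<subseteq> carrier W'"
    using list_all2_maps_carrier[OF assms(1)] by auto
  have "submodule (lspan D' W' xs') D' W'" using xs' by (rule D'.lspan_submodule)
  moreover have "lspan D' W' xs' \<noteq> {\<zero>\<^bsub>W'\<^esub>}"
  proof -
    obtain x' where "x' \<in> set xs'" using False by (cases xs') auto
    moreover from this have "x' \<noteq> \<zero>\<^bsub>W'\<^esub>"
      using list_all2_maps_carrier[OF assms(1)] by auto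
    ultimately show ?thesis using D'.set_subset_lspan[OF xs'] by auto
  qed
  ultimately have "{N \<in> proj_points D' W'. N \<subseteq> lspan D' W' xs'} \<in> proj_subspaces D' W'"
    by (auto simp: proj_subspaces_def)
  then obtain S where S: "S \<in> proj_subspaces D W" "\<beta> ` S = {N \<in> proj_points D' W'. N \<subseteq> lspan D' W' xs'}"
    using subspaces by (metis (no_types, lifting) image_iff)
  then obtain U where U: "submodule U D W" "S = {N \<in> proj_points D W. N \<subseteq> U}"
    by (auto simp: proj_subspaces_def)
  have iff: "u \<in> U \<longleftrightarrow> u' \<in> lspan D' W' xs'" if m: "maps u u'" for u u'
  proof -
    have uc: "u \<in> carrier W" "u' \<in> carrier W'" using m by auto
    have pt: "cyclic_sub D W u \<in> proj_points D W" "cyclic_sub D' W' u' \<in> proj_points D' W'"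
      using m by (auto simp: maps_def D.proj_points_eq D'.proj_points_eq)
    have "u \<in> U \<longleftrightarrow> cyclic_sub D W u \<in> S"
      using D.cyclic_sub_subset_iff[OF U(1) uc(1)] pt U(2) by auto
    also have "\<dots> \<longleftrightarrow> \<beta> (cyclic_sub D W u) \<in> \<beta> ` S"
      using inj_on_image_mem_iff[OF bij_betw_imp_inj_on[OF bij] pt(1), of S] U(2) by auto
    also have "\<dots> \<longleftrightarrow> u' \<in> lspan D' W' xs'"
      using m pt D'.cyclic_sub_subset_iff[OF D'.lspan_submodule[OF xs'] uc(2)] S(2)
      by (auto simp: maps_def)
    finally show ?thesis .
  qed
  have "set xs \<subseteq> U"
  proof
    fix x assume "x \<in> set xs"
    then obtain k where k: "k < length xs" "x = xs ! k" by (auto simp: in_set_conv_nth)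
    then have "maps x (xs' ! k)" "xs' ! k \<in> set xs'"
      using assms(1) by (auto simp: list_all2_conv_all_nth)
    then show "x \<in> U" using iff D'.set_subset_lspan[OF xs'] by auto
  qed
  then have "lspan D W xs \<subseteq> U" by (rule D.lspan_least[OF U(1)])
  then show ?thesis using iff[OF assms(2)] assms(3) by auto
qed

text \<open>Upgrades one-sided incidence statements to equivalences, by applying them to the inverse
  collineation.\<close>

lemma maps_inv: "collineation.maps D' W' D W (inv_into (proj_points D W) \<beta>) u' u \<longleftrightarrow> maps u u'"
proof -
  interpret inv: collineation D' W' D W "inv_into (proj_points D W) \<beta>" by (rule collineation_inv)
  show ?thesis
    unfolding inv.maps_def maps_def
    using bij_betw_inv_into_left[OF bij] bij_betw_inv_into_right[OF bij]
    by (metis D.proj_points_eq D'.proj_points_eq DiffI image_eqI singletonD)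
qed

lemma maps_lspan_iff:
  assumes "list_all2 maps xs xs'" "maps y y'"
  shows "y \<in> lspan D W xs \<longleftrightarrow> y' \<in> lspan D' W' xs'"
proof -
  interpret inv: collineation D' W' D W "inv_into (proj_points D W) \<beta>" by (rule collineation_inv)
  have "list_all2 inv.maps xs' xs" "inv.maps y' y"
    using assms by (auto simp: list_all2_conv_all_nth maps_inv)
  then show ?thesis using maps_lspan[OF assms] inv.maps_lspan[of xs' xs y' y] by blast
qed

lemma maps_lindep_free:
  assumes "list_all2 maps xs xs'" "lindep_free D W xs"
  shows "lindep_free D' W' xs'"
  using assms by (induction rule: list_all2_induct) (auto simp: maps_lspan_iff)

lemma ex_maps_list:
  "set xs \<subseteq> carrier W - {\<zero>\<^bsub>W\<^esub>} \<Longrightarrow> \<exists>xs'. list_all2 maps xs xs'"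
proof (induction xs)
  case (Cons x xs)
  then obtain xs' x' where "list_all2 maps xs xs'" "maps x x'" using ex_maps[of x] by auto
  then show ?case by (intro exI[of _ "x' # xs'"]) auto
qed auto

text \<open>Independence and spanning are both expressed by membership in spans, which a
  collineation respects. So dimension is preserved whatever its size, while the division ring is
  recovered only from dimension three on.\<close>

lemma list_basis_transfer:
  assumes "list_basis D W xs"
  shows "\<exists>xs'. list_basis D' W' xs' \<and> length xs' = length xs"
proof -
  have xs: "set xs \<subseteq> carrier W" "lindep_free D W xs" using assms by (auto simp: list_basis_def)
  have "\<zero>\<^bsub>W\<^esub> \<notin> set xs" using xs
  proof (induction xs)
    case (Cons x xs)
    then show ?case using D.submoduleD(2)[OF D.lspan_submodule[of xs]] by auto
  qed auto
  then obtain xs' where xs': "list_all2 maps xs xs'" using ex_maps_list[of xs] xs by auto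
  have c: "set xs' \<subseteq> carrier W'"
    using list_all2_maps_carrier[OF xs'] by auto
  have "y' \<in> lspan D' W' xs'" if y': "y' \<in> carrier W'" for y'
  proof (cases "y' = \<zero>\<^bsub>W'\<^esub>")
    case True
    then show ?thesis using D'.submoduleD(2)[OF D'.lspan_submodule[OF c]] by simp
  next
    case False
    then obtain y where "maps y y'" using ex_maps_onto y' by auto
    then show ?thesis using maps_lspan[OF xs'] assms by (auto simp: list_basis_def)
  qed
  then have "list_basis D' W' xs'"
    using c maps_lindep_free[OF xs' xs(2)] D'.lspan_subset[OF c] by (auto simp: list_basis_def)
  then show ?thesis using list_all2_lengthD[OF xs'] by auto
qed

end

section \<open>Semilinear isomorphisms induce collineations\<close>

lemma semilinear_iso_zero:
  assumes "lmodule R M" "lmodule R' M'" "f \<in> semilinear_iso R \<sigma> M M'"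
  shows "f \<zero>\<^bsub>M\<^esub> = \<zero>\<^bsub>M'\<^esub>"
proof -
  interpret M: lmodule R M by fact
  interpret M': lmodule R' M' by fact
  have "f \<zero>\<^bsub>M\<^esub> \<in> carrier M'"
    using assms(3) by (auto simp: semilinear_iso_def bij_betw_def)
  moreover have "f (\<zero>\<^bsub>M\<^esub> \<oplus>\<^bsub>M\<^esub> \<zero>\<^bsub>M\<^esub>) = f \<zero>\<^bsub>M\<^esub> \<oplus>\<^bsub>M'\<^esub> f \<zero>\<^bsub>M\<^esub>"
    using assms(3) M.M.zero_closed unfolding semilinear_iso_def by blast
  ultimately show ?thesis by (metis M'.M.add.r_cancel_one' M.M.r_zero M.M.zero_closed)
qed

lemma semilinear_iso_eq_zero_iff:
  assumes "lmodule R M" "lmodule R' M'" "f \<in> semilinear_iso R \<sigma> M M'" "w \<in> carrier M"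
  shows "f w = \<zero>\<^bsub>M'\<^esub> \<longleftrightarrow> w = \<zero>\<^bsub>M\<^esub>"
proof -
  interpret M: lmodule R M by fact
  have "inj_on f (carrier M)" using assms(3) by (simp add: semilinear_iso_def bij_betw_def)
  then show ?thesis
    using semilinear_iso_zero[OF assms(1-3)] inj_onD[of f "carrier M" w "\<zero>\<^bsub>M\<^esub>"] assms(4) by auto
qed

lemma semilinear_iso_inv:
  assumes "lmodule R M" "lmodule R' M'" "f \<in> semilinear_iso R \<sigma> M M'"
    "bij_betw \<sigma> (carrier R) (carrier R')"
  shows "inv_into (carrier M) f \<in> semilinear_iso R' (inv_into (carrier R) \<sigma>) M' M"
proof -
  interpret M: lmodule R M by fact
  interpret M': lmodule R' M' by fact
  let ?g = "inv_into (carrier M) f" and ?s = "inv_into (carrier R) \<sigma>"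
  have b: "bij_betw f (carrier M) (carrier M')" using assms(3) by (simp add: semilinear_iso_def)
  have fg: "f (?g y) = y" "?g y \<in> carrier M" if "y \<in> carrier M'" for y
    using bij_betw_inv_into_right[OF b that] bij_betw_apply[OF bij_betw_inv_into[OF b] that] by auto
  have gf: "?g (f x) = x" if "x \<in> carrier M" for x
    using bij_betw_inv_into_left[OF b that] .
  have s: "\<sigma> (?s a) = a" "?s a \<in> carrier R" if "a \<in> carrier R'" for a
    using bij_betw_inv_into_right[OF assms(4) that] bij_betw_apply[OF bij_betw_inv_into[OF assms(4)] that]
    by auto
  have add: "f (x \<oplus>\<^bsub>M\<^esub> y) = f x \<oplus>\<^bsub>M'\<^esub> f y" if "x \<in> carrier M" "y \<in> carrier M" for x y
    using assms(3) that by (auto simp: semilinear_iso_def)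
  have sm: "f (a \<odot>\<^bsub>M\<^esub> x) = \<sigma> a \<odot>\<^bsub>M'\<^esub> f x" if "x \<in> carrier M" "a \<in> carrier R" for x a
    using assms(3) that by (auto simp: semilinear_iso_def)
  have "?g (x \<oplus>\<^bsub>M'\<^esub> y) = ?g x \<oplus>\<^bsub>M\<^esub> ?g y" if "x \<in> carrier M'" "y \<in> carrier M'" for x y
    using gf[of "?g x \<oplus>\<^bsub>M\<^esub> ?g y"] add[of "?g x" "?g y"] fg that by simp
  moreover have "?g (a \<odot>\<^bsub>M'\<^esub> x) = ?s a \<odot>\<^bsub>M\<^esub> ?g x" if "x \<in> carrier M'" "a \<in> carrier R'" for x a
    using gf[of "?s a \<odot>\<^bsub>M\<^esub> ?g x"] sm[of "?g x" "?s a"] fg s that by simp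
  ultimately show ?thesis using bij_betw_inv_into[OF b] by (auto simp: semilinear_iso_def)
qed

lemma semilinear_iso_cyclic_sub:
  assumes "f \<in> semilinear_iso R \<sigma> M M'" "\<sigma> ` carrier R = carrier R'" "w \<in> carrier M"
  shows "f ` cyclic_sub R M w = cyclic_sub R' M' (f w)"
proof -
  have sm: "f (a \<odot>\<^bsub>M\<^esub> w) = \<sigma> a \<odot>\<^bsub>M'\<^esub> f w" if "a \<in> carrier R" for a
    using assms(1,3) that by (auto simp: semilinear_iso_def)
  have "f ` cyclic_sub R M w = (\<lambda>a. f (a \<odot>\<^bsub>M\<^esub> w)) ` carrier R"
    by (auto simp: cyclic_sub_def)
  also have "\<dots> = (\<lambda>b. b \<odot>\<^bsub>M'\<^esub> f w) ` (\<sigma> ` carrier R)"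
    by (auto simp: image_image sm intro!: image_cong)
  finally show ?thesis by (auto simp: cyclic_sub_def assms(2))
qed

lemma semilinear_iso_submodule:
  assumes "lmodule R M" "lmodule R' M'" "f \<in> semilinear_iso R \<sigma> M M'"
    "\<sigma> ` carrier R = carrier R'" "submodule U R M"
  shows "submodule (f ` U) R' M'"
proof -
  interpret M: lmodule R M by fact
  interpret M': lmodule R' M' by fact
  note U = M.submoduleD[OF assms(5)]
  have b: "bij_betw f (carrier M) (carrier M')" using assms(3) by (simp add: semilinear_iso_def)
  have add: "f (x \<oplus>\<^bsub>M\<^esub> y) = f x \<oplus>\<^bsub>M'\<^esub> f y" if "x \<in> carrier M" "y \<in> carrier M" for x y
    using assms(3) that by (auto simp: semilinear_iso_def)
  have sm: "f (a \<odot>\<^bsub>M\<^esub> x) = \<sigma> a \<odot>\<^bsub>M'\<^esub> f x" if "x \<in> carrier M" "a \<in> carrier R" for x a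
    using assms(3) that by (auto simp: semilinear_iso_def)
  show ?thesis
  proof (rule M'.submoduleI)
    show "f ` U \<subseteq> carrier M'" using U(1) b by (auto simp: bij_betw_def)
    show "\<zero>\<^bsub>M'\<^esub> \<in> f ` U" using U(2) semilinear_iso_zero[OF assms(1-3)] by force
  next
    fix x y assume "x \<in> f ` U" "y \<in> f ` U"
    then obtain u v where uv: "u \<in> U" "v \<in> U" "x = f u" "y = f v" by auto
    then have "x \<oplus>\<^bsub>M'\<^esub> y = f (u \<oplus>\<^bsub>M\<^esub> v)" using add subsetD[OF U(1)] by simp
    then show "x \<oplus>\<^bsub>M'\<^esub> y \<in> f ` U" using U(3) uv by auto
  next
    fix a x assume a: "a \<in> carrier R'" and x: "x \<in> f ` U"
    from x obtain u where u: "u \<in> U" "x = f u" by auto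
    from a obtain c where c: "c \<in> carrier R" "a = \<sigma> c" unfolding assms(4)[symmetric] by auto
    note uc = u(1) c(1) u(2) c(2)
    then have "a \<odot>\<^bsub>M'\<^esub> x = f (c \<odot>\<^bsub>M\<^esub> u)" using sm subsetD[OF U(1)] by simp
    then show "a \<odot>\<^bsub>M'\<^esub> x \<in> f ` U" using U(4) uc by auto
  qed
qed

text \<open>Cyclic submodules go to cyclic submodules, hence points to points; that every subspace
  is hit follows by pulling it back along the inverse semilinear map.\<close>

lemma semilinear_iso_PG:
  assumes "left_vector_space R M" "left_vector_space R' M'" "f \<in> semilinear_iso R \<sigma> M M'"
    "bij_betw \<sigma> (carrier R) (carrier R')"
  shows "(`) f \<in> geom_isos (PG R M) (PG R' M')"
proof -
  interpret M: left_vector_space R M by fact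
  interpret M': left_vector_space R' M' by fact
  let ?g = "inv_into (carrier M) f"
  have im: "\<sigma> ` carrier R = carrier R'" using assms(4) by (simp add: bij_betw_def)
  have b: "bij_betw f (carrier M) (carrier M')" using assms(3) by (simp add: semilinear_iso_def)
  note f0 = semilinear_iso_zero[OF M.lmodule_axioms M'.lmodule_axioms assms(3)]
  have f0_iff: "f w = \<zero>\<^bsub>M'\<^esub> \<longleftrightarrow> w = \<zero>\<^bsub>M\<^esub>" if "w \<in> carrier M" for w
    using semilinear_iso_eq_zero_iff[OF M.lmodule_axioms M'.lmodule_axioms assms(3) that] .
  have inj: "inj_on ((`) f) (Pow (carrier M))"
    using bij_betw_imp_inj_on[OF b] by (rule inj_on_image_Pow)
  have sub: "proj_points R M \<subseteq> Pow (carrier M)"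
    using M.submoduleD(1)[OF M.cyclic_sub_submodule] by (auto simp: M.proj_points_eq)
  have "f ` (carrier M - {\<zero>\<^bsub>M\<^esub>}) = carrier M' - {\<zero>\<^bsub>M'\<^esub>}"
    using b f0_iff by (auto simp: bij_betw_def)
  moreover have "(`) f ` proj_points R M = cyclic_sub R' M' ` f ` (carrier M - {\<zero>\<^bsub>M\<^esub>})"
    unfolding M.proj_points_eq image_image
    by (intro image_cong refl semilinear_iso_cyclic_sub[OF assms(3) im]) auto
  ultimately have pts: "(`) f ` proj_points R M = proj_points R' M'"
    by (simp add: M'.proj_points_eq)
  have bp: "bij_betw ((`) f) (proj_points R M) (proj_points R' M')"
    using pts inj_on_subset[OF inj sub] by (simp add: bij_betw_def)
  have sp: "(`) f ` {N \<in> proj_points R M. N \<subseteq> U} = {N \<in> proj_points R' M'. N \<subseteq> f ` U}"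
    if "U \<subseteq> carrier M" for U
  proof -
    have "f ` N \<subseteq> f ` U \<longleftrightarrow> N \<subseteq> U" if N: "N \<in> proj_points R M" for N
    proof -
      have "N \<subseteq> carrier M" using sub N by auto
      then have "x \<in> U" if "x \<in> N" "f x \<in> f ` U" for x
        using inj_on_image_mem_iff[OF bij_betw_imp_inj_on[OF b] _ \<open>U \<subseteq> carrier M\<close>] that by auto
      then show ?thesis by auto
    qed
    then show ?thesis unfolding pts[symmetric] by auto
  qed
  have "(\<lambda>S. (`) f ` S) ` proj_subspaces R M = proj_subspaces R' M'"
  proof (intro equalityI subsetI)
    fix S assume "S \<in> (\<lambda>S. (`) f ` S) ` proj_subspaces R M"
    then obtain U where U: "submodule U R M" "U \<noteq> {\<zero>\<^bsub>M\<^esub>}"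
      "S = (`) f ` {N \<in> proj_points R M. N \<subseteq> U}"
      by (auto simp: proj_subspaces_def)
    note Uc = M.submoduleD(1,2)[OF U(1)]
    obtain u where "u \<in> U" "u \<noteq> \<zero>\<^bsub>M\<^esub>" using U(2) Uc(2) by auto
    then have "f ` U \<noteq> {\<zero>\<^bsub>M'\<^esub>}" using f0_iff[of u] Uc(1) by auto
    then show "S \<in> proj_subspaces R' M'"
      using U sp[OF Uc(1)] semilinear_iso_submodule[OF M.lmodule_axioms M'.lmodule_axioms assms(3) im U(1)]
      unfolding proj_subspaces_def by blast
  next
    fix S assume "S \<in> proj_subspaces R' M'"
    then obtain U where U: "submodule U R' M'" "U \<noteq> {\<zero>\<^bsub>M'\<^esub>}"
      "S = {N \<in> proj_points R' M'. N \<subseteq> U}"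
      by (auto simp: proj_subspaces_def)
    note Uc = M'.submoduleD(1,2)[OF U(1)]
    define U0 where "U0 = ?g ` U"
    have U0: "submodule U0 R M"
      unfolding U0_def
      by (rule semilinear_iso_submodule[OF M'.lmodule_axioms M.lmodule_axioms
            semilinear_iso_inv[OF M.lmodule_axioms M'.lmodule_axioms assms(3,4)] _ U(1)])
        (use bij_betw_inv_into[OF assms(4)] in \<open>simp add: bij_betw_def\<close>)
    have fU0: "f ` U0 = U" using image_inv_into_cancel[of f] b Uc(1) by (simp add: U0_def bij_betw_def)
    then have "U0 \<noteq> {\<zero>\<^bsub>M\<^esub>}" using U(2) f0 by auto
    moreover have "S = (`) f ` {N \<in> proj_points R M. N \<subseteq> U0}"
      using sp[OF M.submoduleD(1)[OF U0]] U(3) fU0 by simp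
    ultimately show "S \<in> (\<lambda>S. (`) f ` S) ` proj_subspaces R M"
      using U0 unfolding proj_subspaces_def by blast
  qed
  then show ?thesis using bp by (auto simp: geom_isos_def PG_def)
qed

text \<open>One inclusion only. The reverse one is obtained in
  \<open>semilinear_iso_quad_isos\<close> from the inverse map.\<close>

lemma semilinear_iso_cross_ratio_rel:
  assumes "lmodule R M" "lmodule R' M'" "f \<in> semilinear_iso R \<sigma> M M'"
    "bij_betw \<sigma> (carrier R) (carrier R')" "c \<odot>\<^bsub>R\<^esub> \<one>\<^bsub>R\<^esub> \<in> carrier R"
    "\<sigma> (c \<odot>\<^bsub>R\<^esub> \<one>\<^bsub>R\<^esub>) = c \<odot>\<^bsub>R'\<^esub> \<one>\<^bsub>R'\<^esub>"
  shows "(\<lambda>(p, q, r, s). (f ` p, f ` q, f ` r, f ` s)) ` cross_ratio_rel R M c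
    \<subseteq> cross_ratio_rel R' M' c"
proof
  interpret M: lmodule R M by fact
  interpret M': lmodule R' M' by fact
  fix z assume "z \<in> (\<lambda>(p, q, r, s). (f ` p, f ` q, f ` r, f ` s)) ` cross_ratio_rel R M c"
  then obtain u w where uw: "u \<in> carrier M" "u \<noteq> \<zero>\<^bsub>M\<^esub>" "w \<in> carrier M" "w \<noteq> \<zero>\<^bsub>M\<^esub>"
    "cyclic_sub R M u \<noteq> cyclic_sub R M w"
    "z = (f ` cyclic_sub R M u, f ` cyclic_sub R M w, f ` cyclic_sub R M (u \<oplus>\<^bsub>M\<^esub> w),
      f ` cyclic_sub R M (u \<oplus>\<^bsub>M\<^esub> ((c \<odot>\<^bsub>R\<^esub> \<one>\<^bsub>R\<^esub>) \<odot>\<^bsub>M\<^esub> w)))"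
    by (auto simp: cross_ratio_rel_def)
  have im: "\<sigma> ` carrier R = carrier R'" using assms(4) by (simp add: bij_betw_def)
  note cy = semilinear_iso_cyclic_sub[OF assms(3) im]
  have b: "bij_betw f (carrier M) (carrier M')" using assms(3) by (simp add: semilinear_iso_def)
  have f: "f u \<in> carrier M'" "f w \<in> carrier M'" "f u \<noteq> \<zero>\<^bsub>M'\<^esub>" "f w \<noteq> \<zero>\<^bsub>M'\<^esub>"
    using bij_betw_apply[OF b] uw(1-4) semilinear_iso_eq_zero_iff[OF assms(1-3)] by auto
  have "f ` cyclic_sub R M u \<noteq> f ` cyclic_sub R M w"
    using inj_on_image_eq_iff[OF bij_betw_imp_inj_on[OF b], of "cyclic_sub R M u" "cyclic_sub R M w"]
      M.submoduleD(1)[OF M.cyclic_sub_submodule] uw(1,3,5) by simp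
  then have ne: "cyclic_sub R' M' (f u) \<noteq> cyclic_sub R' M' (f w)" using cy uw(1,3) by simp
  have "f (u \<oplus>\<^bsub>M\<^esub> w) = f u \<oplus>\<^bsub>M'\<^esub> f w"
    using assms(3) uw(1,3) by (auto simp: semilinear_iso_def)
  moreover have "f (u \<oplus>\<^bsub>M\<^esub> ((c \<odot>\<^bsub>R\<^esub> \<one>\<^bsub>R\<^esub>) \<odot>\<^bsub>M\<^esub> w)) = f u \<oplus>\<^bsub>M'\<^esub> ((c \<odot>\<^bsub>R'\<^esub> \<one>\<^bsub>R'\<^esub>) \<odot>\<^bsub>M'\<^esub> f w)"
    using assms(3,5,6) uw(1,3) M.smult_closed[OF assms(5) uw(3)] by (simp add: semilinear_iso_def)
  ultimately have "z = (cyclic_sub R' M' (f u), cyclic_sub R' M' (f w), cyclic_sub R' M' (f u \<oplus>\<^bsub>M'\<^esub> f w),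
      cyclic_sub R' M' (f u \<oplus>\<^bsub>M'\<^esub> ((c \<odot>\<^bsub>R'\<^esub> \<one>\<^bsub>R'\<^esub>) \<odot>\<^bsub>M'\<^esub> f w)))"
    using uw(1,3,6) cy assms(5) by simp
  then show "z \<in> cross_ratio_rel R' M' c"
    unfolding cross_ratio_rel_def using f ne by blast
qed

section \<open>The fundamental theorem of projective geometry\<close>

text \<open>Homogeneous coordinates: points with \<open>a\<close> equal to one form the affine plane
  with origin \<open>x\<close>, those with \<open>a\<close> equal to zero the line at infinity
  through \<open>y\<close> and \<open>z\<close>.\<close>

definition comb3 :: "('r, 'm, 'q) module_scheme \<Rightarrow> 'm \<Rightarrow> 'm \<Rightarrow> 'm \<Rightarrow> 'r \<Rightarrow> 'r \<Rightarrow> 'r \<Rightarrow> 'm" where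
  "comb3 M x y z a b c = a \<odot>\<^bsub>M\<^esub> x \<oplus>\<^bsub>M\<^esub> (b \<odot>\<^bsub>M\<^esub> y \<oplus>\<^bsub>M\<^esub> c \<odot>\<^bsub>M\<^esub> z)"

context lmodule
begin

lemma lspan2_iff:
  assumes "u \<in> carrier M" "v \<in> carrier M"
  shows "w \<in> lspan R M [u, v] \<longleftrightarrow> (\<exists>p\<in>carrier R. \<exists>q\<in>carrier R. w = p \<odot>\<^bsub>M\<^esub> u \<oplus>\<^bsub>M\<^esub> q \<odot>\<^bsub>M\<^esub> v)"
proof -
  have "lspan R M [v] = {q \<odot>\<^bsub>M\<^esub> v |q. q \<in> carrier R}"
    using cyclic_sub_eq_lspan[OF assms(2)] by (auto simp: cyclic_sub_def)
  then show ?thesis by (subst lspan_Cons) auto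
qed

lemma comb3_closed [simp]:
  assumes "x \<in> carrier M" "y \<in> carrier M" "z \<in> carrier M" "a \<in> carrier R" "b \<in> carrier R" "c \<in> carrier R"
  shows "comb3 M x y z a b c \<in> carrier M"
  using assms by (simp add: comb3_def)

lemma comb3_add:
  assumes "x \<in> carrier M" "y \<in> carrier M" "z \<in> carrier M" "a \<in> carrier R" "b \<in> carrier R" "c \<in> carrier R"
    "a' \<in> carrier R" "b' \<in> carrier R" "c' \<in> carrier R"
  shows "comb3 M x y z a b c \<oplus>\<^bsub>M\<^esub> comb3 M x y z a' b' c'
    = comb3 M x y z (a \<oplus>\<^bsub>R\<^esub> a') (b \<oplus>\<^bsub>R\<^esub> b') (c \<oplus>\<^bsub>R\<^esub> c')"
  using assms by (simp add: comb3_def smult_l_distr M.a_ac)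

lemma comb3_smult:
  assumes "x \<in> carrier M" "y \<in> carrier M" "z \<in> carrier M" "a \<in> carrier R" "b \<in> carrier R" "c \<in> carrier R"
    "d \<in> carrier R"
  shows "d \<odot>\<^bsub>M\<^esub> comb3 M x y z a b c = comb3 M x y z (d \<otimes>\<^bsub>R\<^esub> a) (d \<otimes>\<^bsub>R\<^esub> b) (d \<otimes>\<^bsub>R\<^esub> c)"
  using assms by (simp add: comb3_def smult_r_distr smult_assoc1)

end

lemma (in left_vector_space) comb3_eq_iff:
  assumes "x \<in> carrier M" "y \<in> carrier M" "z \<in> carrier M" "lindep_free R M [x, y, z]"
    "a \<in> carrier R" "b \<in> carrier R" "c \<in> carrier R" "a' \<in> carrier R" "b' \<in> carrier R" "c' \<in> carrier R"
  shows "comb3 M x y z a b c = comb3 M x y z a' b' c' \<longleftrightarrow> a = a' \<and> b = b' \<and> c = c'"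
proof
  have eq: "comb3 M x y z a b c = lincomb M [a, b, c] [x, y, z]" if "c \<in> carrier R" for a b c
    using assms(1-3) that by (simp add: comb3_def)
  have inj: "inj_on (\<lambda>cs. lincomb M cs [x, y, z]) (coeffs R [x, y, z])"
    using assms(1-4) by (intro lincomb_inj) simp_all
  assume "comb3 M x y z a b c = comb3 M x y z a' b' c'"
  then have "[a, b, c] = [a', b', c']"
    using inj_onD[OF inj, of "[a, b, c]" "[a', b', c']"] assms(5-) eq by (simp add: coeffs_def)
  then show "a = a' \<and> b = b' \<and> c = c'" by simp
qed auto

context collineation
begin

lemma maps_line:
  assumes "maps u u'" "maps v v'" "maps w w'" "w = p \<odot>\<^bsub>W\<^esub> u \<oplus>\<^bsub>W\<^esub> q \<odot>\<^bsub>W\<^esub> v" "p \<in> carrier D" "q \<in> carrier D"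
  shows "\<exists>r\<in>carrier D'. \<exists>s\<in>carrier D'. w' = r \<odot>\<^bsub>W'\<^esub> u' \<oplus>\<^bsub>W'\<^esub> s \<odot>\<^bsub>W'\<^esub> v'"
proof -
  have "w \<in> lspan D W [u, v]"
    using assms D.lspan2_iff[of u v] maps_carrier(1) by blast
  then have "w' \<in> lspan D' W' [u', v']"
    using maps_lspan[of "[u, v]" "[u', v']" w w'] assms by simp
  then show ?thesis using assms D'.lspan2_iff[of u' v'] maps_carrier(2) by blast
qed

text \<open>The image point of \<open>u + v\<close> serves as unit point: it rescales the representative of \<open>v\<close>.\<close>

lemma ex_unit_rep:
  assumes "maps u u'" "v \<in> carrier W" "lindep_free D W [u, v]"
  shows "\<exists>v'. maps v v' \<and> maps (u \<oplus>\<^bsub>W\<^esub> v) (u' \<oplus>\<^bsub>W'\<^esub> v')"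
proof -
  have u: "u \<in> carrier W" "u' \<in> carrier W'" "u \<noteq> \<zero>\<^bsub>W\<^esub>" "u' \<noteq> \<zero>\<^bsub>W'\<^esub>" using assms(1) by auto
  have v0: "v \<noteq> \<zero>\<^bsub>W\<^esub>" and uv: "u \<notin> cyclic_sub D W v"
    using assms by (auto simp: D.cyclic_sub_eq_lspan)
  obtain v1 where v1: "maps v v1" using ex_maps[OF assms(2) v0] by auto
  have vu: "v \<notin> cyclic_sub D W u"
  proof
    assume "v \<in> cyclic_sub D W u"
    then obtain a where a: "a \<in> carrier D" "v = a \<odot>\<^bsub>W\<^esub> u" by (auto simp: cyclic_sub_def)
    then have "a \<noteq> \<zero>\<^bsub>D\<^esub>" using v0 u by auto
    then have "cyclic_sub D W v = cyclic_sub D W u" using a u D.cyclic_sub_smult by auto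
    then show False using uv u by auto
  qed
  have nin: "u \<oplus>\<^bsub>W\<^esub> v \<notin> cyclic_sub D W u" "u \<oplus>\<^bsub>W\<^esub> v \<notin> cyclic_sub D W v"
    using D.submodule_add_cancel[OF D.cyclic_sub_submodule[OF u(1)], of u v] vu u assms(2)
      D.submodule_add_cancel[OF D.cyclic_sub_submodule[OF assms(2)], of v u] uv
    by (auto simp: D.M.a_comm)
  have sum0: "u \<oplus>\<^bsub>W\<^esub> v \<noteq> \<zero>\<^bsub>W\<^esub>"
    using nin(1) D.submoduleD(2)[OF D.cyclic_sub_submodule[OF u(1)]] by auto
  then obtain w where w: "maps (u \<oplus>\<^bsub>W\<^esub> v) w" using ex_maps[of "u \<oplus>\<^bsub>W\<^esub> v"] u assms(2) by auto
  have "u \<oplus>\<^bsub>W\<^esub> v = \<one>\<^bsub>D\<^esub> \<odot>\<^bsub>W\<^esub> u \<oplus>\<^bsub>W\<^esub> \<one>\<^bsub>D\<^esub> \<odot>\<^bsub>W\<^esub> v" using u assms(2) by simp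
  then obtain r s where rs: "r \<in> carrier D'" "s \<in> carrier D'" "w = r \<odot>\<^bsub>W'\<^esub> u' \<oplus>\<^bsub>W'\<^esub> s \<odot>\<^bsub>W'\<^esub> v1"
    using maps_line[OF assms(1) v1 w] by blast
  have v1c: "v1 \<in> carrier W'" using v1 by auto
  have nin': "w \<notin> cyclic_sub D' W' u'" "w \<notin> cyclic_sub D' W' v1"
    using nin maps_lspan_iff[of "[u]" "[u']", OF _ w] maps_lspan_iff[of "[v]" "[v1]", OF _ w]
      assms v1 u v1c by (auto simp: D.cyclic_sub_eq_lspan D'.cyclic_sub_eq_lspan)
  have r0: "r \<noteq> \<zero>\<^bsub>D'\<^esub>"
    using nin'(2) rs u v1c by (auto simp: cyclic_sub_def)
  have s0: "s \<noteq> \<zero>\<^bsub>D'\<^esub>"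
    using nin'(1) rs u v1c by (auto simp: cyclic_sub_def)
  note ri = division_ring_inv[OF D'.division rs(1) r0]
  define v' where "v' = (inv\<^bsub>D'\<^esub> r \<otimes>\<^bsub>D'\<^esub> s) \<odot>\<^bsub>W'\<^esub> v1"
  have "inv\<^bsub>D'\<^esub> r \<otimes>\<^bsub>D'\<^esub> s \<noteq> \<zero>\<^bsub>D'\<^esub>"
  proof
    assume "inv\<^bsub>D'\<^esub> r \<otimes>\<^bsub>D'\<^esub> s = \<zero>\<^bsub>D'\<^esub>"
    then have "r \<otimes>\<^bsub>D'\<^esub> (inv\<^bsub>D'\<^esub> r \<otimes>\<^bsub>D'\<^esub> s) = \<zero>\<^bsub>D'\<^esub>" using rs by simp
    then show False using ri rs s0 by (simp flip: D'.R.m_assoc)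
  qed
  then have "maps v v'" unfolding v'_def using v1 ri rs by (intro maps_smult) auto
  moreover have "inv\<^bsub>D'\<^esub> r \<odot>\<^bsub>W'\<^esub> w = u' \<oplus>\<^bsub>W'\<^esub> v'"
    unfolding rs(3) v'_def using ri rs u v1c
    by (simp add: D'.smult_r_distr D'.smult_assoc1 D'.smult_inv_cancel r0)
  ultimately show ?thesis using maps_smult[OF w ri(1,4)] by metis
qed

text \<open>The point of \<open>u + a v\<close> lies on the line through \<open>u\<close> and
  \<open>v\<close> and differs from the point of \<open>v\<close>. Its image therefore has a nonzero
  coordinate at \<open>u'\<close>, which can be scaled to one.\<close>

lemma ex_slope:
  assumes "maps u u'" "maps v v'" "u \<notin> lspan D W [v]" "a \<in> carrier D"
  shows "\<exists>b\<in>carrier D'. maps (u \<oplus>\<^bsub>W\<^esub> a \<odot>\<^bsub>W\<^esub> v) (u' \<oplus>\<^bsub>W'\<^esub> b \<odot>\<^bsub>W'\<^esub> v')"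
proof -
  have c: "u \<in> carrier W" "u' \<in> carrier W'" "v \<in> carrier W" "v' \<in> carrier W'" using assms by auto
  have sub: "submodule (lspan D W [v]) D W" using c by (intro D.lspan_submodule) simp
  have "a \<odot>\<^bsub>W\<^esub> v \<in> lspan D W [v]"
    using D.submoduleD(4)[OF sub assms(4)] D.set_subset_lspan[of "[v]"] c by auto
  then have nin: "u \<oplus>\<^bsub>W\<^esub> a \<odot>\<^bsub>W\<^esub> v \<notin> lspan D W [v]"
    using D.submodule_add_cancel[OF sub _ c(1)] assms(3) by auto
  then have "u \<oplus>\<^bsub>W\<^esub> a \<odot>\<^bsub>W\<^esub> v \<noteq> \<zero>\<^bsub>W\<^esub>" using D.submoduleD(2)[OF sub] by auto
  then obtain w where w: "maps (u \<oplus>\<^bsub>W\<^esub> a \<odot>\<^bsub>W\<^esub> v) w"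
    using ex_maps[of "u \<oplus>\<^bsub>W\<^esub> a \<odot>\<^bsub>W\<^esub> v"] c assms(4) by auto
  have "u \<oplus>\<^bsub>W\<^esub> a \<odot>\<^bsub>W\<^esub> v = \<one>\<^bsub>D\<^esub> \<odot>\<^bsub>W\<^esub> u \<oplus>\<^bsub>W\<^esub> a \<odot>\<^bsub>W\<^esub> v" using c by simp
  then obtain r s where rs: "r \<in> carrier D'" "s \<in> carrier D'" "w = r \<odot>\<^bsub>W'\<^esub> u' \<oplus>\<^bsub>W'\<^esub> s \<odot>\<^bsub>W'\<^esub> v'"
    using maps_line[OF assms(1,2) w _ D.R.one_closed assms(4)] by blast
  have "w \<notin> lspan D' W' [v']"
    using nin maps_lspan_iff[of "[v]" "[v']", OF _ w] assms(2) by simp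
  then have r0: "r \<noteq> \<zero>\<^bsub>D'\<^esub>"
    using rs c D'.cyclic_sub_eq_lspan[of v'] by (auto simp: cyclic_sub_def)
  note ri = division_ring_inv[OF D'.division rs(1) r0]
  have "inv\<^bsub>D'\<^esub> r \<odot>\<^bsub>W'\<^esub> w = u' \<oplus>\<^bsub>W'\<^esub> (inv\<^bsub>D'\<^esub> r \<otimes>\<^bsub>D'\<^esub> s) \<odot>\<^bsub>W'\<^esub> v'"
    unfolding rs(3) using ri rs c r0
    by (simp add: D'.smult_r_distr D'.smult_assoc1 D'.smult_inv_cancel)
  then show ?thesis
    using maps_smult[OF w ri(1,4)] ri(1) rs(2) by (intro bexI[of _ "inv\<^bsub>D'\<^esub> r \<otimes>\<^bsub>D'\<^esub> s"]) auto
qed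

end

text \<open>The last two assumptions fix the scalars left free in \<open>y'\<close> and
  \<open>z'\<close>: in both coordinate directions, coefficient one must correspond to coefficient
  one.\<close>

locale framed_collineation = collineation +
  fixes x y z x' y' z'
  assumes indep: "lindep_free D W [x, y, z]"
    and mx: "maps x x'" and my: "maps y y'" and mz: "maps z z'"
    and mxy: "maps (x \<oplus>\<^bsub>W\<^esub> y) (x' \<oplus>\<^bsub>W'\<^esub> y')" and mxz: "maps (x \<oplus>\<^bsub>W\<^esub> z) (x' \<oplus>\<^bsub>W'\<^esub> z')"
begin

abbreviation "P \<equiv> comb3 W x y z"
abbreviation "P' \<equiv> comb3 W' x' y' z'"

lemma frame_carrier [simp]:
  "x \<in> carrier W" "y \<in> carrier W" "z \<in> carrier W" "x' \<in> carrier W'" "y' \<in> carrier W'" "z' \<in> carrier W'"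
  using mx my mz by auto

lemma indep': "lindep_free D' W' [x', y', z']"
  using maps_lindep_free[OF _ indep, of "[x', y', z']"] mx my mz by simp

lemmas P_eq_iff = D.comb3_eq_iff[OF frame_carrier(1-3) indep]
lemmas P'_eq_iff = D'.comb3_eq_iff[OF frame_carrier(4-6) indep']
lemma P'_eqD:
  assumes "P' a b c = P' a' b' c'" "{a, b, c, a', b', c'} \<subseteq> carrier D'"
  shows "a' = a" "b' = b" "c' = c"
  using assms P'_eq_iff by auto

lemmas P_add = D.comb3_add[OF frame_carrier(1-3)]
lemmas P'_add = D'.comb3_add[OF frame_carrier(4-6)]
lemmas P_smult = D.comb3_smult[OF frame_carrier(1-3)]
lemmas P'_smult = D'.comb3_smult[OF frame_carrier(4-6)]

lemma P_zero: "P \<zero>\<^bsub>D\<^esub> \<zero>\<^bsub>D\<^esub> \<zero>\<^bsub>D\<^esub> = \<zero>\<^bsub>W\<^esub>" "P' \<zero>\<^bsub>D'\<^esub> \<zero>\<^bsub>D'\<^esub> \<zero>\<^bsub>D'\<^esub> = \<zero>\<^bsub>W'\<^esub>"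
  by (simp_all add: comb3_def)

lemma P_unit:
  "P \<one>\<^bsub>D\<^esub> \<zero>\<^bsub>D\<^esub> \<zero>\<^bsub>D\<^esub> = x" "P \<zero>\<^bsub>D\<^esub> \<one>\<^bsub>D\<^esub> \<zero>\<^bsub>D\<^esub> = y" "P \<zero>\<^bsub>D\<^esub> \<zero>\<^bsub>D\<^esub> \<one>\<^bsub>D\<^esub> = z"
  "P' \<one>\<^bsub>D'\<^esub> \<zero>\<^bsub>D'\<^esub> \<zero>\<^bsub>D'\<^esub> = x'" "P' \<zero>\<^bsub>D'\<^esub> \<one>\<^bsub>D'\<^esub> \<zero>\<^bsub>D'\<^esub> = y'" "P' \<zero>\<^bsub>D'\<^esub> \<zero>\<^bsub>D'\<^esub> \<one>\<^bsub>D'\<^esub> = z'"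
  by (simp_all add: comb3_def)

lemma P_nonzero:
  assumes "a \<in> carrier D" "b \<in> carrier D" "c \<in> carrier D" "a \<noteq> \<zero>\<^bsub>D\<^esub> \<or> b \<noteq> \<zero>\<^bsub>D\<^esub> \<or> c \<noteq> \<zero>\<^bsub>D\<^esub>"
  shows "P a b c \<noteq> \<zero>\<^bsub>W\<^esub>"
  using P_eq_iff[of a b c "\<zero>\<^bsub>D\<^esub>" "\<zero>\<^bsub>D\<^esub>" "\<zero>\<^bsub>D\<^esub>"] assms P_zero by auto

lemma P'_nonzero:
  assumes "a \<in> carrier D'" "b \<in> carrier D'" "c \<in> carrier D'" "a \<noteq> \<zero>\<^bsub>D'\<^esub> \<or> b \<noteq> \<zero>\<^bsub>D'\<^esub> \<or> c \<noteq> \<zero>\<^bsub>D'\<^esub>"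
  shows "P' a b c \<noteq> \<zero>\<^bsub>W'\<^esub>"
  using P'_eq_iff[of a b c "\<zero>\<^bsub>D'\<^esub>" "\<zero>\<^bsub>D'\<^esub>" "\<zero>\<^bsub>D'\<^esub>"] assms P_zero by auto

lemma maps_P_exists:
  assumes "a \<in> carrier D" "b \<in> carrier D" "c \<in> carrier D" "a \<noteq> \<zero>\<^bsub>D\<^esub> \<or> b \<noteq> \<zero>\<^bsub>D\<^esub> \<or> c \<noteq> \<zero>\<^bsub>D\<^esub>"
  shows "\<exists>w'. maps (P a b c) w'"
  using ex_maps[OF _ P_nonzero[OF assms]] assms by simp

text \<open>Collinearity in coordinates. The lemmas below follow one pattern: a point is put on
  lines through points with known images, and the resulting expressions for its image are compared
  by \<open>P'_eq_iff\<close>.\<close>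

lemma maps_P_line:
  assumes "maps (P a1 b1 c1) (P' a1' b1' c1')" "maps (P a2 b2 c2) (P' a2' b2' c2')"
    "maps (P a3 b3 c3) w'"
    "a3 = p \<otimes>\<^bsub>D\<^esub> a1 \<oplus>\<^bsub>D\<^esub> q \<otimes>\<^bsub>D\<^esub> a2" "b3 = p \<otimes>\<^bsub>D\<^esub> b1 \<oplus>\<^bsub>D\<^esub> q \<otimes>\<^bsub>D\<^esub> b2"
    "c3 = p \<otimes>\<^bsub>D\<^esub> c1 \<oplus>\<^bsub>D\<^esub> q \<otimes>\<^bsub>D\<^esub> c2"
    "{a1, b1, c1, a2, b2, c2, p, q} \<subseteq> carrier D" "{a1', b1', c1', a2', b2', c2'} \<subseteq> carrier D'"
  shows "\<exists>r\<in>carrier D'. \<exists>s\<in>carrier D'.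
    w' = P' (r \<otimes>\<^bsub>D'\<^esub> a1' \<oplus>\<^bsub>D'\<^esub> s \<otimes>\<^bsub>D'\<^esub> a2') (r \<otimes>\<^bsub>D'\<^esub> b1' \<oplus>\<^bsub>D'\<^esub> s \<otimes>\<^bsub>D'\<^esub> b2')
      (r \<otimes>\<^bsub>D'\<^esub> c1' \<oplus>\<^bsub>D'\<^esub> s \<otimes>\<^bsub>D'\<^esub> c2')"
proof -
  have "P a3 b3 c3 = p \<odot>\<^bsub>W\<^esub> P a1 b1 c1 \<oplus>\<^bsub>W\<^esub> q \<odot>\<^bsub>W\<^esub> P a2 b2 c2"
    using assms(4-7) by (simp add: P_smult P_add)
  then obtain r s where "r \<in> carrier D'" "s \<in> carrier D'"
    "w' = r \<odot>\<^bsub>W'\<^esub> P' a1' b1' c1' \<oplus>\<^bsub>W'\<^esub> s \<odot>\<^bsub>W'\<^esub> P' a2' b2' c2'"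
    using maps_line[OF assms(1-3), of p q] assms(7) by auto
  then show ?thesis
    using assms(8) by (intro bexI[of _ r] bexI[of _ s]) (simp_all add: P'_smult P'_add)
qed

lemma maps_rescale:
  assumes "maps u w'" "w' = P' r (r \<otimes>\<^bsub>D'\<^esub> b) (r \<otimes>\<^bsub>D'\<^esub> c)" "r \<in> carrier D'" "b \<in> carrier D'" "c \<in> carrier D'"
  shows "maps u (P' \<one>\<^bsub>D'\<^esub> b c)"
proof -
  have r0: "r \<noteq> \<zero>\<^bsub>D'\<^esub>" using assms P_zero(2) maps_carrier(4)[OF assms(1)] by auto
  note ri = division_ring_inv[OF D'.division assms(3) r0]
  have "inv\<^bsub>D'\<^esub> r \<odot>\<^bsub>W'\<^esub> w' = P' \<one>\<^bsub>D'\<^esub> b c"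
    using assms ri by (simp add: P'_smult flip: D'.R.m_assoc)
  then show ?thesis using maps_smult[OF assms(1) ri(1,4)] by simp
qed

lemma maps_P_unique:
  assumes "maps u (P' \<one>\<^bsub>D'\<^esub> b c)" "maps u (P' \<one>\<^bsub>D'\<^esub> b' c')" "{b, c, b', c'} \<subseteq> carrier D'"
  shows "b' = b" "c' = c"
proof -
  obtain a where "a \<in> carrier D'" "P' \<one>\<^bsub>D'\<^esub> b' c' = a \<odot>\<^bsub>W'\<^esub> P' \<one>\<^bsub>D'\<^esub> b c"
    using maps_unique[OF assms(1,2)] by auto
  then show "b' = b" "c' = c" using assms(3) by (auto simp: P'_smult P'_eq_iff)
qed

lemma ex_slopes:
  shows "\<exists>\<sigma> \<tau>. \<forall>a\<in>carrier D. \<sigma> a \<in> carrier D' \<and> \<tau> a \<in> carrier D'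
    \<and> maps (P \<one>\<^bsub>D\<^esub> a \<zero>\<^bsub>D\<^esub>) (P' \<one>\<^bsub>D'\<^esub> (\<sigma> a) \<zero>\<^bsub>D'\<^esub>) \<and> maps (P \<one>\<^bsub>D\<^esub> \<zero>\<^bsub>D\<^esub> a) (P' \<one>\<^bsub>D'\<^esub> \<zero>\<^bsub>D'\<^esub> (\<tau> a))"
proof -
  have nin: "x \<notin> lspan D W [y]" "x \<notin> lspan D W [z]"
  proof -
    have sub: "lspan D W [z] \<subseteq> lspan D W [y, z]" "lspan D W [y] \<subseteq> lspan D W [y, z]"
      using D.lspan_mono[of "[z]" "[y, z]"] D.lspan_mono[of "[y]" "[y, z]"]
        D.set_subset_lspan[of "[y, z]"] by auto
    show "x \<notin> lspan D W [y]" "x \<notin> lspan D W [z]" using indep sub by auto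
  qed
  have "\<exists>b\<in>carrier D'. maps (P \<one>\<^bsub>D\<^esub> a \<zero>\<^bsub>D\<^esub>) (P' \<one>\<^bsub>D'\<^esub> b \<zero>\<^bsub>D'\<^esub>)" if "a \<in> carrier D" for a
    using ex_slope[OF mx my nin(1) that] that by (auto simp: comb3_def)
  moreover have "\<exists>b\<in>carrier D'. maps (P \<one>\<^bsub>D\<^esub> \<zero>\<^bsub>D\<^esub> a) (P' \<one>\<^bsub>D'\<^esub> \<zero>\<^bsub>D'\<^esub> b)" if "a \<in> carrier D" for a
    using ex_slope[OF mx mz nin(2) that] that by (auto simp: comb3_def)
  ultimately show ?thesis by metis
qed

end

text \<open>\<open>\<sigma>\<close> and \<open>\<tau>\<close> record the collineation on the affine
  lines in the directions \<open>y\<close> and \<open>z\<close>. They are chosen independently, and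
  nothing but their values at zero and one ties them together at first.\<close>

locale slopes = framed_collineation +
  fixes \<sigma> \<tau>
  assumes slope_closed [simp]: "a \<in> carrier D \<Longrightarrow> \<sigma> a \<in> carrier D'" "a \<in> carrier D \<Longrightarrow> \<tau> a \<in> carrier D'"
    and my_slope: "a \<in> carrier D \<Longrightarrow> maps (P \<one>\<^bsub>D\<^esub> a \<zero>\<^bsub>D\<^esub>) (P' \<one>\<^bsub>D'\<^esub> (\<sigma> a) \<zero>\<^bsub>D'\<^esub>)"
    and mz_slope: "a \<in> carrier D \<Longrightarrow> maps (P \<one>\<^bsub>D\<^esub> \<zero>\<^bsub>D\<^esub> a) (P' \<one>\<^bsub>D'\<^esub> \<zero>\<^bsub>D'\<^esub> (\<tau> a))"
begin

lemma slope_zero: "\<sigma> \<zero>\<^bsub>D\<^esub> = \<zero>\<^bsub>D'\<^esub>" "\<tau> \<zero>\<^bsub>D\<^esub> = \<zero>\<^bsub>D'\<^esub>"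
  using maps_P_unique[of "P \<one>\<^bsub>D\<^esub> \<zero>\<^bsub>D\<^esub> \<zero>\<^bsub>D\<^esub>" "\<zero>\<^bsub>D'\<^esub>" "\<zero>\<^bsub>D'\<^esub>"] my_slope[of "\<zero>\<^bsub>D\<^esub>"] mz_slope[of "\<zero>\<^bsub>D\<^esub>"] mx
  by (auto simp: P_unit)

lemma slope_one: "\<sigma> \<one>\<^bsub>D\<^esub> = \<one>\<^bsub>D'\<^esub>" "\<tau> \<one>\<^bsub>D\<^esub> = \<one>\<^bsub>D'\<^esub>"
proof -
  have "maps (P \<one>\<^bsub>D\<^esub> \<one>\<^bsub>D\<^esub> \<zero>\<^bsub>D\<^esub>) (P' \<one>\<^bsub>D'\<^esub> \<one>\<^bsub>D'\<^esub> \<zero>\<^bsub>D'\<^esub>)" "maps (P \<one>\<^bsub>D\<^esub> \<zero>\<^bsub>D\<^esub> \<one>\<^bsub>D\<^esub>) (P' \<one>\<^bsub>D'\<^esub> \<zero>\<^bsub>D'\<^esub> \<one>\<^bsub>D'\<^esub>)"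
    using mxy mxz by (simp_all add: comb3_def)
  then show "\<sigma> \<one>\<^bsub>D\<^esub> = \<one>\<^bsub>D'\<^esub>" "\<tau> \<one>\<^bsub>D\<^esub> = \<one>\<^bsub>D'\<^esub>"
    using maps_P_unique(1)[OF _ my_slope[of "\<one>\<^bsub>D\<^esub>"], of "\<one>\<^bsub>D'\<^esub>" "\<zero>\<^bsub>D'\<^esub>"]
      maps_P_unique(2)[OF _ mz_slope[of "\<one>\<^bsub>D\<^esub>"], of "\<zero>\<^bsub>D'\<^esub>" "\<one>\<^bsub>D'\<^esub>"] by simp_all
qed

text \<open>
  The point at infinity of the direction \<open>y - z\<close> is the intersection of the line at infinity \<open>y z\<close>
  with each of the lines joining \<open>x + a y\<close> and \<open>x + a z\<close>; this identifies the two coordinates.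
\<close>

lemma maps_diff: "maps (P \<zero>\<^bsub>D\<^esub> \<one>\<^bsub>D\<^esub> (\<ominus>\<^bsub>D\<^esub> \<one>\<^bsub>D\<^esub>)) (P' \<zero>\<^bsub>D'\<^esub> \<one>\<^bsub>D'\<^esub> (\<ominus>\<^bsub>D'\<^esub> \<one>\<^bsub>D'\<^esub>))"
proof -
  obtain w' where w: "maps (P \<zero>\<^bsub>D\<^esub> \<one>\<^bsub>D\<^esub> (\<ominus>\<^bsub>D\<^esub> \<one>\<^bsub>D\<^esub>)) w'"
    using maps_P_exists[of "\<zero>\<^bsub>D\<^esub>" "\<one>\<^bsub>D\<^esub>" "\<ominus>\<^bsub>D\<^esub> \<one>\<^bsub>D\<^esub>"] by auto
  obtain p q where pq: "p \<in> carrier D'" "q \<in> carrier D'" "w' = P' \<zero>\<^bsub>D'\<^esub> p q"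
    using maps_P_line[of "\<zero>\<^bsub>D\<^esub>" "\<one>\<^bsub>D\<^esub>" "\<zero>\<^bsub>D\<^esub>" "\<zero>\<^bsub>D'\<^esub>" "\<one>\<^bsub>D'\<^esub>" "\<zero>\<^bsub>D'\<^esub>" "\<zero>\<^bsub>D\<^esub>" "\<zero>\<^bsub>D\<^esub>" "\<one>\<^bsub>D\<^esub>"
        "\<zero>\<^bsub>D'\<^esub>" "\<zero>\<^bsub>D'\<^esub>" "\<one>\<^bsub>D'\<^esub>", OF _ _ w, of "\<one>\<^bsub>D\<^esub>" "\<ominus>\<^bsub>D\<^esub> \<one>\<^bsub>D\<^esub>"] my mz
    by (auto simp: P_unit)
  obtain r s where rs: "r \<in> carrier D'" "s \<in> carrier D'" "w' = P' (r \<oplus>\<^bsub>D'\<^esub> s) r s"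
    using maps_P_line[OF my_slope[of "\<one>\<^bsub>D\<^esub>"] mz_slope[of "\<one>\<^bsub>D\<^esub>"] w, of "\<one>\<^bsub>D\<^esub>" "\<ominus>\<^bsub>D\<^esub> \<one>\<^bsub>D\<^esub>"]
    by (auto simp: slope_one D.R.r_neg)
  have "r \<oplus>\<^bsub>D'\<^esub> s = \<zero>\<^bsub>D'\<^esub>" using pq rs by (auto simp: P'_eq_iff)
  then have s: "s = \<ominus>\<^bsub>D'\<^esub> r" using rs by (metis D'.R.minus_equality D'.R.a_comm)
  have r0: "r \<noteq> \<zero>\<^bsub>D'\<^esub>" using maps_carrier(4)[OF w] rs s P_zero(2) by auto
  have w': "w' = r \<odot>\<^bsub>W'\<^esub> P' \<zero>\<^bsub>D'\<^esub> \<one>\<^bsub>D'\<^esub> (\<ominus>\<^bsub>D'\<^esub> \<one>\<^bsub>D'\<^esub>)"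
    using rs s by (simp add: P'_smult D'.R.r_minus D'.R.r_neg)
  note ri = division_ring_inv[OF D'.division rs(1) r0]
  show ?thesis
    using maps_smult[OF w ri(1,4)] rs(1) r0 by (simp add: w' D'.smult_inv_cancel)
qed

text \<open>With \<open>a\<close> inverted, \<open>y - z\<close> equals
  \<open>a^-1 (x + a y) - a^-1 (x + a z)\<close>. On the image side the coefficients
  \<open>r\<close> and \<open>s\<close> satisfy \<open>r + s = 0\<close>,
  \<open>r \<sigma>(a) = 1\<close> and \<open>s \<tau>(a) = -1\<close>, so
  \<open>r \<sigma>(a) = r \<tau>(a)\<close> with \<open>r\<close> invertible.\<close>

lemma slopes_agree:
  assumes "a \<in> carrier D"
  shows "\<tau> a = \<sigma> a"
proof (cases "a = \<zero>\<^bsub>D\<^esub>")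
  case False
  note ai = division_ring_inv[OF D.division assms False]
  have "\<exists>r\<in>carrier D'. \<exists>s\<in>carrier D'. P' \<zero>\<^bsub>D'\<^esub> \<one>\<^bsub>D'\<^esub> (\<ominus>\<^bsub>D'\<^esub> \<one>\<^bsub>D'\<^esub>)
    = P' (r \<otimes>\<^bsub>D'\<^esub> \<one>\<^bsub>D'\<^esub> \<oplus>\<^bsub>D'\<^esub> s \<otimes>\<^bsub>D'\<^esub> \<one>\<^bsub>D'\<^esub>) (r \<otimes>\<^bsub>D'\<^esub> \<sigma> a \<oplus>\<^bsub>D'\<^esub> s \<otimes>\<^bsub>D'\<^esub> \<zero>\<^bsub>D'\<^esub>)
      (r \<otimes>\<^bsub>D'\<^esub> \<zero>\<^bsub>D'\<^esub> \<oplus>\<^bsub>D'\<^esub> s \<otimes>\<^bsub>D'\<^esub> \<tau> a)"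
    by (rule maps_P_line[OF my_slope[OF assms] mz_slope[OF assms] maps_diff, of "inv\<^bsub>D\<^esub> a" "\<ominus>\<^bsub>D\<^esub> (inv\<^bsub>D\<^esub> a)"])
      (use ai assms in \<open>simp_all add: D.R.r_neg D.R.l_minus\<close>)
  then obtain r s where rs: "r \<in> carrier D'" "s \<in> carrier D'"
    "P' \<zero>\<^bsub>D'\<^esub> \<one>\<^bsub>D'\<^esub> (\<ominus>\<^bsub>D'\<^esub> \<one>\<^bsub>D'\<^esub>) = P' (r \<otimes>\<^bsub>D'\<^esub> \<one>\<^bsub>D'\<^esub> \<oplus>\<^bsub>D'\<^esub> s \<otimes>\<^bsub>D'\<^esub> \<one>\<^bsub>D'\<^esub>)
      (r \<otimes>\<^bsub>D'\<^esub> \<sigma> a \<oplus>\<^bsub>D'\<^esub> s \<otimes>\<^bsub>D'\<^esub> \<zero>\<^bsub>D'\<^esub>) (r \<otimes>\<^bsub>D'\<^esub> \<zero>\<^bsub>D'\<^esub> \<oplus>\<^bsub>D'\<^esub> s \<otimes>\<^bsub>D'\<^esub> \<tau> a)"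
    by blast
  have e: "r \<oplus>\<^bsub>D'\<^esub> s = \<zero>\<^bsub>D'\<^esub>" "r \<otimes>\<^bsub>D'\<^esub> \<sigma> a = \<one>\<^bsub>D'\<^esub>" "s \<otimes>\<^bsub>D'\<^esub> \<tau> a = \<ominus>\<^bsub>D'\<^esub> \<one>\<^bsub>D'\<^esub>"
    using P'_eqD[OF rs(3)] rs(1,2) assms by simp_all
  have s: "s = \<ominus>\<^bsub>D'\<^esub> r" using e rs by (metis D'.R.minus_equality D'.R.a_comm)
  have "r \<otimes>\<^bsub>D'\<^esub> \<tau> a = \<one>\<^bsub>D'\<^esub>"
  proof -
    have "\<ominus>\<^bsub>D'\<^esub> (r \<otimes>\<^bsub>D'\<^esub> \<tau> a) = \<ominus>\<^bsub>D'\<^esub> \<one>\<^bsub>D'\<^esub>" using e(3) s rs(1) assms by (simp add: D'.R.l_minus)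
    then have "\<ominus>\<^bsub>D'\<^esub> (\<ominus>\<^bsub>D'\<^esub> (r \<otimes>\<^bsub>D'\<^esub> \<tau> a)) = \<ominus>\<^bsub>D'\<^esub> (\<ominus>\<^bsub>D'\<^esub> \<one>\<^bsub>D'\<^esub>)" by simp
    then show ?thesis using rs(1) assms by simp
  qed
  have r0: "r \<noteq> \<zero>\<^bsub>D'\<^esub>" using e(2) assms D'.one_neq_zero by (metis D'.R.l_null slope_closed(1))
  note ri = division_ring_inv[OF D'.division rs(1) r0]
  have "inv\<^bsub>D'\<^esub> r \<otimes>\<^bsub>D'\<^esub> (r \<otimes>\<^bsub>D'\<^esub> b) = b" if "b \<in> carrier D'" for b
    using ri rs that by (simp flip: D'.R.m_assoc)
  from this[of "\<sigma> a"] this[of "\<tau> a"] show ?thesis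
    using e(2) \<open>r \<otimes>\<^bsub>D'\<^esub> \<tau> a = \<one>\<^bsub>D'\<^esub>\<close> assms by simp
qed (simp add: slope_zero)

text \<open>The point \<open>x + a y + b z\<close> is the meet of the line joining
  \<open>x + a y\<close> to \<open>z\<close> with the line joining \<open>x + b z\<close> to
  \<open>y\<close>.\<close>

lemma maps_affine:
  assumes "a \<in> carrier D" "b \<in> carrier D"
  shows "maps (P \<one>\<^bsub>D\<^esub> a b) (P' \<one>\<^bsub>D'\<^esub> (\<sigma> a) (\<sigma> b))"
proof -
  obtain w' where w: "maps (P \<one>\<^bsub>D\<^esub> a b) w'"
    using maps_P_exists[of "\<one>\<^bsub>D\<^esub>" a b] assms by auto
  obtain p q where pq: "p \<in> carrier D'" "q \<in> carrier D'" "w' = P' p (p \<otimes>\<^bsub>D'\<^esub> \<sigma> a) q"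
    using maps_P_line[of "\<one>\<^bsub>D\<^esub>" a "\<zero>\<^bsub>D\<^esub>" "\<one>\<^bsub>D'\<^esub>" "\<sigma> a" "\<zero>\<^bsub>D'\<^esub>" "\<zero>\<^bsub>D\<^esub>" "\<zero>\<^bsub>D\<^esub>" "\<one>\<^bsub>D\<^esub>"
        "\<zero>\<^bsub>D'\<^esub>" "\<zero>\<^bsub>D'\<^esub>" "\<one>\<^bsub>D'\<^esub>", OF _ _ w, of "\<one>\<^bsub>D\<^esub>" b] my_slope mz assms
    by (auto simp: P_unit)
  obtain r s where rs: "r \<in> carrier D'" "s \<in> carrier D'" "w' = P' r s (r \<otimes>\<^bsub>D'\<^esub> \<tau> b)"
    using maps_P_line[of "\<one>\<^bsub>D\<^esub>" "\<zero>\<^bsub>D\<^esub>" b "\<one>\<^bsub>D'\<^esub>" "\<zero>\<^bsub>D'\<^esub>" "\<tau> b" "\<zero>\<^bsub>D\<^esub>" "\<one>\<^bsub>D\<^esub>" "\<zero>\<^bsub>D\<^esub>"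
        "\<zero>\<^bsub>D'\<^esub>" "\<one>\<^bsub>D'\<^esub>" "\<zero>\<^bsub>D'\<^esub>", OF _ _ w, of "\<one>\<^bsub>D\<^esub>" a] mz_slope my assms
    by (auto simp: P_unit)
  have "p = r" "q = r \<otimes>\<^bsub>D'\<^esub> \<tau> b" using pq rs assms by (auto simp: P'_eq_iff)
  then show ?thesis
    using maps_rescale[OF w, of r "\<sigma> a" "\<sigma> b"] pq rs(1) assms by (simp add: slopes_agree)
qed

text \<open>The point \<open>b y + z\<close> is the meet of the line at infinity with the line
  joining the origin \<open>x\<close> to \<open>x + b y + z\<close>.\<close>

lemma maps_infinite:
  assumes "b \<in> carrier D"
  shows "maps (P \<zero>\<^bsub>D\<^esub> b \<one>\<^bsub>D\<^esub>) (P' \<zero>\<^bsub>D'\<^esub> (\<sigma> b) \<one>\<^bsub>D'\<^esub>)"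
proof -
  obtain w' where w: "maps (P \<zero>\<^bsub>D\<^esub> b \<one>\<^bsub>D\<^esub>) w'"
    using maps_P_exists[of "\<zero>\<^bsub>D\<^esub>" b "\<one>\<^bsub>D\<^esub>"] assms by auto
  obtain p q where pq: "p \<in> carrier D'" "q \<in> carrier D'" "w' = P' \<zero>\<^bsub>D'\<^esub> p q"
    using maps_P_line[of "\<zero>\<^bsub>D\<^esub>" "\<one>\<^bsub>D\<^esub>" "\<zero>\<^bsub>D\<^esub>" "\<zero>\<^bsub>D'\<^esub>" "\<one>\<^bsub>D'\<^esub>" "\<zero>\<^bsub>D'\<^esub>" "\<zero>\<^bsub>D\<^esub>" "\<zero>\<^bsub>D\<^esub>" "\<one>\<^bsub>D\<^esub>"
        "\<zero>\<^bsub>D'\<^esub>" "\<zero>\<^bsub>D'\<^esub>" "\<one>\<^bsub>D'\<^esub>", OF _ _ w, of b "\<one>\<^bsub>D\<^esub>"] my mz assms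
    by (auto simp: P_unit)
  have mx': "maps (P \<one>\<^bsub>D\<^esub> \<zero>\<^bsub>D\<^esub> \<zero>\<^bsub>D\<^esub>) (P' \<one>\<^bsub>D'\<^esub> \<zero>\<^bsub>D'\<^esub> \<zero>\<^bsub>D'\<^esub>)" using mx by (simp add: P_unit)
  have "\<exists>r\<in>carrier D'. \<exists>s\<in>carrier D'. w' = P' (r \<otimes>\<^bsub>D'\<^esub> \<one>\<^bsub>D'\<^esub> \<oplus>\<^bsub>D'\<^esub> s \<otimes>\<^bsub>D'\<^esub> \<one>\<^bsub>D'\<^esub>)
      (r \<otimes>\<^bsub>D'\<^esub> \<sigma> b \<oplus>\<^bsub>D'\<^esub> s \<otimes>\<^bsub>D'\<^esub> \<zero>\<^bsub>D'\<^esub>) (r \<otimes>\<^bsub>D'\<^esub> \<sigma> \<one>\<^bsub>D\<^esub> \<oplus>\<^bsub>D'\<^esub> s \<otimes>\<^bsub>D'\<^esub> \<zero>\<^bsub>D'\<^esub>)"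
    by (rule maps_P_line[OF maps_affine[OF assms D.R.one_closed] mx' w, of "\<one>\<^bsub>D\<^esub>" "\<ominus>\<^bsub>D\<^esub> \<one>\<^bsub>D\<^esub>"])
      (use assms in \<open>simp_all add: D.R.r_neg\<close>)
  then obtain r s where rs: "r \<in> carrier D'" "s \<in> carrier D'"
    "w' = P' (r \<otimes>\<^bsub>D'\<^esub> \<one>\<^bsub>D'\<^esub> \<oplus>\<^bsub>D'\<^esub> s \<otimes>\<^bsub>D'\<^esub> \<one>\<^bsub>D'\<^esub>)
      (r \<otimes>\<^bsub>D'\<^esub> \<sigma> b \<oplus>\<^bsub>D'\<^esub> s \<otimes>\<^bsub>D'\<^esub> \<zero>\<^bsub>D'\<^esub>) (r \<otimes>\<^bsub>D'\<^esub> \<sigma> \<one>\<^bsub>D\<^esub> \<oplus>\<^bsub>D'\<^esub> s \<otimes>\<^bsub>D'\<^esub> \<zero>\<^bsub>D'\<^esub>)"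
    by blast
  have w': "w' = r \<odot>\<^bsub>W'\<^esub> P' \<zero>\<^bsub>D'\<^esub> (\<sigma> b) \<one>\<^bsub>D'\<^esub>"
  proof -
    have "P' \<zero>\<^bsub>D'\<^esub> p q = P' (r \<oplus>\<^bsub>D'\<^esub> s) (r \<otimes>\<^bsub>D'\<^esub> \<sigma> b) r"
      using pq(3) rs assms by (simp add: slope_one)
    from P'_eqD(1)[OF this] have "r \<oplus>\<^bsub>D'\<^esub> s = \<zero>\<^bsub>D'\<^esub>" using pq(1,2) rs(1,2) assms by simp
    then show ?thesis using rs assms by (simp add: P'_smult slope_one)
  qed
  have r0: "r \<noteq> \<zero>\<^bsub>D'\<^esub>" using maps_carrier(4)[OF w] w' assms by auto
  note ri = division_ring_inv[OF D'.division rs(1) r0]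
  show ?thesis
    using maps_smult[OF w ri(1,4)] rs(1) r0 assms by (simp add: w' D'.smult_inv_cancel)
qed

text \<open>The point \<open>x + (a + b) y + z\<close> is the sum of \<open>x + a y\<close> and the
  infinite point \<open>b y + z\<close>. The first and third coordinates force both image
  coefficients to be one, and the second coordinate is the claim.\<close>

lemma slope_add:
  assumes "a \<in> carrier D" "b \<in> carrier D"
  shows "\<sigma> (a \<oplus>\<^bsub>D\<^esub> b) = \<sigma> a \<oplus>\<^bsub>D'\<^esub> \<sigma> b"
proof -
  note m = maps_infinite[OF assms(2)]
  have "\<exists>r\<in>carrier D'. \<exists>s\<in>carrier D'. P' \<one>\<^bsub>D'\<^esub> (\<sigma> (a \<oplus>\<^bsub>D\<^esub> b)) (\<sigma> \<one>\<^bsub>D\<^esub>)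
    = P' (r \<otimes>\<^bsub>D'\<^esub> \<one>\<^bsub>D'\<^esub> \<oplus>\<^bsub>D'\<^esub> s \<otimes>\<^bsub>D'\<^esub> \<zero>\<^bsub>D'\<^esub>) (r \<otimes>\<^bsub>D'\<^esub> \<sigma> a \<oplus>\<^bsub>D'\<^esub> s \<otimes>\<^bsub>D'\<^esub> \<sigma> b)
      (r \<otimes>\<^bsub>D'\<^esub> \<zero>\<^bsub>D'\<^esub> \<oplus>\<^bsub>D'\<^esub> s \<otimes>\<^bsub>D'\<^esub> \<one>\<^bsub>D'\<^esub>)"
    by (rule maps_P_line[OF my_slope[OF assms(1)] m maps_affine[OF _ D.R.one_closed], of _ "\<one>\<^bsub>D\<^esub>" "\<one>\<^bsub>D\<^esub>"])
      (use assms in simp_all)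
  then obtain r s where rs: "r \<in> carrier D'" "s \<in> carrier D'"
    "P' \<one>\<^bsub>D'\<^esub> (\<sigma> (a \<oplus>\<^bsub>D\<^esub> b)) (\<sigma> \<one>\<^bsub>D\<^esub>) = P' (r \<otimes>\<^bsub>D'\<^esub> \<one>\<^bsub>D'\<^esub> \<oplus>\<^bsub>D'\<^esub> s \<otimes>\<^bsub>D'\<^esub> \<zero>\<^bsub>D'\<^esub>)
      (r \<otimes>\<^bsub>D'\<^esub> \<sigma> a \<oplus>\<^bsub>D'\<^esub> s \<otimes>\<^bsub>D'\<^esub> \<sigma> b) (r \<otimes>\<^bsub>D'\<^esub> \<zero>\<^bsub>D'\<^esub> \<oplus>\<^bsub>D'\<^esub> s \<otimes>\<^bsub>D'\<^esub> \<one>\<^bsub>D'\<^esub>)"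
    by blast
  from P'_eqD[OF rs(3)] have "r = \<one>\<^bsub>D'\<^esub>" "r \<otimes>\<^bsub>D'\<^esub> \<sigma> a \<oplus>\<^bsub>D'\<^esub> s \<otimes>\<^bsub>D'\<^esub> \<sigma> b = \<sigma> (a \<oplus>\<^bsub>D\<^esub> b)" "s = \<one>\<^bsub>D'\<^esub>"
    using rs(1,2) assms by (simp_all add: slope_one)
  then show ?thesis using assms by simp
qed

text \<open>The point \<open>x + (a b) y + a z\<close> lies on the line from the origin to
  \<open>b y + z\<close>, with coefficient \<open>a\<close>. Its image has coefficient
  \<open>\<sigma>(a)\<close> at that point, and the \<open>y\<close>-coordinate gives the product in
  the same order because scalars act from the left.\<close>

lemma slope_mult:
  assumes "a \<in> carrier D" "b \<in> carrier D"
  shows "\<sigma> (a \<otimes>\<^bsub>D\<^esub> b) = \<sigma> a \<otimes>\<^bsub>D'\<^esub> \<sigma> b"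
proof -
  note m = maps_infinite[OF assms(2)]
  obtain r s where "r \<in> carrier D'" "s \<in> carrier D'"
    "P' \<one>\<^bsub>D'\<^esub> (\<sigma> (a \<otimes>\<^bsub>D\<^esub> b)) (\<sigma> a) = P' r (s \<otimes>\<^bsub>D'\<^esub> \<sigma> b) s"
    using maps_P_line[OF my_slope[of "\<zero>\<^bsub>D\<^esub>"] m maps_affine[of "a \<otimes>\<^bsub>D\<^esub> b" a], of "\<one>\<^bsub>D\<^esub>" a] assms
    by (auto simp: slope_zero)
  then show ?thesis using assms by (auto simp: P'_eq_iff)
qed

lemma slope_ring_iso: "\<sigma> \<in> ring_iso D D'"
proof (rule ring_iso_memI)
  show "bij_betw \<sigma> (carrier D) (carrier D')"
    unfolding bij_betw_def
  proof (intro conjI inj_onI equalityI subsetI)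
    fix a b assume ab: "a \<in> carrier D" "b \<in> carrier D" "\<sigma> a = \<sigma> b"
    then obtain c where "c \<in> carrier D" "P \<one>\<^bsub>D\<^esub> a \<zero>\<^bsub>D\<^esub> = c \<odot>\<^bsub>W\<^esub> P \<one>\<^bsub>D\<^esub> b \<zero>\<^bsub>D\<^esub>"
      using maps_inj[OF my_slope[OF ab(1)], of "P \<one>\<^bsub>D\<^esub> b \<zero>\<^bsub>D\<^esub>"] my_slope[OF ab(2)] by auto
    then show "a = b" using ab by (auto simp: P_smult P_eq_iff)
  next
    fix a' assume a': "a' \<in> carrier D'"
    then obtain u where u: "maps u (P' \<one>\<^bsub>D'\<^esub> a' \<zero>\<^bsub>D'\<^esub>)"
      \<comment> \<open>Surjectivity is geometric: the preimage \<open>u\<close> lies on the line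
        through \<open>x\<close> and \<open>y\<close> and is not the point of \<open>y\<close>, so
        after scaling it has the form \<open>x + c y\<close>.\<close>
      using ex_maps_onto[OF _ P'_nonzero[of "\<one>\<^bsub>D'\<^esub>" a' "\<zero>\<^bsub>D'\<^esub>"]] by auto
    have "P' \<one>\<^bsub>D'\<^esub> a' \<zero>\<^bsub>D'\<^esub> = \<one>\<^bsub>D'\<^esub> \<odot>\<^bsub>W'\<^esub> x' \<oplus>\<^bsub>W'\<^esub> a' \<odot>\<^bsub>W'\<^esub> y'"
      using a' by (simp add: comb3_def)
    then have "P' \<one>\<^bsub>D'\<^esub> a' \<zero>\<^bsub>D'\<^esub> \<in> lspan D' W' [x', y']"
      using a' D'.R.one_closed by (subst D'.lspan2_iff) (simp_all del: D'.smult_one, blast)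
    then have "u \<in> lspan D W [x, y]"
      using maps_lspan_iff[of "[x, y]" "[x', y']", OF _ u] mx my by simp
    then obtain p q where pq: "p \<in> carrier D" "q \<in> carrier D" "u = P p q \<zero>\<^bsub>D\<^esub>"
      by (subst (asm) D.lspan2_iff) (auto simp: comb3_def)
    have p0: "p \<noteq> \<zero>\<^bsub>D\<^esub>"
    proof
      assume p: "p = \<zero>\<^bsub>D\<^esub>"
      then have "u = q \<odot>\<^bsub>W\<^esub> y" using pq by (simp add: comb3_def)
      moreover from this have "q \<noteq> \<zero>\<^bsub>D\<^esub>" using maps_carrier(3)[OF u] by auto
      ultimately have "maps u (P' \<zero>\<^bsub>D'\<^esub> \<one>\<^bsub>D'\<^esub> \<zero>\<^bsub>D'\<^esub>)" using maps_smult_left[OF my] pq by (simp add: P_unit)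
      then obtain c where "c \<in> carrier D'" "P' \<one>\<^bsub>D'\<^esub> a' \<zero>\<^bsub>D'\<^esub> = c \<odot>\<^bsub>W'\<^esub> P' \<zero>\<^bsub>D'\<^esub> \<one>\<^bsub>D'\<^esub> \<zero>\<^bsub>D'\<^esub>"
        using maps_unique[OF _ u] by auto
      then show False using a' by (auto simp: P'_smult P'_eq_iff)
    qed
    note pi = division_ring_inv[OF D.division pq(1) p0]
    have "inv\<^bsub>D\<^esub> p \<odot>\<^bsub>W\<^esub> u = P \<one>\<^bsub>D\<^esub> (inv\<^bsub>D\<^esub> p \<otimes>\<^bsub>D\<^esub> q) \<zero>\<^bsub>D\<^esub>"
      using pq pi by (simp add: P_smult)
    then have "maps (P \<one>\<^bsub>D\<^esub> (inv\<^bsub>D\<^esub> p \<otimes>\<^bsub>D\<^esub> q) \<zero>\<^bsub>D\<^esub>) (P' \<one>\<^bsub>D'\<^esub> a' \<zero>\<^bsub>D'\<^esub>)"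
      using maps_smult_left[OF u pi(1,4)] by simp
    then have "a' = \<sigma> (inv\<^bsub>D\<^esub> p \<otimes>\<^bsub>D\<^esub> q)"
      using maps_P_unique(1)[OF my_slope[of "inv\<^bsub>D\<^esub> p \<otimes>\<^bsub>D\<^esub> q"]] pi pq a' by auto
    then show "a' \<in> \<sigma> ` carrier D" using pi pq by auto
  qed auto
qed (auto simp: slope_add slope_mult slope_one)

end

text \<open>No semilinear map on the whole space is constructed. The ring isomorphism and its effect
  along a single line are all that control of cross-ratios requires.\<close>

theorem (in collineation) fundamental_theorem:
  assumes "lindep_free D W [x, y, z]" "x \<in> carrier W" "y \<in> carrier W" "z \<in> carrier W"
  shows "\<exists>\<sigma>\<in>ring_iso D D'. \<exists>x' y'. lindep_free D' W' [x', y'] \<and> maps x x' \<and> maps y y'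
    \<and> (\<forall>a\<in>carrier D. maps (x \<oplus>\<^bsub>W\<^esub> a \<odot>\<^bsub>W\<^esub> y) (x' \<oplus>\<^bsub>W'\<^esub> \<sigma> a \<odot>\<^bsub>W'\<^esub> y'))"
proof -
  have sub: "lspan D W [z] \<subseteq> lspan D W [y, z]" "lspan D W [y] \<subseteq> lspan D W [y, z]"
    using D.lspan_Cons_superset(1)[of y "[z]"] D.lspan_mono[of "[y]" "[y, z]"]
      D.lspan_Cons_superset(2)[of y "[z]"] assms(2-4) by auto
  have yz: "y \<noteq> \<zero>\<^bsub>W\<^esub>" "z \<noteq> \<zero>\<^bsub>W\<^esub>"
    using assms D.submoduleD(2)[OF D.lspan_submodule[of "[z]"]] by auto
  then have ind: "lindep_free D W [x, y]" "lindep_free D W [x, z]" using assms sub by auto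
  have "x \<noteq> \<zero>\<^bsub>W\<^esub>"
    using assms D.submoduleD(2)[OF D.lspan_submodule[of "[y, z]"]] by auto
  then obtain x' where mx: "maps x x'" using ex_maps assms by auto
  obtain y' where my: "maps y y'" "maps (x \<oplus>\<^bsub>W\<^esub> y) (x' \<oplus>\<^bsub>W'\<^esub> y')"
    using ex_unit_rep[OF mx assms(3) ind(1)] by auto
  obtain z' where mz: "maps z z'" "maps (x \<oplus>\<^bsub>W\<^esub> z) (x' \<oplus>\<^bsub>W'\<^esub> z')"
    using ex_unit_rep[OF mx assms(4) ind(2)] by auto
  interpret framed_collineation D W D' W' \<beta> x y z x' y' z'
    by unfold_locales (use assms mx my mz in auto)
  obtain \<sigma> \<tau> where "\<forall>a\<in>carrier D. \<sigma> a \<in> carrier D' \<and> \<tau> a \<in> carrier D'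
    \<and> maps (P \<one>\<^bsub>D\<^esub> a \<zero>\<^bsub>D\<^esub>) (P' \<one>\<^bsub>D'\<^esub> (\<sigma> a) \<zero>\<^bsub>D'\<^esub>) \<and> maps (P \<one>\<^bsub>D\<^esub> \<zero>\<^bsub>D\<^esub> a) (P' \<one>\<^bsub>D'\<^esub> \<zero>\<^bsub>D'\<^esub> (\<tau> a))"
    using ex_slopes by blast
  then interpret slopes D W D' W' \<beta> x y z x' y' z' \<sigma> \<tau>
    by unfold_locales auto
  have "maps (x \<oplus>\<^bsub>W\<^esub> a \<odot>\<^bsub>W\<^esub> y) (x' \<oplus>\<^bsub>W'\<^esub> \<sigma> a \<odot>\<^bsub>W'\<^esub> y')" if "a \<in> carrier D" for a
    using my_slope[OF that] that by (simp add: comb3_def)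
  moreover have "lindep_free D' W' [x', y']"
    using maps_lindep_free[of "[x, y]" "[x', y']"] mx my ind by simp
  ultimately show ?thesis using slope_ring_iso mx my by blast
qed

section \<open>Cross-ratios pin down central scalars\<close>

lemma (in left_vector_space) cyclic_sub_neqI:
  assumes "lindep_free R M [x, y]" "x \<in> carrier M" "y \<in> carrier M"
  shows "cyclic_sub R M x \<noteq> cyclic_sub R M y"
  using assms by (metis cyclic_sub_eq_lspan lindep_free.simps(2) mem_cyclic_sub)

text \<open>Write \<open>u = p x\<close> and \<open>w = q y\<close>. The third point forces
  \<open>q = p\<close>, the fourth \<open>s p = p a\<close>. Centrality of \<open>s\<close> turns
  this into \<open>p s = p a\<close>; without it only a conjugate of \<open>a\<close> would be
  determined.\<close>

lemma (in left_vector_space) cross_ratio_unique: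
  assumes "lindep_free R M [x, y]" "x \<in> carrier M" "y \<in> carrier M" "a \<in> carrier R" "s \<in> carrier R"
    "\<And>d. d \<in> carrier R \<Longrightarrow> s \<otimes>\<^bsub>R\<^esub> d = d \<otimes>\<^bsub>R\<^esub> s"
    "u \<in> carrier M - {\<zero>\<^bsub>M\<^esub>}" "w \<in> carrier M - {\<zero>\<^bsub>M\<^esub>}"
    "cyclic_sub R M u = cyclic_sub R M x" "cyclic_sub R M w = cyclic_sub R M y"
    "cyclic_sub R M (u \<oplus>\<^bsub>M\<^esub> w) = cyclic_sub R M (x \<oplus>\<^bsub>M\<^esub> y)"
    "cyclic_sub R M (u \<oplus>\<^bsub>M\<^esub> s \<odot>\<^bsub>M\<^esub> w) = cyclic_sub R M (x \<oplus>\<^bsub>M\<^esub> a \<odot>\<^bsub>M\<^esub> y)"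
  shows "a = s"
proof -
  have inj: "p = p' \<and> q = q'"
    if "p \<odot>\<^bsub>M\<^esub> x \<oplus>\<^bsub>M\<^esub> q \<odot>\<^bsub>M\<^esub> y = p' \<odot>\<^bsub>M\<^esub> x \<oplus>\<^bsub>M\<^esub> q' \<odot>\<^bsub>M\<^esub> y"
      "p \<in> carrier R" "q \<in> carrier R" "p' \<in> carrier R" "q' \<in> carrier R" for p q p' q'
    using inj_onD[OF lincomb_inj[OF _ assms(1)], of "[p, q]" "[p', q']"] that assms(2,3)
    by (simp add: coeffs_def)
  obtain p where p: "p \<in> carrier R" "u = p \<odot>\<^bsub>M\<^esub> x"
    using cyclic_sub_eqD[OF _ _ assms(2,9)] assms(7) by auto
  obtain q where q: "q \<in> carrier R" "w = q \<odot>\<^bsub>M\<^esub> y"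
    using cyclic_sub_eqD[OF _ _ assms(3,10)] assms(8) by auto
  have p0: "p \<noteq> \<zero>\<^bsub>R\<^esub>" using p assms(2,7) by auto
  have "u \<oplus>\<^bsub>M\<^esub> w \<in> cyclic_sub R M (x \<oplus>\<^bsub>M\<^esub> y)"
    using assms(7,8) mem_cyclic_sub[of "u \<oplus>\<^bsub>M\<^esub> w"] unfolding assms(11) by simp
  then obtain g where g: "g \<in> carrier R" "u \<oplus>\<^bsub>M\<^esub> w = g \<odot>\<^bsub>M\<^esub> (x \<oplus>\<^bsub>M\<^esub> y)"
    by (auto simp: cyclic_sub_def)
  then have "p \<odot>\<^bsub>M\<^esub> x \<oplus>\<^bsub>M\<^esub> q \<odot>\<^bsub>M\<^esub> y = g \<odot>\<^bsub>M\<^esub> x \<oplus>\<^bsub>M\<^esub> g \<odot>\<^bsub>M\<^esub> y"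
    using p q assms(2,3) by (simp add: smult_r_distr)
  then have pq: "q = p" using inj p q g by blast
  have "u \<oplus>\<^bsub>M\<^esub> s \<odot>\<^bsub>M\<^esub> w \<in> cyclic_sub R M (x \<oplus>\<^bsub>M\<^esub> a \<odot>\<^bsub>M\<^esub> y)"
    using assms(5,7,8) mem_cyclic_sub[of "u \<oplus>\<^bsub>M\<^esub> s \<odot>\<^bsub>M\<^esub> w"] unfolding assms(12) by simp
  then obtain h where h: "h \<in> carrier R" "u \<oplus>\<^bsub>M\<^esub> s \<odot>\<^bsub>M\<^esub> w = h \<odot>\<^bsub>M\<^esub> (x \<oplus>\<^bsub>M\<^esub> a \<odot>\<^bsub>M\<^esub> y)"
    by (auto simp: cyclic_sub_def)
  then have "p \<odot>\<^bsub>M\<^esub> x \<oplus>\<^bsub>M\<^esub> (s \<otimes>\<^bsub>R\<^esub> p) \<odot>\<^bsub>M\<^esub> y = h \<odot>\<^bsub>M\<^esub> x \<oplus>\<^bsub>M\<^esub> (h \<otimes>\<^bsub>R\<^esub> a) \<odot>\<^bsub>M\<^esub> y"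
    using p q pq assms(2-5) by (simp add: smult_r_distr smult_assoc1)
  then have "p = h \<and> s \<otimes>\<^bsub>R\<^esub> p = h \<otimes>\<^bsub>R\<^esub> a"
    by (rule inj) (use p(1) h(1) assms(4,5) in simp_all)
  then have "p \<otimes>\<^bsub>R\<^esub> s = p \<otimes>\<^bsub>R\<^esub> a" using assms(6)[OF p(1)] by metis
  then have "inv\<^bsub>R\<^esub> p \<otimes>\<^bsub>R\<^esub> (p \<otimes>\<^bsub>R\<^esub> s) = inv\<^bsub>R\<^esub> p \<otimes>\<^bsub>R\<^esub> (p \<otimes>\<^bsub>R\<^esub> a)" by simp
  then show ?thesis
    using division_ring_inv[OF division p(1) p0] p(1) assms(4,5) by (simp flip: R.m_assoc)
qed

lemma (in left_vector_space) list_basis_triple: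
  assumes "list_basis R M xs" "3 \<le> length xs"
  shows "\<exists>x\<in>carrier M. \<exists>y\<in>carrier M. \<exists>z\<in>carrier M. lindep_free R M [x, y, z]"
proof -
  obtain x y z zs where xs: "xs = x # y # z # zs"
    using assms(2) by (metis One_nat_def Suc_le_length_iff eval_nat_numeral(3) numeral_2_eq_2)
  have c: "x \<in> carrier M" "y \<in> carrier M" "z \<in> carrier M" and zs: "set zs \<subseteq> carrier M"
    using assms(1) xs by (auto simp: list_basis_def)
  have "lspan R M [y, z] \<subseteq> lspan R M (y # z # zs)" "lspan R M [z] \<subseteq> lspan R M (z # zs)"
    using lspan_mono[of "[y, z]" "y # z # zs"] lspan_mono[of "[z]" "z # zs"]
      set_subset_lspan[of "y # z # zs"] set_subset_lspan[of "z # zs"] c zs by simp_all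
  moreover have "z \<noteq> \<zero>\<^bsub>M\<^esub>"
    using assms(1) xs submoduleD(2)[OF lspan_submodule[OF zs]] by (auto simp: list_basis_def)
  ultimately have "lindep_free R M [x, y, z]" using assms(1) xs by (auto simp: list_basis_def)
  then show ?thesis using c by blast
qed

text \<open>A single \<open>\<sigma>\<close> serves every \<open>c\<close>, and each
  \<open>c\<close> carries its own premises. Plain collineations and those preserving cross-ratios
  in \<open>k\<close> are thereby treated alike.\<close>

theorem collineation_ring_iso:
  fixes D :: "('k, 'd, 'y) module_scheme" and D' :: "('k, 'e, 'y2) module_scheme"
  assumes "collineation D W D' W' \<beta>" "list_basis D W xs" "3 \<le> length xs"
  shows "\<exists>\<sigma>\<in>ring_iso D D'. \<forall>c. c \<odot>\<^bsub>D\<^esub> \<one>\<^bsub>D\<^esub> \<in> carrier D \<longrightarrow> c \<odot>\<^bsub>D'\<^esub> \<one>\<^bsub>D'\<^esub> \<in> carrier D' \<longrightarrow>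
    (\<forall>d\<in>carrier D'. (c \<odot>\<^bsub>D'\<^esub> \<one>\<^bsub>D'\<^esub>) \<otimes>\<^bsub>D'\<^esub> d = d \<otimes>\<^bsub>D'\<^esub> (c \<odot>\<^bsub>D'\<^esub> \<one>\<^bsub>D'\<^esub>)) \<longrightarrow>
    (\<lambda>(p, q, r, s). (\<beta> p, \<beta> q, \<beta> r, \<beta> s)) ` cross_ratio_rel D W c \<subseteq> cross_ratio_rel D' W' c
      \<longrightarrow> \<sigma> (c \<odot>\<^bsub>D\<^esub> \<one>\<^bsub>D\<^esub>) = c \<odot>\<^bsub>D'\<^esub> \<one>\<^bsub>D'\<^esub>"
proof -
  interpret collineation D W D' W' \<beta> by fact
  obtain x y z where c: "x \<in> carrier W" "y \<in> carrier W" "z \<in> carrier W" and ind: "lindep_free D W [x, y, z]"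
    using D.list_basis_triple[OF assms(2,3)] by blast
  have ind2: "lindep_free D W [x, y]"
  proof -
    have "lspan D W [y] \<subseteq> lspan D W [y, z]"
      using D.lspan_mono[of "[y]" "[y, z]"] D.lspan_Cons_superset(2)[of y "[z]"] c by auto
    moreover have "y \<noteq> \<zero>\<^bsub>W\<^esub>"
      using ind D.submoduleD(2)[OF D.lspan_submodule[of "[z]"]] c by auto
    ultimately show ?thesis using ind by auto
  qed
  obtain \<sigma> x' y' where \<sigma>: "\<sigma> \<in> ring_iso D D'" and xy': "lindep_free D' W' [x', y']" "maps x x'" "maps y y'"
    and m: "\<And>a. a \<in> carrier D \<Longrightarrow> maps (x \<oplus>\<^bsub>W\<^esub> a \<odot>\<^bsub>W\<^esub> y) (x' \<oplus>\<^bsub>W'\<^esub> \<sigma> a \<odot>\<^bsub>W'\<^esub> y')"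
    using fundamental_theorem[OF ind c] by blast
  have c': "x' \<in> carrier W'" "y' \<in> carrier W'" using xy' by auto
  have "\<sigma> (c \<odot>\<^bsub>D\<^esub> \<one>\<^bsub>D\<^esub>) = c \<odot>\<^bsub>D'\<^esub> \<one>\<^bsub>D'\<^esub>"
    if h: "c \<odot>\<^bsub>D\<^esub> \<one>\<^bsub>D\<^esub> \<in> carrier D" "c \<odot>\<^bsub>D'\<^esub> \<one>\<^bsub>D'\<^esub> \<in> carrier D'"
      "\<forall>d\<in>carrier D'. (c \<odot>\<^bsub>D'\<^esub> \<one>\<^bsub>D'\<^esub>) \<otimes>\<^bsub>D'\<^esub> d = d \<otimes>\<^bsub>D'\<^esub> (c \<odot>\<^bsub>D'\<^esub> \<one>\<^bsub>D'\<^esub>)"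
      "(\<lambda>(p, q, r, s). (\<beta> p, \<beta> q, \<beta> r, \<beta> s)) ` cross_ratio_rel D W c \<subseteq> cross_ratio_rel D' W' c" for c
  proof -
    let ?s = "c \<odot>\<^bsub>D\<^esub> \<one>\<^bsub>D\<^esub>" and ?s' = "c \<odot>\<^bsub>D'\<^esub> \<one>\<^bsub>D'\<^esub>"
    \<comment> \<open>A test quadruple of cross-ratio \<open>c\<close> on the line where the effect
      of the collineation is known.\<close>
    have "(cyclic_sub D W x, cyclic_sub D W y, cyclic_sub D W (x \<oplus>\<^bsub>W\<^esub> y), cyclic_sub D W (x \<oplus>\<^bsub>W\<^esub> ?s \<odot>\<^bsub>W\<^esub> y))
      \<in> cross_ratio_rel D W c"
      unfolding cross_ratio_rel_def
      using D.cyclic_sub_neqI[OF ind2 c(1,2)] c maps_carrier(3)[OF xy'(2)] maps_carrier(3)[OF xy'(3)]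
      by blast
    then have "(\<beta> (cyclic_sub D W x), \<beta> (cyclic_sub D W y), \<beta> (cyclic_sub D W (x \<oplus>\<^bsub>W\<^esub> y)),
        \<beta> (cyclic_sub D W (x \<oplus>\<^bsub>W\<^esub> ?s \<odot>\<^bsub>W\<^esub> y))) \<in> cross_ratio_rel D' W' c"
      using h(4) by (auto simp: image_subset_iff)
    moreover have "maps (x \<oplus>\<^bsub>W\<^esub> y) (x' \<oplus>\<^bsub>W'\<^esub> y')"
      using m[OF D.R.one_closed] ring_iso_memE(4)[OF \<sigma>] c c' by simp
    ultimately have "(cyclic_sub D' W' x', cyclic_sub D' W' y', cyclic_sub D' W' (x' \<oplus>\<^bsub>W'\<^esub> y'),
        cyclic_sub D' W' (x' \<oplus>\<^bsub>W'\<^esub> \<sigma> ?s \<odot>\<^bsub>W'\<^esub> y')) \<in> cross_ratio_rel D' W' c"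
      using m[OF h(1)] xy'(2,3) by (simp add: maps_def)
    then obtain u w where uw: "u \<in> carrier W' - {\<zero>\<^bsub>W'\<^esub>}" "w \<in> carrier W' - {\<zero>\<^bsub>W'\<^esub>}"
      "cyclic_sub D' W' u = cyclic_sub D' W' x'" "cyclic_sub D' W' w = cyclic_sub D' W' y'"
      "cyclic_sub D' W' (u \<oplus>\<^bsub>W'\<^esub> w) = cyclic_sub D' W' (x' \<oplus>\<^bsub>W'\<^esub> y')"
      "cyclic_sub D' W' (u \<oplus>\<^bsub>W'\<^esub> ?s' \<odot>\<^bsub>W'\<^esub> w) = cyclic_sub D' W' (x' \<oplus>\<^bsub>W'\<^esub> \<sigma> ?s \<odot>\<^bsub>W'\<^esub> y')"
      unfolding cross_ratio_rel_def mem_Collect_eq prod.inject by metis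
    show ?thesis
      by (rule D'.cross_ratio_unique[OF xy'(1) c' ring_iso_memE(1)[OF \<sigma> h(1)] h(2) _ uw])
        (use h(3) in auto)
  qed
  then show ?thesis using \<sigma> by blast
qed

section \<open>Dual modules over division algebras\<close>

lemma opp_simps [simp]:
  "carrier (opp R) = carrier R" "mult (opp R) = (\<lambda>x y. y \<otimes>\<^bsub>R\<^esub> x)" "one (opp R) = one R"
  "zero (opp R) = zero R" "add (opp R) = add R"
  by (simp_all add: opp_def)

lemma opp_opp [simp]: "opp (opp R) = R"
  by (simp add: opp_def)

lemma ring_opp:
  assumes "ring R"
  shows "ring (opp R)"
proof -
  interpret ring R by fact
  show ?thesis
  proof (rule ringI)
    show "abelian_group (opp R)"
      by (rule abelian_groupI) (auto simp: a_ac intro: bexI[of _ "\<ominus>\<^bsub>R\<^esub> x" for x] l_neg)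
    show "monoid (opp R)" by (rule monoidI) (auto simp: m_assoc)
  qed (auto simp: l_distr r_distr)
qed

lemma division_ring_opp: "division_ring R \<Longrightarrow> division_ring (opp R)"
  by (auto simp: division_ring_def ring_opp Units_def)

lemma ring_iso_opp: "\<sigma> \<in> ring_iso R S \<Longrightarrow> \<sigma> \<in> ring_iso (opp R) (opp S)"
  by (auto simp: ring_iso_def ring_hom_def)

lemma (in left_vector_space) ex_coords:
  assumes "list_basis R M xs"
  obtains coords where
    "\<And>v. v \<in> carrier M \<Longrightarrow> coords v \<in> coeffs R xs"
    "\<And>v. v \<in> carrier M \<Longrightarrow> lincomb M (coords v) xs = v"
    "\<And>cs. cs \<in> coeffs R xs \<Longrightarrow> coords (lincomb M cs xs) = cs"
    "\<And>v w. \<lbrakk>v \<in> carrier M; w \<in> carrier M\<rbrakk> \<Longrightarrow> coords (v \<oplus>\<^bsub>M\<^esub> w) = map2 (\<oplus>\<^bsub>R\<^esub>) (coords v) (coords w)"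
    "\<And>a v. \<lbrakk>a \<in> carrier R; v \<in> carrier M\<rbrakk> \<Longrightarrow> coords (a \<odot>\<^bsub>M\<^esub> v) = map ((\<otimes>\<^bsub>R\<^esub>) a) (coords v)"
proof
  let ?c = "inv_into (coeffs R xs) (\<lambda>cs. lincomb M cs xs)"
  note b = list_basis_bij[OF assms]
  have xs: "set xs \<subseteq> carrier M" using assms by (simp add: list_basis_def)
  show c: "?c v \<in> coeffs R xs" if "v \<in> carrier M" for v
    using bij_betw_apply[OF bij_betw_inv_into[OF b] that] .
  show l: "lincomb M (?c v) xs = v" if "v \<in> carrier M" for v
    using bij_betw_inv_into_right[OF b that] .
  show i: "?c (lincomb M cs xs) = cs" if "cs \<in> coeffs R xs" for cs
    using bij_betw_inv_into_left[OF b that] .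
  show "?c (v \<oplus>\<^bsub>M\<^esub> w) = map2 (\<oplus>\<^bsub>R\<^esub>) (?c v) (?c w)" if vw: "v \<in> carrier M" "w \<in> carrier M" for v w
    using i[OF map2_add_coeffs[OF c[OF vw(1)] c[OF vw(2)]]] lincomb_add[OF xs c[OF vw(1)] c[OF vw(2)]]
      l[OF vw(1)] l[OF vw(2)] by simp
  show "?c (a \<odot>\<^bsub>M\<^esub> v) = map ((\<otimes>\<^bsub>R\<^esub>) a) (?c v)" if av: "a \<in> carrier R" "v \<in> carrier M" for a v
    using i[OF map_mult_coeffs[OF c[OF av(2)] av(1)]] lincomb_smult[OF xs c[OF av(2)] av(1)] l[OF av(2)]
    by simp
qed

text \<open>Coefficient lists behave like a free module without being packaged as one;
  \<open>ts\<close> consists of the images of the unit lists.\<close>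

lemma (in lmodule) linear_coeffs_lincomb:
  assumes "\<And>cs. cs \<in> coeffs R xs \<Longrightarrow> \<Psi> cs \<in> carrier M"
    "\<And>cs ds. \<lbrakk>cs \<in> coeffs R xs; ds \<in> coeffs R xs\<rbrakk> \<Longrightarrow> \<Psi> (map2 (\<oplus>\<^bsub>R\<^esub>) cs ds) = \<Psi> cs \<oplus>\<^bsub>M\<^esub> \<Psi> ds"
    "\<And>a cs. \<lbrakk>a \<in> carrier R; cs \<in> coeffs R xs\<rbrakk> \<Longrightarrow> \<Psi> (map ((\<otimes>\<^bsub>R\<^esub>) a) cs) = a \<odot>\<^bsub>M\<^esub> \<Psi> cs"
  shows "\<exists>ts. length ts = length xs \<and> set ts \<subseteq> carrier M \<and> (\<forall>cs\<in>coeffs R xs. \<Psi> cs = lincomb M cs ts)"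
  using assms
proof (induction xs arbitrary: \<Psi>)
  case Nil
  have "\<Psi> [] = \<Psi> [] \<oplus>\<^bsub>M\<^esub> \<Psi> []" using Nil(2)[of "[]" "[]"] by simp
  then have "\<Psi> [] = \<zero>\<^bsub>M\<^esub>" using Nil(1)[of "[]"] by (metis M.add.r_cancel_one' coeffs_Nil singletonI)
  then show ?case by auto
next
  case (Cons x xs)
  define zs where "zs = map (\<lambda>_. \<zero>\<^bsub>R\<^esub>) xs"
  have zs: "zs \<in> coeffs R xs" by (auto simp: zs_def coeffs_def)
  have zadd: "map2 (\<oplus>\<^bsub>R\<^esub>) zs cs = cs" if "cs \<in> coeffs R xs" for cs
    using that by (intro nth_equalityI) (auto simp: zs_def coeffs_def subset_iff)
  have zmul: "map ((\<otimes>\<^bsub>R\<^esub>) a) zs = zs" if "a \<in> carrier R" for a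
    using that by (auto simp: zs_def)
  have "\<exists>ts. length ts = length xs \<and> set ts \<subseteq> carrier M
      \<and> (\<forall>cs\<in>coeffs R xs. \<Psi> (\<zero>\<^bsub>R\<^esub> # cs) = lincomb M cs ts)"
  proof (rule Cons.IH)
    show "\<Psi> (\<zero>\<^bsub>R\<^esub> # cs) \<in> carrier M" if "cs \<in> coeffs R xs" for cs using Cons.prems(1) that by simp
    show "\<Psi> (\<zero>\<^bsub>R\<^esub> # map2 (\<oplus>\<^bsub>R\<^esub>) cs ds) = \<Psi> (\<zero>\<^bsub>R\<^esub> # cs) \<oplus>\<^bsub>M\<^esub> \<Psi> (\<zero>\<^bsub>R\<^esub> # ds)"
      if "cs \<in> coeffs R xs" "ds \<in> coeffs R xs" for cs ds
      using Cons.prems(2)[of "\<zero>\<^bsub>R\<^esub> # cs" "\<zero>\<^bsub>R\<^esub> # ds"] that by simp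
    show "\<Psi> (\<zero>\<^bsub>R\<^esub> # map ((\<otimes>\<^bsub>R\<^esub>) a) cs) = a \<odot>\<^bsub>M\<^esub> \<Psi> (\<zero>\<^bsub>R\<^esub> # cs)"
      if "a \<in> carrier R" "cs \<in> coeffs R xs" for a cs
      using Cons.prems(3)[of a "\<zero>\<^bsub>R\<^esub> # cs"] that by simp
  qed
  then obtain ts where ts: "length ts = length xs" "set ts \<subseteq> carrier M"
    "\<And>cs. cs \<in> coeffs R xs \<Longrightarrow> \<Psi> (\<zero>\<^bsub>R\<^esub> # cs) = lincomb M cs ts" by auto
  have "\<Psi> (c # cs) = lincomb M (c # cs) (\<Psi> (\<one>\<^bsub>R\<^esub> # zs) # ts)" if c: "c \<in> carrier R" "cs \<in> coeffs R xs" for c cs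
    using Cons.prems(2)[of "c # zs" "\<zero>\<^bsub>R\<^esub> # cs"] Cons.prems(3)[of c "\<one>\<^bsub>R\<^esub> # zs"] zs c
      zadd[OF c(2)] zmul[OF c(1)] ts(3)[OF c(2)] by simp
  moreover have "\<Psi> (\<one>\<^bsub>R\<^esub> # zs) \<in> carrier M" using Cons.prems(1) zs by simp
  ultimately show ?case
    using ts(1,2) by (intro exI[of _ "\<Psi> (\<one>\<^bsub>R\<^esub> # zs) # ts"]) (auto simp: coeffs_Cons)
qed

text \<open>Moves the module axioms along a bijection. This equips \<open>HomD\<close> with its
  structure, via the simpler dual module, and handles records that agree except in irrelevant
  fields, as for corners.\<close>

lemma lmodule_transfer:
  assumes "lmodule R M" "bij_betw f (carrier M) (carrier N)" "f \<zero>\<^bsub>M\<^esub> = \<zero>\<^bsub>N\<^esub>"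
    "\<And>x y. \<lbrakk>x \<in> carrier M; y \<in> carrier M\<rbrakk> \<Longrightarrow> f (x \<oplus>\<^bsub>M\<^esub> y) = f x \<oplus>\<^bsub>N\<^esub> f y"
    "\<And>a x. \<lbrakk>a \<in> carrier R; x \<in> carrier M\<rbrakk> \<Longrightarrow> f (a \<odot>\<^bsub>M\<^esub> x) = a \<odot>\<^bsub>N\<^esub> f x"
  shows "lmodule R N"
proof -
  interpret M: lmodule R M by fact
  have im: "\<exists>u\<in>carrier M. x = f u" if "x \<in> carrier N" for x
    using assms(2) that by (auto simp: bij_betw_def)
  have cl: "f u \<in> carrier N" if "u \<in> carrier M" for u using bij_betw_apply[OF assms(2) that] .
  show ?thesis
  proof (intro lmodule.intro lmodule_axioms.intro M.R.ring_axioms abelian_groupI)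
    fix x y assume "x \<in> carrier N" "y \<in> carrier N"
    then obtain u v where uv: "u \<in> carrier M" "v \<in> carrier M" "x = f u" "y = f v" using im by metis
    then show "x \<oplus>\<^bsub>N\<^esub> y \<in> carrier N" "x \<oplus>\<^bsub>N\<^esub> y = y \<oplus>\<^bsub>N\<^esub> x"
      using cl[of "u \<oplus>\<^bsub>M\<^esub> v"] assms(4)[of u v] assms(4)[of v u] by (simp_all add: M.M.a_comm)
    fix z assume "z \<in> carrier N"
    then obtain w where "w \<in> carrier M" "z = f w" using im by metis
    then show "x \<oplus>\<^bsub>N\<^esub> y \<oplus>\<^bsub>N\<^esub> z = x \<oplus>\<^bsub>N\<^esub> (y \<oplus>\<^bsub>N\<^esub> z)"
      using uv by (simp add: M.M.a_assoc flip: assms(4))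
  next
    show "\<zero>\<^bsub>N\<^esub> \<in> carrier N" using cl[of "\<zero>\<^bsub>M\<^esub>"] assms(3) by simp
  next
    fix x assume "x \<in> carrier N"
    then obtain u where u: "u \<in> carrier M" "x = f u" using im by metis
    then show "\<zero>\<^bsub>N\<^esub> \<oplus>\<^bsub>N\<^esub> x = x" "\<one>\<^bsub>R\<^esub> \<odot>\<^bsub>N\<^esub> x = x"
      using assms(4)[of "\<zero>\<^bsub>M\<^esub>" u] assms(5)[of "\<one>\<^bsub>R\<^esub>" u] assms(3) by simp_all
    have "f (\<ominus>\<^bsub>M\<^esub> u) \<oplus>\<^bsub>N\<^esub> x = \<zero>\<^bsub>N\<^esub>"
      using u assms(4)[of "\<ominus>\<^bsub>M\<^esub> u" u] assms(3) by (simp add: M.M.l_neg)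
    then show "\<exists>y\<in>carrier N. y \<oplus>\<^bsub>N\<^esub> x = \<zero>\<^bsub>N\<^esub>" using cl u by blast
  next
    fix a x assume "a \<in> carrier R" "x \<in> carrier N"
    then obtain u where u: "a \<in> carrier R" "u \<in> carrier M" "x = f u" using im by metis
    then show "a \<odot>\<^bsub>N\<^esub> x \<in> carrier N" using cl[of "a \<odot>\<^bsub>M\<^esub> u"] assms(5)[of a u] by simp
    {
      fix y assume "y \<in> carrier N"
      then obtain v where "v \<in> carrier M" "y = f v" using im by metis
      then show "a \<odot>\<^bsub>N\<^esub> (x \<oplus>\<^bsub>N\<^esub> y) = a \<odot>\<^bsub>N\<^esub> x \<oplus>\<^bsub>N\<^esub> a \<odot>\<^bsub>N\<^esub> y"
        using u by (simp add: M.smult_r_distr flip: assms(4,5))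
    }
  next
    fix a b x assume "a \<in> carrier R" "b \<in> carrier R" "x \<in> carrier N"
    then obtain u where "a \<in> carrier R" "b \<in> carrier R" "u \<in> carrier M" "x = f u" using im by metis
    then show "(a \<oplus>\<^bsub>R\<^esub> b) \<odot>\<^bsub>N\<^esub> x = a \<odot>\<^bsub>N\<^esub> x \<oplus>\<^bsub>N\<^esub> b \<odot>\<^bsub>N\<^esub> x" "(a \<otimes>\<^bsub>R\<^esub> b) \<odot>\<^bsub>N\<^esub> x = a \<odot>\<^bsub>N\<^esub> (b \<odot>\<^bsub>N\<^esub> x)"
      by (simp_all add: M.smult_l_distr M.smult_assoc1 flip: assms(4,5))
  qed
qed

section \<open>Division algebras and linear functionals\<close>

locale division_algebra = K?: field K + D?: ring D + module K D
  for K :: "('k, 'p) ring_scheme" (structure) and D :: "('k, 'd) module" (structure) +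
  assumes smult_mult_left:
      "\<lbrakk> c \<in> carrier K; x \<in> carrier D; y \<in> carrier D \<rbrakk> \<Longrightarrow> (c \<odot>\<^bsub>D\<^esub> x) \<otimes>\<^bsub>D\<^esub> y = c \<odot>\<^bsub>D\<^esub> (x \<otimes>\<^bsub>D\<^esub> y)"
    and smult_mult_right:
      "\<lbrakk> c \<in> carrier K; x \<in> carrier D; y \<in> carrier D \<rbrakk> \<Longrightarrow> x \<otimes>\<^bsub>D\<^esub> (c \<odot>\<^bsub>D\<^esub> y) = c \<odot>\<^bsub>D\<^esub> (x \<otimes>\<^bsub>D\<^esub> y)"
    and division: "division_ring D"
    and finite_dim: "\<exists>bs. list_basis K D bs"

lemma (in field) division_ring: "division_ring R"
  by (simp add: division_ring_def ring_axioms field_Units)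

lemma module_lmodule: "module R M \<Longrightarrow> lmodule R M"
  unfolding module_def lmodule_def module_axioms_def lmodule_axioms_def cring_def by auto

text \<open>Unlike \<open>linear_maps\<close> this demands no extensionality, so maps such as
  \<open>\<lambda>x. \<tau> (x \<otimes> a)\<close> qualify as they stand.\<close>

definition functional :: "('k, 'p) ring_scheme \<Rightarrow> ('k, 'm, 'q) module_scheme \<Rightarrow> ('m \<Rightarrow> 'k) \<Rightarrow> bool" where
  "functional K M f \<longleftrightarrow> (\<forall>x\<in>carrier M. f x \<in> carrier K)
     \<and> (\<forall>x\<in>carrier M. \<forall>y\<in>carrier M. f (x \<oplus>\<^bsub>M\<^esub> y) = f x \<oplus>\<^bsub>K\<^esub> f y)
     \<and> (\<forall>c\<in>carrier K. \<forall>x\<in>carrier M. f (c \<odot>\<^bsub>M\<^esub> x) = c \<otimes>\<^bsub>K\<^esub> f x)"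

lemma functionalD:
  assumes "functional K M f"
  shows "x \<in> carrier M \<Longrightarrow> f x \<in> carrier K"
    "\<lbrakk>x \<in> carrier M; y \<in> carrier M\<rbrakk> \<Longrightarrow> f (x \<oplus>\<^bsub>M\<^esub> y) = f x \<oplus>\<^bsub>K\<^esub> f y"
    "\<lbrakk>c \<in> carrier K; x \<in> carrier M\<rbrakk> \<Longrightarrow> f (c \<odot>\<^bsub>M\<^esub> x) = c \<otimes>\<^bsub>K\<^esub> f x"
  using assms by (auto simp: functional_def)

fun fcomb :: "('k, 'p) ring_scheme \<Rightarrow> 'k list \<Rightarrow> ('m \<Rightarrow> 'k) list \<Rightarrow> 'm \<Rightarrow> 'k" where
  "fcomb K (c # cs) (f # fs) x = c \<otimes>\<^bsub>K\<^esub> f x \<oplus>\<^bsub>K\<^esub> fcomb K cs fs x"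
| "fcomb K _ _ x = \<zero>\<^bsub>K\<^esub>"

context
  fixes K :: "('k, 'p) ring_scheme" and M :: "('k, 'm, 'q) module_scheme"
  assumes K: "field K" and M: "lmodule K M"
begin

interpretation K: field K by (rule K)
interpretation M: lmodule K M by (rule M)

lemma functional_zero: "functional K M f \<Longrightarrow> f \<zero>\<^bsub>M\<^esub> = \<zero>\<^bsub>K\<^esub>"
  using functionalD(3)[of K M f "\<zero>\<^bsub>K\<^esub>" "\<zero>\<^bsub>M\<^esub>"] functionalD(1)[of K M f "\<zero>\<^bsub>M\<^esub>"] by simp

lemma functional_minus:
  assumes "functional K M f" "x \<in> carrier M"
  shows "f (\<ominus>\<^bsub>M\<^esub> x) = \<ominus>\<^bsub>K\<^esub> f x"
proof -
  have "f (\<ominus>\<^bsub>M\<^esub> x) \<oplus>\<^bsub>K\<^esub> f x = \<zero>\<^bsub>K\<^esub>"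
    using functionalD(2)[OF assms(1), of "\<ominus>\<^bsub>M\<^esub> x" x] functional_zero[OF assms(1)] assms(2)
    by (simp add: M.M.l_neg)
  then show ?thesis using functionalD(1)[OF assms(1)] assms(2) by (simp add: K.minus_equality)
qed

lemma functional_kernel_submodule:
  assumes "functional K M f" "submodule H K M"
  shows "submodule {x \<in> H. f x = \<zero>\<^bsub>K\<^esub>} K M"
  using M.submoduleD[OF assms(2)] functionalD[OF assms(1)] functional_zero[OF assms(1)]
  by (intro M.submoduleI) (auto simp: subset_iff)

lemma functional_fcomb:
  assumes "\<forall>f\<in>set fs. functional K M f" "cs \<in> coeffs K fs"
  shows "functional K M (fcomb K cs fs)"
  using assms
proof (induction fs arbitrary: cs)
  case Nil
  then show ?case by (auto simp: functional_def)
next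
  case (Cons f fs)
  then obtain d ds where cs: "cs = d # ds" "d \<in> carrier K" "ds \<in> coeffs K fs" by (auto simp: coeffs_Cons)
  have f: "functional K M f" and g: "functional K M (fcomb K ds fs)" using Cons cs by auto
  note fD = functionalD[OF f] and gD = functionalD[OF g]
  show ?case
    unfolding functional_def cs fcomb.simps
    using fD(1) gD(1) cs(2)
    by (auto simp: fD(2,3) gD(2,3) K.r_distr K.a_ac K.m_ac)
qed

text \<open>Induction on \<open>fs\<close> with the subspace \<open>H\<close> left variable: the
  induction hypothesis is used on the kernel of the first functional, and the discrepancy on
  \<open>H\<close> is a multiple of that functional. No finiteness of the dimension enters.\<close>

lemma functional_in_span:
  assumes "submodule H K M" "\<forall>g\<in>set fs. functional K M g" "functional K M f"
    "\<And>x. \<lbrakk>x \<in> H; \<forall>g\<in>set fs. g x = \<zero>\<^bsub>K\<^esub>\<rbrakk> \<Longrightarrow> f x = \<zero>\<^bsub>K\<^esub>"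
  shows "\<exists>cs\<in>coeffs K fs. \<forall>x\<in>H. f x = fcomb K cs fs x"
  using assms
proof (induction fs arbitrary: H)
  case (Cons g fs)
  let ?H = "{x \<in> H. g x = \<zero>\<^bsub>K\<^esub>}"
  have g: "functional K M g" using Cons.prems by simp
  have "\<exists>cs\<in>coeffs K fs. \<forall>x\<in>?H. f x = fcomb K cs fs x"
    by (rule Cons.IH) (use Cons.prems functional_kernel_submodule[OF g] in auto)
  then obtain cs where cs: "cs \<in> coeffs K fs" "\<And>x. \<lbrakk>x \<in> H; g x = \<zero>\<^bsub>K\<^esub>\<rbrakk> \<Longrightarrow> f x = fcomb K cs fs x"
    by auto
  define h where "h = fcomb K cs fs"
  have h: "functional K M h" unfolding h_def using Cons.prems cs by (intro functional_fcomb) auto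
  note HD = M.submoduleD[OF Cons.prems(1)]
  note fD = functionalD[OF Cons.prems(3)] and gD = functionalD[OF g] and hD = functionalD[OF h]
  show ?case
  proof (cases "\<forall>x\<in>H. g x = \<zero>\<^bsub>K\<^esub>")
    case True
    then have "f x = fcomb K (\<zero>\<^bsub>K\<^esub> # cs) (g # fs) x" if "x \<in> H" for x
      using cs(2)[OF that] that hD(1)[of x] HD(1) by (auto simp: h_def)
    then show ?thesis using cs(1) by (intro bexI[of _ "\<zero>\<^bsub>K\<^esub> # cs"]) auto
  next
    case False
    then obtain z where z: "z \<in> H" "g z \<noteq> \<zero>\<^bsub>K\<^esub>" by auto
    have zc: "z \<in> carrier M" using z HD(1) by auto
    have gz: "inv\<^bsub>K\<^esub> (g z) \<in> carrier K" "inv\<^bsub>K\<^esub> (g z) \<otimes>\<^bsub>K\<^esub> g z = \<one>\<^bsub>K\<^esub>"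
      using division_ring_inv[OF K.division_ring gD(1)[OF zc] z(2)] by auto
    \<comment> \<open>The coefficient forced by evaluation at \<open>z\<close>; every element of
      \<open>H\<close> is a multiple of \<open>z\<close> plus an element of the kernel of
      \<open>g\<close>.\<close>
    define c where "c = (f z \<ominus>\<^bsub>K\<^esub> h z) \<otimes>\<^bsub>K\<^esub> inv\<^bsub>K\<^esub> (g z)"
    have c: "c \<in> carrier K" using gz fD(1)[OF zc] hD(1)[OF zc] by (simp add: c_def)
    have cgz: "c \<otimes>\<^bsub>K\<^esub> g z = f z \<ominus>\<^bsub>K\<^esub> h z"
      using gz fD(1)[OF zc] hD(1)[OF zc] gD(1)[OF zc] by (simp add: c_def K.m_assoc)
    have "f x = fcomb K (c # cs) (g # fs) x" if x: "x \<in> H" for x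
    proof -
      have xc: "x \<in> carrier M" using x HD(1) by auto
      define q where "q = g x \<otimes>\<^bsub>K\<^esub> inv\<^bsub>K\<^esub> (g z)"
      have q: "q \<in> carrier K" using gz gD(1)[OF xc] by (simp add: q_def)
      have qgz: "q \<otimes>\<^bsub>K\<^esub> g z = g x" using gz gD(1)[OF xc] gD(1)[OF zc] by (simp add: q_def K.m_assoc)
      define y where "y = x \<ominus>\<^bsub>M\<^esub> q \<odot>\<^bsub>M\<^esub> z"
      have y: "y \<in> H" using x z q HD(4,6) by (simp add: y_def)
      have xy: "x = y \<oplus>\<^bsub>M\<^esub> q \<odot>\<^bsub>M\<^esub> z"
        using xc zc q by (simp add: y_def a_minus_def M.M.a_assoc M.M.l_neg)
      have yc: "y \<in> carrier M" using y HD(1) by auto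
      have "g x = g y \<oplus>\<^bsub>K\<^esub> g x"
        using gD(2)[OF yc, of "q \<odot>\<^bsub>M\<^esub> z"] gD(3)[OF q zc] xy qgz q zc by simp
      then have "g y = \<zero>\<^bsub>K\<^esub>" using K.add.r_cancel_one'[OF gD(1)[OF xc] gD(1)[OF yc]] by simp
      then have fy: "f y = h y" using cs(2)[OF y] by (simp add: h_def)
      have "f x = h y \<oplus>\<^bsub>K\<^esub> q \<otimes>\<^bsub>K\<^esub> f z"
        using fD(2)[OF yc, of "q \<odot>\<^bsub>M\<^esub> z"] fD(3)[OF q zc] xy q zc fy by simp
      also have "f z = c \<otimes>\<^bsub>K\<^esub> g z \<oplus>\<^bsub>K\<^esub> h z"
        using cgz fD(1)[OF zc] hD(1)[OF zc] by (simp add: a_minus_def K.a_assoc K.l_neg)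
      also have "h y \<oplus>\<^bsub>K\<^esub> q \<otimes>\<^bsub>K\<^esub> (c \<otimes>\<^bsub>K\<^esub> g z \<oplus>\<^bsub>K\<^esub> h z) = c \<otimes>\<^bsub>K\<^esub> (q \<otimes>\<^bsub>K\<^esub> g z) \<oplus>\<^bsub>K\<^esub> (h y \<oplus>\<^bsub>K\<^esub> q \<otimes>\<^bsub>K\<^esub> h z)"
        using c q gD(1)[OF zc] hD(1)[OF zc] hD(1)[OF yc] by (simp add: K.r_distr K.a_ac K.m_ac)
      also have "h y \<oplus>\<^bsub>K\<^esub> q \<otimes>\<^bsub>K\<^esub> h z = h x"
        using hD(2)[OF yc, of "q \<odot>\<^bsub>M\<^esub> z"] hD(3)[OF q zc] xy q zc by simp
      finally show ?thesis by (simp add: qgz h_def)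
    qed
    then show ?thesis using c cs(1) by (intro bexI[of _ "c # cs"]) auto
  qed
qed auto

end

section \<open>The dual of a right module\<close>

definition dual_functionals ::
  "('k, 'p) ring_scheme \<Rightarrow> ('k, 'd) module \<Rightarrow> ('d, 'm, 'q) module_scheme \<Rightarrow> ('m \<Rightarrow> 'k) set" where
  "dual_functionals K D M = {\<mu> \<in> carrier M \<rightarrow>\<^sub>E carrier K.
     (\<forall>v\<in>carrier M. \<forall>w\<in>carrier M. \<mu> (v \<oplus>\<^bsub>M\<^esub> w) = \<mu> v \<oplus>\<^bsub>K\<^esub> \<mu> w)
     \<and> (\<forall>c\<in>carrier K. \<forall>v\<in>carrier M. \<mu> ((c \<odot>\<^bsub>D\<^esub> \<one>\<^bsub>D\<^esub>) \<odot>\<^bsub>M\<^esub> v) = c \<otimes>\<^bsub>K\<^esub> \<mu> v)}"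

text \<open>Since \<open>a \<odot> v\<close> stands for the right action \<open>v a\<close>, the
  formula is a left action of \<open>D\<close>. The field acts through the scalars
  \<open>c 1\<close> of \<open>D\<close>, so \<open>M\<close> carries no separate structure over
  \<open>K\<close>.\<close>

definition dual_module ::
  "('k, 'p) ring_scheme \<Rightarrow> ('k, 'd) module \<Rightarrow> ('d, 'm, 'q) module_scheme \<Rightarrow> ('d, 'm \<Rightarrow> 'k) module" where
  "dual_module K D M = \<lparr>carrier = dual_functionals K D M, mult = undefined, one = undefined,
     zero = (\<lambda>v\<in>carrier M. \<zero>\<^bsub>K\<^esub>), add = (\<lambda>\<mu> \<nu>. \<lambda>v\<in>carrier M. \<mu> v \<oplus>\<^bsub>K\<^esub> \<nu> v),
     smult = (\<lambda>a \<mu>. \<lambda>v\<in>carrier M. \<mu> (a \<odot>\<^bsub>M\<^esub> v))\<rparr>"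

definition HomD ::
  "('k, 'p) ring_scheme \<Rightarrow> ('k, 'd) module \<Rightarrow> ('d, 'm) module \<Rightarrow> ('d, 'm \<Rightarrow> 'd \<Rightarrow> 'k) module" where
  "HomD K D M = \<lparr>carrier = linear_maps (opp D) M (Ddual K D), mult = undefined, one = undefined,
      zero = (\<lambda>v\<in>carrier M. \<zero>\<^bsub>Ddual K D\<^esub>),
      add = (\<lambda>\<phi> \<psi>. \<lambda>v\<in>carrier M. \<phi> v \<oplus>\<^bsub>Ddual K D\<^esub> \<psi> v),
      smult = (\<lambda>a \<phi>. \<lambda>v\<in>carrier M. \<lambda>x\<in>carrier D. \<phi> v (x \<otimes>\<^bsub>D\<^esub> a))\<rparr>"

text \<open>The adjunction isomorphism from \<open>Hom_k(M, k)\<close> to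
  \<open>Hom_D(M, Hom_k(D, k))\<close>; evaluation at the unit of \<open>D\<close> is its inverse.
  Through it, projective points of \<open>HomD\<close> are computed with plain functionals.\<close>

definition adjoint_map :: "('k, 'd) module \<Rightarrow> ('d, 'm) module \<Rightarrow> ('m \<Rightarrow> 'k) \<Rightarrow> 'm \<Rightarrow> 'd \<Rightarrow> 'k" where
  "adjoint_map D M \<mu> = (\<lambda>v\<in>carrier M. \<lambda>d\<in>carrier D. \<mu> (d \<odot>\<^bsub>M\<^esub> v))"

text \<open>The form that sums \<open>\<tau> (d a)\<close> over matching entries. Fixing a nonzero
  \<open>\<tau>\<close> makes it a concrete replacement for an identification of \<open>D\<close>
  with its dual.\<close>

fun pairing :: "('k, 'p) ring_scheme \<Rightarrow> ('k, 'd) module \<Rightarrow> ('d \<Rightarrow> 'k) \<Rightarrow> 'd list \<Rightarrow> 'd list \<Rightarrow> 'k" where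
  "pairing K D \<tau> (d # ds) (a # as) = \<tau> (d \<otimes>\<^bsub>D\<^esub> a) \<oplus>\<^bsub>K\<^esub> pairing K D \<tau> ds as"
| "pairing K D \<tau> _ _ = \<zero>\<^bsub>K\<^esub>"

locale right_vector_space = division_algebra K D + M?: lmodule "opp D" M
  for K :: "('k, 'p) ring_scheme" and D :: "('k, 'd) module" and M :: "('d, 'm) module"
begin

lemma right_space: "left_vector_space (opp D) M"
  by (intro left_vector_space.intro left_vector_space_axioms.intro lmodule_axioms division_ring_opp division)

lemma scalar_one_closed: "c \<in> carrier K \<Longrightarrow> c \<odot>\<^bsub>D\<^esub> \<one>\<^bsub>D\<^esub> \<in> carrier D"
  by (rule module.smult_closed[OF module_axioms]) auto

lemma smult_smult:
  assumes "a \<in> carrier D" "b \<in> carrier D" "v \<in> carrier M"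
  shows "a \<odot>\<^bsub>M\<^esub> (b \<odot>\<^bsub>M\<^esub> v) = (b \<otimes>\<^bsub>D\<^esub> a) \<odot>\<^bsub>M\<^esub> v"
  using M.smult_assoc1[of a b v] assms by simp

lemma scalar_commute:
  assumes "c \<in> carrier K" "d \<in> carrier D"
  shows "(c \<odot>\<^bsub>D\<^esub> \<one>\<^bsub>D\<^esub>) \<otimes>\<^bsub>D\<^esub> d = c \<odot>\<^bsub>D\<^esub> d" "d \<otimes>\<^bsub>D\<^esub> (c \<odot>\<^bsub>D\<^esub> \<one>\<^bsub>D\<^esub>) = c \<odot>\<^bsub>D\<^esub> d"
  using smult_mult_left[OF assms(1), of "\<one>\<^bsub>D\<^esub>" d] smult_mult_right[OF assms(1), of d "\<one>\<^bsub>D\<^esub>"] assms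
  by simp_all

lemma carrier_dual_module [simp]: "carrier (dual_module K D M) = dual_functionals K D M"
  by (simp add: dual_module_def)

lemma dual_functionalsD:
  assumes "\<mu> \<in> dual_functionals K D M"
  shows "v \<in> carrier M \<Longrightarrow> \<mu> v \<in> carrier K"
    "\<lbrakk>v \<in> carrier M; w \<in> carrier M\<rbrakk> \<Longrightarrow> \<mu> (v \<oplus>\<^bsub>M\<^esub> w) = \<mu> v \<oplus>\<^bsub>K\<^esub> \<mu> w"
    "\<lbrakk>c \<in> carrier K; v \<in> carrier M\<rbrakk> \<Longrightarrow> \<mu> ((c \<odot>\<^bsub>D\<^esub> \<one>\<^bsub>D\<^esub>) \<odot>\<^bsub>M\<^esub> v) = c \<otimes>\<^bsub>K\<^esub> \<mu> v"
    "\<mu> \<in> extensional (carrier M)"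
  using assms by (auto simp: dual_functionals_def PiE_def)

lemma dual_functionalsI:
  assumes "\<And>v. v \<in> carrier M \<Longrightarrow> f v \<in> carrier K"
    "\<And>v w. \<lbrakk>v \<in> carrier M; w \<in> carrier M\<rbrakk> \<Longrightarrow> f (v \<oplus>\<^bsub>M\<^esub> w) = f v \<oplus>\<^bsub>K\<^esub> f w"
    "\<And>c v. \<lbrakk>c \<in> carrier K; v \<in> carrier M\<rbrakk> \<Longrightarrow> f ((c \<odot>\<^bsub>D\<^esub> \<one>\<^bsub>D\<^esub>) \<odot>\<^bsub>M\<^esub> v) = c \<otimes>\<^bsub>K\<^esub> f v"
  shows "(\<lambda>v\<in>carrier M. f v) \<in> dual_functionals K D M"
  using assms scalar_one_closed by (auto simp: dual_functionals_def)

lemma dual_eqI: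
  assumes "\<mu> \<in> dual_functionals K D M" "\<nu> \<in> dual_functionals K D M"
    "\<And>v. v \<in> carrier M \<Longrightarrow> \<mu> v = \<nu> v"
  shows "\<mu> = \<nu>"
  using extensionalityI[OF dual_functionalsD(4)[OF assms(1)] dual_functionalsD(4)[OF assms(2)]] assms(3) .

lemma smult_dual_closed:
  assumes "\<mu> \<in> dual_functionals K D M" "a \<in> carrier D"
  shows "(\<lambda>v\<in>carrier M. \<mu> (a \<odot>\<^bsub>M\<^esub> v)) \<in> dual_functionals K D M"
proof (rule dual_functionalsI)
  note \<mu> = dual_functionalsD[OF assms(1)]
  fix v assume v: "v \<in> carrier M"
  then show "\<mu> (a \<odot>\<^bsub>M\<^esub> v) \<in> carrier K" using \<mu>(1) assms by simp
  fix w assume "w \<in> carrier M"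
  then show "\<mu> (a \<odot>\<^bsub>M\<^esub> (v \<oplus>\<^bsub>M\<^esub> w)) = \<mu> (a \<odot>\<^bsub>M\<^esub> v) \<oplus>\<^bsub>K\<^esub> \<mu> (a \<odot>\<^bsub>M\<^esub> w)"
    using \<mu>(2) assms v by (simp add: M.smult_r_distr)
next
  note \<mu> = dual_functionalsD[OF assms(1)]
  fix c v assume c: "c \<in> carrier K" and v: "v \<in> carrier M"
  have "a \<odot>\<^bsub>M\<^esub> ((c \<odot>\<^bsub>D\<^esub> \<one>\<^bsub>D\<^esub>) \<odot>\<^bsub>M\<^esub> v) = (c \<odot>\<^bsub>D\<^esub> \<one>\<^bsub>D\<^esub>) \<odot>\<^bsub>M\<^esub> (a \<odot>\<^bsub>M\<^esub> v)"
    using c v assms scalar_one_closed[OF c] by (simp add: smult_smult scalar_commute)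
  then show "\<mu> (a \<odot>\<^bsub>M\<^esub> ((c \<odot>\<^bsub>D\<^esub> \<one>\<^bsub>D\<^esub>) \<odot>\<^bsub>M\<^esub> v)) = c \<otimes>\<^bsub>K\<^esub> \<mu> (a \<odot>\<^bsub>M\<^esub> v)"
    using \<mu>(3)[OF c] v assms by simp
qed

lemma dual_module_lmodule: "lmodule D (dual_module K D M)"
proof (intro lmodule.intro lmodule_axioms.intro D.ring_axioms abelian_groupI;
    (simp only: dual_module_def module.simps ring.simps monoid.simps partial_object.simps)?)
  fix \<mu> \<nu> assume \<mu>: "\<mu> \<in> dual_functionals K D M" and \<nu>: "\<nu> \<in> dual_functionals K D M"
  note \<mu>D = dual_functionalsD[OF \<mu>] and \<nu>D = dual_functionalsD[OF \<nu>]
  show "(\<lambda>v\<in>carrier M. \<mu> v \<oplus>\<^bsub>K\<^esub> \<nu> v) \<in> dual_functionals K D M"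
    by (rule dual_functionalsI) (auto simp: \<mu>D(1-3) \<nu>D(1-3) K.a_ac K.r_distr)
  show "(\<lambda>v\<in>carrier M. \<mu> v \<oplus>\<^bsub>K\<^esub> \<nu> v) = (\<lambda>v\<in>carrier M. \<nu> v \<oplus>\<^bsub>K\<^esub> \<mu> v)"
    by (rule restrict_ext) (auto simp: \<mu>D(1) \<nu>D(1) K.a_comm)
  fix \<kappa> assume "\<kappa> \<in> dual_functionals K D M"
  note \<kappa>D = dual_functionalsD[OF this]
  show "(\<lambda>v\<in>carrier M. (\<lambda>v\<in>carrier M. \<mu> v \<oplus>\<^bsub>K\<^esub> \<nu> v) v \<oplus>\<^bsub>K\<^esub> \<kappa> v)
      = (\<lambda>v\<in>carrier M. \<mu> v \<oplus>\<^bsub>K\<^esub> (\<lambda>v\<in>carrier M. \<nu> v \<oplus>\<^bsub>K\<^esub> \<kappa> v) v)"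
    by (rule restrict_ext) (auto simp: \<mu>D(1) \<nu>D(1) \<kappa>D(1) K.a_assoc)
next
  show "(\<lambda>v\<in>carrier M. \<zero>\<^bsub>K\<^esub>) \<in> dual_functionals K D M"
    by (rule dual_functionalsI) auto
next
  fix \<mu> assume \<mu>: "\<mu> \<in> dual_functionals K D M"
  note \<mu>D = dual_functionalsD[OF \<mu>]
  show "(\<lambda>v\<in>carrier M. (\<lambda>v\<in>carrier M. \<zero>\<^bsub>K\<^esub>) v \<oplus>\<^bsub>K\<^esub> \<mu> v) = \<mu>"
    using \<mu>D(4) by (intro extensionalityI[of _ "carrier M"]) (auto simp: \<mu>D(1))
  show "(\<lambda>v\<in>carrier M. \<mu> (\<one>\<^bsub>D\<^esub> \<odot>\<^bsub>M\<^esub> v)) = \<mu>"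
    using \<mu>D(4) M.smult_one by (intro extensionalityI[of _ "carrier M"]) auto
  have "(\<lambda>v\<in>carrier M. \<ominus>\<^bsub>K\<^esub> \<mu> v) \<in> dual_functionals K D M"
    by (rule dual_functionalsI) (auto simp: \<mu>D(1-3) K.minus_add K.r_minus)
  moreover have "(\<lambda>v\<in>carrier M. (\<lambda>v\<in>carrier M. \<ominus>\<^bsub>K\<^esub> \<mu> v) v \<oplus>\<^bsub>K\<^esub> \<mu> v) = (\<lambda>v\<in>carrier M. \<zero>\<^bsub>K\<^esub>)"
    by (rule restrict_ext) (auto simp: \<mu>D(1) K.l_neg)
  ultimately show "\<exists>\<nu>\<in>dual_functionals K D M. (\<lambda>v\<in>carrier M. \<nu> v \<oplus>\<^bsub>K\<^esub> \<mu> v) = (\<lambda>v\<in>carrier M. \<zero>\<^bsub>K\<^esub>)"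
    by blast
next
  fix a \<mu> assume a: "a \<in> carrier D" and \<mu>: "\<mu> \<in> dual_functionals K D M"
  note \<mu>D = dual_functionalsD[OF \<mu>]
  show "(\<lambda>v\<in>carrier M. \<mu> (a \<odot>\<^bsub>M\<^esub> v)) \<in> dual_functionals K D M"
    by (rule smult_dual_closed[OF \<mu> a])
  {
    fix b assume b: "b \<in> carrier D"
    show "(\<lambda>v\<in>carrier M. \<mu> ((a \<oplus>\<^bsub>D\<^esub> b) \<odot>\<^bsub>M\<^esub> v))
      = (\<lambda>v\<in>carrier M. (\<lambda>v\<in>carrier M. \<mu> (a \<odot>\<^bsub>M\<^esub> v)) v \<oplus>\<^bsub>K\<^esub> (\<lambda>v\<in>carrier M. \<mu> (b \<odot>\<^bsub>M\<^esub> v)) v)"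
      using M.smult_l_distr a b by (intro restrict_ext) (simp add: \<mu>D(2))
    show "(\<lambda>v\<in>carrier M. \<mu> ((a \<otimes>\<^bsub>D\<^esub> b) \<odot>\<^bsub>M\<^esub> v))
      = (\<lambda>v\<in>carrier M. (\<lambda>v\<in>carrier M. \<mu> (b \<odot>\<^bsub>M\<^esub> v)) (a \<odot>\<^bsub>M\<^esub> v))"
      using a b by (intro restrict_ext) (simp add: smult_smult)
  }
  fix \<nu> assume \<nu>: "\<nu> \<in> dual_functionals K D M"
  show "(\<lambda>v\<in>carrier M. (\<lambda>v\<in>carrier M. \<mu> v \<oplus>\<^bsub>K\<^esub> \<nu> v) (a \<odot>\<^bsub>M\<^esub> v))
      = (\<lambda>v\<in>carrier M. (\<lambda>v\<in>carrier M. \<mu> (a \<odot>\<^bsub>M\<^esub> v)) v \<oplus>\<^bsub>K\<^esub> (\<lambda>v\<in>carrier M. \<nu> (a \<odot>\<^bsub>M\<^esub> v)) v)"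
    using a by (intro restrict_ext) simp
qed

lemma adjoint_map_mem:
  assumes "\<mu> \<in> dual_functionals K D M"
  shows "adjoint_map D M \<mu> \<in> carrier (HomD K D M)"
proof -
  note \<mu> = dual_functionalsD[OF assms]
  have e: "(\<lambda>d\<in>carrier D. \<mu> (d \<odot>\<^bsub>M\<^esub> v)) \<in> linear_maps K D (regular K)" if v: "v \<in> carrier M" for v
  proof -
    have "\<mu> ((c \<odot>\<^bsub>D\<^esub> d) \<odot>\<^bsub>M\<^esub> v) = c \<otimes>\<^bsub>K\<^esub> \<mu> (d \<odot>\<^bsub>M\<^esub> v)" if "c \<in> carrier K" "d \<in> carrier D" for c d
      using \<mu>(3)[OF that(1), of "d \<odot>\<^bsub>M\<^esub> v"] that v scalar_one_closed[OF that(1)]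
      by (simp add: smult_smult scalar_commute)
    then show ?thesis
      using v \<mu>(1,2) M.smult_l_distr module.smult_closed[OF module_axioms]
      by (auto simp: linear_maps_def regular_def)
  qed
  have "(\<lambda>d\<in>carrier D. \<mu> (d \<odot>\<^bsub>M\<^esub> (v \<oplus>\<^bsub>M\<^esub> w)))
      = (\<lambda>d\<in>carrier D. (\<lambda>d\<in>carrier D. \<mu> (d \<odot>\<^bsub>M\<^esub> v)) d \<oplus>\<^bsub>K\<^esub> (\<lambda>d\<in>carrier D. \<mu> (d \<odot>\<^bsub>M\<^esub> w)) d)"
    if "v \<in> carrier M" "w \<in> carrier M" for v w
    using that \<mu>(2) by (intro restrict_ext) (simp add: M.smult_r_distr)
  moreover have "(\<lambda>d\<in>carrier D. \<mu> (d \<odot>\<^bsub>M\<^esub> (a \<odot>\<^bsub>M\<^esub> v)))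
      = (\<lambda>x\<in>carrier D. (\<lambda>d\<in>carrier D. \<mu> (d \<odot>\<^bsub>M\<^esub> v)) (a \<otimes>\<^bsub>D\<^esub> x))"
    if "v \<in> carrier M" "a \<in> carrier D" for v a
    using that by (intro restrict_ext) (simp add: smult_smult)
  ultimately show ?thesis
    using e by (auto simp: HomD_def linear_maps_def[of "opp D"] adjoint_map_def Ddual_def)
qed

lemma HomD_memD:
  assumes "\<phi> \<in> carrier (HomD K D M)"
  shows "\<phi> \<in> extensional (carrier M)"
    "v \<in> carrier M \<Longrightarrow> \<phi> v \<in> linear_maps K D (regular K)"
    "\<lbrakk>v \<in> carrier M; w \<in> carrier M\<rbrakk> \<Longrightarrow> \<phi> (v \<oplus>\<^bsub>M\<^esub> w) = (\<lambda>x\<in>carrier D. \<phi> v x \<oplus>\<^bsub>K\<^esub> \<phi> w x)"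
    "\<lbrakk>a \<in> carrier D; v \<in> carrier M\<rbrakk> \<Longrightarrow> \<phi> (a \<odot>\<^bsub>M\<^esub> v) = (\<lambda>x\<in>carrier D. \<phi> v (a \<otimes>\<^bsub>D\<^esub> x))"
  using assms by (auto simp: HomD_def linear_maps_def[of "opp D"] Ddual_def PiE_def)

lemma adjoint_map_bij:
  "bij_betw (adjoint_map D M) (dual_functionals K D M) (carrier (HomD K D M))"
proof (rule bij_betw_byWitness[where f' = "\<lambda>\<phi>. \<lambda>v\<in>carrier M. \<phi> v \<one>\<^bsub>D\<^esub>"])
  show "\<forall>\<mu>\<in>dual_functionals K D M. (\<lambda>v\<in>carrier M. adjoint_map D M \<mu> v \<one>\<^bsub>D\<^esub>) = \<mu>"
    using dual_functionalsD(4) M.smult_one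
    by (auto simp: adjoint_map_def intro!: extensionalityI[of _ "carrier M"])
  show ran: "(\<lambda>\<phi>. \<lambda>v\<in>carrier M. \<phi> v \<one>\<^bsub>D\<^esub>) ` carrier (HomD K D M) \<subseteq> dual_functionals K D M"
  proof (clarify, rule dual_functionalsI)
    fix \<phi> assume "\<phi> \<in> carrier (HomD K D M)"
    note \<phi> = HomD_memD[OF this]
    {
      fix v w assume "v \<in> carrier M" "w \<in> carrier M"
      then show "\<phi> (v \<oplus>\<^bsub>M\<^esub> w) \<one>\<^bsub>D\<^esub> = \<phi> v \<one>\<^bsub>D\<^esub> \<oplus>\<^bsub>K\<^esub> \<phi> w \<one>\<^bsub>D\<^esub>" using \<phi>(3) by simp
    }
    fix v assume v: "v \<in> carrier M"
    note \<phi>v = \<phi>(2)[OF v]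
    show "\<phi> v \<one>\<^bsub>D\<^esub> \<in> carrier K" using \<phi>v by (auto simp: linear_maps_def regular_def)
    fix c assume c: "c \<in> carrier K"
    have "\<phi> ((c \<odot>\<^bsub>D\<^esub> \<one>\<^bsub>D\<^esub>) \<odot>\<^bsub>M\<^esub> v) \<one>\<^bsub>D\<^esub> = \<phi> v (c \<odot>\<^bsub>D\<^esub> \<one>\<^bsub>D\<^esub>)"
      using \<phi>(4)[OF scalar_one_closed[OF c] v] scalar_one_closed[OF c] by simp
    also have "\<dots> = c \<otimes>\<^bsub>K\<^esub> \<phi> v \<one>\<^bsub>D\<^esub>" using \<phi>v c by (auto simp: linear_maps_def regular_def)
    finally show "\<phi> ((c \<odot>\<^bsub>D\<^esub> \<one>\<^bsub>D\<^esub>) \<odot>\<^bsub>M\<^esub> v) \<one>\<^bsub>D\<^esub> = c \<otimes>\<^bsub>K\<^esub> \<phi> v \<one>\<^bsub>D\<^esub>" .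
  qed
  show "\<forall>\<phi>\<in>carrier (HomD K D M). adjoint_map D M (\<lambda>v\<in>carrier M. \<phi> v \<one>\<^bsub>D\<^esub>) = \<phi>"
  proof
    fix \<phi> assume "\<phi> \<in> carrier (HomD K D M)"
    note \<phi> = HomD_memD[OF this]
    have "(\<lambda>d\<in>carrier D. (\<lambda>v\<in>carrier M. \<phi> v \<one>\<^bsub>D\<^esub>) (d \<odot>\<^bsub>M\<^esub> v)) = \<phi> v" if v: "v \<in> carrier M" for v
    proof (rule extensionalityI[of _ "carrier D"])
      show "\<phi> v \<in> extensional (carrier D)" using \<phi>(2)[OF v] by (auto simp: linear_maps_def PiE_def)
    qed (use \<phi>(4)[OF _ v] v in auto)
    then show "adjoint_map D M (\<lambda>v\<in>carrier M. \<phi> v \<one>\<^bsub>D\<^esub>) = \<phi>"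
      unfolding adjoint_map_def using \<phi>(1) by (intro extensionalityI[of _ "carrier M"]) auto
  qed
  show "adjoint_map D M ` dual_functionals K D M \<subseteq> carrier (HomD K D M)"
    using adjoint_map_mem by auto
qed

lemma adjoint_map_hom:
  "adjoint_map D M \<zero>\<^bsub>dual_module K D M\<^esub> = \<zero>\<^bsub>HomD K D M\<^esub>"
  "\<lbrakk>\<mu> \<in> dual_functionals K D M; \<nu> \<in> dual_functionals K D M\<rbrakk> \<Longrightarrow>
    adjoint_map D M (\<mu> \<oplus>\<^bsub>dual_module K D M\<^esub> \<nu>) = adjoint_map D M \<mu> \<oplus>\<^bsub>HomD K D M\<^esub> adjoint_map D M \<nu>"
  "\<lbrakk>a \<in> carrier D; \<mu> \<in> dual_functionals K D M\<rbrakk> \<Longrightarrow>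
    adjoint_map D M (a \<odot>\<^bsub>dual_module K D M\<^esub> \<mu>) = a \<odot>\<^bsub>HomD K D M\<^esub> adjoint_map D M \<mu>"
  by (auto simp: adjoint_map_def dual_module_def HomD_def Ddual_def smult_smult
      intro!: restrict_ext)

lemma HomD_left_vector_space: "left_vector_space D (HomD K D M)"
  by (intro left_vector_space.intro left_vector_space_axioms.intro division
      lmodule_transfer[OF dual_module_lmodule, of "adjoint_map D M"])
    (simp_all add: adjoint_map_hom adjoint_map_bij)

lemma adjoint_map_eq_zero_iff:
  assumes "\<mu> \<in> dual_functionals K D M"
  shows "adjoint_map D M \<mu> = \<zero>\<^bsub>HomD K D M\<^esub> \<longleftrightarrow> (\<forall>v\<in>carrier M. \<mu> v = \<zero>\<^bsub>K\<^esub>)"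
proof -
  have z: "\<zero>\<^bsub>dual_module K D M\<^esub> \<in> dual_functionals K D M"
    by (auto simp: dual_module_def intro!: dual_functionalsI)
  have "adjoint_map D M \<mu> = \<zero>\<^bsub>HomD K D M\<^esub> \<longleftrightarrow> \<mu> = \<zero>\<^bsub>dual_module K D M\<^esub>"
    using inj_onD[OF bij_betw_imp_inj_on[OF adjoint_map_bij] _ assms z] adjoint_map_hom(1) by auto
  also have "\<dots> \<longleftrightarrow> (\<forall>v\<in>carrier M. \<mu> v = \<zero>\<^bsub>K\<^esub>)"
    using dual_eqI[OF assms z] by (auto simp: dual_module_def)
  finally show ?thesis .
qed

text \<open>Brings equality of projective points into the form in which isomorphisms between the
  quotients of \<open>P_i\<close> appear, see \<open>Mquot_iso_iff\<close>.\<close>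

lemma cyclic_sub_adjoint_eq_iff:
  assumes "\<mu> \<in> dual_functionals K D M" "\<nu> \<in> dual_functionals K D M"
    "\<exists>v\<in>carrier M. \<mu> v \<noteq> \<zero>\<^bsub>K\<^esub>" "\<exists>v\<in>carrier M. \<nu> v \<noteq> \<zero>\<^bsub>K\<^esub>"
  shows "cyclic_sub D (HomD K D M) (adjoint_map D M \<mu>) = cyclic_sub D (HomD K D M) (adjoint_map D M \<nu>)
    \<longleftrightarrow> (\<exists>a\<in>carrier D. a \<noteq> \<zero>\<^bsub>D\<^esub> \<and> (\<forall>v\<in>carrier M. \<mu> v = \<nu> (a \<odot>\<^bsub>M\<^esub> v)))"
proof -
  interpret H: left_vector_space D "HomD K D M" by (rule HomD_left_vector_space)
  have c: "adjoint_map D M \<mu> \<in> carrier (HomD K D M)" "adjoint_map D M \<nu> \<in> carrier (HomD K D M)"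
    using adjoint_map_mem assms by auto
  have n: "adjoint_map D M \<mu> \<noteq> \<zero>\<^bsub>HomD K D M\<^esub>" using adjoint_map_eq_zero_iff assms by auto
  have "cyclic_sub D (HomD K D M) (adjoint_map D M \<mu>) = cyclic_sub D (HomD K D M) (adjoint_map D M \<nu>)
    \<longleftrightarrow> (\<exists>a\<in>carrier D. a \<noteq> \<zero>\<^bsub>D\<^esub> \<and> adjoint_map D M \<mu> = a \<odot>\<^bsub>HomD K D M\<^esub> adjoint_map D M \<nu>)"
    using H.cyclic_sub_eqD[OF c(1) n c(2)] H.cyclic_sub_smult[OF _ _ c(2)] by auto
  also have "\<dots> \<longleftrightarrow> (\<exists>a\<in>carrier D. a \<noteq> \<zero>\<^bsub>D\<^esub> \<and> (\<forall>v\<in>carrier M. \<mu> v = \<nu> (a \<odot>\<^bsub>M\<^esub> v)))"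
  proof (intro bex_cong refl conj_cong)
    fix a assume a: "a \<in> carrier D"
    have m: "a \<odot>\<^bsub>dual_module K D M\<^esub> \<nu> \<in> dual_functionals K D M"
      using smult_dual_closed[OF assms(2) a] by (simp add: dual_module_def)
    have "adjoint_map D M \<mu> = a \<odot>\<^bsub>HomD K D M\<^esub> adjoint_map D M \<nu> \<longleftrightarrow> \<mu> = a \<odot>\<^bsub>dual_module K D M\<^esub> \<nu>"
      using inj_onD[OF bij_betw_imp_inj_on[OF adjoint_map_bij] _ assms(1) m]
        adjoint_map_hom(3)[OF a assms(2)] by auto
    also have "\<dots> \<longleftrightarrow> (\<forall>v\<in>carrier M. \<mu> v = \<nu> (a \<odot>\<^bsub>M\<^esub> v))"
      using dual_eqI[OF assms(1) m] by (auto simp: dual_module_def)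
    finally show "adjoint_map D M \<mu> = a \<odot>\<^bsub>HomD K D M\<^esub> adjoint_map D M \<nu>
      \<longleftrightarrow> (\<forall>v\<in>carrier M. \<mu> v = \<nu> (a \<odot>\<^bsub>M\<^esub> v))" .
  qed
  finally show ?thesis .
qed

end

section \<open>Nonzero functionals on a division algebra are nondegenerate\<close>

context division_algebra
begin

lemma lmodule_KD: "lmodule K D"
  by (rule module_lmodule) (rule module_axioms)

lemma left_space_KD: "left_vector_space K D"
  by (intro left_vector_space.intro left_vector_space_axioms.intro lmodule_KD K.division_ring)

text \<open>The first coordinate with respect to a basis over the field.\<close>

lemma ex_nonzero_functional: "\<exists>\<tau>. functional K D \<tau> \<and> (\<exists>x\<in>carrier D. \<tau> x \<noteq> \<zero>\<^bsub>K\<^esub>)"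
proof -
  interpret V: left_vector_space K D by (rule left_space_KD)
  obtain bs where bs: "list_basis K D bs" using finite_dim by auto
  have "bs \<noteq> []"
    using bs division_ring_one_neq_zero[OF division] D.one_closed by (auto simp: list_basis_def)
  then obtain b bs' where bs': "bs = b # bs'" by (cases bs) auto
  obtain co where co: "\<And>v. v \<in> carrier D \<Longrightarrow> co v \<in> coeffs K bs"
    "\<And>cs. cs \<in> coeffs K bs \<Longrightarrow> co (lincomb D cs bs) = cs"
    "\<And>v w. \<lbrakk>v \<in> carrier D; w \<in> carrier D\<rbrakk> \<Longrightarrow> co (v \<oplus>\<^bsub>D\<^esub> w) = map2 (\<oplus>\<^bsub>K\<^esub>) (co v) (co w)"
    "\<And>a v. \<lbrakk>a \<in> carrier K; v \<in> carrier D\<rbrakk> \<Longrightarrow> co (a \<odot>\<^bsub>D\<^esub> v) = map ((\<otimes>\<^bsub>K\<^esub>) a) (co v)"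
    by (rule V.ex_coords[OF bs]) blast
  have ne: "\<exists>c cs. co v = c # cs \<and> c \<in> carrier K" if "v \<in> carrier D" for v
    using co(1)[OF that] by (auto simp: bs' coeffs_Cons)
  have "functional K D (\<lambda>v. hd (co v))"
    unfolding functional_def
  proof (intro conjI ballI)
    show "hd (co v) \<in> carrier K" if "v \<in> carrier D" for v using ne[OF that] by auto
    show "hd (co (v \<oplus>\<^bsub>D\<^esub> w)) = hd (co v) \<oplus>\<^bsub>K\<^esub> hd (co w)" if "v \<in> carrier D" "w \<in> carrier D" for v w
      using ne[OF that(1)] ne[OF that(2)] co(3)[OF that] by auto
    show "hd (co (a \<odot>\<^bsub>D\<^esub> v)) = a \<otimes>\<^bsub>K\<^esub> hd (co v)" if "a \<in> carrier K" "v \<in> carrier D" for a v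
      using ne[OF that(2)] co(4)[OF that] by auto
  qed
  moreover have "hd (co b) = \<one>\<^bsub>K\<^esub>"
  proof -
    let ?cs = "\<one>\<^bsub>K\<^esub> # map (\<lambda>_. \<zero>\<^bsub>K\<^esub>) bs'"
    have cl: "b \<in> carrier D" "set bs' \<subseteq> carrier D" using bs bs' by (auto simp: list_basis_def)
    have "lincomb D (map (\<lambda>_. \<zero>\<^bsub>K\<^esub>) ys) ys = \<zero>\<^bsub>D\<^esub>" if "set ys \<subseteq> carrier D" for ys
      using that by (induction ys) auto
    then have "lincomb D ?cs bs = b" using cl by (simp add: bs')
    moreover have "?cs \<in> coeffs K bs" by (auto simp: coeffs_def bs')
    ultimately show ?thesis using co(2)[of ?cs] by simp
  qed
  moreover have "b \<in> carrier D" using bs bs' by (auto simp: list_basis_def)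
  ultimately show ?thesis by (metis K.one_not_zero)
qed

lemma functional_mult:
  assumes "functional K D \<tau>" "a \<in> carrier D"
  shows "functional K D (\<lambda>x. \<tau> (x \<otimes>\<^bsub>D\<^esub> a))" "functional K D (\<lambda>x. \<tau> (a \<otimes>\<^bsub>D\<^esub> x))"
  using functionalD[OF assms(1)] assms(2) module.smult_closed[OF module_axioms]
  by (auto simp: functional_def smult_mult_left smult_mult_right D.l_distr D.r_distr)

text \<open>For nonzero \<open>a\<close> the value \<open>\<tau> x0\<close> is attained on
  \<open>(x0 a^-1) a\<close> and on \<open>a (a^-1 x0)\<close>.\<close>

lemma functional_nondegenerate:
  assumes "functional K D \<tau>" "x0 \<in> carrier D" "\<tau> x0 \<noteq> \<zero>\<^bsub>K\<^esub>" "a \<in> carrier D"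
  shows "(\<And>x. x \<in> carrier D \<Longrightarrow> \<tau> (x \<otimes>\<^bsub>D\<^esub> a) = \<zero>\<^bsub>K\<^esub>) \<Longrightarrow> a = \<zero>\<^bsub>D\<^esub>"
    "(\<And>x. x \<in> carrier D \<Longrightarrow> \<tau> (a \<otimes>\<^bsub>D\<^esub> x) = \<zero>\<^bsub>K\<^esub>) \<Longrightarrow> a = \<zero>\<^bsub>D\<^esub>"
proof -
  have "\<tau> ((x0 \<otimes>\<^bsub>D\<^esub> inv\<^bsub>D\<^esub> a) \<otimes>\<^bsub>D\<^esub> a) \<noteq> \<zero>\<^bsub>K\<^esub>" "\<tau> (a \<otimes>\<^bsub>D\<^esub> (inv\<^bsub>D\<^esub> a \<otimes>\<^bsub>D\<^esub> x0)) \<noteq> \<zero>\<^bsub>K\<^esub>"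
    "inv\<^bsub>D\<^esub> a \<in> carrier D" if "a \<noteq> \<zero>\<^bsub>D\<^esub>"
    using division_ring_inv[OF division assms(4) that] assms
    by (simp_all add: D.m_assoc) (simp flip: D.m_assoc)
  then show "(\<And>x. x \<in> carrier D \<Longrightarrow> \<tau> (x \<otimes>\<^bsub>D\<^esub> a) = \<zero>\<^bsub>K\<^esub>) \<Longrightarrow> a = \<zero>\<^bsub>D\<^esub>"
    "(\<And>x. x \<in> carrier D \<Longrightarrow> \<tau> (a \<otimes>\<^bsub>D\<^esub> x) = \<zero>\<^bsub>K\<^esub>) \<Longrightarrow> a = \<zero>\<^bsub>D\<^esub>"
    using assms(2) D.m_closed by metis+
qed

text \<open>The functionals \<open>x \<mapsto> \<tau> (x b)\<close>, with \<open>b\<close> running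
  through a basis, have trivial common kernel by nondegeneracy. So \<open>\<eta>\<close> is a
  combination of them, and the coefficients are collected into one element \<open>a\<close>.\<close>

lemma functional_repr:
  assumes \<tau>: "functional K D \<tau>" "x0 \<in> carrier D" "\<tau> x0 \<noteq> \<zero>\<^bsub>K\<^esub>" and \<eta>: "functional K D \<eta>"
  shows "\<exists>a\<in>carrier D. \<forall>x\<in>carrier D. \<eta> x = \<tau> (x \<otimes>\<^bsub>D\<^esub> a)"
proof -
  interpret V: left_vector_space K D by (rule left_space_KD)
  obtain bs where bs: "list_basis K D bs" using finite_dim by auto
  have bsc: "set bs \<subseteq> carrier D" using bs by (simp add: list_basis_def)
  have top: "submodule (carrier D) K D" by (intro V.submoduleI) auto
  define fs where "fs = map (\<lambda>b x. \<tau> (x \<otimes>\<^bsub>D\<^esub> b)) bs"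
  have "\<exists>cs\<in>coeffs K fs. \<forall>x\<in>carrier D. \<eta> x = fcomb K cs fs x"
  proof (rule functional_in_span[OF K.field_axioms lmodule_KD top _ \<eta>])
    show "\<forall>g\<in>set fs. functional K D g" using functional_mult(1)[OF \<tau>(1)] bsc by (auto simp: fs_def)
    fix x assume x: "x \<in> carrier D" "\<forall>g\<in>set fs. g x = \<zero>\<^bsub>K\<^esub>"
    have "submodule {y \<in> carrier D. \<tau> (x \<otimes>\<^bsub>D\<^esub> y) = \<zero>\<^bsub>K\<^esub>} K D"
      by (rule functional_kernel_submodule[OF K.field_axioms lmodule_KD functional_mult(2)[OF \<tau>(1) x(1)] top])
    then have "lspan K D bs \<subseteq> {y \<in> carrier D. \<tau> (x \<otimes>\<^bsub>D\<^esub> y) = \<zero>\<^bsub>K\<^esub>}"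
      by (rule V.lspan_least) (use x(2) bsc in \<open>auto simp: fs_def\<close>)
    then have "x = \<zero>\<^bsub>D\<^esub>"
      using functional_nondegenerate(2)[OF \<tau> x(1)] bs by (auto simp: list_basis_def)
    then show "\<eta> x = \<zero>\<^bsub>K\<^esub>" using functional_zero[OF K.field_axioms lmodule_KD \<eta>] by simp
  qed
  then obtain cs where cs: "cs \<in> coeffs K fs" "\<And>x. x \<in> carrier D \<Longrightarrow> \<eta> x = fcomb K cs fs x" by auto
  have cs': "cs \<in> coeffs K bs" using cs(1) by (simp add: coeffs_def fs_def)
  have "fcomb K cs (map (\<lambda>b x. \<tau> (x \<otimes>\<^bsub>D\<^esub> b)) bs) x = \<tau> (x \<otimes>\<^bsub>D\<^esub> lincomb D cs bs)"
    if "x \<in> carrier D" "cs \<in> coeffs K bs" "set bs \<subseteq> carrier D" for x cs bs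
    using that(2,3)
  proof (induction bs arbitrary: cs)
    case Nil
    then show ?case using functional_zero[OF K.field_axioms lmodule_KD \<tau>(1)] that(1) by simp
  next
    case (Cons b bs)
    then obtain d ds where ds: "cs = d # ds" "d \<in> carrier K" "ds \<in> coeffs K bs" by (auto simp: coeffs_Cons)
    then show ?case
      using Cons that(1) functionalD(2,3)[OF \<tau>(1)] by (simp add: D.r_distr smult_mult_right)
  qed
  then have "\<eta> x = \<tau> (x \<otimes>\<^bsub>D\<^esub> lincomb D cs bs)" if "x \<in> carrier D" for x
    using cs(2)[OF that] that cs' bsc by (simp add: fs_def)
  then show ?thesis using V.lincomb_closed[OF bsc cs'] by auto
qed

lemma pairing_closed:
  assumes "functional K D \<tau>" "ds \<in> coeffs D xs" "as \<in> coeffs D xs"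
  shows "pairing K D \<tau> ds as \<in> carrier K"
  using assms(2,3)
proof (induction xs arbitrary: ds as)
  case (Cons x xs)
  then show ?case using functionalD(1)[OF assms(1)] by (auto simp: coeffs_Cons)
qed auto

lemma pairing_zero:
  assumes "functional K D \<tau>" "as \<in> coeffs D xs"
  shows "pairing K D \<tau> (map (\<lambda>_. \<zero>\<^bsub>D\<^esub>) xs) as = \<zero>\<^bsub>K\<^esub>"
  using assms(2) functional_zero[OF K.field_axioms lmodule_KD assms(1)]
  by (induction xs arbitrary: as) (auto simp: coeffs_Cons)

lemma pairing_add:
  assumes \<tau>: "functional K D \<tau>" and "ds \<in> coeffs D xs" "ds' \<in> coeffs D xs" "as \<in> coeffs D xs"
  shows "pairing K D \<tau> (map2 (\<oplus>\<^bsub>D\<^esub>) ds ds') as = pairing K D \<tau> ds as \<oplus>\<^bsub>K\<^esub> pairing K D \<tau> ds' as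
    \<and> pairing K D \<tau> as (map2 (\<oplus>\<^bsub>D\<^esub>) ds ds') = pairing K D \<tau> as ds \<oplus>\<^bsub>K\<^esub> pairing K D \<tau> as ds'"
  using assms(2-)
proof (induction xs arbitrary: ds ds' as)
  case (Cons x xs)
  obtain d s d' s' a r where eq: "ds = d # s" "ds' = d' # s'" "as = a # r"
    using Cons.prems by (auto simp: coeffs_Cons)
  have cl: "d \<in> carrier D" "d' \<in> carrier D" "a \<in> carrier D" "s \<in> coeffs D xs" "s' \<in> coeffs D xs" "r \<in> coeffs D xs"
    using Cons.prems eq by auto
  note pc = pairing_closed[OF \<tau>]
  show ?case
    using cl Cons.IH[OF cl(4,5,6)] functionalD(1,2)[OF \<tau>] pc[OF cl(4,6)] pc[OF cl(5,6)]
      pc[OF cl(6,4)] pc[OF cl(6,5)]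
    by (simp add: eq D.l_distr D.r_distr K.a_ac)
qed auto

lemma pairing_smult:
  assumes \<tau>: "functional K D \<tau>" and "ds \<in> coeffs D xs" "as \<in> coeffs D xs"
  shows "a \<in> carrier D \<Longrightarrow> pairing K D \<tau> ds (map ((\<otimes>\<^bsub>D\<^esub>) a) as) = pairing K D \<tau> (map (\<lambda>d. d \<otimes>\<^bsub>D\<^esub> a) ds) as"
    "c \<in> carrier K \<Longrightarrow> pairing K D \<tau> (map (\<lambda>d. d \<otimes>\<^bsub>D\<^esub> (c \<odot>\<^bsub>D\<^esub> \<one>\<^bsub>D\<^esub>)) ds) as = c \<otimes>\<^bsub>K\<^esub> pairing K D \<tau> ds as"
proof -
  have 1: "pairing K D \<tau> ds (map ((\<otimes>\<^bsub>D\<^esub>) a) as) = pairing K D \<tau> (map (\<lambda>d. d \<otimes>\<^bsub>D\<^esub> a) ds) as"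
    if "a \<in> carrier D" "ds \<in> coeffs D xs" "as \<in> coeffs D xs" for a ds as xs
    using that(2,3)
  proof (induction xs arbitrary: ds as)
    case (Cons x xs)
    then show ?case using that(1) by (auto simp: coeffs_Cons D.m_assoc)
  qed auto
  show "a \<in> carrier D \<Longrightarrow> pairing K D \<tau> ds (map ((\<otimes>\<^bsub>D\<^esub>) a) as) = pairing K D \<tau> (map (\<lambda>d. d \<otimes>\<^bsub>D\<^esub> a) ds) as"
    using 1 assms(2,3) by blast
  have 2: "pairing K D \<tau> (map (\<lambda>d. d \<otimes>\<^bsub>D\<^esub> (c \<odot>\<^bsub>D\<^esub> \<one>\<^bsub>D\<^esub>)) ds) as = c \<otimes>\<^bsub>K\<^esub> pairing K D \<tau> ds as"
    if c: "c \<in> carrier K" and "ds \<in> coeffs D xs" "as \<in> coeffs D xs" for c ds as xs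
    using that(2,3)
  proof (induction xs arbitrary: ds as)
    case (Cons x xs)
    obtain d s a r where eq: "ds = d # s" "as = a # r"
      using Cons.prems by (auto simp: coeffs_Cons)
    have cl: "d \<in> carrier D" "a \<in> carrier D" "s \<in> coeffs D xs" "r \<in> coeffs D xs"
      using Cons.prems eq by auto
    have "d \<otimes>\<^bsub>D\<^esub> (c \<odot>\<^bsub>D\<^esub> \<one>\<^bsub>D\<^esub>) \<otimes>\<^bsub>D\<^esub> a = c \<odot>\<^bsub>D\<^esub> (d \<otimes>\<^bsub>D\<^esub> a)"
      using smult_mult_right[OF c cl(1), of "\<one>\<^bsub>D\<^esub>"] smult_mult_left[OF c cl(1,2)] cl by simp
    then show ?case
      using cl Cons.IH[OF cl(3,4)] functionalD(1,3)[OF \<tau>] pairing_closed[OF \<tau> cl(3,4)] c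
      by (simp add: eq K.r_distr)
  qed (use c in auto)
  show "c \<in> carrier K \<Longrightarrow> pairing K D \<tau> (map (\<lambda>d. d \<otimes>\<^bsub>D\<^esub> (c \<odot>\<^bsub>D\<^esub> \<one>\<^bsub>D\<^esub>)) ds) as = c \<otimes>\<^bsub>K\<^esub> pairing K D \<tau> ds as"
    using 2 assms(2,3) by blast
qed

text \<open>Test lists beginning with zero separate the tails; test lists vanishing after the head
  separate the heads, by nondegeneracy of \<open>\<tau>\<close>.\<close>

lemma pairing_nondegenerate:
  assumes \<tau>: "functional K D \<tau>" "x0 \<in> carrier D" "\<tau> x0 \<noteq> \<zero>\<^bsub>K\<^esub>"
    and "as \<in> coeffs D xs" "as' \<in> coeffs D xs"
    "\<And>ds. ds \<in> coeffs D xs \<Longrightarrow> pairing K D \<tau> ds as = pairing K D \<tau> ds as'"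
  shows "as = as'"
  using assms(4-)
proof (induction xs arbitrary: as as')
  case (Cons x xs)
  obtain a r a' r' where eq: "as = a # r" "as' = a' # r'"
    using Cons.prems by (auto simp: coeffs_Cons)
  have cl: "a \<in> carrier D" "a' \<in> carrier D" "r \<in> coeffs D xs" "r' \<in> coeffs D xs"
    using Cons.prems eq by auto
  have \<tau>0: "\<tau> \<zero>\<^bsub>D\<^esub> = \<zero>\<^bsub>K\<^esub>" using functional_zero[OF K.field_axioms lmodule_KD \<tau>(1)] .
  note \<tau>D = functionalD[OF \<tau>(1)]
  have "r = r'"
  proof (rule Cons.IH[OF cl(3,4)])
    fix ds assume ds: "ds \<in> coeffs D xs"
    show "pairing K D \<tau> ds r = pairing K D \<tau> ds r'"
      using Cons.prems(3)[of "\<zero>\<^bsub>D\<^esub> # ds"] ds cl \<tau>0 pairing_closed[OF \<tau>(1) ds cl(3)]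
        pairing_closed[OF \<tau>(1) ds cl(4)] by (simp add: eq)
  qed
  moreover have "a \<ominus>\<^bsub>D\<^esub> a' = \<zero>\<^bsub>D\<^esub>"
  proof (rule functional_nondegenerate(1)[OF \<tau>])
    fix d assume d: "d \<in> carrier D"
    note z = pairing_zero[OF \<tau>(1) cl(3)] pairing_zero[OF \<tau>(1) cl(4)]
    have "map (\<lambda>_. \<zero>\<^bsub>D\<^esub>) xs \<in> coeffs D xs" by (auto simp: coeffs_def)
    then have "\<tau> (d \<otimes>\<^bsub>D\<^esub> a) = \<tau> (d \<otimes>\<^bsub>D\<^esub> a')"
      using z Cons.prems(3)[of "d # map (\<lambda>_. \<zero>\<^bsub>D\<^esub>) xs"] d cl \<tau>D(1) by (simp add: eq)
    moreover have "\<tau> (d \<otimes>\<^bsub>D\<^esub> (a \<ominus>\<^bsub>D\<^esub> a')) = \<tau> (d \<otimes>\<^bsub>D\<^esub> a) \<ominus>\<^bsub>K\<^esub> \<tau> (d \<otimes>\<^bsub>D\<^esub> a')"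
      using d cl \<tau>D(1,2) functional_minus[OF K.field_axioms lmodule_KD \<tau>(1)]
      by (simp add: a_minus_def D.r_distr D.r_minus)
    ultimately show "\<tau> (d \<otimes>\<^bsub>D\<^esub> (a \<ominus>\<^bsub>D\<^esub> a')) = \<zero>\<^bsub>K\<^esub>"
      using \<tau>D(1) d cl by (simp add: K.minus_eq_zero_iff)
  qed (use cl in simp)
  ultimately show ?case using cl eq by (simp add: D.minus_eq_zero_iff)
qed auto

end

text \<open>With right coordinates on \<open>M\<close>, every list \<open>as\<close> yields the
  functional that pairs the coordinates of \<open>v\<close> with \<open>as\<close>. This is linear
  over \<open>D\<close> on the left and bijective, so the dual is free on as many elements as
  \<open>M\<close>.\<close>

theorem (in right_vector_space) HomD_list_basis:
  assumes "list_basis (opp D) M xs"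
  shows "\<exists>ts. list_basis D (HomD K D M) ts \<and> length ts = length xs"
proof -
  interpret R: left_vector_space "opp D" M by (rule right_space)
  interpret H: left_vector_space D "HomD K D M" by (rule HomD_left_vector_space)
  have xs: "set xs \<subseteq> carrier M" "lspan (opp D) M xs = carrier M" using assms by (auto simp: list_basis_def)
  obtain \<tau> x0 where \<tau>: "functional K D \<tau>" "x0 \<in> carrier D" "\<tau> x0 \<noteq> \<zero>\<^bsub>K\<^esub>"
    using ex_nonzero_functional by auto
  have co_opp: "coeffs (opp D) ys = coeffs D ys" for ys :: "'m list" by (simp add: coeffs_def)
  obtain co where co: "\<And>v. v \<in> carrier M \<Longrightarrow> co v \<in> coeffs D xs"
    "\<And>v. v \<in> carrier M \<Longrightarrow> lincomb M (co v) xs = v"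
    "\<And>cs. cs \<in> coeffs D xs \<Longrightarrow> co (lincomb M cs xs) = cs"
    "\<And>v w. \<lbrakk>v \<in> carrier M; w \<in> carrier M\<rbrakk> \<Longrightarrow> co (v \<oplus>\<^bsub>M\<^esub> w) = map2 (\<oplus>\<^bsub>D\<^esub>) (co v) (co w)"
    "\<And>a v. \<lbrakk>a \<in> carrier D; v \<in> carrier M\<rbrakk> \<Longrightarrow> co (a \<odot>\<^bsub>M\<^esub> v) = map (\<lambda>d. d \<otimes>\<^bsub>D\<^esub> a) (co v)"
    by (rule R.ex_coords[OF assms, unfolded co_opp opp_simps]) blast
  define \<mu> where "\<mu> = (\<lambda>as. \<lambda>v\<in>carrier M. pairing K D \<tau> (co v) as)"
  define \<Psi> where "\<Psi> = (\<lambda>as. adjoint_map D M (\<mu> as))"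
  have \<mu>c: "\<mu> as \<in> dual_functionals K D M" if as: "as \<in> coeffs D xs" for as
    unfolding \<mu>_def
    using pairing_closed[OF \<tau>(1) _ as] pairing_add[OF \<tau>(1) _ _ as] pairing_smult(2)[OF \<tau>(1) _ as]
    by (intro dual_functionalsI) (simp_all add: co scalar_one_closed)
  have \<Psi>c: "\<Psi> as \<in> carrier (HomD K D M)" if "as \<in> coeffs D xs" for as
    unfolding \<Psi>_def by (rule adjoint_map_mem[OF \<mu>c[OF that]])
  have \<Psi>add: "\<Psi> (map2 (\<oplus>\<^bsub>D\<^esub>) as bs) = \<Psi> as \<oplus>\<^bsub>HomD K D M\<^esub> \<Psi> bs"
    if "as \<in> coeffs D xs" "bs \<in> coeffs D xs" for as bs
  proof -
    have "\<mu> (map2 (\<oplus>\<^bsub>D\<^esub>) as bs) = \<mu> as \<oplus>\<^bsub>dual_module K D M\<^esub> \<mu> bs"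
      using pairing_add[OF \<tau>(1) that] co(1) by (auto simp: \<mu>_def dual_module_def intro!: restrict_ext)
    then show ?thesis using adjoint_map_hom(2)[OF \<mu>c[OF that(1)] \<mu>c[OF that(2)]] by (simp add: \<Psi>_def)
  qed
  have \<Psi>mul: "\<Psi> (map ((\<otimes>\<^bsub>D\<^esub>) a) as) = a \<odot>\<^bsub>HomD K D M\<^esub> \<Psi> as"
    if "a \<in> carrier D" "as \<in> coeffs D xs" for as a
  proof -
    have "\<mu> (map ((\<otimes>\<^bsub>D\<^esub>) a) as) = a \<odot>\<^bsub>dual_module K D M\<^esub> \<mu> as"
      using pairing_smult(1)[OF \<tau>(1) _ that(2) that(1)] co(1,5) that(1)
      by (auto simp: \<mu>_def dual_module_def intro!: restrict_ext)
    then show ?thesis using adjoint_map_hom(3)[OF that(1) \<mu>c[OF that(2)]] by (simp add: \<Psi>_def)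
  qed
  obtain ts where ts: "length ts = length xs" "set ts \<subseteq> carrier (HomD K D M)"
    "\<And>cs. cs \<in> coeffs D xs \<Longrightarrow> \<Psi> cs = lincomb (HomD K D M) cs ts"
    using H.linear_coeffs_lincomb[of xs \<Psi>, OF \<Psi>c \<Psi>add \<Psi>mul] by blast
  \<comment> \<open>Surjectivity, one basis vector at a time: \<open>d \<mapsto> \<nu> (y d)\<close>
    is a functional on \<open>D\<close>, hence of the form \<open>\<tau> (d a)\<close> by
    \<open>functional_repr\<close>.\<close>
  have ex: "\<exists>as\<in>coeffs D ys. \<forall>ds\<in>coeffs D ys. \<nu> (lincomb M ds ys) = pairing K D \<tau> ds as"
    if \<nu>: "\<nu> \<in> dual_functionals K D M" and "set ys \<subseteq> carrier M" for \<nu> ys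
    using that(2)
  proof (induction ys)
    case Nil
    have "\<nu> \<zero>\<^bsub>M\<^esub> = \<zero>\<^bsub>K\<^esub>"
      using dual_functionalsD(3)[OF \<nu>, of "\<zero>\<^bsub>K\<^esub>" "\<zero>\<^bsub>M\<^esub>"] dual_functionalsD(1)[OF \<nu>, of "\<zero>\<^bsub>M\<^esub>"]
        M.smult_r_null[of "\<zero>\<^bsub>K\<^esub> \<odot>\<^bsub>D\<^esub> \<one>\<^bsub>D\<^esub>"] scalar_one_closed[of "\<zero>\<^bsub>K\<^esub>"] by simp
    then show ?case by simp
  next
    case (Cons y ys)
    note \<nu>D = dual_functionalsD[OF \<nu>]
    have y: "y \<in> carrier M" and ys: "set ys \<subseteq> carrier M" using Cons.prems by auto
    obtain as where as: "as \<in> coeffs D ys" "\<And>ds. ds \<in> coeffs D ys \<Longrightarrow> \<nu> (lincomb M ds ys) = pairing K D \<tau> ds as"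
      using Cons by auto
    have "functional K D (\<lambda>d. \<nu> (d \<odot>\<^bsub>M\<^esub> y))"
      unfolding functional_def
    proof (intro conjI ballI)
      show "\<nu> (d \<odot>\<^bsub>M\<^esub> y) \<in> carrier K" if "d \<in> carrier D" for d using \<nu>D(1) y that by simp
      show "\<nu> ((d \<oplus>\<^bsub>D\<^esub> d') \<odot>\<^bsub>M\<^esub> y) = \<nu> (d \<odot>\<^bsub>M\<^esub> y) \<oplus>\<^bsub>K\<^esub> \<nu> (d' \<odot>\<^bsub>M\<^esub> y)"
        if "d \<in> carrier D" "d' \<in> carrier D" for d d'
        using M.smult_l_distr[of d d' y] \<nu>D(2) y that by simp
      show "\<nu> ((c \<odot>\<^bsub>D\<^esub> d) \<odot>\<^bsub>M\<^esub> y) = c \<otimes>\<^bsub>K\<^esub> \<nu> (d \<odot>\<^bsub>M\<^esub> y)" if "c \<in> carrier K" "d \<in> carrier D" for c d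
        using \<nu>D(3)[OF that(1), of "d \<odot>\<^bsub>M\<^esub> y"] that y scalar_one_closed[OF that(1)]
        by (simp add: smult_smult scalar_commute)
    qed
    then obtain a where a: "a \<in> carrier D" "\<And>d. d \<in> carrier D \<Longrightarrow> \<nu> (d \<odot>\<^bsub>M\<^esub> y) = \<tau> (d \<otimes>\<^bsub>D\<^esub> a)"
      using functional_repr[OF \<tau>] by blast
    have "\<nu> (lincomb M ds (y # ys)) = pairing K D \<tau> ds (a # as)" if ds: "ds \<in> coeffs D (y # ys)" for ds
    proof -
      obtain d s where eq: "ds = d # s" "d \<in> carrier D" "s \<in> coeffs D ys" using ds by (auto simp: coeffs_Cons)
      then show ?thesis
        using \<nu>D(2)[of "d \<odot>\<^bsub>M\<^esub> y" "lincomb M s ys"] M.lincomb_closed[OF ys, of s] a(2)[OF eq(2)] as(2)[OF eq(3)] y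
        by (simp add: co_opp)
    qed
    then show ?case using a(1) as(1) by (intro bexI[of _ "a # as"]) auto
  qed
  have "bij_betw \<Psi> (coeffs D xs) (carrier (HomD K D M))"
    unfolding bij_betw_def
  proof (intro conjI inj_onI equalityI subsetI)
    fix as bs assume h: "as \<in> coeffs D xs" "bs \<in> coeffs D xs" "\<Psi> as = \<Psi> bs"
    then have "\<mu> as = \<mu> bs"
      using inj_onD[OF bij_betw_imp_inj_on[OF adjoint_map_bij]] \<mu>c by (auto simp: \<Psi>_def)
    then have e: "\<mu> as v = \<mu> bs v" for v by simp
    have "pairing K D \<tau> ds as = pairing K D \<tau> ds bs" if "ds \<in> coeffs D xs" for ds
      using e[of "lincomb M ds xs"] that co(3)[OF that] M.lincomb_closed[OF xs(1), of ds]
      by (simp add: \<mu>_def co_opp)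
    then show "as = bs" by (rule pairing_nondegenerate[OF \<tau> h(1,2)])
  next
    fix \<phi> assume "\<phi> \<in> carrier (HomD K D M)"
    then obtain \<nu> where \<nu>: "\<nu> \<in> dual_functionals K D M" "\<phi> = adjoint_map D M \<nu>"
      using adjoint_map_bij by (auto simp: bij_betw_def)
    obtain as where as: "as \<in> coeffs D xs" "\<And>ds. ds \<in> coeffs D xs \<Longrightarrow> \<nu> (lincomb M ds xs) = pairing K D \<tau> ds as"
      using ex[OF \<nu>(1) xs(1)] by blast
    have "\<nu> = \<mu> as"
    proof (rule dual_eqI[OF \<nu>(1) \<mu>c[OF as(1)]])
      fix v assume v: "v \<in> carrier M"
      then show "\<nu> v = \<mu> as v" using as(2)[OF co(1)[OF v]] co(2)[OF v] by (simp add: \<mu>_def)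
    qed
    then show "\<phi> \<in> \<Psi> ` coeffs D xs" using as(1) \<nu>(2) by (auto simp: \<Psi>_def)
  qed (use \<Psi>c in auto)
  then have "bij_betw (\<lambda>cs. lincomb (HomD K D M) cs ts) (coeffs D xs) (carrier (HomD K D M))"
    by (rule bij_betw_cong[THEN iffD1, rotated]) (rule ts(3))
  then have "list_basis D (HomD K D M) ts"
    using coeffs_length_cong[OF ts(1), of D] ts(2) by (intro H.list_basisI) auto
  then show ?thesis using ts(1) by auto
qed

section \<open>Quotient modules\<close>

lemma quot_mod_simps [simp]:
  "carrier (quot_mod M N) = a_rcosets\<^bsub>M\<^esub> N" "mult (quot_mod M N) = rcoset_mult M N"
  "one (quot_mod M N) = N +>\<^bsub>M\<^esub> \<one>\<^bsub>M\<^esub>" "zero (quot_mod M N) = N" "add (quot_mod M N) = set_add M"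
  "smult (quot_mod M N) = (\<lambda>a X. N <+>\<^bsub>M\<^esub> ((\<lambda>x. a \<odot>\<^bsub>M\<^esub> x) ` X))"
  by (simp_all add: quot_mod_def)

lemma a_rcosets_eq: "a_rcosets\<^bsub>M\<^esub> N = (\<lambda>x. N +>\<^bsub>M\<^esub> x) ` carrier M"
  by (auto simp: A_RCOSETS_def')

locale quotient_module = lmodule R M for R M +
  fixes N
  assumes submodule: "submodule N R M"
begin

lemmas sub = submoduleD[OF submodule]

lemma sub_carrier: "x \<in> N \<Longrightarrow> x \<in> carrier M"
  using sub(1) by auto

lemma mem_coset_iff: "x \<in> carrier M \<Longrightarrow> y \<in> N +>\<^bsub>M\<^esub> x \<longleftrightarrow> y \<in> carrier M \<and> y \<ominus>\<^bsub>M\<^esub> x \<in> N"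
proof
  assume x: "x \<in> carrier M" and "y \<in> N +>\<^bsub>M\<^esub> x"
  then obtain h where "h \<in> N" "y = h \<oplus>\<^bsub>M\<^esub> x" by (auto simp: a_r_coset_def')
  then show "y \<in> carrier M \<and> y \<ominus>\<^bsub>M\<^esub> x \<in> N"
    using x sub_carrier by (simp add: a_minus_def M.a_assoc M.r_neg)
next
  assume x: "x \<in> carrier M" and y: "y \<in> carrier M \<and> y \<ominus>\<^bsub>M\<^esub> x \<in> N"
  have "y = (y \<ominus>\<^bsub>M\<^esub> x) \<oplus>\<^bsub>M\<^esub> x" using x y by (simp add: a_minus_def M.a_assoc M.l_neg)
  then show "y \<in> N +>\<^bsub>M\<^esub> x" using y by (auto simp: a_r_coset_def')
qed

lemma self_mem_coset: "x \<in> carrier M \<Longrightarrow> x \<in> N +>\<^bsub>M\<^esub> x"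
  using sub(2) by (simp add: mem_coset_iff a_minus_def M.r_neg)

lemma coset_eq_iff:
  assumes "x \<in> carrier M" "y \<in> carrier M"
  shows "N +>\<^bsub>M\<^esub> x = N +>\<^bsub>M\<^esub> y \<longleftrightarrow> x \<ominus>\<^bsub>M\<^esub> y \<in> N"
proof
  assume "N +>\<^bsub>M\<^esub> x = N +>\<^bsub>M\<^esub> y"
  then show "x \<ominus>\<^bsub>M\<^esub> y \<in> N" using self_mem_coset[OF assms(1)] mem_coset_iff[OF assms(2)] by simp
next
  assume h: "x \<ominus>\<^bsub>M\<^esub> y \<in> N"
  have "z \<ominus>\<^bsub>M\<^esub> x \<in> N \<longleftrightarrow> z \<ominus>\<^bsub>M\<^esub> y \<in> N" if z: "z \<in> carrier M" for z
  proof -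
    have 1: "z \<ominus>\<^bsub>M\<^esub> y = (z \<ominus>\<^bsub>M\<^esub> x) \<oplus>\<^bsub>M\<^esub> (x \<ominus>\<^bsub>M\<^esub> y)"
      using assms z by (simp add: a_minus_def M.a_assoc M.r_neg1)
    have "\<ominus>\<^bsub>M\<^esub> y \<oplus>\<^bsub>M\<^esub> (\<ominus>\<^bsub>M\<^esub> x \<oplus>\<^bsub>M\<^esub> y) = \<ominus>\<^bsub>M\<^esub> x"
      using assms M.a_comm[of "\<ominus>\<^bsub>M\<^esub> x" y] by (simp add: M.r_neg1)
    then have "z \<ominus>\<^bsub>M\<^esub> x = (z \<ominus>\<^bsub>M\<^esub> y) \<ominus>\<^bsub>M\<^esub> (x \<ominus>\<^bsub>M\<^esub> y)"
      using assms z by (simp add: a_minus_def M.a_assoc M.minus_add)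
    then show ?thesis using 1 sub(3)[OF _ h] sub(6)[OF _ h] by metis
  qed
  then show "N +>\<^bsub>M\<^esub> x = N +>\<^bsub>M\<^esub> y" using mem_coset_iff assms by blast
qed

lemma coset_zero_iff: "x \<in> carrier M \<Longrightarrow> N +>\<^bsub>M\<^esub> x = N \<longleftrightarrow> x \<in> N"
proof -
  assume x: "x \<in> carrier M"
  have "N +>\<^bsub>M\<^esub> \<zero>\<^bsub>M\<^esub> = N"
    using sub_carrier by (force simp: a_r_coset_def')
  then show ?thesis using coset_eq_iff[OF x M.zero_closed] x
    M.minus_equality[of "\<zero>\<^bsub>M\<^esub>" "\<zero>\<^bsub>M\<^esub>"] by (simp add: a_minus_def)
qed

lemma coset_add:
  assumes "x \<in> carrier M" "y \<in> carrier M"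
  shows "(N +>\<^bsub>M\<^esub> x) <+>\<^bsub>M\<^esub> (N +>\<^bsub>M\<^esub> y) = N +>\<^bsub>M\<^esub> (x \<oplus>\<^bsub>M\<^esub> y)"
proof (intro equalityI subsetI)
  fix z assume "z \<in> (N +>\<^bsub>M\<^esub> x) <+>\<^bsub>M\<^esub> (N +>\<^bsub>M\<^esub> y)"
  then obtain h k where hk: "h \<in> N" "k \<in> N" "z = (h \<oplus>\<^bsub>M\<^esub> x) \<oplus>\<^bsub>M\<^esub> (k \<oplus>\<^bsub>M\<^esub> y)"
    by (auto simp: set_add_def' a_r_coset_def')
  then have "z = (h \<oplus>\<^bsub>M\<^esub> k) \<oplus>\<^bsub>M\<^esub> (x \<oplus>\<^bsub>M\<^esub> y)" using assms sub_carrier by (simp add: M.a_ac)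
  then show "z \<in> N +>\<^bsub>M\<^esub> (x \<oplus>\<^bsub>M\<^esub> y)" using hk sub(3) by (auto simp: a_r_coset_def')
next
  fix z assume "z \<in> N +>\<^bsub>M\<^esub> (x \<oplus>\<^bsub>M\<^esub> y)"
  then obtain h where hk: "h \<in> N" "z = h \<oplus>\<^bsub>M\<^esub> (x \<oplus>\<^bsub>M\<^esub> y)" by (auto simp: a_r_coset_def')
  then have "z = (h \<oplus>\<^bsub>M\<^esub> x) \<oplus>\<^bsub>M\<^esub> (\<zero>\<^bsub>M\<^esub> \<oplus>\<^bsub>M\<^esub> y)" using assms sub_carrier by (simp add: M.a_ac)
  then show "z \<in> (N +>\<^bsub>M\<^esub> x) <+>\<^bsub>M\<^esub> (N +>\<^bsub>M\<^esub> y)"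
    using hk(1) sub(2) unfolding set_add_def' a_r_coset_def' by blast
qed

lemma coset_smult:
  assumes "a \<in> carrier R" "x \<in> carrier M"
  shows "N <+>\<^bsub>M\<^esub> ((\<lambda>y. a \<odot>\<^bsub>M\<^esub> y) ` (N +>\<^bsub>M\<^esub> x)) = N +>\<^bsub>M\<^esub> (a \<odot>\<^bsub>M\<^esub> x)"
proof (intro equalityI subsetI)
  fix z assume "z \<in> N <+>\<^bsub>M\<^esub> ((\<lambda>y. a \<odot>\<^bsub>M\<^esub> y) ` (N +>\<^bsub>M\<^esub> x))"
  then obtain h k where hk: "h \<in> N" "k \<in> N" "z = h \<oplus>\<^bsub>M\<^esub> a \<odot>\<^bsub>M\<^esub> (k \<oplus>\<^bsub>M\<^esub> x)"
    by (auto simp: set_add_def' a_r_coset_def')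
  then have "z = (h \<oplus>\<^bsub>M\<^esub> a \<odot>\<^bsub>M\<^esub> k) \<oplus>\<^bsub>M\<^esub> a \<odot>\<^bsub>M\<^esub> x"
    using assms sub_carrier by (simp add: smult_r_distr M.a_assoc)
  then show "z \<in> N +>\<^bsub>M\<^esub> (a \<odot>\<^bsub>M\<^esub> x)" using hk sub(3,4) assms(1) by (auto simp: a_r_coset_def')
next
  fix z assume "z \<in> N +>\<^bsub>M\<^esub> (a \<odot>\<^bsub>M\<^esub> x)"
  then obtain h where "h \<in> N" "z = h \<oplus>\<^bsub>M\<^esub> a \<odot>\<^bsub>M\<^esub> x" by (auto simp: a_r_coset_def')
  then show "z \<in> N <+>\<^bsub>M\<^esub> ((\<lambda>y. a \<odot>\<^bsub>M\<^esub> y) ` (N +>\<^bsub>M\<^esub> x))"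
    using self_mem_coset[OF assms(2)] by (auto simp: set_add_def')
qed

lemma quot_lmodule: "lmodule R (quot_mod M N)"
proof -
  have N0: "N = N +>\<^bsub>M\<^esub> \<zero>\<^bsub>M\<^esub>" using coset_zero_iff[OF M.zero_closed] sub(2) by simp
  note simps = coset_add coset_smult a_rcosets_eq
  show ?thesis
  proof (intro lmodule.intro lmodule_axioms.intro R.ring_axioms abelian_groupI)
    fix X assume "X \<in> carrier (quot_mod M N)"
    then obtain x where x: "x \<in> carrier M" "X = N +>\<^bsub>M\<^esub> x" by (auto simp: a_rcosets_eq)
    have "(N +>\<^bsub>M\<^esub> \<zero>\<^bsub>M\<^esub>) <+>\<^bsub>M\<^esub> (N +>\<^bsub>M\<^esub> x) = N +>\<^bsub>M\<^esub> x" using x by (simp add: coset_add)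
    then show "\<zero>\<^bsub>quot_mod M N\<^esub> \<oplus>\<^bsub>quot_mod M N\<^esub> X = X" using x N0 by simp
    have "(N +>\<^bsub>M\<^esub> (\<ominus>\<^bsub>M\<^esub> x)) <+>\<^bsub>M\<^esub> (N +>\<^bsub>M\<^esub> x) = N"
      using x N0 by (simp add: coset_add M.l_neg)
    then show "\<exists>Y\<in>carrier (quot_mod M N). Y \<oplus>\<^bsub>quot_mod M N\<^esub> X = \<zero>\<^bsub>quot_mod M N\<^esub>"
      using x by (auto simp: a_rcosets_eq)
  next
    show "\<zero>\<^bsub>quot_mod M N\<^esub> \<in> carrier (quot_mod M N)" using N0 by (auto simp: a_rcosets_eq)
  qed (auto simp: simps M.a_ac smult_l_distr smult_r_distr smult_assoc1)
qed

end

lemma regular_simps [simp]: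
  "carrier (regular R) = carrier R" "mult (regular R) = mult R" "one (regular R) = one R"
  "zero (regular R) = zero R" "add (regular R) = add R" "smult (regular R) = mult R"
  by (simp_all add: regular_def)

lemma (in ring) regular_lmodule: "lmodule R (regular R)"
proof (intro lmodule.intro lmodule_axioms.intro ring_axioms abelian_groupI)
  fix x assume "x \<in> carrier (regular R)"
  then show "\<exists>y\<in>carrier (regular R). y \<oplus>\<^bsub>regular R\<^esub> x = \<zero>\<^bsub>regular R\<^esub>"
    by (auto intro!: bexI[of _ "\<ominus> x"] l_neg)
qed (auto simp: a_ac l_distr r_distr m_assoc)

section \<open>The Jacobson radical and local corners\<close>

context ring
begin

text \<open>Here \<open>b\<close> is the geometric sum of the powers of \<open>x\<close> below
  \<open>m\<close>; for nilpotent \<open>x\<close> it is a left inverse of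
  \<open>1 - x\<close>.\<close>

lemma geometric_left_inverse:
  assumes "x \<in> carrier R"
  shows "\<exists>b\<in>carrier R. b \<otimes> (\<one> \<ominus> x) = \<one> \<ominus> x [^] (m::nat)"
proof (induction m)
  case 0
  then show ?case using assms by (intro bexI[of _ \<zero>]) (auto simp: a_minus_def r_neg)
next
  case (Suc m)
  then obtain b where b: "b \<in> carrier R" "b \<otimes> (\<one> \<ominus> x) = \<one> \<ominus> x [^] m" by auto
  have xm: "x [^] m \<in> carrier R" using assms by simp
  have "(b \<oplus> x [^] m) \<otimes> (\<one> \<ominus> x) = (\<one> \<ominus> x [^] m) \<oplus> (x [^] m \<ominus> x [^] m \<otimes> x)"
    using b assms xm by (simp add: l_distr) (simp add: a_minus_def r_distr r_minus)
  also have "\<dots> = \<one> \<ominus> x [^] m \<otimes> x"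
    using xm assms by (simp add: a_minus_def a_assoc r_neg1)
  finally show ?case using b xm by (intro bexI[of _ "b \<oplus> x [^] m"]) auto
qed

text \<open>Carries nilpotency from \<open>y x\<close> over to \<open>x y\<close>.\<close>

lemma pow_swap:
  assumes "x \<in> carrier R" "y \<in> carrier R"
  shows "(x \<otimes> y) [^] (Suc m) = x \<otimes> ((y \<otimes> x) [^] m \<otimes> y)"
proof (induction m)
  case 0
  then show ?case using assms by simp
next
  case (Suc m)
  have "(x \<otimes> y) [^] (Suc (Suc m)) = (x \<otimes> ((y \<otimes> x) [^] m \<otimes> y)) \<otimes> (x \<otimes> y)"
    using Suc by (simp add: nat_pow_Suc)
  also have "\<dots> = x \<otimes> ((y \<otimes> x) [^] m \<otimes> (y \<otimes> x) \<otimes> y)"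
    using assms by (simp add: m_assoc)
  finally show ?case by (simp add: nat_pow_Suc)
qed

lemma jacobson_submodule: "submodule (jacobson R) R (regular R)"
proof -
  interpret M: lmodule R "regular R" by (rule regular_lmodule)
  have "submodule I R (regular R)" if "max_left_ideal R I" for I
    using that by (simp add: max_left_ideal_def)
  note D = M.submoduleD[OF this]
  show ?thesis
    by (rule M.submoduleI) (use D in \<open>auto simp: jacobson_def\<close>)
qed

lemma jacobson_carrier: "jacobson R \<subseteq> carrier R"
  by (auto simp: jacobson_def)

text \<open>If a maximal left ideal \<open>I\<close> missed \<open>a\<close>, then \<open>I\<close>
  and the multiples of \<open>a\<close> would generate everything, so \<open>1 = i + z a\<close>
  with \<open>i\<close> in \<open>I\<close>. As \<open>z a\<close> is nilpotent,
  \<open>i = 1 - z a\<close> has a left inverse, and \<open>I\<close> would be the whole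
  ring.\<close>

lemma nil_left_ideal_in_jacobson:
  assumes a: "a \<in> carrier R" and nil: "\<And>z. z \<in> carrier R \<Longrightarrow> \<exists>m::nat. (z \<otimes> a) [^] m = \<zero>"
  shows "a \<in> jacobson R"
  unfolding jacobson_def
proof (intro IntI a InterI)
  interpret M: lmodule R "regular R" by (rule regular_lmodule)
  fix I assume "I \<in> {I. max_left_ideal R I}"
  then have I: "submodule I R (regular R)" "I \<noteq> carrier R"
    "\<And>H. submodule H R (regular R) \<Longrightarrow> I \<subseteq> H \<Longrightarrow> H = I \<or> H = carrier R"
    by (auto simp: max_left_ideal_def)
  note ID = M.submoduleD[OF I(1), simplified]
  show "a \<in> I"
  proof (rule ccontr)
    assume aI: "a \<notin> I"
    define H where "H = {i \<oplus> z \<otimes> a | i z. i \<in> I \<and> z \<in> carrier R}"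
    have "submodule H R (regular R)"
    proof (rule M.submoduleI)
      show "H \<subseteq> carrier (regular R)" using ID(1) a by (auto simp: H_def)
      show "\<zero>\<^bsub>regular R\<^esub> \<in> H" using ID(2) a by (force simp: H_def intro!: exI[of _ \<zero>])
    next
      fix x y assume "x \<in> H" "y \<in> H"
      then obtain i z j w where "i \<in> I" "j \<in> I" "z \<in> carrier R" "w \<in> carrier R"
        "x = i \<oplus> z \<otimes> a" "y = j \<oplus> w \<otimes> a" by (auto simp: H_def)
      moreover from this have "x \<oplus> y = (i \<oplus> j) \<oplus> (z \<oplus> w) \<otimes> a"
        using ID(1) a by (simp add: subset_iff l_distr a_ac)
      ultimately show "x \<oplus>\<^bsub>regular R\<^esub> y \<in> H" unfolding H_def using ID(3) by auto
    next
      fix c x assume c: "c \<in> carrier R" and "x \<in> H"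
      then obtain i z where "i \<in> I" "z \<in> carrier R" "x = i \<oplus> z \<otimes> a" by (auto simp: H_def)
      moreover from this have "c \<otimes> x = c \<otimes> i \<oplus> (c \<otimes> z) \<otimes> a"
        using ID(1) a c by (simp add: subset_iff r_distr m_assoc)
      ultimately show "c \<odot>\<^bsub>regular R\<^esub> x \<in> H" unfolding H_def using ID(4) c by auto
    qed
    moreover have "I \<subseteq> H"
    proof
      fix i assume "i \<in> I"
      moreover from this have "i = i \<oplus> \<zero> \<otimes> a" using ID(1) a by auto
      ultimately show "i \<in> H" unfolding H_def by blast
    qed
    moreover have "a \<in> H"
    proof -
      have "a = \<zero> \<oplus> \<one> \<otimes> a" using a by simp
      then show ?thesis unfolding H_def using ID(2) by auto
    qed
    ultimately have "H = carrier R" using I(3)[of H] aI by auto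
    then have "\<one> \<in> H" by auto
    then obtain i z where iz: "i \<in> I" "z \<in> carrier R" "\<one> = i \<oplus> z \<otimes> a" by (auto simp: H_def)
    have ic: "i \<in> carrier R" using iz ID(1) by auto
    have i: "\<one> \<ominus> z \<otimes> a = i"
      unfolding iz(3) using ic iz(2) a by (simp add: a_minus_def a_assoc r_neg)
    obtain m :: nat where m: "(z \<otimes> a) [^] m = \<zero>" using nil iz by auto
    obtain b where "b \<in> carrier R" "b \<otimes> i = \<one>"
      using geometric_left_inverse[of "z \<otimes> a" m] iz(2) a i m by (auto simp: a_minus_def)
    then have "\<one> \<in> I" using ID(4) iz(1) by metis
    then have "x \<in> I" if "x \<in> carrier R" for x using ID(4)[OF that, of \<one>] that by simp
    then show False using I(2) ID(1) by auto
  qed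
qed

lemma jpow_Suc_mem: "\<lbrakk>x \<in> jpow R m; y \<in> jacobson R\<rbrakk> \<Longrightarrow> x \<otimes> y \<in> jpow R (Suc m)"
  by (auto intro: ideal_prod.prod)

lemma pow_mem_jpow:
  assumes "a \<in> jacobson R"
  shows "a [^] m \<in> jpow R m"
proof (induction m)
  case (Suc m)
  then show ?case using jpow_Suc_mem[OF Suc assms] by (simp add: nat_pow_Suc)
qed simp

end

locale nilpotent_radical = ring +
  fixes n :: nat
  assumes nilpotent: "jpow R n = {\<zero>}"
begin

text \<open>One direction is the nilpotency of the radical applied to \<open>z a\<close>. The
  criterion no longer mentions maximal left ideals and is what all later arguments use.\<close>

lemma jacobson_iff_nil:
  "a \<in> jacobson R \<longleftrightarrow> a \<in> carrier R \<and> (\<forall>z\<in>carrier R. \<exists>m::nat. (z \<otimes> a) [^] m = \<zero>)"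
proof
  assume a: "a \<in> jacobson R"
  interpret M: lmodule R "regular R" by (rule regular_lmodule)
  have "(z \<otimes> a) [^] n = \<zero>" if "z \<in> carrier R" for z
    using pow_mem_jpow[of "z \<otimes> a" n] M.submoduleD(4)[OF jacobson_submodule that a] nilpotent by simp
  then show "a \<in> carrier R \<and> (\<forall>z\<in>carrier R. \<exists>m::nat. (z \<otimes> a) [^] m = \<zero>)"
    using a jacobson_carrier by auto
qed (auto intro: nil_left_ideal_in_jacobson)

text \<open>The definition yields a left ideal. Closure on the right comes from
  \<open>pow_swap\<close>: the nilpotency of \<open>b z a\<close> implies that of
  \<open>z a b\<close>.\<close>

lemma jacobson_ideal: "ideal (jacobson R) R"
proof -
  interpret M: lmodule R "regular R" by (rule regular_lmodule)
  note D = M.submoduleD[OF jacobson_submodule, simplified]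
  have r: "a \<otimes> b \<in> jacobson R" if a: "a \<in> jacobson R" and b: "b \<in> carrier R" for a b
  proof -
    have ac: "a \<in> carrier R" using a jacobson_carrier by auto
    have "\<exists>m::nat. (z \<otimes> (a \<otimes> b)) [^] m = \<zero>" if z: "z \<in> carrier R" for z
    proof -
      obtain m :: nat where m: "(b \<otimes> z \<otimes> a) [^] m = \<zero>"
        using a jacobson_iff_nil b z by (meson m_closed)
      have "(z \<otimes> (a \<otimes> b)) [^] Suc m = (z \<otimes> a) \<otimes> ((b \<otimes> (z \<otimes> a)) [^] m \<otimes> b)"
        using pow_swap[of "z \<otimes> a" b m] ac b z by (simp add: m_assoc)
      also have "\<dots> = \<zero>" using m ac b z by (simp add: m_assoc)
      finally show ?thesis by blast
    qed
    then show ?thesis using jacobson_iff_nil ac b by simp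
  qed
  show ?thesis
  proof (rule idealI[OF ring_axioms])
    show "subgroup (jacobson R) (add_monoid R)"
    proof (rule add.subgroupI)
      fix a assume "a \<in> jacobson R"
      then show "\<ominus> a \<in> jacobson R" using D(4)[of "\<ominus> \<one>" a] D(1) by (auto simp: l_minus)
    qed (use D in auto)
  qed (use D r in auto)
qed

lemma jpow_ideal: "ideal (jpow R m) R"
  by (induction m) (auto simp: oneideal intro: ideal_prod_is_ideal jacobson_ideal)

text \<open>\<open>jpow\<close> multiplies by the radical on the right only; the mirrored statement
  is needed for the radical to annihilate the last layer from the left.\<close>

lemma jacobson_mult_jpow:
  assumes "x \<in> jacobson R"
  shows "y \<in> jpow R m \<Longrightarrow> x \<otimes> y \<in> jpow R (Suc m)"
proof (induction m arbitrary: y)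
  case 0
  then have "\<one> \<otimes> (x \<otimes> y) \<in> jpow R (Suc 0)"
    using jpow_Suc_mem[of \<one> 0 "x \<otimes> y"] ideal.I_r_closed[OF jacobson_ideal assms, of y] by simp
  then show ?case using assms 0 jacobson_carrier by auto
next
  case (Suc m)
  have xc: "x \<in> carrier R" using assms jacobson_carrier by auto
  have "y \<in> jpow R m \<cdot> jacobson R" using Suc.prems by simp
  then show ?case
  proof (induction y rule: ideal_prod.induct)
    case (prod i j)
    then show ?case
      using Suc.IH[OF prod(1)] jpow_Suc_mem[of "x \<otimes> i" "Suc m" j] xc jacobson_carrier
        ideal.Icarr[OF jpow_ideal prod(1)] by (auto simp: m_assoc)
  next
    case (sum s1 s2)
    have "s1 \<in> carrier R" "s2 \<in> carrier R"
      using sum ideal.Icarr[OF jpow_ideal[of "Suc m"]] by auto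
    then have "x \<otimes> (s1 \<oplus> s2) = x \<otimes> s1 \<oplus> x \<otimes> s2" using xc by (simp add: r_distr)
    then show ?case
      using sum additive_subgroup.a_closed[OF ideal.axioms(1)[OF jpow_ideal[of "Suc (Suc m)"]]] by metis
  qed
qed

end

lemma not_lindep_freeD:
  "\<not> lindep_free R M xs \<Longrightarrow> \<exists>us x vs. xs = us @ x # vs \<and> x \<in> lspan R M vs"
proof (induction xs)
  case (Cons x xs)
  then show ?case by (cases "x \<in> lspan R M xs") (auto intro: exI[of _ "[]"], metis append_Cons)
qed simp

section \<open>Local corners of a basic algebra\<close>

context basic_algebra
begin

sublocale nilpotent_radical L n
  by unfold_locales (rule jacobson_nilpotent)

lemma lmodule_KL: "lmodule K L"
  by (rule module_lmodule) (rule module_axioms)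

lemma vs_KL: "left_vector_space K L"
  by (intro left_vector_space.intro left_vector_space_axioms.intro lmodule_KL K.division_ring)

lemma ex_basis: "\<exists>bs. list_basis K L bs"
  using finite_dim lmodule.has_dim_list_basis[OF lmodule_KL] K.one_not_zero by blast

definition Corner :: "'a \<Rightarrow> 'a set" where
  "Corner f = {f \<otimes>\<^bsub>L\<^esub> y \<otimes>\<^bsub>L\<^esub> f | y. y \<in> carrier L}"

lemma Corner_iff:
  assumes "idempotent L f"
  shows "a \<in> Corner f \<longleftrightarrow> a \<in> carrier L \<and> f \<otimes>\<^bsub>L\<^esub> a = a \<and> a \<otimes>\<^bsub>L\<^esub> f = a"
proof
  have f: "f \<in> carrier L" "f \<otimes>\<^bsub>L\<^esub> f = f" using assms by (auto simp: idempotent_def)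
  assume "a \<in> Corner f"
  then obtain y where y: "y \<in> carrier L" "a = f \<otimes>\<^bsub>L\<^esub> y \<otimes>\<^bsub>L\<^esub> f" by (auto simp: Corner_def)
  have "f \<otimes>\<^bsub>L\<^esub> (f \<otimes>\<^bsub>L\<^esub> y) = f \<otimes>\<^bsub>L\<^esub> y" using f y by (simp flip: L.m_assoc)
  then show "a \<in> carrier L \<and> f \<otimes>\<^bsub>L\<^esub> a = a \<and> a \<otimes>\<^bsub>L\<^esub> f = a"
    using f y by (simp add: L.m_assoc) (metis L.m_assoc L.m_closed)
next
  assume "a \<in> carrier L \<and> f \<otimes>\<^bsub>L\<^esub> a = a \<and> a \<otimes>\<^bsub>L\<^esub> f = a"
  then show "a \<in> Corner f" unfolding Corner_def by (intro CollectI exI[of _ a]) auto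
qed

text \<open>\<open>f\<close> is the sum of the orthogonal idempotents \<open>y\<close> and
  \<open>f - y\<close>, so one of them vanishes.\<close>

lemma primitive_eq:
  assumes "primitive_idempotent L f" "idempotent L y" "f \<otimes>\<^bsub>L\<^esub> y = y" "y \<otimes>\<^bsub>L\<^esub> f = y" "y \<noteq> \<zero>\<^bsub>L\<^esub>"
  shows "y = f"
proof -
  have f: "f \<in> carrier L" "f \<otimes>\<^bsub>L\<^esub> f = f" and y: "y \<in> carrier L" "y \<otimes>\<^bsub>L\<^esub> y = y"
    using assms by (auto simp: primitive_idempotent_def idempotent_def)
  let ?z = "f \<ominus>\<^bsub>L\<^esub> y"
  have z: "idempotent L ?z" "y \<otimes>\<^bsub>L\<^esub> ?z = \<zero>\<^bsub>L\<^esub>" "?z \<otimes>\<^bsub>L\<^esub> y = \<zero>\<^bsub>L\<^esub>"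
    using f y assms(3,4)
    by (simp_all add: idempotent_def a_minus_def L.r_distr L.l_distr L.r_minus L.l_minus L.r_neg)
  have "f = y \<oplus>\<^bsub>L\<^esub> ?z" using f y by (simp add: a_minus_def L.a_comm[of f] L.r_neg1 L.r_neg2)
  then have "y = \<zero>\<^bsub>L\<^esub> \<or> ?z = \<zero>\<^bsub>L\<^esub>"
    using assms(1,2) z unfolding primitive_idempotent_def by blast
  then show ?thesis using assms(5) f y by (simp add: L.minus_eq_zero_iff)
qed

text \<open>A linear dependence between powers of \<open>a\<close>, read from its lowest term upwards.\<close>

lemma ex_power_dependence:
  assumes f: "idempotent L f" and a: "a \<in> Corner f"
  shows "\<exists>k b. 1 \<le> k \<and> b \<in> Corner f \<and> a \<otimes>\<^bsub>L\<^esub> b = b \<otimes>\<^bsub>L\<^esub> a \<and> a [^]\<^bsub>L\<^esub> (k::nat) = a [^]\<^bsub>L\<^esub> k \<otimes>\<^bsub>L\<^esub> (a \<otimes>\<^bsub>L\<^esub> b)"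
proof -
  interpret V: left_vector_space K L by (rule vs_KL)
  note aC = a[unfolded Corner_iff[OF f]]
  have fc: "f \<in> carrier L" "f \<otimes>\<^bsub>L\<^esub> f = f" using f by (auto simp: idempotent_def)
  obtain bs where bs: "list_basis K L bs" using ex_basis by auto
  \<comment> \<open>The exponents run from 1 to one more than the dimension, which is one vector too
    many for independence. Exponent 0 is left out because the unit of \<open>L\<close> need not lie
    in the corner.\<close>
  define xs where "xs = map (\<lambda>k::nat. a [^]\<^bsub>L\<^esub> k) [1..<length bs + 2]"
  have xc: "set xs \<subseteq> carrier L" using aC by (auto simp: xs_def)
  have lenx: "length xs = length bs + 1" by (simp add: xs_def del: upt_Suc)
  have nth: "xs ! m = a [^]\<^bsub>L\<^esub> (m + 1)" if "m < length xs" for m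
    using that lenx by (simp add: xs_def del: upt_Suc L.nat_pow_Suc)
  have "\<not> lindep_free K L xs"
  proof
    assume "lindep_free K L xs"
    then have "length xs \<le> length bs"
      by (rule V.steinitz) (use bs xc in \<open>auto simp: list_basis_def\<close>)
    then show False using lenx by simp
  qed
  then obtain us x vs where uv: "xs = us @ x # vs" "x \<in> lspan K L vs"
    using not_lindep_freeD by blast
  define k where "k = length us + 1"
  have len: "length us < length xs" using uv(1) by simp
  have x: "x = a [^]\<^bsub>L\<^esub> k"
  proof -
    have "x = xs ! length us" using uv(1) by simp
    then show ?thesis using nth[OF len] by (simp add: k_def)
  qed
  have vs: "\<exists>j. v = a [^]\<^bsub>L\<^esub> (k + 1 + j)" if "v \<in> set vs" for v
  proof -
    obtain i where i: "i < length vs" "v = vs ! i" using \<open>v \<in> set vs\<close> by (auto simp: in_set_conv_nth)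
    have "v = xs ! (length us + 1 + i)" using i uv(1) by (simp add: nth_append)
    moreover have "length us + 1 + i < length xs" using i uv(1) by simp
    ultimately have "v = a [^]\<^bsub>L\<^esub> (k + 1 + i)" using nth by (simp add: k_def del: L.nat_pow_Suc)
    then show ?thesis by blast
  qed
  \<comment> \<open>All multiples of the next power of \<open>a\<close> by corner elements commuting
    with \<open>a\<close>. The higher powers lie in this subspace, so the dependence puts the lowest
    one there too.\<close>
  define H where "H = {a [^]\<^bsub>L\<^esub> (Suc k) \<otimes>\<^bsub>L\<^esub> c | c. c \<in> Corner f \<and> a \<otimes>\<^bsub>L\<^esub> c = c \<otimes>\<^bsub>L\<^esub> a}"
  note CI = Corner_iff[OF f]
  have ak: "a [^]\<^bsub>L\<^esub> (Suc k) \<in> carrier L" using aC by simp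
  have "submodule H K L"
  proof (rule V.submoduleI)
    show "H \<subseteq> carrier L" using ak by (auto simp: H_def CI)
    show "\<zero>\<^bsub>L\<^esub> \<in> H" unfolding H_def using ak aC fc by (force simp: CI intro!: exI[of _ "\<zero>\<^bsub>L\<^esub>"])
  next
    fix u v assume "u \<in> H" "v \<in> H"
    then obtain c d where cd: "c \<in> Corner f" "d \<in> Corner f" "a \<otimes>\<^bsub>L\<^esub> c = c \<otimes>\<^bsub>L\<^esub> a" "a \<otimes>\<^bsub>L\<^esub> d = d \<otimes>\<^bsub>L\<^esub> a"
      "u = a [^]\<^bsub>L\<^esub> (Suc k) \<otimes>\<^bsub>L\<^esub> c" "v = a [^]\<^bsub>L\<^esub> (Suc k) \<otimes>\<^bsub>L\<^esub> d" by (auto simp: H_def)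
    have "u \<oplus>\<^bsub>L\<^esub> v = a [^]\<^bsub>L\<^esub> (Suc k) \<otimes>\<^bsub>L\<^esub> (c \<oplus>\<^bsub>L\<^esub> d)" using cd ak by (simp add: CI L.r_distr)
    moreover have "c \<oplus>\<^bsub>L\<^esub> d \<in> Corner f" using cd fc by (simp add: CI L.r_distr L.l_distr)
    moreover have "a \<otimes>\<^bsub>L\<^esub> (c \<oplus>\<^bsub>L\<^esub> d) = (c \<oplus>\<^bsub>L\<^esub> d) \<otimes>\<^bsub>L\<^esub> a" using cd aC by (simp add: CI L.r_distr L.l_distr)
    ultimately show "u \<oplus>\<^bsub>L\<^esub> v \<in> H" unfolding H_def by blast
  next
    fix s u assume s: "s \<in> carrier K" and "u \<in> H"
    then obtain c where cd: "c \<in> Corner f" "a \<otimes>\<^bsub>L\<^esub> c = c \<otimes>\<^bsub>L\<^esub> a" "u = a [^]\<^bsub>L\<^esub> (Suc k) \<otimes>\<^bsub>L\<^esub> c" by (auto simp: H_def)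
    have "s \<odot>\<^bsub>L\<^esub> u = a [^]\<^bsub>L\<^esub> (Suc k) \<otimes>\<^bsub>L\<^esub> (s \<odot>\<^bsub>L\<^esub> c)" using cd ak s by (simp add: CI smult_mult_right)
    moreover have "s \<odot>\<^bsub>L\<^esub> c \<in> Corner f" using cd fc s by (simp add: CI smult_mult_right smult_mult_left)
    moreover have "a \<otimes>\<^bsub>L\<^esub> (s \<odot>\<^bsub>L\<^esub> c) = (s \<odot>\<^bsub>L\<^esub> c) \<otimes>\<^bsub>L\<^esub> a"
      using cd aC s by (simp add: CI smult_mult_right smult_mult_left)
    ultimately show "s \<odot>\<^bsub>L\<^esub> u \<in> H" unfolding H_def by blast
  qed
  moreover have "set vs \<subseteq> H"
  proof
    fix v assume "v \<in> set vs"
    then obtain j where j: "v = a [^]\<^bsub>L\<^esub> (k + 1 + j)" using vs by blast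
    have pc: "a \<otimes>\<^bsub>L\<^esub> a [^]\<^bsub>L\<^esub> j = a [^]\<^bsub>L\<^esub> j \<otimes>\<^bsub>L\<^esub> a" using aC L.nat_pow_Suc2[of a j] by simp
    have fp: "f \<otimes>\<^bsub>L\<^esub> a [^]\<^bsub>L\<^esub> j = a [^]\<^bsub>L\<^esub> j \<otimes>\<^bsub>L\<^esub> f"
      using L.group_commutes_pow[of a f j] aC fc by simp
    have akf: "a [^]\<^bsub>L\<^esub> (Suc k) \<otimes>\<^bsub>L\<^esub> f = a [^]\<^bsub>L\<^esub> (Suc k)"
      using aC fc by (simp add: L.m_assoc)
    have "v = a [^]\<^bsub>L\<^esub> (Suc k) \<otimes>\<^bsub>L\<^esub> a [^]\<^bsub>L\<^esub> j" using j aC L.nat_pow_mult[of a "Suc k" j] by simp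
    also have "\<dots> = a [^]\<^bsub>L\<^esub> (Suc k) \<otimes>\<^bsub>L\<^esub> (f \<otimes>\<^bsub>L\<^esub> a [^]\<^bsub>L\<^esub> j)"
      using akf ak fc aC by (simp flip: L.m_assoc del: L.nat_pow_Suc)
    finally have v: "v = a [^]\<^bsub>L\<^esub> (Suc k) \<otimes>\<^bsub>L\<^esub> (f \<otimes>\<^bsub>L\<^esub> a [^]\<^bsub>L\<^esub> j)" .
    have 1: "f \<otimes>\<^bsub>L\<^esub> (f \<otimes>\<^bsub>L\<^esub> a [^]\<^bsub>L\<^esub> j) = f \<otimes>\<^bsub>L\<^esub> a [^]\<^bsub>L\<^esub> j" using fc aC by (simp flip: L.m_assoc)
    have 2: "f \<otimes>\<^bsub>L\<^esub> a [^]\<^bsub>L\<^esub> j \<otimes>\<^bsub>L\<^esub> f = f \<otimes>\<^bsub>L\<^esub> a [^]\<^bsub>L\<^esub> j" using fc aC fp by (simp add: L.m_assoc)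
    have 3: "a \<otimes>\<^bsub>L\<^esub> (f \<otimes>\<^bsub>L\<^esub> a [^]\<^bsub>L\<^esub> j) = f \<otimes>\<^bsub>L\<^esub> a [^]\<^bsub>L\<^esub> j \<otimes>\<^bsub>L\<^esub> a"
    proof -
      have "a \<otimes>\<^bsub>L\<^esub> (f \<otimes>\<^bsub>L\<^esub> a [^]\<^bsub>L\<^esub> j) = (f \<otimes>\<^bsub>L\<^esub> a) \<otimes>\<^bsub>L\<^esub> a [^]\<^bsub>L\<^esub> j" using aC fc by (simp flip: L.m_assoc)
      also have "\<dots> = f \<otimes>\<^bsub>L\<^esub> (a [^]\<^bsub>L\<^esub> j \<otimes>\<^bsub>L\<^esub> a)" using aC fc pc by (metis L.m_assoc L.nat_pow_closed)
      finally show ?thesis using aC fc by (simp add: L.m_assoc)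
    qed
    show "v \<in> H" unfolding H_def using v 1 2 3 fc aC by (auto simp: CI)
  qed
  ultimately have "x \<in> H" using V.lspan_least uv(2) by blast
  then obtain c where c: "c \<in> Corner f" "a \<otimes>\<^bsub>L\<^esub> c = c \<otimes>\<^bsub>L\<^esub> a" "a [^]\<^bsub>L\<^esub> k = a [^]\<^bsub>L\<^esub> (Suc k) \<otimes>\<^bsub>L\<^esub> c"
    using x by (auto simp: H_def)
  have "a [^]\<^bsub>L\<^esub> k = a [^]\<^bsub>L\<^esub> k \<otimes>\<^bsub>L\<^esub> (a \<otimes>\<^bsub>L\<^esub> c)"
    using c aC by (simp add: CI L.m_assoc)
  moreover have "1 \<le> k" by (simp add: k_def)
  ultimately show ?thesis using c by blast
qed

text \<open>Fitting's argument. From \<open>a^k = a^k (a b)\<close> with \<open>b\<close> commuting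
  with \<open>a\<close>, the element \<open>g = (a b)^k\<close> is an idempotent of the corner,
  hence zero or \<open>f\<close>. If it is zero, then \<open>a^k = a^k g\<close> vanishes; if it is
  \<open>f\<close>, splitting one factor \<open>a\<close> off \<open>a^k b^k\<close> gives an
  inverse.\<close>

lemma corner_nilpotent_or_unit:
  assumes f: "primitive_idempotent L f" and a: "a \<in> Corner f"
  shows "(\<exists>m::nat. a [^]\<^bsub>L\<^esub> m = \<zero>\<^bsub>L\<^esub>) \<or> (\<exists>c\<in>Corner f. a \<otimes>\<^bsub>L\<^esub> c = f \<and> c \<otimes>\<^bsub>L\<^esub> a = f)"
proof -
  have fi: "idempotent L f" using f by (simp add: primitive_idempotent_def)
  have fc: "f \<in> carrier L" "f \<otimes>\<^bsub>L\<^esub> f = f" using fi by (auto simp: idempotent_def)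
  note CI = Corner_iff[OF fi]
  obtain k :: nat and b where kb: "1 \<le> k" "b \<in> Corner f" "a \<otimes>\<^bsub>L\<^esub> b = b \<otimes>\<^bsub>L\<^esub> a"
    "a [^]\<^bsub>L\<^esub> k = a [^]\<^bsub>L\<^esub> k \<otimes>\<^bsub>L\<^esub> (a \<otimes>\<^bsub>L\<^esub> b)"
    using ex_power_dependence[OF fi a] by blast
  have ac: "a \<in> carrier L" "b \<in> carrier L" using a kb(2) by (auto simp: CI)
  define g where "g = (a \<otimes>\<^bsub>L\<^esub> b) [^]\<^bsub>L\<^esub> k"
  have gc: "g \<in> carrier L" using ac by (simp add: g_def)
  have gab: "g = a [^]\<^bsub>L\<^esub> k \<otimes>\<^bsub>L\<^esub> b [^]\<^bsub>L\<^esub> k" "g = b [^]\<^bsub>L\<^esub> k \<otimes>\<^bsub>L\<^esub> a [^]\<^bsub>L\<^esub> k"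
    using L.pow_mult_distrib[OF kb(3) ac] L.pow_mult_distrib[OF kb(3)[symmetric] ac(2,1)] kb(3)
    by (simp_all add: g_def)
  have absorb: "a [^]\<^bsub>L\<^esub> k \<otimes>\<^bsub>L\<^esub> (a \<otimes>\<^bsub>L\<^esub> b) [^]\<^bsub>L\<^esub> (m::nat) = a [^]\<^bsub>L\<^esub> k" for m
  proof (induction m)
    case (Suc m)
    have "a [^]\<^bsub>L\<^esub> k \<otimes>\<^bsub>L\<^esub> (a \<otimes>\<^bsub>L\<^esub> b) [^]\<^bsub>L\<^esub> (Suc m)
      = (a [^]\<^bsub>L\<^esub> k \<otimes>\<^bsub>L\<^esub> (a \<otimes>\<^bsub>L\<^esub> b) [^]\<^bsub>L\<^esub> m) \<otimes>\<^bsub>L\<^esub> (a \<otimes>\<^bsub>L\<^esub> b)"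
      using ac by (simp add: L.m_assoc)
    then show ?case using Suc kb(4) by simp
  qed (use ac in simp)
  have akg: "a [^]\<^bsub>L\<^esub> k \<otimes>\<^bsub>L\<^esub> g = a [^]\<^bsub>L\<^esub> k" unfolding g_def by (rule absorb)
  have gg: "g \<otimes>\<^bsub>L\<^esub> g = g"
  proof -
    have "g \<otimes>\<^bsub>L\<^esub> g = b [^]\<^bsub>L\<^esub> k \<otimes>\<^bsub>L\<^esub> (a [^]\<^bsub>L\<^esub> k \<otimes>\<^bsub>L\<^esub> g)" using ac gc gab(2) by (simp add: L.m_assoc)
    then show ?thesis using akg gab(2) by simp
  qed
  obtain k' where k': "k = Suc k'" using kb(1) by (cases k) auto
  have fak: "f \<otimes>\<^bsub>L\<^esub> a [^]\<^bsub>L\<^esub> k = a [^]\<^bsub>L\<^esub> k" "a [^]\<^bsub>L\<^esub> k \<otimes>\<^bsub>L\<^esub> f = a [^]\<^bsub>L\<^esub> k"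
    "f \<otimes>\<^bsub>L\<^esub> b [^]\<^bsub>L\<^esub> k = b [^]\<^bsub>L\<^esub> k" "b [^]\<^bsub>L\<^esub> k \<otimes>\<^bsub>L\<^esub> f = b [^]\<^bsub>L\<^esub> k"
  proof -
    have *: "f \<otimes>\<^bsub>L\<^esub> u [^]\<^bsub>L\<^esub> k = u [^]\<^bsub>L\<^esub> k" "u [^]\<^bsub>L\<^esub> k \<otimes>\<^bsub>L\<^esub> f = u [^]\<^bsub>L\<^esub> k" if "u \<in> Corner f" for u
    proof -
      have u: "u \<in> carrier L" "f \<otimes>\<^bsub>L\<^esub> u = u" "u \<otimes>\<^bsub>L\<^esub> f = u" using that by (auto simp: CI)
      show "u [^]\<^bsub>L\<^esub> k \<otimes>\<^bsub>L\<^esub> f = u [^]\<^bsub>L\<^esub> k" using u fc by (simp add: k' L.m_assoc)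
      have "f \<otimes>\<^bsub>L\<^esub> (u \<otimes>\<^bsub>L\<^esub> u [^]\<^bsub>L\<^esub> k') = u \<otimes>\<^bsub>L\<^esub> u [^]\<^bsub>L\<^esub> k'" using u fc by (simp flip: L.m_assoc)
      then show "f \<otimes>\<^bsub>L\<^esub> u [^]\<^bsub>L\<^esub> k = u [^]\<^bsub>L\<^esub> k" using u L.nat_pow_Suc2[of u k'] by (simp add: k' del: L.nat_pow_Suc)
    qed
    show "f \<otimes>\<^bsub>L\<^esub> a [^]\<^bsub>L\<^esub> k = a [^]\<^bsub>L\<^esub> k" "a [^]\<^bsub>L\<^esub> k \<otimes>\<^bsub>L\<^esub> f = a [^]\<^bsub>L\<^esub> k"
      "f \<otimes>\<^bsub>L\<^esub> b [^]\<^bsub>L\<^esub> k = b [^]\<^bsub>L\<^esub> k" "b [^]\<^bsub>L\<^esub> k \<otimes>\<^bsub>L\<^esub> f = b [^]\<^bsub>L\<^esub> k" using * a kb(2) by auto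
  qed
  have fg: "f \<otimes>\<^bsub>L\<^esub> g = g"
    unfolding gab(1) using fak(1) ac fc by (simp flip: L.m_assoc)
  have gf: "g \<otimes>\<^bsub>L\<^esub> f = g"
    unfolding gab(1) using fak(4) ac fc by (simp add: L.m_assoc)
  show ?thesis
  proof (cases "g = \<zero>\<^bsub>L\<^esub>")
    case True
    then have "a [^]\<^bsub>L\<^esub> k = \<zero>\<^bsub>L\<^esub>" using akg ac by simp
    then show ?thesis by blast
  next
    case False
    have g: "g = f"
      by (rule primitive_eq[OF f _ fg gf False]) (use gc gg in \<open>simp add: idempotent_def\<close>)
    define c where "c = a [^]\<^bsub>L\<^esub> k' \<otimes>\<^bsub>L\<^esub> b [^]\<^bsub>L\<^esub> k"
    have cc: "c \<in> carrier L" using ac by (simp add: c_def)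
    have ac1: "a \<otimes>\<^bsub>L\<^esub> c = f"
    proof -
      have "a \<otimes>\<^bsub>L\<^esub> c = a [^]\<^bsub>L\<^esub> k \<otimes>\<^bsub>L\<^esub> b [^]\<^bsub>L\<^esub> k"
        using ac L.nat_pow_Suc2[of a k'] by (simp add: c_def k' L.m_assoc del: L.nat_pow_Suc)
      then show ?thesis using gab(1) g by simp
    qed
    have ca1: "c \<otimes>\<^bsub>L\<^esub> a = f"
    proof -
      have "b [^]\<^bsub>L\<^esub> k \<otimes>\<^bsub>L\<^esub> a = a \<otimes>\<^bsub>L\<^esub> b [^]\<^bsub>L\<^esub> k"
        using L.group_commutes_pow[of b a k] ac kb(3) by simp
      then have "c \<otimes>\<^bsub>L\<^esub> a = a [^]\<^bsub>L\<^esub> k' \<otimes>\<^bsub>L\<^esub> a \<otimes>\<^bsub>L\<^esub> b [^]\<^bsub>L\<^esub> k" using ac by (simp add: c_def L.m_assoc)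
      then show ?thesis using gab(1) g by (simp add: k')
    qed
    \<comment> \<open>Compression by \<open>f\<close> brings the inverse into the corner and does
      not change its products with \<open>a\<close>.\<close>
    have "f \<otimes>\<^bsub>L\<^esub> c \<otimes>\<^bsub>L\<^esub> f \<in> Corner f" using cc by (auto simp: Corner_def)
    moreover have "a \<otimes>\<^bsub>L\<^esub> (f \<otimes>\<^bsub>L\<^esub> c \<otimes>\<^bsub>L\<^esub> f) = f"
    proof -
      have "a \<otimes>\<^bsub>L\<^esub> (f \<otimes>\<^bsub>L\<^esub> c \<otimes>\<^bsub>L\<^esub> f) = (a \<otimes>\<^bsub>L\<^esub> f) \<otimes>\<^bsub>L\<^esub> c \<otimes>\<^bsub>L\<^esub> f" using ac cc fc by (simp add: L.m_assoc)
      then show ?thesis using a ac1 fc by (simp add: CI)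
    qed
    moreover have "(f \<otimes>\<^bsub>L\<^esub> c \<otimes>\<^bsub>L\<^esub> f) \<otimes>\<^bsub>L\<^esub> a = f"
    proof -
      have "(f \<otimes>\<^bsub>L\<^esub> c \<otimes>\<^bsub>L\<^esub> f) \<otimes>\<^bsub>L\<^esub> a = f \<otimes>\<^bsub>L\<^esub> (c \<otimes>\<^bsub>L\<^esub> (f \<otimes>\<^bsub>L\<^esub> a))" using ac cc fc by (simp add: L.m_assoc)
      then show ?thesis using a ca1 fc by (simp add: CI)
    qed
    ultimately show ?thesis by blast
  qed
qed

text \<open>
  If \<open>a\<close> is not a unit of the local ring \<open>f L f\<close>, neither is \<open>a f z f\<close>, so it is nilpotent; hence so
  is \<open>z a\<close>.
\<close>

lemma corner_unit:
  assumes f: "primitive_idempotent L f" and a: "a \<in> Corner f" "a \<notin> jacobson L"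
  shows "\<exists>c\<in>Corner f. a \<otimes>\<^bsub>L\<^esub> c = f \<and> c \<otimes>\<^bsub>L\<^esub> a = f"
proof (rule ccontr)
  assume nu: "\<not> (\<exists>c\<in>Corner f. a \<otimes>\<^bsub>L\<^esub> c = f \<and> c \<otimes>\<^bsub>L\<^esub> a = f)"
  have fi: "idempotent L f" and f0: "f \<noteq> \<zero>\<^bsub>L\<^esub>" using f by (auto simp: primitive_idempotent_def)
  have fc: "f \<in> carrier L" "f \<otimes>\<^bsub>L\<^esub> f = f" using fi by (auto simp: idempotent_def)
  note CI = Corner_iff[OF fi]
  have aC: "a \<in> carrier L" "f \<otimes>\<^bsub>L\<^esub> a = a" "a \<otimes>\<^bsub>L\<^esub> f = a" using a by (auto simp: CI)
  obtain m :: nat where m: "a [^]\<^bsub>L\<^esub> m = \<zero>\<^bsub>L\<^esub>"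
    using corner_nilpotent_or_unit[OF f a(1)] nu by blast
  \<comment> \<open>A one-sided inverse is already impossible: it would give
    \<open>f a^l r^l = f\<close> for all \<open>l\<close>, against the nilpotency of
    \<open>a\<close>.\<close>
  have noright: "a \<otimes>\<^bsub>L\<^esub> r \<noteq> f" if r: "r \<in> Corner f" for r
  proof
    assume ar: "a \<otimes>\<^bsub>L\<^esub> r = f"
    have rC: "r \<in> carrier L" "f \<otimes>\<^bsub>L\<^esub> r = r" using r by (auto simp: CI)
    have "f \<otimes>\<^bsub>L\<^esub> (a [^]\<^bsub>L\<^esub> l \<otimes>\<^bsub>L\<^esub> r [^]\<^bsub>L\<^esub> l) = f" for l :: nat
    proof (induction l)
      case 0
      then show ?case using fc by simp
    next
      case (Suc l)
      have "f \<otimes>\<^bsub>L\<^esub> (a [^]\<^bsub>L\<^esub> Suc l \<otimes>\<^bsub>L\<^esub> r [^]\<^bsub>L\<^esub> Suc l) = f \<otimes>\<^bsub>L\<^esub> (a [^]\<^bsub>L\<^esub> l \<otimes>\<^bsub>L\<^esub> ((a \<otimes>\<^bsub>L\<^esub> r) \<otimes>\<^bsub>L\<^esub> r [^]\<^bsub>L\<^esub> l))"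
        using aC rC fc L.nat_pow_Suc2[of r l] by (simp add: L.m_assoc)
      also have "\<dots> = f \<otimes>\<^bsub>L\<^esub> (a [^]\<^bsub>L\<^esub> l \<otimes>\<^bsub>L\<^esub> f \<otimes>\<^bsub>L\<^esub> r [^]\<^bsub>L\<^esub> l)"
        using ar aC rC fc by (simp add: L.m_assoc)
      also have "a [^]\<^bsub>L\<^esub> l \<otimes>\<^bsub>L\<^esub> f = f \<otimes>\<^bsub>L\<^esub> a [^]\<^bsub>L\<^esub> l"
        using L.group_commutes_pow[of a f l] aC fc by simp
      also have "f \<otimes>\<^bsub>L\<^esub> (f \<otimes>\<^bsub>L\<^esub> a [^]\<^bsub>L\<^esub> l \<otimes>\<^bsub>L\<^esub> r [^]\<^bsub>L\<^esub> l) = (f \<otimes>\<^bsub>L\<^esub> f) \<otimes>\<^bsub>L\<^esub> (a [^]\<^bsub>L\<^esub> l \<otimes>\<^bsub>L\<^esub> r [^]\<^bsub>L\<^esub> l)"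
        using aC(1) rC(1) fc(1) by (simp add: L.m_assoc)
      finally show ?case using Suc fc by simp
    qed
    from this[of m] show False using m rC fc f0 by simp
  qed
  have "\<exists>l::nat. (z \<otimes>\<^bsub>L\<^esub> a) [^]\<^bsub>L\<^esub> l = \<zero>\<^bsub>L\<^esub>" if z: "z \<in> carrier L" for z
  proof -
    have w: "f \<otimes>\<^bsub>L\<^esub> z \<otimes>\<^bsub>L\<^esub> f \<in> Corner f" using z by (auto simp: Corner_def)
    have azf: "a \<otimes>\<^bsub>L\<^esub> (f \<otimes>\<^bsub>L\<^esub> z \<otimes>\<^bsub>L\<^esub> f) = a \<otimes>\<^bsub>L\<^esub> (z \<otimes>\<^bsub>L\<^esub> f)"
    proof -
      have "a \<otimes>\<^bsub>L\<^esub> (f \<otimes>\<^bsub>L\<^esub> z \<otimes>\<^bsub>L\<^esub> f) = (a \<otimes>\<^bsub>L\<^esub> f) \<otimes>\<^bsub>L\<^esub> (z \<otimes>\<^bsub>L\<^esub> f)" using aC(1) fc(1) z by (simp add: L.m_assoc)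
      then show ?thesis using aC by simp
    qed
    have aw: "a \<otimes>\<^bsub>L\<^esub> (z \<otimes>\<^bsub>L\<^esub> f) \<in> Corner f"
    proof -
      have "f \<otimes>\<^bsub>L\<^esub> (a \<otimes>\<^bsub>L\<^esub> (z \<otimes>\<^bsub>L\<^esub> f)) = a \<otimes>\<^bsub>L\<^esub> (z \<otimes>\<^bsub>L\<^esub> f)" using aC fc z by (simp flip: L.m_assoc)
      then show ?thesis using aC fc z by (simp add: CI L.m_assoc)
    qed
    have "\<not> (\<exists>c\<in>Corner f. (a \<otimes>\<^bsub>L\<^esub> (z \<otimes>\<^bsub>L\<^esub> f)) \<otimes>\<^bsub>L\<^esub> c = f)"
    proof
      assume "\<exists>c\<in>Corner f. (a \<otimes>\<^bsub>L\<^esub> (z \<otimes>\<^bsub>L\<^esub> f)) \<otimes>\<^bsub>L\<^esub> c = f"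
      then obtain c where c: "c \<in> Corner f" "(a \<otimes>\<^bsub>L\<^esub> (f \<otimes>\<^bsub>L\<^esub> z \<otimes>\<^bsub>L\<^esub> f)) \<otimes>\<^bsub>L\<^esub> c = f" unfolding azf by auto
      have "(f \<otimes>\<^bsub>L\<^esub> z \<otimes>\<^bsub>L\<^esub> f) \<otimes>\<^bsub>L\<^esub> c \<in> Corner f"
      proof -
        have wC: "f \<otimes>\<^bsub>L\<^esub> z \<otimes>\<^bsub>L\<^esub> f \<in> carrier L" "f \<otimes>\<^bsub>L\<^esub> (f \<otimes>\<^bsub>L\<^esub> z \<otimes>\<^bsub>L\<^esub> f) = f \<otimes>\<^bsub>L\<^esub> z \<otimes>\<^bsub>L\<^esub> f" using w by (auto simp: CI)
        have cC: "c \<in> carrier L" "c \<otimes>\<^bsub>L\<^esub> f = c" using c by (auto simp: CI)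
        have "f \<otimes>\<^bsub>L\<^esub> ((f \<otimes>\<^bsub>L\<^esub> z \<otimes>\<^bsub>L\<^esub> f) \<otimes>\<^bsub>L\<^esub> c) = (f \<otimes>\<^bsub>L\<^esub> z \<otimes>\<^bsub>L\<^esub> f) \<otimes>\<^bsub>L\<^esub> c"
          using L.m_assoc[OF fc(1) wC(1) cC(1)] wC by simp
        moreover have "(f \<otimes>\<^bsub>L\<^esub> z \<otimes>\<^bsub>L\<^esub> f) \<otimes>\<^bsub>L\<^esub> c \<otimes>\<^bsub>L\<^esub> f = (f \<otimes>\<^bsub>L\<^esub> z \<otimes>\<^bsub>L\<^esub> f) \<otimes>\<^bsub>L\<^esub> c"
          using L.m_assoc[OF wC(1) cC(1) fc(1)] cC by simp
        ultimately show ?thesis using wC(1) cC(1) by (simp add: CI)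
      qed
      moreover have "a \<otimes>\<^bsub>L\<^esub> ((f \<otimes>\<^bsub>L\<^esub> z \<otimes>\<^bsub>L\<^esub> f) \<otimes>\<^bsub>L\<^esub> c) = f"
        using c w aC(1) by (simp add: L.m_assoc[symmetric] CI)
      ultimately show False using noright by blast
    qed
    then obtain l :: nat where l: "(a \<otimes>\<^bsub>L\<^esub> (z \<otimes>\<^bsub>L\<^esub> f)) [^]\<^bsub>L\<^esub> l = \<zero>\<^bsub>L\<^esub>"
      using corner_nilpotent_or_unit[OF f aw] by blast
    have "z \<otimes>\<^bsub>L\<^esub> a = (z \<otimes>\<^bsub>L\<^esub> f) \<otimes>\<^bsub>L\<^esub> a" using z aC fc by (simp add: L.m_assoc)
    then have "(z \<otimes>\<^bsub>L\<^esub> a) [^]\<^bsub>L\<^esub> Suc l = (z \<otimes>\<^bsub>L\<^esub> f) \<otimes>\<^bsub>L\<^esub> ((a \<otimes>\<^bsub>L\<^esub> (z \<otimes>\<^bsub>L\<^esub> f)) [^]\<^bsub>L\<^esub> l \<otimes>\<^bsub>L\<^esub> a)"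
      using L.pow_swap[of "z \<otimes>\<^bsub>L\<^esub> f" a l] z aC fc by simp
    also have "\<dots> = \<zero>\<^bsub>L\<^esub>" using l z aC fc by simp
    finally show ?thesis by blast
  qed
  then show False using nil_left_ideal_in_jacobson[OF aC(1)] a(2) by blast
qed

lemma Pmod_carrier: "carrier (Pmod L f) = {y \<otimes>\<^bsub>L\<^esub> f | y. y \<in> carrier L}"
  by (simp add: Pmod_def)

lemma Pmod_simps [simp]:
  "zero (Pmod L f) = \<zero>\<^bsub>L\<^esub>" "add (Pmod L f) = add L" "smult (Pmod L f) = mult L"
  by (simp_all add: Pmod_def)

lemma Pmod_iff:
  assumes "idempotent L f"
  shows "y \<in> carrier (Pmod L f) \<longleftrightarrow> y \<in> carrier L \<and> y \<otimes>\<^bsub>L\<^esub> f = y"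
  using assms by (auto simp: Pmod_carrier idempotent_def L.m_assoc intro!: exI[of _ y])

lemma idem: "i \<in> {1..t} \<Longrightarrow> idempotent L (e i)"
  using primitive by (auto simp: primitive_idempotent_def)

lemma e_closed [simp]: "i \<in> {1..t} \<Longrightarrow> e i \<in> carrier L"
  and e_idem [simp]: "i \<in> {1..t} \<Longrightarrow> e i \<otimes>\<^bsub>L\<^esub> e i = e i"
  and e_nonzero: "i \<in> {1..t} \<Longrightarrow> e i \<noteq> \<zero>\<^bsub>L\<^esub>"
  using primitive by (auto simp: primitive_idempotent_def idempotent_def)

text \<open>This is where basicness enters. If \<open>a = e_g y e_h\<close> is outside the radical,
  some \<open>e_h z a\<close> is not nilpotent and so invertible in the local corner at
  \<open>h\<close>. This yields \<open>w\<close> with \<open>w a = e_h\<close> and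
  \<open>a w = e_g\<close>, and right multiplication by \<open>a\<close> identifies two projectives
  that are not isomorphic.\<close>

lemma off_diagonal_jacobson:
  assumes g: "g \<in> {1..t}" and h: "h \<in> {1..t}" and gh: "g \<noteq> h" and y: "y \<in> carrier L"
  shows "e g \<otimes>\<^bsub>L\<^esub> y \<otimes>\<^bsub>L\<^esub> e h \<in> jacobson L"
proof (rule ccontr)
  let ?a = "e g \<otimes>\<^bsub>L\<^esub> y \<otimes>\<^bsub>L\<^esub> e h"
  have ec: "e g \<in> carrier L" "e h \<in> carrier L" "e g \<otimes>\<^bsub>L\<^esub> e g = e g" "e h \<otimes>\<^bsub>L\<^esub> e h = e h"
    using g h by auto
  define a where "a = ?a"
  have ac: "a \<in> carrier L" using ec y by (simp add: a_def)
  have ga: "e g \<otimes>\<^bsub>L\<^esub> a = a" using ec y by (simp add: a_def flip: L.m_assoc)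
  have ah: "a \<otimes>\<^bsub>L\<^esub> e h = a" using ec y by (simp add: a_def L.m_assoc)
  assume "?a \<notin> jacobson L"
  then obtain z where z: "z \<in> carrier L" "\<And>l::nat. (z \<otimes>\<^bsub>L\<^esub> a) [^]\<^bsub>L\<^esub> l \<noteq> \<zero>\<^bsub>L\<^esub>"
    using nil_left_ideal_in_jacobson[OF ac] by (auto simp: a_def)
  define b where "b = e h \<otimes>\<^bsub>L\<^esub> (z \<otimes>\<^bsub>L\<^esub> a)"
  have bC: "b \<in> Corner (e h)"
    unfolding b_def Corner_def using z(1) ac ec ah
    by (intro CollectI exI[of _ "z \<otimes>\<^bsub>L\<^esub> a"]) (simp add: L.m_assoc)
  have bc: "b \<in> carrier L" using z(1) ac ec by (simp add: b_def)
  have bnil: "b [^]\<^bsub>L\<^esub> l \<noteq> \<zero>\<^bsub>L\<^esub>" for l :: nat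
  proof
    assume l: "b [^]\<^bsub>L\<^esub> l = \<zero>\<^bsub>L\<^esub>"
    have "z \<otimes>\<^bsub>L\<^esub> a = (z \<otimes>\<^bsub>L\<^esub> a) \<otimes>\<^bsub>L\<^esub> e h" using z(1) ac ec ah by (simp add: L.m_assoc)
    then have "(z \<otimes>\<^bsub>L\<^esub> a) [^]\<^bsub>L\<^esub> Suc l = (z \<otimes>\<^bsub>L\<^esub> a) \<otimes>\<^bsub>L\<^esub> (b [^]\<^bsub>L\<^esub> l \<otimes>\<^bsub>L\<^esub> e h)"
      using L.pow_swap[of "z \<otimes>\<^bsub>L\<^esub> a" "e h" l] z(1) ac ec by (simp add: b_def)
    also have "\<dots> = \<zero>\<^bsub>L\<^esub>" using l z(1) ac ec by simp
    finally show False using z(2)[of "Suc l"] by simp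
  qed
  obtain u where u: "u \<in> Corner (e h)" "u \<otimes>\<^bsub>L\<^esub> b = e h"
    using corner_nilpotent_or_unit[OF primitive[OF h] bC] bnil by blast
  have uc: "u \<in> carrier L" "e h \<otimes>\<^bsub>L\<^esub> u = u" "u \<otimes>\<^bsub>L\<^esub> e h = u" using u Corner_iff[OF idem[OF h]] by auto
  define w where "w = u \<otimes>\<^bsub>L\<^esub> (z \<otimes>\<^bsub>L\<^esub> e g)"
  have wc: "w \<in> carrier L" using uc z(1) ec by (simp add: w_def)
  have wg: "w \<otimes>\<^bsub>L\<^esub> e g = w" using uc(1) z(1) ec by (simp add: w_def L.m_assoc)
  have hw: "e h \<otimes>\<^bsub>L\<^esub> w = w" using uc z(1) ec by (simp add: w_def flip: L.m_assoc)
  have wa: "w \<otimes>\<^bsub>L\<^esub> a = e h"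
  proof -
    have "w \<otimes>\<^bsub>L\<^esub> a = u \<otimes>\<^bsub>L\<^esub> (z \<otimes>\<^bsub>L\<^esub> (e g \<otimes>\<^bsub>L\<^esub> a))" using uc(1) z(1) ec ac by (simp add: w_def L.m_assoc)
    also have "\<dots> = (u \<otimes>\<^bsub>L\<^esub> e h) \<otimes>\<^bsub>L\<^esub> (z \<otimes>\<^bsub>L\<^esub> a)" using ga uc(3) by simp
    also have "\<dots> = u \<otimes>\<^bsub>L\<^esub> b" using uc(1) z(1) ec ac by (simp add: b_def L.m_assoc)
    finally show ?thesis using u by simp
  qed
  \<comment> \<open>\<open>a w\<close> is an idempotent below \<open>e g\<close>, so primitivity
    makes it \<open>e g\<close> unless it is zero; but \<open>e h\<close> equals
    \<open>w (a w) a\<close>.\<close>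
  have aw: "a \<otimes>\<^bsub>L\<^esub> w = e g"
  proof (rule primitive_eq[OF primitive[OF g]])
    have "(a \<otimes>\<^bsub>L\<^esub> w) \<otimes>\<^bsub>L\<^esub> (a \<otimes>\<^bsub>L\<^esub> w) = a \<otimes>\<^bsub>L\<^esub> ((w \<otimes>\<^bsub>L\<^esub> a) \<otimes>\<^bsub>L\<^esub> w)" using ac wc by (simp add: L.m_assoc)
    then show "idempotent L (a \<otimes>\<^bsub>L\<^esub> w)" using ac wc wa hw by (simp add: idempotent_def)
    show "e g \<otimes>\<^bsub>L\<^esub> (a \<otimes>\<^bsub>L\<^esub> w) = a \<otimes>\<^bsub>L\<^esub> w" using ga ac wc ec by (simp flip: L.m_assoc)
    show "a \<otimes>\<^bsub>L\<^esub> w \<otimes>\<^bsub>L\<^esub> e g = a \<otimes>\<^bsub>L\<^esub> w" using wg ac wc ec by (simp add: L.m_assoc)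
    show "a \<otimes>\<^bsub>L\<^esub> w \<noteq> \<zero>\<^bsub>L\<^esub>"
    proof
      assume 0: "a \<otimes>\<^bsub>L\<^esub> w = \<zero>\<^bsub>L\<^esub>"
      have "e h = (w \<otimes>\<^bsub>L\<^esub> a) \<otimes>\<^bsub>L\<^esub> (w \<otimes>\<^bsub>L\<^esub> a)" using wa ec by simp
      also have "\<dots> = w \<otimes>\<^bsub>L\<^esub> ((a \<otimes>\<^bsub>L\<^esub> w) \<otimes>\<^bsub>L\<^esub> a)" using ac wc by (simp add: L.m_assoc)
      finally show False using 0 ac wc e_nonzero[OF h] by simp
    qed
  qed
  have "(\<lambda>y. y \<otimes>\<^bsub>L\<^esub> a) \<in> semilinear_iso L (\<lambda>a. a) (Pmod L (e g)) (Pmod L (e h))"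
    unfolding semilinear_iso_def
  proof (intro CollectI conjI ballI)
    show "bij_betw (\<lambda>y. y \<otimes>\<^bsub>L\<^esub> a) (carrier (Pmod L (e g))) (carrier (Pmod L (e h)))"
      by (rule bij_betw_byWitness[where f' = "\<lambda>y. y \<otimes>\<^bsub>L\<^esub> w"])
        (use ac wc ec ah wg wa aw in \<open>auto simp: Pmod_iff[OF idem[OF g]] Pmod_iff[OF idem[OF h]] L.m_assoc\<close>)
  qed (use ac in \<open>auto simp: Pmod_iff[OF idem[OF g]] L.l_distr L.m_assoc\<close>)
  then show False using basic[OF g h gh] by (auto simp: mod_isomorphic_def)
qed

end

section \<open>Residue division algebras and terminal bimodules\<close>

text \<open>Independent lists inside \<open>N\<close> have bounded length by the exchange lemma, and
  one of maximal length spans \<open>N\<close>.\<close>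

lemma (in left_vector_space) ex_basis_submodule:
  assumes "list_basis R M xs" "submodule N R M"
  shows "\<exists>ys. lindep_free R M ys \<and> set ys \<subseteq> N \<and> lspan R M ys = N"
proof -
  note N = submoduleD[OF assms(2)]
  let ?P = "\<lambda>l. \<exists>ys. lindep_free R M ys \<and> set ys \<subseteq> N \<and> length ys = l"
  have bd: "l \<le> length xs" if "?P l" for l
    using that steinitz[of _ xs] assms(1) N(1) by (auto simp: list_basis_def)
  have "?P 0" by (intro exI[of _ "[]"]) auto
  then have g: "?P (Greatest ?P)" by (rule GreatestI_nat[where b = "length xs"]) (rule bd)
  define l where "l = Greatest ?P"
  have l: "l' \<le> l" if "?P l'" for l'
    unfolding l_def using that by (rule Greatest_le_nat[where b = "length xs"]) (rule bd)
  from g have "?P l" by (simp only: l_def)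
  then obtain ys where ys: "lindep_free R M ys" "set ys \<subseteq> N" "length ys = l" by auto
  have "y \<in> lspan R M ys" if y: "y \<in> N" for y
  proof (rule ccontr)
    assume "y \<notin> lspan R M ys"
    then have "?P (Suc l)" using ys y by (intro exI[of _ "y # ys"]) simp
    then show False using l[of "Suc l"] by simp
  qed
  then show ?thesis using ys lspan_least[OF assms(2) ys(2)] by blast
qed

lemma lspan_image:
  assumes "lmodule R M" "lmodule R N" "\<And>x. x \<in> carrier M \<Longrightarrow> f x \<in> carrier N"
    "\<And>x y. \<lbrakk>x \<in> carrier M; y \<in> carrier M\<rbrakk> \<Longrightarrow> f (x \<oplus>\<^bsub>M\<^esub> y) = f x \<oplus>\<^bsub>N\<^esub> f y"
    "\<And>a x. \<lbrakk>a \<in> carrier R; x \<in> carrier M\<rbrakk> \<Longrightarrow> f (a \<odot>\<^bsub>M\<^esub> x) = a \<odot>\<^bsub>N\<^esub> f x"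
    "set xs \<subseteq> carrier M"
  shows "f ` lspan R M xs = lspan R N (map f xs)"
proof -
  interpret M: lmodule R M by fact
  interpret N: lmodule R N by fact
  have f0: "f \<zero>\<^bsub>M\<^esub> = \<zero>\<^bsub>N\<^esub>"
    using assms(5)[of "\<zero>\<^bsub>R\<^esub>" "\<zero>\<^bsub>M\<^esub>"] assms(3)[of "\<zero>\<^bsub>M\<^esub>"] by simp
  have "f (lincomb M cs xs) = lincomb N cs (map f xs)" if "cs \<in> coeffs R xs" for cs
    using assms(6) that
  proof (induction xs arbitrary: cs)
    case (Cons x xs)
    then obtain d ds where "cs = d # ds" "d \<in> carrier R" "ds \<in> coeffs R xs" by (auto simp: coeffs_Cons)
    then show ?case using Cons by (simp add: assms(4,5))
  qed (simp add: f0)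
  moreover have "coeffs R (map f xs) = coeffs R xs" by (simp add: coeffs_def)
  ultimately show ?thesis by (auto simp: lspan_def image_image intro!: image_cong)
qed

section \<open>Residue division algebras of the corners\<close>

context basic_algebra
begin

abbreviation J where "J \<equiv> jacobson L"

lemmas J_ideal = ideal.I_l_closed[OF jacobson_ideal] ideal.I_r_closed[OF jacobson_ideal]

lemma J_carrier: "x \<in> J \<Longrightarrow> x \<in> carrier L"
  using jacobson_carrier by auto

lemma J_submodule: "submodule J K L"
proof -
  interpret V: left_vector_space K L by (rule vs_KL)
  show ?thesis
  proof (rule V.submoduleI)
    show "\<zero>\<^bsub>L\<^esub> \<in> J" "\<And>x y. \<lbrakk>x \<in> J; y \<in> J\<rbrakk> \<Longrightarrow> x \<oplus>\<^bsub>L\<^esub> y \<in> J"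
      using additive_subgroup.zero_closed[OF ideal.axioms(1)[OF jacobson_ideal]]
        additive_subgroup.a_closed[OF ideal.axioms(1)[OF jacobson_ideal]] by auto
    fix c x assume c: "c \<in> carrier K" and x: "x \<in> J"
    have "(c \<odot>\<^bsub>L\<^esub> \<one>\<^bsub>L\<^esub>) \<otimes>\<^bsub>L\<^esub> x = c \<odot>\<^bsub>L\<^esub> x" using smult_mult_left[of c "\<one>\<^bsub>L\<^esub>" x] c J_carrier[OF x] by simp
    then show "c \<odot>\<^bsub>L\<^esub> x \<in> J" using J_ideal(1)[OF x, of "c \<odot>\<^bsub>L\<^esub> \<one>\<^bsub>L\<^esub>"] c by simp
  qed (rule jacobson_carrier)
qed

definition rad :: "nat \<Rightarrow> 'a set" where
  "rad i = {e i \<otimes>\<^bsub>L\<^esub> y \<otimes>\<^bsub>L\<^esub> e i | y. y \<in> J}"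

lemma rad_iff: "i \<in> {1..t} \<Longrightarrow> a \<in> rad i \<longleftrightarrow> a \<in> Corner (e i) \<and> a \<in> J"
proof
  assume i: "i \<in> {1..t}" and "a \<in> rad i"
  then obtain y where "y \<in> J" "a = e i \<otimes>\<^bsub>L\<^esub> y \<otimes>\<^bsub>L\<^esub> e i" by (auto simp: rad_def)
  then show "a \<in> Corner (e i) \<and> a \<in> J"
    using i J_ideal J_carrier e_closed by (auto simp: Corner_def)
next
  assume i: "i \<in> {1..t}" and "a \<in> Corner (e i) \<and> a \<in> J"
  then show "a \<in> rad i" unfolding rad_def
    by (intro CollectI exI[of _ a]) (simp add: Corner_iff[OF idem])
qed

lemma corner_simps [simp]:
  "carrier (corner L f) = Corner f" "mult (corner L f) = mult L" "one (corner L f) = f"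
  "zero (corner L f) = \<zero>\<^bsub>L\<^esub>" "add (corner L f) = add L" "smult (corner L f) = smult L"
  by (simp_all add: corner_def Corner_def)

lemma Corner_closed:
  assumes "i \<in> {1..t}" "a \<in> Corner (e i)" "b \<in> Corner (e i)"
  shows "a \<oplus>\<^bsub>L\<^esub> b \<in> Corner (e i)" "a \<otimes>\<^bsub>L\<^esub> b \<in> Corner (e i)"
    "a \<ominus>\<^bsub>L\<^esub> b \<in> Corner (e i)"
proof -
  note CI = Corner_iff[OF idem[OF assms(1)]]
  have e: "e i \<in> carrier L" using assms(1) by simp
  have a: "a \<in> carrier L" "e i \<otimes>\<^bsub>L\<^esub> a = a" "a \<otimes>\<^bsub>L\<^esub> e i = a"
    and b: "b \<in> carrier L" "e i \<otimes>\<^bsub>L\<^esub> b = b" "b \<otimes>\<^bsub>L\<^esub> e i = b" using assms CI by auto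
  show "a \<oplus>\<^bsub>L\<^esub> b \<in> Corner (e i)" using a b e by (simp add: CI L.r_distr L.l_distr)
  have "e i \<otimes>\<^bsub>L\<^esub> (a \<otimes>\<^bsub>L\<^esub> b) = a \<otimes>\<^bsub>L\<^esub> b" using a b(1) e by (simp flip: L.m_assoc)
  then show "a \<otimes>\<^bsub>L\<^esub> b \<in> Corner (e i)" using a b e by (simp add: CI L.m_assoc)
  show "a \<ominus>\<^bsub>L\<^esub> b \<in> Corner (e i)"
    using a b e by (simp add: CI a_minus_def L.r_distr L.l_distr L.r_minus L.l_minus)
qed

lemma Corner_smult_closed:
  "\<lbrakk>i \<in> {1..t}; a \<in> Corner (e i); c \<in> carrier K\<rbrakk> \<Longrightarrow> c \<odot>\<^bsub>L\<^esub> a \<in> Corner (e i)"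
  by (simp add: Corner_iff[OF idem] smult_mult_left smult_mult_right)

lemma Corner_unit [simp]: "i \<in> {1..t} \<Longrightarrow> e i \<in> Corner (e i)" "i \<in> {1..t} \<Longrightarrow> \<zero>\<^bsub>L\<^esub> \<in> Corner (e i)"
  by (simp_all add: Corner_iff[OF idem])

lemma Corner_carrier: "i \<in> {1..t} \<Longrightarrow> a \<in> Corner (e i) \<Longrightarrow> a \<in> carrier L"
  by (simp add: Corner_iff[OF idem])

lemma corner_lmodule:
  assumes i: "i \<in> {1..t}"
  shows "lmodule K (corner L (e i))"
proof (rule lmodule_transfer[where f = "\<lambda>x. x"])
  interpret V: left_vector_space K L by (rule vs_KL)
  show "lmodule K (L\<lparr>carrier := Corner (e i)\<rparr>)"
    by (intro V.submodule_lmodule V.submoduleI) (use i Corner_closed Corner_smult_closed Corner_carrier in auto)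
qed (auto simp: bij_betw_def)

lemma rad_submodule:
  assumes i: "i \<in> {1..t}"
  shows "submodule (rad i) K (corner L (e i))"
proof -
  interpret C: lmodule K "corner L (e i)" by (rule corner_lmodule[OF i])
  interpret V: left_vector_space K L by (rule vs_KL)
  note D = V.submoduleD[OF J_submodule]
  show ?thesis
    by (rule C.submoduleI) (use i D Corner_closed Corner_smult_closed in \<open>auto simp: rad_iff\<close>)
qed

text \<open>Negatives are taken relative to the carrier, so those of the corner have to be
  identified with those of \<open>L\<close>. \<open>Vleft_minus\<close> does the same for the
  bimodules.\<close>

lemma corner_minus:
  assumes i: "i \<in> {1..t}" "a \<in> Corner (e i)" "b \<in> Corner (e i)"
  shows "a \<ominus>\<^bsub>corner L (e i)\<^esub> b = a \<ominus>\<^bsub>L\<^esub> b"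
proof -
  interpret C: lmodule K "corner L (e i)" by (rule corner_lmodule[OF i(1)])
  have "\<ominus>\<^bsub>L\<^esub> b \<in> Corner (e i)" using Corner_closed(3)[OF i(1) Corner_unit(2)[OF i(1)] i(3)] Corner_carrier[OF i(1,3)]
    by (simp add: a_minus_def)
  then have "\<ominus>\<^bsub>corner L (e i)\<^esub> b = \<ominus>\<^bsub>L\<^esub> b"
    using C.M.minus_equality[of "\<ominus>\<^bsub>L\<^esub> b" b] i Corner_carrier[OF i(1,3)] by (simp add: L.l_neg)
  then show ?thesis by (simp add: a_minus_def)
qed

definition res :: "nat \<Rightarrow> 'a \<Rightarrow> 'a set" where
  "res i a = rad i +>\<^bsub>L\<^esub> a"

lemma res_mem: "x \<in> res i a \<longleftrightarrow> (\<exists>h\<in>rad i. x = h \<oplus>\<^bsub>L\<^esub> a)"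
  by (auto simp: res_def a_r_coset_def')

context
  fixes i assumes i: "i \<in> {1..t}"
begin

interpretation Q: quotient_module K "corner L (e i)" "rad i"
  by (intro quotient_module.intro quotient_module_axioms.intro corner_lmodule rad_submodule i)

lemma coset_corner: "rad i +>\<^bsub>corner L (e i)\<^esub> a = res i a"
  by (simp add: res_def a_r_coset_def')

lemma Dres_eq: "Dres L e i = quot_mod (corner L (e i)) (rad i)"
  by (simp add: Dres_def rad_def)

lemma res_eq_iff:
  assumes "a \<in> Corner (e i)" "b \<in> Corner (e i)"
  shows "res i a = res i b \<longleftrightarrow> a \<ominus>\<^bsub>L\<^esub> b \<in> J"
  using Q.coset_eq_iff[of a b] assms corner_minus[OF i assms] Corner_closed(3)[OF i assms]
  by (simp add: coset_corner rad_iff[OF i])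

lemma res_self: "a \<in> Corner (e i) \<Longrightarrow> a \<in> res i a"
  using Q.self_mem_coset[of a] by (simp add: coset_corner)

lemma Dres_carrier: "carrier (Dres L e i) = res i ` Corner (e i)"
  by (simp add: Dres_eq a_rcosets_eq coset_corner)

lemma Dres_one: "\<one>\<^bsub>Dres L e i\<^esub> = res i (e i)"
  by (simp add: Dres_eq coset_corner)

lemma Dres_zero: "\<zero>\<^bsub>Dres L e i\<^esub> = res i \<zero>\<^bsub>L\<^esub>"
  using Q.coset_zero_iff[of "\<zero>\<^bsub>L\<^esub>"] Q.sub(2) i by (simp add: Dres_eq coset_corner)

lemma Dres_add:
  "\<lbrakk>a \<in> Corner (e i); b \<in> Corner (e i)\<rbrakk> \<Longrightarrow> res i a \<oplus>\<^bsub>Dres L e i\<^esub> res i b = res i (a \<oplus>\<^bsub>L\<^esub> b)"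
  using Q.coset_add[of a b] by (simp add: Dres_eq coset_corner)

lemma Dres_smult:
  "\<lbrakk>c \<in> carrier K; a \<in> Corner (e i)\<rbrakk> \<Longrightarrow> c \<odot>\<^bsub>Dres L e i\<^esub> res i a = res i (c \<odot>\<^bsub>L\<^esub> a)"
  using Q.coset_smult[of c a] by (simp add: Dres_eq coset_corner)

text \<open>A product of cosets is defined as the union over all pairs of representatives. It
  collapses to one class because changing representatives alters the product by
  \<open>h y + a k\<close> with \<open>h\<close> and \<open>k\<close> in the radical.\<close>

lemma Dres_mult:
  assumes "a \<in> Corner (e i)" "b \<in> Corner (e i)"
  shows "res i a \<otimes>\<^bsub>Dres L e i\<^esub> res i b = res i (a \<otimes>\<^bsub>L\<^esub> b)"
proof -
  have "res i (x \<otimes>\<^bsub>L\<^esub> y) = res i (a \<otimes>\<^bsub>L\<^esub> b)" if xy: "x \<in> res i a" "y \<in> res i b" for x y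
  proof -
    obtain h k where hk: "h \<in> rad i" "k \<in> rad i" "x = h \<oplus>\<^bsub>L\<^esub> a" "y = k \<oplus>\<^bsub>L\<^esub> b"
      using xy by (auto simp: res_mem)
    have c: "h \<in> carrier L" "k \<in> carrier L" "a \<in> carrier L" "b \<in> carrier L" "h \<in> J" "k \<in> J"
      "h \<in> Corner (e i)" "k \<in> Corner (e i)"
      using hk assms Corner_carrier[OF i] by (auto simp: rad_iff[OF i])
    have xc: "x \<in> Corner (e i)" "y \<in> Corner (e i)" using hk c assms Corner_closed[OF i] by auto
    have "x \<otimes>\<^bsub>L\<^esub> y = h \<otimes>\<^bsub>L\<^esub> y \<oplus>\<^bsub>L\<^esub> (a \<otimes>\<^bsub>L\<^esub> k \<oplus>\<^bsub>L\<^esub> a \<otimes>\<^bsub>L\<^esub> b)"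
      using c by (simp add: hk L.l_distr L.r_distr L.a_ac)
    then have "x \<otimes>\<^bsub>L\<^esub> y \<ominus>\<^bsub>L\<^esub> a \<otimes>\<^bsub>L\<^esub> b = h \<otimes>\<^bsub>L\<^esub> y \<oplus>\<^bsub>L\<^esub> a \<otimes>\<^bsub>L\<^esub> k"
      using c Corner_carrier[OF i xc(2)] by (simp add: a_minus_def L.a_assoc L.r_neg)
    moreover have "h \<otimes>\<^bsub>L\<^esub> y \<in> J" "a \<otimes>\<^bsub>L\<^esub> k \<in> J"
      using J_ideal(2)[OF c(5)] J_ideal(1)[OF c(6)] c Corner_carrier[OF i xc(2)] by auto
    ultimately have "x \<otimes>\<^bsub>L\<^esub> y \<ominus>\<^bsub>L\<^esub> a \<otimes>\<^bsub>L\<^esub> b \<in> J"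
      using additive_subgroup.a_closed[OF ideal.axioms(1)[OF jacobson_ideal]] by simp
    then show ?thesis using res_eq_iff Corner_closed(2)[OF i] xc assms by simp
  qed
  then have "(\<Union>x\<in>res i a. \<Union>y\<in>res i b. res i (x \<otimes>\<^bsub>L\<^esub> y)) = res i (a \<otimes>\<^bsub>L\<^esub> b)"
    using res_self[OF assms(1)] res_self[OF assms(2)] by (intro equalityI UN_least) blast+
  then show ?thesis by (simp add: Dres_eq rcoset_mult_def coset_corner)
qed

lemma Dres_lmodule: "lmodule K (Dres L e i)"
  using Q.quot_lmodule by (simp add: Dres_eq)

lemma Dres_ring: "ring (Dres L e i)"
proof -
  interpret Dm: lmodule K "Dres L e i" by (rule Dres_lmodule)
  note cl = Corner_closed[OF i] Corner_smult_closed[OF i] Corner_carrier[OF i]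
  show ?thesis
  proof (rule ringI)
    show "abelian_group (Dres L e i)" by (rule Dm.M.abelian_group_axioms)
    show "monoid (Dres L e i)"
      by (rule monoidI)
        (use cl i in \<open>auto simp: Dres_carrier Dres_mult Dres_one L.m_assoc Corner_iff[OF idem[OF i]]\<close>)
  qed (use cl in \<open>auto simp: Dres_carrier Dres_mult Dres_add L.l_distr L.r_distr\<close>)
qed

lemma e_not_jacobson: "e i \<notin> J"
proof
  assume "e i \<in> J"
  then have "e i [^]\<^bsub>L\<^esub> n = \<zero>\<^bsub>L\<^esub>" using pow_mem_jpow[of "e i" n] jacobson_nilpotent by simp
  moreover have "e i [^]\<^bsub>L\<^esub> Suc m = e i" for m :: nat
    by (induction m) (use i in auto)
  moreover obtain n' where "n = Suc n'" using n_pos by (cases n) auto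
  ultimately show False using e_nonzero[OF i] by metis
qed

lemma res_eq_zero_iff: "a \<in> Corner (e i) \<Longrightarrow> res i a = \<zero>\<^bsub>Dres L e i\<^esub> \<longleftrightarrow> a \<in> J"
  unfolding Dres_zero using res_eq_iff[of a "\<zero>\<^bsub>L\<^esub>"] i Corner_carrier[OF i]
    L.minus_equality[of "\<zero>\<^bsub>L\<^esub>" "\<zero>\<^bsub>L\<^esub>"] by (simp add: a_minus_def)

text \<open>A representative of a nonzero class lies outside the radical and is therefore invertible
  in the corner itself, by \<open>corner_unit\<close>.\<close>

lemma Dres_division: "division_ring (Dres L e i)"
proof -
  interpret D: ring "Dres L e i" by (rule Dres_ring)
  have "X \<in> Units (Dres L e i) \<longleftrightarrow> X \<noteq> \<zero>\<^bsub>Dres L e i\<^esub>" if Xc: "X \<in> carrier (Dres L e i)" for X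
  proof
    assume "X \<noteq> \<zero>\<^bsub>Dres L e i\<^esub>"
    moreover obtain a where a: "a \<in> Corner (e i)" "X = res i a" using Xc by (auto simp: Dres_carrier)
    ultimately obtain c where c: "c \<in> Corner (e i)" "a \<otimes>\<^bsub>L\<^esub> c = e i" "c \<otimes>\<^bsub>L\<^esub> a = e i"
      using corner_unit[OF primitive[OF i]] res_eq_zero_iff by metis
    then have "res i c \<in> carrier (Dres L e i)" "X \<otimes>\<^bsub>Dres L e i\<^esub> res i c = \<one>\<^bsub>Dres L e i\<^esub>"
      "res i c \<otimes>\<^bsub>Dres L e i\<^esub> X = \<one>\<^bsub>Dres L e i\<^esub>"
      using a by (simp_all add: Dres_mult Dres_one Dres_carrier)
    then show "X \<in> Units (Dres L e i)" using Xc unfolding Units_def by blast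
  next
    assume X: "X \<in> Units (Dres L e i)"
    show "X \<noteq> \<zero>\<^bsub>Dres L e i\<^esub>"
    proof
      assume "X = \<zero>\<^bsub>Dres L e i\<^esub>"
      then have "\<one>\<^bsub>Dres L e i\<^esub> = \<zero>\<^bsub>Dres L e i\<^esub>" using X by (auto simp: Units_def)
      then show False using res_eq_zero_iff[of "e i"] e_not_jacobson i by (simp add: Dres_one)
    qed
  qed
  then show ?thesis using Dres_ring by (auto simp: division_ring_def Units_def)
qed

lemma Dres_division_algebra: "division_algebra K (Dres L e i)"
proof -
  interpret D: ring "Dres L e i" by (rule Dres_ring)
  interpret Dm: left_vector_space K "Dres L e i"
    by (intro left_vector_space.intro left_vector_space_axioms.intro Dres_lmodule K.division_ring)
  note cl = Corner_closed[OF i] Corner_smult_closed[OF i] Corner_carrier[OF i]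
  interpret M: module K "Dres L e i"
    by (intro module.intro module_axioms.intro K.is_cring lmodule.axioms(2)[OF Dres_lmodule] Dm.smult_closed
        Dm.smult_l_distr Dm.smult_r_distr Dm.smult_assoc1 Dm.smult_one)
  show ?thesis
  proof (unfold_locales)
    show "division_ring (Dres L e i)" by (rule Dres_division)
    obtain bs where bs: "list_basis K L bs" using ex_basis by auto
    have bsc: "set bs \<subseteq> carrier L" "lspan K L bs = carrier L" using bs by (auto simp: list_basis_def)
    \<comment> \<open>Compression to the corner followed by passage to residues is a linear
      surjection, so it maps a basis of \<open>L\<close> to a spanning list.\<close>
    let ?f = "\<lambda>x. res i (e i \<otimes>\<^bsub>L\<^esub> x \<otimes>\<^bsub>L\<^esub> e i)"
    have fc: "e i \<otimes>\<^bsub>L\<^esub> x \<otimes>\<^bsub>L\<^esub> e i \<in> Corner (e i)" if "x \<in> carrier L" for x using that by (auto simp: Corner_def)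
    have "?f ` lspan K L bs = lspan K (Dres L e i) (map ?f bs)"
      by (rule lspan_image[OF lmodule_KL Dres_lmodule _ _ _ bsc(1)])
        (use fc i in \<open>auto simp: Dres_carrier Dres_add Dres_smult L.l_distr L.r_distr smult_mult_left smult_mult_right\<close>)
    moreover have "?f ` carrier L = carrier (Dres L e i)"
      by (auto simp: Dres_carrier Corner_def)
    ultimately have "lspan K (Dres L e i) (map ?f bs) = carrier (Dres L e i)" using bsc(2) by simp
    then show "\<exists>bs. list_basis K (Dres L e i) bs"
      by (rule Dm.ex_basis_of_spanning) (use bsc(1) fc in \<open>auto simp: Dres_carrier\<close>)
  qed (use cl in \<open>auto simp: Dres_carrier Dres_mult Dres_smult smult_mult_left smult_mult_right\<close>)
qed

end

section \<open>The last layer and its two residue actions\<close>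

definition T where "T = jpow L (n - 1)"

lemma T_ideal: "ideal T L"
  unfolding T_def by (rule jpow_ideal)

lemma T_carrier: "x \<in> T \<Longrightarrow> x \<in> carrier L"
  by (rule ideal.Icarr[OF T_ideal])

lemma T_closed:
  shows "\<lbrakk>x \<in> T; y \<in> T\<rbrakk> \<Longrightarrow> x \<oplus>\<^bsub>L\<^esub> y \<in> T" and "\<zero>\<^bsub>L\<^esub> \<in> T"
    and "\<lbrakk>x \<in> T; y \<in> carrier L\<rbrakk> \<Longrightarrow> y \<otimes>\<^bsub>L\<^esub> x \<in> T"
    and "\<lbrakk>x \<in> T; y \<in> carrier L\<rbrakk> \<Longrightarrow> x \<otimes>\<^bsub>L\<^esub> y \<in> T"
     apply (erule (1) additive_subgroup.a_closed[OF ideal.axioms(1)[OF T_ideal]])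
    apply (rule additive_subgroup.zero_closed[OF ideal.axioms(1)[OF T_ideal]])
   apply (erule (1) ideal.I_l_closed[OF T_ideal])
  apply (erule (1) ideal.I_r_closed[OF T_ideal])
  done

text \<open>Both products lie in the power with exponent \<open>Suc (n - 1)\<close>, which is
  \<open>n\<close> because \<open>n\<close> is positive. Consequently the left and right actions on
  the layer depend only on residue classes.\<close>

lemma T_J:
  assumes "x \<in> T" "y \<in> J"
  shows "x \<otimes>\<^bsub>L\<^esub> y = \<zero>\<^bsub>L\<^esub>" "y \<otimes>\<^bsub>L\<^esub> x = \<zero>\<^bsub>L\<^esub>"
proof -
  have n: "jpow L (Suc (n - 1)) = {\<zero>\<^bsub>L\<^esub>}" using n_pos jacobson_nilpotent by (simp del: jpow.simps)
  show "x \<otimes>\<^bsub>L\<^esub> y = \<zero>\<^bsub>L\<^esub>" "y \<otimes>\<^bsub>L\<^esub> x = \<zero>\<^bsub>L\<^esub>"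
    using jpow_Suc_mem[OF assms[unfolded T_def]] jacobson_mult_jpow[OF assms(2) assms(1)[unfolded T_def]]
    unfolding n by simp_all
qed

lemma V_iff:
  assumes "i \<in> {1..t}" "j \<in> {1..t}"
  shows "v \<in> V L e n i j \<longleftrightarrow> v \<in> T \<and> e j \<otimes>\<^bsub>L\<^esub> v = v \<and> v \<otimes>\<^bsub>L\<^esub> e i = v"
proof
  have e: "e i \<in> carrier L" "e j \<in> carrier L" using assms by auto
  assume "v \<in> V L e n i j"
  then obtain x where x: "x \<in> T" "v = e j \<otimes>\<^bsub>L\<^esub> x \<otimes>\<^bsub>L\<^esub> e i" by (auto simp: V_def T_def)
  have "e j \<otimes>\<^bsub>L\<^esub> v = v" using x e assms T_carrier[OF x(1)] by (simp flip: L.m_assoc)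
  moreover have "v \<otimes>\<^bsub>L\<^esub> e i = v" using x e assms T_carrier[OF x(1)] by (simp add: L.m_assoc)
  moreover have "v \<in> T" using x e T_closed by simp
  ultimately show "v \<in> T \<and> e j \<otimes>\<^bsub>L\<^esub> v = v \<and> v \<otimes>\<^bsub>L\<^esub> e i = v" by simp
next
  assume "v \<in> T \<and> e j \<otimes>\<^bsub>L\<^esub> v = v \<and> v \<otimes>\<^bsub>L\<^esub> e i = v"
  then show "v \<in> V L e n i j" unfolding V_def T_def by (intro CollectI exI[of _ v]) auto
qed

lemma Vmod_simps [simp]:
  "carrier (Vright L e n i j) = V L e n i j" "zero (Vright L e n i j) = \<zero>\<^bsub>L\<^esub>" "add (Vright L e n i j) = add L"
  "carrier (Vleft L e n i j) = V L e n i j" "zero (Vleft L e n i j) = \<zero>\<^bsub>L\<^esub>" "add (Vleft L e n i j) = add L"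
  "carrier (Vscal L e n i j) = V L e n i j" "zero (Vscal L e n i j) = \<zero>\<^bsub>L\<^esub>" "add (Vscal L e n i j) = add L"
  "smult (Vscal L e n i j) = smult L"
  by (simp_all add: Vright_def Vleft_def Vscal_def)

context
  fixes i j assumes i: "i \<in> {1..t}" and j: "j \<in> {1..t}"
begin

lemma V_carrier: "v \<in> V L e n i j \<Longrightarrow> v \<in> carrier L"
  using V_iff[OF i j] T_carrier by auto

lemma V_closed:
  assumes "v \<in> V L e n i j"
  shows "w \<in> V L e n i j \<Longrightarrow> v \<oplus>\<^bsub>L\<^esub> w \<in> V L e n i j"
    "a \<in> Corner (e i) \<Longrightarrow> v \<otimes>\<^bsub>L\<^esub> a \<in> V L e n i j"
    "a \<in> Corner (e j) \<Longrightarrow> a \<otimes>\<^bsub>L\<^esub> v \<in> V L e n i j"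
    "c \<in> carrier K \<Longrightarrow> c \<odot>\<^bsub>L\<^esub> v \<in> V L e n i j"
    "\<ominus>\<^bsub>L\<^esub> v \<in> V L e n i j"
proof -
  have v: "v \<in> T" "e j \<otimes>\<^bsub>L\<^esub> v = v" "v \<otimes>\<^bsub>L\<^esub> e i = v" "v \<in> carrier L"
    using assms V_iff[OF i j] T_carrier by auto
  have e: "e i \<in> carrier L" "e j \<in> carrier L" using i j by auto
  show "w \<in> V L e n i j \<Longrightarrow> v \<oplus>\<^bsub>L\<^esub> w \<in> V L e n i j"
    using v e T_closed T_carrier by (simp add: V_iff[OF i j] L.l_distr L.r_distr)
  show c: "c \<odot>\<^bsub>L\<^esub> v \<in> V L e n i j" if c: "c \<in> carrier K" for c
  proof -
    have "(c \<odot>\<^bsub>L\<^esub> \<one>\<^bsub>L\<^esub>) \<otimes>\<^bsub>L\<^esub> v = c \<odot>\<^bsub>L\<^esub> v" using smult_mult_left[of c "\<one>\<^bsub>L\<^esub>" v] c v by simp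
    then have "c \<odot>\<^bsub>L\<^esub> v \<in> T" using T_closed(3)[OF v(1), of "c \<odot>\<^bsub>L\<^esub> \<one>\<^bsub>L\<^esub>"] c by simp
    then show ?thesis using v c e by (simp add: V_iff[OF i j] smult_mult_left smult_mult_right)
  qed
  show "v \<otimes>\<^bsub>L\<^esub> a \<in> V L e n i j" if "a \<in> Corner (e i)"
  proof -
    have a: "a \<in> carrier L" "a \<otimes>\<^bsub>L\<^esub> e i = a" using that by (auto simp: Corner_iff[OF idem[OF i]])
    have "e j \<otimes>\<^bsub>L\<^esub> (v \<otimes>\<^bsub>L\<^esub> a) = v \<otimes>\<^bsub>L\<^esub> a" using v a e by (simp flip: L.m_assoc)
    moreover have "v \<otimes>\<^bsub>L\<^esub> a \<otimes>\<^bsub>L\<^esub> e i = v \<otimes>\<^bsub>L\<^esub> a" using v(4) a e by (simp add: L.m_assoc)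
    ultimately show ?thesis using T_closed(4)[OF v(1) a(1)] by (simp add: V_iff[OF i j])
  qed
  show "a \<otimes>\<^bsub>L\<^esub> v \<in> V L e n i j" if "a \<in> Corner (e j)"
  proof -
    have a: "a \<in> carrier L" "e j \<otimes>\<^bsub>L\<^esub> a = a" using that by (auto simp: Corner_iff[OF idem[OF j]])
    have "e j \<otimes>\<^bsub>L\<^esub> (a \<otimes>\<^bsub>L\<^esub> v) = a \<otimes>\<^bsub>L\<^esub> v" using v(4) a e by (simp flip: L.m_assoc)
    moreover have "a \<otimes>\<^bsub>L\<^esub> v \<otimes>\<^bsub>L\<^esub> e i = a \<otimes>\<^bsub>L\<^esub> v" using v a e by (simp add: L.m_assoc)
    ultimately show ?thesis using T_closed(3)[OF v(1) a(1)] by (simp add: V_iff[OF i j])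
  qed
  have "\<ominus>\<^bsub>L\<^esub> v \<in> T" using T_closed(3)[OF v(1), of "\<ominus>\<^bsub>L\<^esub> \<one>\<^bsub>L\<^esub>"] v by (simp add: L.l_minus)
  then show "\<ominus>\<^bsub>L\<^esub> v \<in> V L e n i j"
    using v e by (simp add: V_iff[OF i j] L.l_minus L.r_minus)
qed

lemma zero_in_V: "\<zero>\<^bsub>L\<^esub> \<in> V L e n i j"
  using i j T_closed by (simp add: V_iff)

text \<open>Representatives differ by radical elements, which \<open>T_J\<close> kills; the image
  under multiplication is a singleton and \<open>the_elem\<close> returns its element.\<close>

lemma Vright_smult:
  assumes "a \<in> Corner (e i)" "v \<in> V L e n i j"
  shows "res i a \<odot>\<^bsub>Vright L e n i j\<^esub> v = v \<otimes>\<^bsub>L\<^esub> a"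
proof -
  have "v \<otimes>\<^bsub>L\<^esub> x = v \<otimes>\<^bsub>L\<^esub> a" if x: "x \<in> res i a" for x
  proof -
    obtain h where h: "h \<in> J" "x = h \<oplus>\<^bsub>L\<^esub> a" using x by (auto simp: res_mem rad_iff[OF i])
    then show ?thesis
      using T_J(1)[of v h] assms V_iff[OF i j] Corner_carrier[OF i] J_carrier[OF h(1)] V_carrier
      by (simp add: L.r_distr)
  qed
  then have "(\<lambda>x. v \<otimes>\<^bsub>L\<^esub> x) ` res i a = (\<lambda>x. v \<otimes>\<^bsub>L\<^esub> a) ` res i a" by (rule image_cong[OF refl])
  also have "\<dots> = {v \<otimes>\<^bsub>L\<^esub> a}" by (rule image_constant[OF res_self[OF i assms(1)]])
  finally have "(\<lambda>x. v \<otimes>\<^bsub>L\<^esub> x) ` res i a = {v \<otimes>\<^bsub>L\<^esub> a}" .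
  then show ?thesis by (simp add: Vright_def)
qed

lemma Vleft_smult:
  assumes "a \<in> Corner (e j)" "v \<in> V L e n i j"
  shows "res j a \<odot>\<^bsub>Vleft L e n i j\<^esub> v = a \<otimes>\<^bsub>L\<^esub> v"
proof -
  have "x \<otimes>\<^bsub>L\<^esub> v = a \<otimes>\<^bsub>L\<^esub> v" if x: "x \<in> res j a" for x
  proof -
    obtain h where h: "h \<in> J" "x = h \<oplus>\<^bsub>L\<^esub> a" using x by (auto simp: res_mem rad_iff[OF j])
    then show ?thesis
      using T_J(2)[of v h] assms V_iff[OF i j] Corner_carrier[OF j] J_carrier[OF h(1)] V_carrier
      by (simp add: L.l_distr)
  qed
  then have "(\<lambda>x. x \<otimes>\<^bsub>L\<^esub> v) ` res j a = (\<lambda>x. a \<otimes>\<^bsub>L\<^esub> v) ` res j a" by (rule image_cong[OF refl])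
  also have "\<dots> = {a \<otimes>\<^bsub>L\<^esub> v}" by (rule image_constant[OF res_self[OF j assms(1)]])
  finally have "(\<lambda>x. x \<otimes>\<^bsub>L\<^esub> v) ` res j a = {a \<otimes>\<^bsub>L\<^esub> v}" .
  then show ?thesis by (simp add: Vleft_def)
qed

lemma V_abelian:
  assumes "carrier M = V L e n i j" "zero M = \<zero>\<^bsub>L\<^esub>" "add M = add L"
  shows "abelian_group M"
proof (rule abelian_groupI)
  fix x assume "x \<in> carrier M"
  then have "\<ominus>\<^bsub>L\<^esub> x \<in> carrier M" "\<ominus>\<^bsub>L\<^esub> x \<oplus>\<^bsub>M\<^esub> x = \<zero>\<^bsub>M\<^esub>"
    using V_closed(5) V_carrier by (simp_all add: assms L.l_neg)
  then show "\<exists>y\<in>carrier M. y \<oplus>\<^bsub>M\<^esub> x = \<zero>\<^bsub>M\<^esub>" by blast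
qed (use assms zero_in_V V_closed(1) V_carrier in \<open>auto simp: L.a_ac\<close>)

lemma Vright_lmodule: "lmodule (opp (Dres L e i)) (Vright L e n i j)"
proof (intro lmodule.intro lmodule_axioms.intro ring_opp Dres_ring i V_abelian Vmod_simps)
  note s = Vright_smult Dres_carrier[OF i] Dres_add[OF i] Dres_mult[OF i] Dres_one[OF i]
  fix a b x y assume "a \<in> carrier (opp (Dres L e i))" and "b \<in> carrier (opp (Dres L e i))"
    and x: "x \<in> carrier (Vright L e n i j)" and y: "y \<in> carrier (Vright L e n i j)"
  then obtain p q where pq: "p \<in> Corner (e i)" "a = res i p" "q \<in> Corner (e i)" "b = res i q"
    by (auto simp: s)
  have xy: "x \<in> V L e n i j" "y \<in> V L e n i j" using x y by auto
  have c: "p \<in> carrier L" "q \<in> carrier L" "x \<in> carrier L" "y \<in> carrier L"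
    using pq xy Corner_carrier[OF i] V_carrier by auto
  note act = Vright_smult[OF pq(1) xy(1)] Vright_smult[OF pq(3) xy(1)] Vright_smult[OF pq(1) xy(2)]
  show "a \<odot>\<^bsub>Vright L e n i j\<^esub> x \<in> carrier (Vright L e n i j)"
    using V_closed(2)[OF xy(1) pq(1)] act(1) pq(2) by simp
  show "(a \<oplus>\<^bsub>opp (Dres L e i)\<^esub> b) \<odot>\<^bsub>Vright L e n i j\<^esub> x = a \<odot>\<^bsub>Vright L e n i j\<^esub> x \<oplus>\<^bsub>Vright L e n i j\<^esub> b \<odot>\<^bsub>Vright L e n i j\<^esub> x"
    using Vright_smult[OF Corner_closed(1)[OF i pq(1,3)] xy(1)] act(1,2) pq(2,4) c
    by (simp add: Dres_add[OF i pq(1,3)] L.l_distr L.r_distr)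
  show "a \<odot>\<^bsub>Vright L e n i j\<^esub> (x \<oplus>\<^bsub>Vright L e n i j\<^esub> y) = a \<odot>\<^bsub>Vright L e n i j\<^esub> x \<oplus>\<^bsub>Vright L e n i j\<^esub> a \<odot>\<^bsub>Vright L e n i j\<^esub> y"
    using Vright_smult[OF pq(1) V_closed(1)[OF xy]] act(1,3) pq(2) c by (simp add: L.l_distr L.r_distr)
  show "(a \<otimes>\<^bsub>opp (Dres L e i)\<^esub> b) \<odot>\<^bsub>Vright L e n i j\<^esub> x = a \<odot>\<^bsub>Vright L e n i j\<^esub> (b \<odot>\<^bsub>Vright L e n i j\<^esub> x)"
    using Vright_smult[OF Corner_closed(2)[OF i pq(3,1)] xy(1)] act(2)
      Vright_smult[OF pq(1) V_closed(2)[OF xy(1) pq(3)]] pq(2,4) c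
    by (simp add: Dres_mult[OF i pq(3,1)] L.m_assoc)
next
  fix x assume x: "x \<in> carrier (Vright L e n i j)"
  show "\<one>\<^bsub>opp (Dres L e i)\<^esub> \<odot>\<^bsub>Vright L e n i j\<^esub> x = x"
    using x i by (simp add: Dres_one Vright_smult V_iff[OF i j])
qed

lemma Vleft_lmodule: "lmodule (Dres L e j) (Vleft L e n i j)"
proof (intro lmodule.intro lmodule_axioms.intro Dres_ring j V_abelian Vmod_simps)
  note s = Vleft_smult Dres_carrier[OF j] Dres_add[OF j] Dres_mult[OF j] Dres_one[OF j]
  fix a b x y assume "a \<in> carrier (Dres L e j)" and "b \<in> carrier (Dres L e j)"
    and x: "x \<in> carrier (Vleft L e n i j)" and y: "y \<in> carrier (Vleft L e n i j)"
  then obtain p q where pq: "p \<in> Corner (e j)" "a = res j p" "q \<in> Corner (e j)" "b = res j q"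
    by (auto simp: s)
  have xy: "x \<in> V L e n i j" "y \<in> V L e n i j" using x y by auto
  have c: "p \<in> carrier L" "q \<in> carrier L" "x \<in> carrier L" "y \<in> carrier L"
    using pq xy Corner_carrier[OF j] V_carrier by auto
  note act = Vleft_smult[OF pq(1) xy(1)] Vleft_smult[OF pq(3) xy(1)] Vleft_smult[OF pq(1) xy(2)]
  show "a \<odot>\<^bsub>Vleft L e n i j\<^esub> x \<in> carrier (Vleft L e n i j)"
    using V_closed(3)[OF xy(1) pq(1)] act(1) pq(2) by simp
  show "(a \<oplus>\<^bsub>Dres L e j\<^esub> b) \<odot>\<^bsub>Vleft L e n i j\<^esub> x = a \<odot>\<^bsub>Vleft L e n i j\<^esub> x \<oplus>\<^bsub>Vleft L e n i j\<^esub> b \<odot>\<^bsub>Vleft L e n i j\<^esub> x"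
    using Vleft_smult[OF Corner_closed(1)[OF j pq(1,3)] xy(1)] act(1,2) pq(2,4) c
    by (simp add: Dres_add[OF j pq(1,3)] L.l_distr L.r_distr)
  show "a \<odot>\<^bsub>Vleft L e n i j\<^esub> (x \<oplus>\<^bsub>Vleft L e n i j\<^esub> y) = a \<odot>\<^bsub>Vleft L e n i j\<^esub> x \<oplus>\<^bsub>Vleft L e n i j\<^esub> a \<odot>\<^bsub>Vleft L e n i j\<^esub> y"
    using Vleft_smult[OF pq(1) V_closed(1)[OF xy]] act(1,3) pq(2) c by (simp add: L.l_distr L.r_distr)
  show "(a \<otimes>\<^bsub>Dres L e j\<^esub> b) \<odot>\<^bsub>Vleft L e n i j\<^esub> x = a \<odot>\<^bsub>Vleft L e n i j\<^esub> (b \<odot>\<^bsub>Vleft L e n i j\<^esub> x)"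
    using Vleft_smult[OF Corner_closed(2)[OF j pq(1,3)] xy(1)] act(2)
      Vleft_smult[OF pq(1) V_closed(3)[OF xy(1) pq(3)]] pq(2,4) c
    by (simp add: Dres_mult[OF j pq(1,3)] L.m_assoc)
next
  fix x assume x: "x \<in> carrier (Vleft L e n i j)"
  show "\<one>\<^bsub>Dres L e j\<^esub> \<odot>\<^bsub>Vleft L e n i j\<^esub> x = x"
    using x j by (simp add: Dres_one Vleft_smult V_iff[OF i j])
qed

lemma scalar_Dres:
  "c \<in> carrier K \<Longrightarrow> h \<in> {1..t} \<Longrightarrow> c \<odot>\<^bsub>Dres L e h\<^esub> \<one>\<^bsub>Dres L e h\<^esub> = res h (c \<odot>\<^bsub>L\<^esub> e h)"
  by (simp add: Dres_one Dres_smult)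

text \<open>The field acts identically through \<open>D_i\<close> and through \<open>D_j\<close>.
  When \<open>D_j\<close> is the field, the left structure can thus be read off from the right
  one.\<close>

lemma scalar_actions:
  assumes "c \<in> carrier K" "v \<in> V L e n i j"
  shows "(c \<odot>\<^bsub>Dres L e i\<^esub> \<one>\<^bsub>Dres L e i\<^esub>) \<odot>\<^bsub>Vright L e n i j\<^esub> v = c \<odot>\<^bsub>L\<^esub> v"
    "(c \<odot>\<^bsub>Dres L e j\<^esub> \<one>\<^bsub>Dres L e j\<^esub>) \<odot>\<^bsub>Vleft L e n i j\<^esub> v = c \<odot>\<^bsub>L\<^esub> v"
proof -
  have v: "v \<in> carrier L" "e j \<otimes>\<^bsub>L\<^esub> v = v" "v \<otimes>\<^bsub>L\<^esub> e i = v"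
    using V_carrier[OF assms(2)] assms(2) by (auto simp: V_iff[OF i j])
  show "(c \<odot>\<^bsub>Dres L e i\<^esub> \<one>\<^bsub>Dres L e i\<^esub>) \<odot>\<^bsub>Vright L e n i j\<^esub> v = c \<odot>\<^bsub>L\<^esub> v"
    using Vright_smult[OF Corner_smult_closed[OF i Corner_unit(1)[OF i] assms(1)] assms(2)]
      smult_mult_right[OF assms(1) v(1) e_closed[OF i]] v(3) by (simp add: scalar_Dres[OF assms(1) i])
  show "(c \<odot>\<^bsub>Dres L e j\<^esub> \<one>\<^bsub>Dres L e j\<^esub>) \<odot>\<^bsub>Vleft L e n i j\<^esub> v = c \<odot>\<^bsub>L\<^esub> v"
    using Vleft_smult[OF Corner_smult_closed[OF j Corner_unit(1)[OF j] assms(1)] assms(2)]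
      smult_mult_left[OF assms(1) e_closed[OF j] v(1)] v(2) by (simp add: scalar_Dres[OF assms(1) j])
qed

lemma V_right_vector_space: "right_vector_space K (Dres L e i) (Vright L e n i j)"
  by (intro right_vector_space.intro Dres_division_algebra Vright_lmodule i)

text \<open>A list spanning the bimodule over the field also spans it over \<open>D_i\<close>, since
  every \<open>D_i\<close>-submodule is stable under the field.\<close>

lemma Vright_ex_basis: "\<exists>xs. list_basis (opp (Dres L e i)) (Vright L e n i j) xs"
proof -
  interpret O: left_vector_space "opp (Dres L e i)" "Vright L e n i j"
    by (rule right_vector_space.right_space[OF V_right_vector_space])
  interpret V: left_vector_space K L by (rule vs_KL)
  obtain bs where bs: "list_basis K L bs" using ex_basis by auto
  have "submodule (V L e n i j) K L"
    by (rule V.submoduleI) (use V_carrier V_closed zero_in_V in auto)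
  then obtain ys where ys: "set ys \<subseteq> V L e n i j" "lspan K L ys = V L e n i j"
    using V.ex_basis_submodule[OF bs] by blast
  have sub: "submodule (lspan (opp (Dres L e i)) (Vright L e n i j) ys) (opp (Dres L e i)) (Vright L e n i j)"
    using ys by (intro O.lspan_submodule) simp
  note D = O.submoduleD[OF sub]
  have "submodule (lspan (opp (Dres L e i)) (Vright L e n i j) ys) K L"
  proof (rule V.submoduleI)
    fix c x assume c: "c \<in> carrier K" and x: "x \<in> lspan (opp (Dres L e i)) (Vright L e n i j) ys"
    have "x \<in> V L e n i j" using subsetD[OF D(1) x] by simp
    moreover have "c \<odot>\<^bsub>Dres L e i\<^esub> \<one>\<^bsub>Dres L e i\<^esub> \<in> carrier (opp (Dres L e i))"
      using right_vector_space.scalar_one_closed[OF V_right_vector_space c] by simp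
    ultimately show "c \<odot>\<^bsub>L\<^esub> x \<in> lspan (opp (Dres L e i)) (Vright L e n i j) ys"
      using D(4)[OF _ x, of "c \<odot>\<^bsub>Dres L e i\<^esub> \<one>\<^bsub>Dres L e i\<^esub>"] scalar_actions(1)[OF c] by simp
  next
    show "lspan (opp (Dres L e i)) (Vright L e n i j) ys \<subseteq> carrier L"
      using D(1) V_carrier by auto
  qed (use D(2,3) in simp_all)
  then have "V L e n i j \<subseteq> lspan (opp (Dres L e i)) (Vright L e n i j) ys"
    using V.lspan_least[of _ ys] O.set_subset_lspan[of ys] ys by auto
  then have "lspan (opp (Dres L e i)) (Vright L e n i j) ys = carrier (Vright L e n i j)"
    using D(1) by auto
  then show ?thesis using O.ex_basis_of_spanning ys(1) by simp
qed

lemma HomVD_eq: "HomVD K L e n i j = HomD K (Dres L e i) (Vright L e n i j)"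
  by (simp add: HomVD_def HomD_def Let_def)

lemma functional_map_eq: "functional_map L e n i j = adjoint_map (Dres L e i) (Vright L e n i j)"
  by (auto simp: functional_map_def adjoint_map_def fun_eq_iff)

lemma Vdual_eq: "Vdual K L e n i j = dual_functionals K (Dres L e i) (Vright L e n i j)"
  unfolding Vdual_def linear_maps_def dual_functionals_def
  using scalar_actions(1) by (intro Collect_cong conj_cong) simp_all

end

end

section \<open>The fibres\<close>

context basic_algebra
begin

text \<open>\<open>ideal_prod\<close> consists of finite sums of products; as the layer absorbs
  multiplication, these sums reduce to \<open>T e_i\<close>.\<close>

lemma JP_iff:
  assumes i: "i \<in> {1..t}"
  shows "x \<in> JP L e n i \<longleftrightarrow> x \<in> T \<and> x \<otimes>\<^bsub>L\<^esub> e i = x"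
proof
  assume "x \<in> JP L e n i"
  then have "x \<in> T \<cdot>\<^bsub>L\<^esub> carrier (Pmod L (e i))" by (simp add: JP_def T_def)
  then show "x \<in> T \<and> x \<otimes>\<^bsub>L\<^esub> e i = x"
  proof (induction x rule: ideal_prod.induct)
    case (prod a y)
    then have "y \<in> carrier L" "y \<otimes>\<^bsub>L\<^esub> e i = y" using Pmod_iff[OF idem[OF i]] by auto
    then show ?case using T_closed(4)[OF prod(1)] T_carrier[OF prod(1)] i by (simp add: L.m_assoc)
  next
    case (sum a b)
    then show ?case using T_closed(1) T_carrier i by (simp add: L.l_distr)
  qed
next
  assume x: "x \<in> T \<and> x \<otimes>\<^bsub>L\<^esub> e i = x"
  have "e i \<in> carrier (Pmod L (e i))" using i by (simp add: Pmod_iff[OF idem])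
  then have "x \<otimes>\<^bsub>L\<^esub> e i \<in> JP L e n i"
    unfolding JP_def using x by (intro ideal_prod.prod) (simp_all add: T_def)
  then show "x \<in> JP L e n i" using x by simp
qed

lemma V_subset_JP: "\<lbrakk>i \<in> {1..t}; j \<in> {1..t}\<rbrakk> \<Longrightarrow> V L e n i j \<subseteq> JP L e n i"
  by (auto simp: JP_iff V_iff)

lemma mult_finsum_e:
  assumes "y \<in> carrier L"
  shows "(\<Oplus>\<^bsub>L\<^esub>h\<in>{1..t}. y \<otimes>\<^bsub>L\<^esub> e h) = y" "(\<Oplus>\<^bsub>L\<^esub>h\<in>{1..t}. e h \<otimes>\<^bsub>L\<^esub> y) = y"
  using L.finsum_rdistr[of "{1..t}" y e] L.finsum_ldistr[of "{1..t}" y e] assms complete by (auto simp: Pi_def)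

lemma split_off:
  assumes "j \<in> {1..t}" "\<And>h. h \<in> {1..t} \<Longrightarrow> f h \<in> carrier L"
  shows "(\<Oplus>\<^bsub>L\<^esub>h\<in>{1..t}. f h) = f j \<oplus>\<^bsub>L\<^esub> (\<Oplus>\<^bsub>L\<^esub>h\<in>{1..t} - {j}. f h)"
proof -
  have "{1..t} = insert j ({1..t} - {j})" using assms(1) by auto
  then have "(\<Oplus>\<^bsub>L\<^esub>h\<in>{1..t}. f h) = (\<Oplus>\<^bsub>L\<^esub>h\<in>insert j ({1..t} - {j}). f h)" by simp
  also have "\<dots> = f j \<oplus>\<^bsub>L\<^esub> (\<Oplus>\<^bsub>L\<^esub>h\<in>{1..t} - {j}. f h)"
    using assms by (intro L.finsum_insert) auto
  finally show ?thesis .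
qed

lemma finsum_mem:
  assumes "\<zero>\<^bsub>L\<^esub> \<in> P" "\<And>x y. \<lbrakk>x \<in> P; y \<in> P\<rbrakk> \<Longrightarrow> x \<oplus>\<^bsub>L\<^esub> y \<in> P" "P \<subseteq> carrier L"
    "finite A" "\<And>h. h \<in> A \<Longrightarrow> f h \<in> P"
  shows "(\<Oplus>\<^bsub>L\<^esub>h\<in>A. f h) \<in> P"
  using assms(4,5)
proof (induction A rule: finite_induct)
  case (insert a A)
  have "(\<Oplus>\<^bsub>L\<^esub>h\<in>insert a A. f h) = f a \<oplus>\<^bsub>L\<^esub> (\<Oplus>\<^bsub>L\<^esub>h\<in>A. f h)"
    using insert.hyps insert.prems assms(3) by (intro L.finsum_insert) auto
  then show ?case using assms(2) insert by simp
qed (simp add: assms(1))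

text \<open>Distinct vertices interact only through the radical, which annihilates the last layer.\<close>

lemma left_mult_T:
  assumes j: "j \<in> {1..t}" and y: "y \<in> carrier L" and x: "x \<in> T"
  shows "e j \<otimes>\<^bsub>L\<^esub> (y \<otimes>\<^bsub>L\<^esub> x) = (e j \<otimes>\<^bsub>L\<^esub> y \<otimes>\<^bsub>L\<^esub> e j) \<otimes>\<^bsub>L\<^esub> (e j \<otimes>\<^bsub>L\<^esub> x)"
proof -
  have ej: "e j \<in> carrier L" and xc: "x \<in> carrier L" using j x T_carrier by auto
  define z where "z = (\<Oplus>\<^bsub>L\<^esub>h\<in>{1..t} - {j}. e j \<otimes>\<^bsub>L\<^esub> y \<otimes>\<^bsub>L\<^esub> e h)"
  have "z \<in> J" unfolding z_def
    using additive_subgroup.zero_closed[OF ideal.axioms(1)[OF jacobson_ideal]]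
      additive_subgroup.a_closed[OF ideal.axioms(1)[OF jacobson_ideal]] jacobson_carrier
      off_diagonal_jacobson[OF j _ _ y]
    by (intro finsum_mem) auto
  then have zx: "z \<otimes>\<^bsub>L\<^esub> x = \<zero>\<^bsub>L\<^esub>" and zc: "z \<in> carrier L" using T_J(2)[OF x] J_carrier by auto
  have "e j \<otimes>\<^bsub>L\<^esub> y = (\<Oplus>\<^bsub>L\<^esub>h\<in>{1..t}. e j \<otimes>\<^bsub>L\<^esub> y \<otimes>\<^bsub>L\<^esub> e h)"
    using mult_finsum_e(1)[of "e j \<otimes>\<^bsub>L\<^esub> y"] ej y by simp
  also have "\<dots> = e j \<otimes>\<^bsub>L\<^esub> y \<otimes>\<^bsub>L\<^esub> e j \<oplus>\<^bsub>L\<^esub> z"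
    unfolding z_def using ej y by (intro split_off[OF j]) simp
  finally have "e j \<otimes>\<^bsub>L\<^esub> (y \<otimes>\<^bsub>L\<^esub> x) = (e j \<otimes>\<^bsub>L\<^esub> y \<otimes>\<^bsub>L\<^esub> e j \<oplus>\<^bsub>L\<^esub> z) \<otimes>\<^bsub>L\<^esub> x"
    using ej y xc by (simp flip: L.m_assoc)
  also have "\<dots> = (e j \<otimes>\<^bsub>L\<^esub> y \<otimes>\<^bsub>L\<^esub> e j) \<otimes>\<^bsub>L\<^esub> x" using ej y xc zc zx by (simp add: L.l_distr)
  also have "\<dots> = (e j \<otimes>\<^bsub>L\<^esub> y \<otimes>\<^bsub>L\<^esub> (e j \<otimes>\<^bsub>L\<^esub> e j)) \<otimes>\<^bsub>L\<^esub> x" using j by simp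
  also have "\<dots> = (e j \<otimes>\<^bsub>L\<^esub> y \<otimes>\<^bsub>L\<^esub> e j) \<otimes>\<^bsub>L\<^esub> (e j \<otimes>\<^bsub>L\<^esub> x)" using ej y xc by (simp add: L.m_assoc del: e_idem)
  finally show ?thesis .
qed

lemma Pmod_lmodule:
  assumes i: "i \<in> {1..t}"
  shows "lmodule L (Pmod L (e i))"
proof -
  interpret R: lmodule L "regular L" by (rule L.regular_lmodule)
  have "submodule (carrier (Pmod L (e i))) L (regular L)"
    by (rule R.submoduleI) (use i in \<open>auto simp: Pmod_iff[OF idem] L.l_distr L.m_assoc\<close>)
  then have "lmodule L ((regular L)\<lparr>carrier := carrier (Pmod L (e i))\<rparr>)" by (rule R.submodule_lmodule)
  then show ?thesis by (simp add: Pmod_def)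
qed

end

section \<open>The submodules of \<open>P_i\<close> that define the fibre\<close>

locale terminal_pair = basic_algebra K L t e n
  for K :: "('k, 'p) ring_scheme" (structure) and L :: "('k, 'a) module" (structure)
    and t :: nat and e :: "nat \<Rightarrow> 'a" and n :: nat +
  fixes i j :: nat
  assumes i: "i \<in> {1..t}" and j: "j \<in> {1..t}"
    and split: "V L e n i j \<noteq> {\<zero>\<^bsub>L\<^esub>} \<Longrightarrow> alg_iso K (regular K) (Dres L e j) \<noteq> {}"
begin

abbreviation Vij where "Vij \<equiv> V L e n i j"

text \<open>By orthogonality the components at vertices other than \<open>j\<close> are killed by
  \<open>e_j\<close>; conversely, expanding the unit as the sum of the \<open>e_h\<close> shows that
  an element killed by \<open>e_j\<close> is the sum of its other components.\<close>

lemma Wcompl_iff: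
  "x \<in> Wcompl L t e n i j \<longleftrightarrow> x \<in> T \<and> x \<otimes>\<^bsub>L\<^esub> e i = x \<and> e j \<otimes>\<^bsub>L\<^esub> x = \<zero>\<^bsub>L\<^esub>"
proof
  let ?P = "{x \<in> T. x \<otimes>\<^bsub>L\<^esub> e i = x \<and> e j \<otimes>\<^bsub>L\<^esub> x = \<zero>\<^bsub>L\<^esub>}"
  assume "x \<in> Wcompl L t e n i j"
  then obtain w where w: "x = (\<Oplus>\<^bsub>L\<^esub>h\<in>{1..t} - {j}. w h)"
    "\<And>h. h \<in> {1..t} - {j} \<Longrightarrow> w h \<in> {e h \<otimes>\<^bsub>L\<^esub> x | x. x \<in> JP L e n i}"
    by (auto simp: Wcompl_def)
  have "w h \<in> ?P" if h: "h \<in> {1..t} - {j}" for h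
  proof -
    obtain y where y: "w h = e h \<otimes>\<^bsub>L\<^esub> y" "y \<in> T" "y \<otimes>\<^bsub>L\<^esub> e i = y" using w(2)[OF h] JP_iff[OF i] by auto
    have yc: "y \<in> carrier L" using y T_carrier by auto
    have hc: "e h \<in> carrier L" "e j \<in> carrier L" "e i \<in> carrier L" using h i j by auto
    have "e j \<otimes>\<^bsub>L\<^esub> (e h \<otimes>\<^bsub>L\<^esub> y) = \<zero>\<^bsub>L\<^esub>"
      using orthogonal[of j h] h j yc hc by (simp flip: L.m_assoc)
    then show ?thesis using y yc hc T_closed(3)[OF y(2) hc(1)] by (simp add: L.m_assoc)
  qed
  then have "x \<in> ?P" unfolding w(1)
    using T_closed(1,2) T_carrier i j by (intro finsum_mem) (auto simp: L.l_distr L.r_distr)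
  then show "x \<in> T \<and> x \<otimes>\<^bsub>L\<^esub> e i = x \<and> e j \<otimes>\<^bsub>L\<^esub> x = \<zero>\<^bsub>L\<^esub>" by simp
next
  assume x: "x \<in> T \<and> x \<otimes>\<^bsub>L\<^esub> e i = x \<and> e j \<otimes>\<^bsub>L\<^esub> x = \<zero>\<^bsub>L\<^esub>"
  then have xc: "x \<in> carrier L" using T_carrier by auto
  have "x = (\<Oplus>\<^bsub>L\<^esub>h\<in>{1..t}. e h \<otimes>\<^bsub>L\<^esub> x)" using mult_finsum_e(2)[OF xc] by simp
  also have "\<dots> = e j \<otimes>\<^bsub>L\<^esub> x \<oplus>\<^bsub>L\<^esub> (\<Oplus>\<^bsub>L\<^esub>h\<in>{1..t} - {j}. e h \<otimes>\<^bsub>L\<^esub> x)"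
    using xc by (intro split_off[OF j]) auto
  also have "\<dots> = (\<Oplus>\<^bsub>L\<^esub>h\<in>{1..t} - {j}. e h \<otimes>\<^bsub>L\<^esub> x)"
    using x xc by (simp add: L.finsum_closed Pi_def)
  finally have "x = (\<Oplus>\<^bsub>L\<^esub>h\<in>{1..t} - {j}. e h \<otimes>\<^bsub>L\<^esub> x)" .
  moreover have "x \<in> JP L e n i" using x JP_iff[OF i] by simp
  ultimately show "x \<in> Wcompl L t e n i j"
    unfolding Wcompl_def by (intro CollectI exI[of _ "\<lambda>h. e h \<otimes>\<^bsub>L\<^esub> x"]) auto
qed

text \<open>The sum of \<open>Wcompl\<close> and \<open>U\<close> in closed form
  (\<open>Nsub_eq\<close>): only the component at \<open>j\<close> is constrained.\<close>

definition Nsub :: "'a set \<Rightarrow> 'a set" where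
  "Nsub U = {x \<in> T. x \<otimes>\<^bsub>L\<^esub> e i = x \<and> e j \<otimes>\<^bsub>L\<^esub> x \<in> U}"

lemma Nsub_eq:
  assumes "U \<subseteq> Vij" 
  shows "Wcompl L t e n i j <+>\<^bsub>L\<^esub> U = Nsub U"
proof (intro equalityI subsetI)
  fix x assume "x \<in> Wcompl L t e n i j <+>\<^bsub>L\<^esub> U"
  then obtain w u where wu: "w \<in> Wcompl L t e n i j" "u \<in> U" "x = w \<oplus>\<^bsub>L\<^esub> u" by (auto simp: set_add_def')
  have w: "w \<in> T" "w \<otimes>\<^bsub>L\<^esub> e i = w" "e j \<otimes>\<^bsub>L\<^esub> w = \<zero>\<^bsub>L\<^esub>" using wu Wcompl_iff by auto
  have u: "u \<in> T" "u \<otimes>\<^bsub>L\<^esub> e i = u" "e j \<otimes>\<^bsub>L\<^esub> u = u" using wu assms V_iff[OF i j] by auto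
  have c: "w \<in> carrier L" "u \<in> carrier L" using w u T_carrier by auto
  show "x \<in> Nsub U"
    unfolding Nsub_def wu(3) using w u c wu(2) i j T_closed(1)[OF w(1) u(1)] by (simp add: L.l_distr L.r_distr)
next
  fix x assume "x \<in> Nsub U"
  then have x: "x \<in> T" "x \<otimes>\<^bsub>L\<^esub> e i = x" "e j \<otimes>\<^bsub>L\<^esub> x \<in> U" by (auto simp: Nsub_def)
  have c: "x \<in> carrier L" "e j \<in> carrier L" "e i \<in> carrier L" using x T_carrier i j by auto
  have jx: "e j \<otimes>\<^bsub>L\<^esub> x \<in> T" using T_closed(3)[OF x(1) c(2)] .
  have mjx: "\<ominus>\<^bsub>L\<^esub> (e j \<otimes>\<^bsub>L\<^esub> x) \<in> T" using T_closed(3)[OF jx, of "\<ominus>\<^bsub>L\<^esub> \<one>\<^bsub>L\<^esub>"] c by (simp add: L.l_minus)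
  have ejej: "e j \<otimes>\<^bsub>L\<^esub> (e j \<otimes>\<^bsub>L\<^esub> x) = e j \<otimes>\<^bsub>L\<^esub> x" using c j by (simp flip: L.m_assoc)
  let ?w = "x \<ominus>\<^bsub>L\<^esub> e j \<otimes>\<^bsub>L\<^esub> x"
  have "?w \<in> T" using T_closed(1)[OF x(1) mjx] by (simp add: a_minus_def)
  moreover have "?w \<otimes>\<^bsub>L\<^esub> e i = ?w" using c x(2) by (simp add: a_minus_def L.l_distr L.l_minus L.m_assoc)
  moreover have "e j \<otimes>\<^bsub>L\<^esub> ?w = \<zero>\<^bsub>L\<^esub>" using c ejej by (simp add: a_minus_def L.r_distr L.r_minus L.r_neg)
  ultimately have "?w \<in> Wcompl L t e n i j" using Wcompl_iff by simp
  moreover have "x = ?w \<oplus>\<^bsub>L\<^esub> e j \<otimes>\<^bsub>L\<^esub> x" using c by (simp add: a_minus_def L.a_assoc L.l_neg)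
  ultimately show "x \<in> Wcompl L t e n i j <+>\<^bsub>L\<^esub> U" using x(3) by (force simp: set_add_def')
qed

lemma Vdual_iff:
  "\<mu> \<in> Vdual K L e n i j \<longleftrightarrow> \<mu> \<in> Vij \<rightarrow>\<^sub>E carrier K \<and> functional K (Vscal L e n i j) \<mu>"
  by (auto simp: Vdual_def linear_maps_def functional_def)

definition nonzero_functionals :: "('a \<Rightarrow> 'k) set" where
  "nonzero_functionals = {\<mu> \<in> Vdual K L e n i j. \<exists>v\<in>Vij. \<mu> v \<noteq> \<zero>\<^bsub>K\<^esub>}"

definition ker :: "('a \<Rightarrow> 'k) \<Rightarrow> 'a set" where
  "ker \<mu> = {v \<in> Vij. \<mu> v = \<zero>\<^bsub>K\<^esub>}"

lemma Vscal_lmodule: "lmodule K (Vscal L e n i j)"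
proof -
  interpret V: left_vector_space K L by (rule vs_KL)
  show ?thesis unfolding Vscal_def
    by (intro V.submodule_lmodule V.submoduleI) (use V_carrier[OF i j] V_closed(1,4)[OF i j] zero_in_V[OF i j] in auto)
qed

lemma VdualD:
  assumes "\<mu> \<in> Vdual K L e n i j"
  shows "v \<in> Vij \<Longrightarrow> \<mu> v \<in> carrier K"
    "\<lbrakk>v \<in> Vij; w \<in> Vij\<rbrakk> \<Longrightarrow> \<mu> (v \<oplus>\<^bsub>L\<^esub> w) = \<mu> v \<oplus>\<^bsub>K\<^esub> \<mu> w"
    "\<lbrakk>c \<in> carrier K; v \<in> Vij\<rbrakk> \<Longrightarrow> \<mu> (c \<odot>\<^bsub>L\<^esub> v) = c \<otimes>\<^bsub>K\<^esub> \<mu> v" "\<mu> \<zero>\<^bsub>L\<^esub> = \<zero>\<^bsub>K\<^esub>"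
  using assms functionalD[of K "Vscal L e n i j" \<mu>] functional_zero[OF K.field_axioms Vscal_lmodule, of \<mu>]
  by (auto simp: Vdual_iff)

lemma Dres_scalar:
  assumes "Vij \<noteq> {\<zero>\<^bsub>L\<^esub>}" "X \<in> carrier (Dres L e j)"
  shows "\<exists>c\<in>carrier K. X = c \<odot>\<^bsub>Dres L e j\<^esub> \<one>\<^bsub>Dres L e j\<^esub>"
proof -
  obtain h where h: "h \<in> alg_iso K (regular K) (Dres L e j)" using split[OF assms(1)] by auto
  then have "bij_betw h (carrier K) (carrier (Dres L e j))" and h1: "h \<one>\<^bsub>K\<^esub> = \<one>\<^bsub>Dres L e j\<^esub>"
    and hs: "\<And>c x. \<lbrakk>c \<in> carrier K; x \<in> carrier K\<rbrakk> \<Longrightarrow> h (c \<otimes>\<^bsub>K\<^esub> x) = c \<odot>\<^bsub>Dres L e j\<^esub> h x"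
    by (auto simp: alg_iso_def ring_iso_def ring_hom_def)
  then have "X \<in> h ` carrier K" using assms(2) by (simp add: bij_betw_def)
  then obtain c where c: "c \<in> carrier K" "X = h c" by blast
  then have "X = c \<odot>\<^bsub>Dres L e j\<^esub> \<one>\<^bsub>Dres L e j\<^esub>" using hs[of c "\<one>\<^bsub>K\<^esub>"] h1 by simp
  then show ?thesis using c by auto
qed

lemma left_action_scalar:
  assumes "Vij \<noteq> {\<zero>\<^bsub>L\<^esub>}" "a \<in> Corner (e j)"
  shows "\<exists>c\<in>carrier K. \<forall>v\<in>Vij. a \<otimes>\<^bsub>L\<^esub> v = c \<odot>\<^bsub>L\<^esub> v"
proof -
  have "res j a \<in> carrier (Dres L e j)" using assms(2) by (simp add: Dres_carrier[OF j])
  then obtain c where c: "c \<in> carrier K" "res j a = c \<odot>\<^bsub>Dres L e j\<^esub> \<one>\<^bsub>Dres L e j\<^esub>"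
    using Dres_scalar[OF assms(1)] by auto
  have "a \<otimes>\<^bsub>L\<^esub> v = c \<odot>\<^bsub>L\<^esub> v" if v: "v \<in> Vij" for v
    using Vleft_smult[OF i j assms(2) v] scalar_actions(2)[OF i j c(1) v] c(2) by simp
  then show ?thesis using c(1) by auto
qed

end

text \<open>\<open>preimage\<close> supplies well-definedness and injectivity together,
  \<open>surj\<close> the rest. The intended \<open>g\<close> is a right multiplication on
  \<open>P_i\<close>.\<close>

lemma quot_mod_isoI:
  assumes "quotient_module R M N" "quotient_module R M N'"
    and closed: "\<And>x. x \<in> carrier M \<Longrightarrow> g x \<in> carrier M"
    and add: "\<And>x y. \<lbrakk>x \<in> carrier M; y \<in> carrier M\<rbrakk> \<Longrightarrow> g (x \<oplus>\<^bsub>M\<^esub> y) = g x \<oplus>\<^bsub>M\<^esub> g y"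
    and smult: "\<And>a x. \<lbrakk>a \<in> carrier R; x \<in> carrier M\<rbrakk> \<Longrightarrow> g (a \<odot>\<^bsub>M\<^esub> x) = a \<odot>\<^bsub>M\<^esub> g x"
    and surj: "\<And>y. y \<in> carrier M \<Longrightarrow> \<exists>x\<in>carrier M. g x = y"
    and preimage: "\<And>x. x \<in> carrier M \<Longrightarrow> g x \<in> N' \<longleftrightarrow> x \<in> N"
  shows "mod_isomorphic R (quot_mod M N) (quot_mod M N')"
proof -
  interpret Q: quotient_module R M N by fact
  interpret Q': quotient_module R M N' by fact
  have neg: "g (\<ominus>\<^bsub>M\<^esub> x) = \<ominus>\<^bsub>M\<^esub> g x" if x: "x \<in> carrier M" for x
    using smult[of "\<ominus>\<^bsub>R\<^esub> \<one>\<^bsub>R\<^esub>" x] x closed[OF x] Q.smult_l_minus[of "\<one>\<^bsub>R\<^esub>"] by simp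
  have eq: "N' +>\<^bsub>M\<^esub> g x = N' +>\<^bsub>M\<^esub> g y \<longleftrightarrow> N +>\<^bsub>M\<^esub> x = N +>\<^bsub>M\<^esub> y"
    if "x \<in> carrier M" "y \<in> carrier M" for x y
    using that closed add[of x "\<ominus>\<^bsub>M\<^esub> y"] neg[of y] preimage[of "x \<ominus>\<^bsub>M\<^esub> y"]
    by (simp add: Q.coset_eq_iff Q'.coset_eq_iff a_minus_def)
  \<comment> \<open>A representative is chosen arbitrarily; \<open>eq\<close> shows that the choice
    does not matter.\<close>
  define f where "f Y = N' +>\<^bsub>M\<^esub> g (SOME x. x \<in> carrier M \<and> N +>\<^bsub>M\<^esub> x = Y)" for Y
  have f: "f (N +>\<^bsub>M\<^esub> x) = N' +>\<^bsub>M\<^esub> g x" if x: "x \<in> carrier M" for x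
    using someI[of "\<lambda>y. y \<in> carrier M \<and> N +>\<^bsub>M\<^esub> y = N +>\<^bsub>M\<^esub> x" x] x eq
    unfolding f_def by blast
  have "f \<in> semilinear_iso R (\<lambda>a. a) (quot_mod M N) (quot_mod M N')"
    unfolding semilinear_iso_def
  proof (intro CollectI conjI ballI)
    show "bij_betw f (carrier (quot_mod M N)) (carrier (quot_mod M N'))"
      unfolding bij_betw_def
    proof (intro conjI equalityI subsetI)
      show "inj_on f (carrier (quot_mod M N))"
        using f eq by (intro inj_onI) (auto simp: a_rcosets_eq)
    next
      fix Y assume "Y \<in> f ` carrier (quot_mod M N)"
      then show "Y \<in> carrier (quot_mod M N')" using f closed by (auto simp: a_rcosets_eq)
    next
      fix Y assume "Y \<in> carrier (quot_mod M N')"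
      then obtain y where y: "y \<in> carrier M" "Y = N' +>\<^bsub>M\<^esub> y" by (auto simp: a_rcosets_eq)
      obtain x where x: "x \<in> carrier M" "g x = y" using surj[OF y(1)] by auto
      have "N +>\<^bsub>M\<^esub> x \<in> carrier (quot_mod M N)" using x by (auto simp: a_rcosets_eq)
      then show "Y \<in> f ` carrier (quot_mod M N)" using f[OF x(1)] x y by blast
    qed
  next
    fix X Y assume "X \<in> carrier (quot_mod M N)" "Y \<in> carrier (quot_mod M N)"
    then obtain x y where "x \<in> carrier M" "X = N +>\<^bsub>M\<^esub> x" "y \<in> carrier M" "Y = N +>\<^bsub>M\<^esub> y"
      by (auto simp: a_rcosets_eq)
    then show "f (X \<oplus>\<^bsub>quot_mod M N\<^esub> Y) = f X \<oplus>\<^bsub>quot_mod M N'\<^esub> f Y"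
      using closed by (simp add: f Q.coset_add Q'.coset_add add)
  next
    fix a X assume "a \<in> carrier R" "X \<in> carrier (quot_mod M N)"
    then obtain x where "a \<in> carrier R" "x \<in> carrier M" "X = N +>\<^bsub>M\<^esub> x" by (auto simp: a_rcosets_eq)
    then show "f (a \<odot>\<^bsub>quot_mod M N\<^esub> X) = a \<odot>\<^bsub>quot_mod M N'\<^esub> f X"
      using closed by (simp add: f Q.coset_smult Q'.coset_smult smult)
  qed
  then show ?thesis unfolding mod_isomorphic_def by blast
qed

section \<open>Isomorphisms between the quotients of \<open>P_i\<close>\<close>

context terminal_pair
begin

lemma e_carrier: "e i \<in> carrier L" "e j \<in> carrier L"
  using i j by auto

lemma nonzero_functionalsD:
  assumes "\<mu> \<in> nonzero_functionals"
  shows "\<mu> \<in> Vdual K L e n i j" "Vij \<noteq> {\<zero>\<^bsub>L\<^esub>}"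
  using assms VdualD(4)[of \<mu>] by (auto simp: nonzero_functionals_def)

lemma projection_V:
  assumes "x \<in> T" "x \<otimes>\<^bsub>L\<^esub> e i = x"
  shows "e j \<otimes>\<^bsub>L\<^esub> x \<in> Vij"
  using assms T_carrier[OF assms(1)] e_carrier T_closed(3)[OF assms(1) e_carrier(2)] e_idem[OF j]
  by (simp add: V_iff[OF i j] L.m_assoc) (simp flip: L.m_assoc)

lemma Nker_iff:
  "x \<in> Nsub (ker \<mu>) \<longleftrightarrow> x \<in> T \<and> x \<otimes>\<^bsub>L\<^esub> e i = x \<and> \<mu> (e j \<otimes>\<^bsub>L\<^esub> x) = \<zero>\<^bsub>K\<^esub>"
  using projection_V by (auto simp: Nsub_def ker_def)

lemma Nker_quotient:
  assumes \<mu>: "\<mu> \<in> nonzero_functionals"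
  shows "quotient_module L (Pmod L (e i)) (Nsub (ker \<mu>))"
proof -
  interpret P: lmodule L "Pmod L (e i)" by (rule Pmod_lmodule[OF i])
  note d = VdualD[OF nonzero_functionalsD(1)[OF \<mu>]]
  have "submodule (Nsub (ker \<mu>)) L (Pmod L (e i))"
  proof (rule P.submoduleI)
    show "Nsub (ker \<mu>) \<subseteq> carrier (Pmod L (e i))"
      using T_carrier by (auto simp: Nker_iff Pmod_iff[OF idem[OF i]])
    show "\<zero>\<^bsub>Pmod L (e i)\<^esub> \<in> Nsub (ker \<mu>)"
      using T_closed(2) e_carrier d(4) by (simp add: Nker_iff)
  next
    fix x y assume "x \<in> Nsub (ker \<mu>)" "y \<in> Nsub (ker \<mu>)"
    then have x: "x \<in> T" "x \<otimes>\<^bsub>L\<^esub> e i = x" "\<mu> (e j \<otimes>\<^bsub>L\<^esub> x) = \<zero>\<^bsub>K\<^esub>"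
      and y: "y \<in> T" "y \<otimes>\<^bsub>L\<^esub> e i = y" "\<mu> (e j \<otimes>\<^bsub>L\<^esub> y) = \<zero>\<^bsub>K\<^esub>" by (auto simp: Nker_iff)
    then show "x \<oplus>\<^bsub>Pmod L (e i)\<^esub> y \<in> Nsub (ker \<mu>)"
      using T_closed(1)[OF x(1) y(1)] T_carrier[OF x(1)] T_carrier[OF y(1)] e_carrier
        d(2)[OF projection_V[OF x(1,2)] projection_V[OF y(1,2)]]
      by (simp add: Nker_iff L.l_distr L.r_distr)
  next
    fix a x assume a: "a \<in> carrier L" and "x \<in> Nsub (ker \<mu>)"
    then have x: "x \<in> T" "x \<otimes>\<^bsub>L\<^esub> e i = x" "\<mu> (e j \<otimes>\<^bsub>L\<^esub> x) = \<zero>\<^bsub>K\<^esub>" by (auto simp: Nker_iff)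
    \<comment> \<open>By \<open>left_mult_T\<close> only the corner part of \<open>a\<close> acts on
      the component at \<open>j\<close>, and there it acts as a scalar, so the kernel of
      \<open>\<mu>\<close> is stable under \<open>L\<close>.\<close>
    have "e j \<otimes>\<^bsub>L\<^esub> a \<otimes>\<^bsub>L\<^esub> e j \<in> Corner (e j)" using a by (auto simp: Corner_def)
    then obtain c where "c \<in> carrier K" "\<And>v. v \<in> Vij \<Longrightarrow> (e j \<otimes>\<^bsub>L\<^esub> a \<otimes>\<^bsub>L\<^esub> e j) \<otimes>\<^bsub>L\<^esub> v = c \<odot>\<^bsub>L\<^esub> v"
      using left_action_scalar[OF nonzero_functionalsD(2)[OF \<mu>]] by blast
    then have "\<mu> (e j \<otimes>\<^bsub>L\<^esub> (a \<otimes>\<^bsub>L\<^esub> x)) = \<zero>\<^bsub>K\<^esub>"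
      using left_mult_T[OF j a x(1)] projection_V[OF x(1,2)] d(3) x(3) by simp
    then show "a \<odot>\<^bsub>Pmod L (e i)\<^esub> x \<in> Nsub (ker \<mu>)"
      using T_closed(3)[OF x(1) a] T_carrier[OF x(1)] a x(2) e_carrier by (simp add: Nker_iff L.m_assoc)
  qed
  then show ?thesis by (intro quotient_module.intro quotient_module_axioms.intro Pmod_lmodule[OF i])
qed

text \<open>An isomorphism given by right multiplication by \<open>a\<close> only shows that
  \<open>\<nu> (v a)\<close> and \<open>\<mu> v\<close> vanish for the same \<open>v\<close>. Hence
  they are proportional, and the factor is absorbed into \<open>a\<close>. In the other direction a
  nonzero residue lifts to a unit of the corner.\<close>

lemma Mquot_iso_iff:
  assumes \<mu>: "\<mu> \<in> nonzero_functionals" and \<nu>: "\<nu> \<in> nonzero_functionals"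
  shows "mod_isomorphic L (quot_mod (Pmod L (e i)) (Nsub (ker \<mu>))) (quot_mod (Pmod L (e i)) (Nsub (ker \<nu>)))
    \<longleftrightarrow> (\<exists>a\<in>carrier (Dres L e i). a \<noteq> \<zero>\<^bsub>Dres L e i\<^esub> \<and> (\<forall>v\<in>Vij. \<mu> v = \<nu> (a \<odot>\<^bsub>Vright L e n i j\<^esub> v)))"
    (is "?iso \<longleftrightarrow> ?eq")
proof
  let ?P = "Pmod L (e i)" and ?N = "Nsub (ker \<mu>)" and ?N' = "Nsub (ker \<nu>)"
  interpret Q: quotient_module L ?P ?N by (rule Nker_quotient[OF \<mu>])
  interpret Q': quotient_module L ?P ?N' by (rule Nker_quotient[OF \<nu>])
  note P_iff = Pmod_iff[OF idem[OF i]]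
  note d = VdualD[OF nonzero_functionalsD(1)[OF \<mu>]] and d' = VdualD[OF nonzero_functionalsD(1)[OF \<nu>]]
  have V_N: "v \<in> ?N \<longleftrightarrow> \<mu> v = \<zero>\<^bsub>K\<^esub>" "v \<in> ?N' \<longleftrightarrow> \<nu> v = \<zero>\<^bsub>K\<^esub>" "v \<in> carrier ?P" if "v \<in> Vij" for v
    using that V_carrier[OF i j that] by (auto simp: Nker_iff V_iff[OF i j] P_iff)
  {
    assume ?iso
    then obtain f where "f \<in> semilinear_iso L (\<lambda>a. a) (quot_mod ?P ?N) (quot_mod ?P ?N')"
      by (auto simp: mod_isomorphic_def)
    then have bij: "bij_betw f (carrier (quot_mod ?P ?N)) (carrier (quot_mod ?P ?N'))"
      and fs: "\<And>y Y. \<lbrakk>y \<in> carrier L; Y \<in> carrier (quot_mod ?P ?N)\<rbrakk> \<Longrightarrow>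
        f (y \<odot>\<^bsub>quot_mod ?P ?N\<^esub> Y) = y \<odot>\<^bsub>quot_mod ?P ?N'\<^esub> f Y"
      by (auto simp: semilinear_iso_def)
    have eP: "e i \<in> carrier ?P" using e_carrier i by (simp add: P_iff)
    have cos: "x \<in> carrier ?P \<Longrightarrow> ?N +>\<^bsub>?P\<^esub> x \<in> carrier (quot_mod ?P ?N)" for x
      by (auto simp: a_rcosets_eq)
    have "f (?N +>\<^bsub>?P\<^esub> e i) \<in> carrier (quot_mod ?P ?N')" using bij_betwE[OF bij] cos[OF eP] by blast
    then obtain y where y: "y \<in> carrier ?P" "f (?N +>\<^bsub>?P\<^esub> e i) = ?N' +>\<^bsub>?P\<^esub> y" by (auto simp: a_rcosets_eq)
    have yL: "y \<in> carrier L" "y \<otimes>\<^bsub>L\<^esub> e i = y" using y(1) by (auto simp: P_iff)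
    \<comment> \<open>\<open>y\<close> lifts the image of the class of \<open>e i\<close>. Since
      \<open>x = x e_i\<close> on \<open>P_i\<close>, multiplication by \<open>y\<close> agrees with
      multiplication by its compression \<open>e_i y\<close>.\<close>
    define a where "a = e i \<otimes>\<^bsub>L\<^esub> y"
    have aC: "a \<in> Corner (e i)"
      using yL e_carrier i unfolding a_def by (simp add: Corner_iff[OF idem[OF i]] L.m_assoc) (simp flip: L.m_assoc)
    have aL: "a \<in> carrier L" "a \<otimes>\<^bsub>L\<^esub> e i = a" using aC by (auto simp: Corner_iff[OF idem[OF i]])
    have xaP: "x \<otimes>\<^bsub>L\<^esub> a \<in> carrier ?P" if "x \<in> carrier ?P" for x
      using that aL e_carrier by (simp add: P_iff L.m_assoc)
    have f: "f (?N +>\<^bsub>?P\<^esub> x) = ?N' +>\<^bsub>?P\<^esub> (x \<otimes>\<^bsub>L\<^esub> a)" if x: "x \<in> carrier ?P" for x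
    proof -
      have xL: "x \<in> carrier L" "x \<otimes>\<^bsub>L\<^esub> e i = x" using x by (auto simp: P_iff)
      have "f (?N +>\<^bsub>?P\<^esub> (x \<otimes>\<^bsub>L\<^esub> e i)) = ?N' +>\<^bsub>?P\<^esub> (x \<otimes>\<^bsub>L\<^esub> y)"
        using fs[OF xL(1) cos[OF eP]] Q.coset_smult[OF xL(1) eP] Q'.coset_smult[OF xL(1) y(1)] y(2) by simp
      moreover have "x \<otimes>\<^bsub>L\<^esub> y = x \<otimes>\<^bsub>L\<^esub> a" using xL yL e_carrier by (simp add: a_def flip: L.m_assoc)
      ultimately show ?thesis using xL by simp
    qed
    have iff: "x \<otimes>\<^bsub>L\<^esub> a \<in> ?N' \<longleftrightarrow> x \<in> ?N" if x: "x \<in> carrier ?P" for x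
    proof -
      have zP: "\<zero>\<^bsub>L\<^esub> \<in> carrier ?P" using e_carrier by (simp add: P_iff)
      have "x \<in> ?N \<longleftrightarrow> ?N +>\<^bsub>?P\<^esub> x = ?N +>\<^bsub>?P\<^esub> \<zero>\<^bsub>L\<^esub>"
        using Q.coset_zero_iff[OF x] Q.coset_zero_iff[OF zP] Q.sub(2) by simp
      also have "\<dots> \<longleftrightarrow> f (?N +>\<^bsub>?P\<^esub> x) = f (?N +>\<^bsub>?P\<^esub> \<zero>\<^bsub>L\<^esub>)"
        using inj_on_eq_iff[OF bij_betw_imp_inj_on[OF bij] cos[OF x] cos[OF zP]] by simp
      also have "\<dots> \<longleftrightarrow> ?N' +>\<^bsub>?P\<^esub> (x \<otimes>\<^bsub>L\<^esub> a) = ?N'"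
        using f[OF x] f[OF zP] aL Q'.coset_zero_iff[OF zP] Q'.sub(2) by simp
      also have "\<dots> \<longleftrightarrow> x \<otimes>\<^bsub>L\<^esub> a \<in> ?N'" by (rule Q'.coset_zero_iff[OF xaP[OF x]])
      finally show ?thesis by simp
    qed
    define g where "g = (\<lambda>v. \<nu> (v \<otimes>\<^bsub>L\<^esub> a))"
    note Va = V_closed(2)[OF i j _ aC]
    have "functional K (Vscal L e n i j) g"
      unfolding functional_def g_def
      using Va d' V_carrier[OF i j] aL by (simp add: L.l_distr smult_mult_left)
    moreover have "functional K (Vscal L e n i j) \<mu>"
      using nonzero_functionalsD(1)[OF \<mu>] by (simp add: Vdual_iff)
    moreover have "submodule Vij K (Vscal L e n i j)"
      using lmodule.submoduleI[OF Vscal_lmodule, of Vij] V_closed(1,4)[OF i j] zero_in_V[OF i j] by simp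
    moreover have "g v = \<zero>\<^bsub>K\<^esub>" if "v \<in> Vij" "\<mu> v = \<zero>\<^bsub>K\<^esub>" for v
      using iff[OF V_N(3)[OF that(1)]] V_N(1)[OF that(1)] V_N(2)[OF Va[OF that(1)]] that(2) by (simp add: g_def)
    \<comment> \<open>The case of one functional: as \<open>g\<close> vanishes on the kernel of
      \<open>\<mu>\<close>, it is a multiple of \<open>\<mu>\<close>.\<close>
    ultimately obtain cs where "cs \<in> coeffs K [\<mu>]" "\<forall>v\<in>Vij. g v = fcomb K cs [\<mu>] v"
      using functional_in_span[OF K.field_axioms Vscal_lmodule, of Vij "[\<mu>]" g] by auto
    then obtain c where c: "c \<in> carrier K" "\<And>v. v \<in> Vij \<Longrightarrow> \<nu> (v \<otimes>\<^bsub>L\<^esub> a) = c \<otimes>\<^bsub>K\<^esub> \<mu> v"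
      using d(1) by (cases cs) (auto simp: coeffs_def g_def)
    obtain v0 where v0: "v0 \<in> Vij" "\<mu> v0 \<noteq> \<zero>\<^bsub>K\<^esub>" using \<mu> by (auto simp: nonzero_functionals_def)
    have "\<nu> (v0 \<otimes>\<^bsub>L\<^esub> a) \<noteq> \<zero>\<^bsub>K\<^esub>"
      using iff[OF V_N(3)[OF v0(1)]] V_N(1)[OF v0(1)] V_N(2)[OF Va[OF v0(1)]] v0(2) by simp
    then have c0: "c \<noteq> \<zero>\<^bsub>K\<^esub>" using c(2)[OF v0(1)] d(1)[OF v0(1)] by auto
    let ?c = "inv\<^bsub>K\<^esub> c"
    have ic: "?c \<in> carrier K" "?c \<otimes>\<^bsub>K\<^esub> c = \<one>\<^bsub>K\<^esub>"
      using division_ring_inv(1,2)[OF K.division_ring] c(1) c0 by auto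
    let ?a = "?c \<odot>\<^bsub>L\<^esub> a"
    have aC': "?a \<in> Corner (e i)" by (rule Corner_smult_closed[OF i aC ic(1)])
    have eq: "\<mu> v = \<nu> (res i ?a \<odot>\<^bsub>Vright L e n i j\<^esub> v)" if v: "v \<in> Vij" for v
    proof -
      have "res i ?a \<odot>\<^bsub>Vright L e n i j\<^esub> v = ?c \<odot>\<^bsub>L\<^esub> (v \<otimes>\<^bsub>L\<^esub> a)"
        using Vright_smult[OF i j aC' v] smult_mult_right[OF ic(1) V_carrier[OF i j v] aL(1)] by simp
      then have "\<nu> (res i ?a \<odot>\<^bsub>Vright L e n i j\<^esub> v) = ?c \<otimes>\<^bsub>K\<^esub> (c \<otimes>\<^bsub>K\<^esub> \<mu> v)"
        using d'(3)[OF ic(1) Va[OF v]] c(2)[OF v] by simp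
      then show ?thesis using ic c(1) d(1)[OF v] by (simp flip: K.m_assoc)
    qed
    have "res i ?a \<noteq> \<zero>\<^bsub>Dres L e i\<^esub>"
    proof
      assume "res i ?a = \<zero>\<^bsub>Dres L e i\<^esub>"
      then have "\<mu> v0 = \<nu> (v0 \<otimes>\<^bsub>L\<^esub> \<zero>\<^bsub>L\<^esub>)"
        using eq[OF v0(1)] Vright_smult[OF i j Corner_unit(2)[OF i] v0(1)] by (simp add: Dres_zero[OF i])
      then show False using v0 d'(4) V_carrier[OF i j v0(1)] by simp
    qed
    moreover have "res i ?a \<in> carrier (Dres L e i)" using aC' by (simp add: Dres_carrier[OF i])
    ultimately show ?eq using eq by blast
  next
    assume ?eq
    then obtain a where a: "a \<in> Corner (e i)" "res i a \<noteq> \<zero>\<^bsub>Dres L e i\<^esub>"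
      and eq: "\<And>v. v \<in> Vij \<Longrightarrow> \<mu> v = \<nu> (v \<otimes>\<^bsub>L\<^esub> a)"
      using Vright_smult[OF i j] by (auto simp: Dres_carrier[OF i])
    \<comment> \<open>So \<open>a\<close> is a unit of the corner, and right multiplication by it is
      bijective on all of \<open>P_i\<close>, not just between the quotients.\<close>
    have "a \<notin> J" using res_eq_zero_iff[OF i a(1)] a(2) by simp
    then obtain c where c: "c \<in> Corner (e i)" "a \<otimes>\<^bsub>L\<^esub> c = e i" "c \<otimes>\<^bsub>L\<^esub> a = e i"
      using corner_unit[OF primitive[OF i] a(1)] by auto
    have aL: "a \<in> carrier L" "a \<otimes>\<^bsub>L\<^esub> e i = a" "c \<in> carrier L" "c \<otimes>\<^bsub>L\<^esub> e i = c"
      using a c by (auto simp: Corner_iff[OF idem[OF i]])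
    show ?iso
    proof (rule quot_mod_isoI[OF Nker_quotient[OF \<mu>] Nker_quotient[OF \<nu>], of "\<lambda>x. x \<otimes>\<^bsub>L\<^esub> a"])
      fix x assume "x \<in> carrier ?P"
      then have x: "x \<in> carrier L" "x \<otimes>\<^bsub>L\<^esub> e i = x" by (auto simp: P_iff)
      show "x \<otimes>\<^bsub>L\<^esub> a \<in> carrier ?P" using x aL e_carrier by (simp add: P_iff L.m_assoc)
      show "\<exists>y\<in>carrier ?P. y \<otimes>\<^bsub>L\<^esub> a = x"
        using x aL c e_carrier by (intro bexI[of _ "x \<otimes>\<^bsub>L\<^esub> c"]) (simp_all add: P_iff L.m_assoc)
      show "x \<otimes>\<^bsub>L\<^esub> a \<in> ?N' \<longleftrightarrow> x \<in> ?N"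
      proof -
        have "x = x \<otimes>\<^bsub>L\<^esub> a \<otimes>\<^bsub>L\<^esub> c" using x aL c by (simp add: L.m_assoc)
        then have T: "x \<otimes>\<^bsub>L\<^esub> a \<in> T \<longleftrightarrow> x \<in> T"
          using T_closed(4)[of x a] T_closed(4)[of "x \<otimes>\<^bsub>L\<^esub> a" c] aL by auto
        have "\<nu> (e j \<otimes>\<^bsub>L\<^esub> (x \<otimes>\<^bsub>L\<^esub> a)) = \<mu> (e j \<otimes>\<^bsub>L\<^esub> x)" if "x \<in> T"
          using eq[OF projection_V[OF that x(2)]] x aL e_carrier by (simp add: L.m_assoc)
        then show ?thesis using T x aL e_carrier by (auto simp: Nker_iff L.m_assoc)
      qed
    next
      fix x y assume "x \<in> carrier ?P" "y \<in> carrier ?P"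
      then show "(x \<oplus>\<^bsub>?P\<^esub> y) \<otimes>\<^bsub>L\<^esub> a = x \<otimes>\<^bsub>L\<^esub> a \<oplus>\<^bsub>?P\<^esub> y \<otimes>\<^bsub>L\<^esub> a"
        using aL by (simp add: P_iff L.l_distr)
    next
      fix y x assume "y \<in> carrier L" "x \<in> carrier ?P"
      then show "y \<odot>\<^bsub>?P\<^esub> x \<otimes>\<^bsub>L\<^esub> a = y \<odot>\<^bsub>?P\<^esub> (x \<otimes>\<^bsub>L\<^esub> a)"
        using aL by (simp add: P_iff L.m_assoc)
    qed
  }
qed

end

text \<open>Used with \<open>A\<close> the nonzero functionals: isomorphism classes of quotients and
  projective points are two images of this set with the same identifications.\<close>

lemma ex_factor:
  assumes "\<And>x y. \<lbrakk>x \<in> A; y \<in> A\<rbrakk> \<Longrightarrow> k x = k y \<longleftrightarrow> c x = c y"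
  shows "\<exists>\<gamma>. bij_betw \<gamma> (k ` A) (c ` A) \<and> (\<forall>x\<in>A. \<gamma> (k x) = c x)"
proof -
  define \<gamma> where "\<gamma> p = c (SOME x. x \<in> A \<and> k x = p)" for p
  have \<gamma>: "\<gamma> (k x) = c x" if "x \<in> A" for x
    using someI[of "\<lambda>y. y \<in> A \<and> k y = k x" x] that assms unfolding \<gamma>_def by metis
  moreover have "bij_betw \<gamma> (k ` A) (c ` A)"
    unfolding bij_betw_def
  proof
    show "inj_on \<gamma> (k ` A)" by (rule inj_onI) (use \<gamma> assms in auto)
    show "\<gamma> ` k ` A = c ` A" using \<gamma> by force
  qed
  ultimately show ?thesis by blast
qed

text \<open>If \<open>u + a w\<close> were zero, \<open>u\<close> would be a multiple of
  \<open>w\<close>, contrary to the distinctness of the first two points.\<close>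

lemma cross_ratio_rel_points:
  fixes R :: "('k, 'd, 'y) module_scheme" and c :: 'k
  assumes "left_vector_space R M" "c \<odot>\<^bsub>R\<^esub> \<one>\<^bsub>R\<^esub> \<in> carrier R"
  shows "cross_ratio_rel R M c \<subseteq> proj_points R M \<times> proj_points R M \<times> proj_points R M \<times> proj_points R M"
proof
  interpret left_vector_space R M by fact
  fix z assume "z \<in> cross_ratio_rel R M c"
  then obtain u w where uw: "u \<in> carrier M" "u \<noteq> \<zero>\<^bsub>M\<^esub>" "w \<in> carrier M" "w \<noteq> \<zero>\<^bsub>M\<^esub>"
    "cyclic_sub R M u \<noteq> cyclic_sub R M w"
    "z = (cyclic_sub R M u, cyclic_sub R M w, cyclic_sub R M (u \<oplus>\<^bsub>M\<^esub> w),
      cyclic_sub R M (u \<oplus>\<^bsub>M\<^esub> (c \<odot>\<^bsub>R\<^esub> \<one>\<^bsub>R\<^esub>) \<odot>\<^bsub>M\<^esub> w))"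
    by (auto simp: cross_ratio_rel_def)
  have nz: "u \<oplus>\<^bsub>M\<^esub> a \<odot>\<^bsub>M\<^esub> w \<noteq> \<zero>\<^bsub>M\<^esub>" if a: "a \<in> carrier R" for a
  proof
    assume "u \<oplus>\<^bsub>M\<^esub> a \<odot>\<^bsub>M\<^esub> w = \<zero>\<^bsub>M\<^esub>"
    then have u: "u = (\<ominus>\<^bsub>R\<^esub> a) \<odot>\<^bsub>M\<^esub> w"
      using M.minus_equality[of u "a \<odot>\<^bsub>M\<^esub> w"] uw(1,3) a by (simp add: smult_l_minus)
    then have "\<ominus>\<^bsub>R\<^esub> a \<noteq> \<zero>\<^bsub>R\<^esub>" using uw(2,3) by auto
    then show False using cyclic_sub_smult[of "\<ominus>\<^bsub>R\<^esub> a" w] uw(3,5) u a by simp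
  qed
  have "u \<oplus>\<^bsub>M\<^esub> w \<noteq> \<zero>\<^bsub>M\<^esub>" using nz[of "\<one>\<^bsub>R\<^esub>"] uw(3) by simp
  then show "z \<in> proj_points R M \<times> proj_points R M \<times> proj_points R M \<times> proj_points R M"
    using uw nz[OF assms(2)] assms(2) by (simp add: proj_points_eq)
qed

section \<open>The fibre as a projective space\<close>

context terminal_pair
begin

lemma Vleft_minus:
  assumes "x \<in> Vij" "y \<in> Vij"
  shows "x \<ominus>\<^bsub>Vleft L e n i j\<^esub> y = x \<ominus>\<^bsub>L\<^esub> y"
proof -
  interpret M: lmodule "Dres L e j" "Vleft L e n i j" by (rule Vleft_lmodule[OF i j])
  have "\<ominus>\<^bsub>L\<^esub> y \<in> Vij" by (rule V_closed(5)[OF i j assms(2)])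
  then have "\<ominus>\<^bsub>Vleft L e n i j\<^esub> y = \<ominus>\<^bsub>L\<^esub> y"
    using M.M.minus_equality[of "\<ominus>\<^bsub>L\<^esub> y" y] assms(2) V_carrier[OF i j] by (simp add: L.l_neg)
  then show ?thesis by (simp add: a_minus_def)
qed

lemma scalar_one_inj:
  assumes "c \<in> carrier K" "d \<in> carrier K" "c \<odot>\<^bsub>Dres L e j\<^esub> \<one>\<^bsub>Dres L e j\<^esub> = d \<odot>\<^bsub>Dres L e j\<^esub> \<one>\<^bsub>Dres L e j\<^esub>"
  shows "c = d"
proof -
  interpret Dj: left_vector_space K "Dres L e j"
    by (rule division_algebra.left_space_KD[OF Dres_division_algebra[OF j]])
  have one: "\<one>\<^bsub>Dres L e j\<^esub> \<in> carrier (Dres L e j)" by (rule ring.ring_simprules(6)[OF Dres_ring[OF j]])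
  have "(c \<ominus>\<^bsub>K\<^esub> d) \<odot>\<^bsub>Dres L e j\<^esub> \<one>\<^bsub>Dres L e j\<^esub> = \<zero>\<^bsub>Dres L e j\<^esub>"
    using assms one by (simp add: a_minus_def Dj.smult_l_distr Dj.smult_l_minus Dj.M.r_neg)
  then have "c \<ominus>\<^bsub>K\<^esub> d = \<zero>\<^bsub>K\<^esub>"
    using Dj.smult_eq_zero_iff[of "c \<ominus>\<^bsub>K\<^esub> d", OF _ one] assms(1,2)
      division_ring_one_neq_zero[OF Dres_division[OF j]] by simp
  then show ?thesis using assms(1,2) by (simp add: K.minus_eq_zero_iff)
qed

text \<open>The submodules in question are linear over \<open>D_j\<close>, whose elements are the
  scalars \<open>c 1\<close>. A class spanning the one-dimensional quotient provides a coordinate,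
  and this coordinate is the functional. Conversely, any vector outside a kernel spans the quotient
  by it.\<close>

lemma hyperplanes_eq_kernels:
  "{U. Vij \<noteq> {\<zero>\<^bsub>L\<^esub>} \<and> submodule U (Dres L e j) (Vleft L e n i j)
      \<and> has_dim (Dres L e j) (quot_mod (Vleft L e n i j) U) 1} = ker ` nonzero_functionals"
  (is "?H = _")
proof (intro equalityI subsetI)
  let ?M = "Vleft L e n i j" and ?D = "Dres L e j"
  have scal: "c \<odot>\<^bsub>?D\<^esub> \<one>\<^bsub>?D\<^esub> \<in> carrier ?D" if "c \<in> carrier K" for c
    using that lmodule.smult_closed[OF Dres_lmodule[OF j]] ring.ring_simprules(6)[OF Dres_ring[OF j]] by blast
  fix U assume "U \<in> ?H"
  then have V0: "Vij \<noteq> {\<zero>\<^bsub>L\<^esub>}" and U: "submodule U ?D ?M" and dim: "has_dim ?D (quot_mod ?M U) 1" by auto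
  interpret Q: quotient_module ?D ?M U
    by (intro quotient_module.intro quotient_module_axioms.intro Vleft_lmodule[OF i j] U)
  interpret B: left_vector_space ?D "quot_mod ?M U"
    by (intro left_vector_space.intro left_vector_space_axioms.intro Q.quot_lmodule Dres_division[OF j])
  obtain xs where "list_basis ?D (quot_mod ?M U) xs" "length xs = 1"
    using B.has_dim_list_basis[OF dim] division_ring_one_neq_zero[OF Dres_division[OF j]] by auto
  then obtain B where B: "list_basis ?D (quot_mod ?M U) [B]" by (auto simp: length_Suc_conv)
  then have "B \<in> carrier (quot_mod ?M U)" by (simp add: list_basis_def)
  then obtain x0 where x0: "x0 \<in> Vij" "B = U +>\<^bsub>?M\<^esub> x0" by (auto simp: a_rcosets_eq)
  have act: "(c \<odot>\<^bsub>?D\<^esub> \<one>\<^bsub>?D\<^esub>) \<odot>\<^bsub>quot_mod ?M U\<^esub> (U +>\<^bsub>?M\<^esub> v) = U +>\<^bsub>?M\<^esub> (c \<odot>\<^bsub>L\<^esub> v)"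
    if "c \<in> carrier K" "v \<in> Vij" for c v
    using Q.coset_smult[OF scal[OF that(1)], of v] that scalar_actions(2)[OF i j that] by simp
  note bij = B.list_basis_bij[OF B]
  have comb: "a \<in> carrier ?D \<Longrightarrow> lincomb (quot_mod ?M U) [a] [B] = a \<odot>\<^bsub>quot_mod ?M U\<^esub> B" for a
    using B.smult_closed[of a B] \<open>B \<in> carrier (quot_mod ?M U)\<close> B.M.r_zero by simp
  have ex: "\<exists>c\<in>carrier K. U +>\<^bsub>?M\<^esub> v = U +>\<^bsub>?M\<^esub> (c \<odot>\<^bsub>L\<^esub> x0)" if v: "v \<in> Vij" for v
  proof -
    have "U +>\<^bsub>?M\<^esub> v \<in> (\<lambda>cs. lincomb (quot_mod ?M U) cs [B]) ` coeffs ?D [B]"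
      using bij v by (auto simp: bij_betw_def a_rcosets_eq)
    then obtain a where a: "a \<in> carrier ?D" "U +>\<^bsub>?M\<^esub> v = a \<odot>\<^bsub>quot_mod ?M U\<^esub> B"
      using comb by (auto simp: coeffs_def length_Suc_conv)
    then show ?thesis using Dres_scalar[OF V0 a(1)] act[OF _ x0(1)] x0(2) by auto
  qed
  have uniq: "c = d" if "c \<in> carrier K" "d \<in> carrier K" "U +>\<^bsub>?M\<^esub> (c \<odot>\<^bsub>L\<^esub> x0) = U +>\<^bsub>?M\<^esub> (d \<odot>\<^bsub>L\<^esub> x0)" for c d
  proof -
    have "[c \<odot>\<^bsub>?D\<^esub> \<one>\<^bsub>?D\<^esub>] = [d \<odot>\<^bsub>?D\<^esub> \<one>\<^bsub>?D\<^esub>]"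
    proof (rule inj_onD[OF bij_betw_imp_inj_on[OF bij]])
      show "lincomb (quot_mod ?M U) [c \<odot>\<^bsub>?D\<^esub> \<one>\<^bsub>?D\<^esub>] [B] = lincomb (quot_mod ?M U) [d \<odot>\<^bsub>?D\<^esub> \<one>\<^bsub>?D\<^esub>] [B]"
        unfolding comb[OF scal[OF that(1)]] comb[OF scal[OF that(2)]]
        unfolding x0(2) act[OF that(1) x0(1)] act[OF that(2) x0(1)]
        by (rule that(3))
    qed (simp_all add: coeffs_def scal[OF that(1)] scal[OF that(2)])
    then show ?thesis using scalar_one_inj that by simp
  qed
  obtain g where g: "\<And>v. v \<in> Vij \<Longrightarrow> g v \<in> carrier K"
    "\<And>v. v \<in> Vij \<Longrightarrow> U +>\<^bsub>?M\<^esub> v = U +>\<^bsub>?M\<^esub> (g v \<odot>\<^bsub>L\<^esub> x0)" using ex by metis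
  \<comment> \<open>The coordinate of the class of \<open>v\<close> with respect to the class of
    \<open>x0\<close>; it is unique by \<open>uniq\<close>, which makes it linear.\<close>
  define \<mu> where "\<mu> = (\<lambda>v\<in>Vij. g v)"
  have \<mu>I: "\<mu> v = c" if "v \<in> Vij" "c \<in> carrier K" "U +>\<^bsub>?M\<^esub> v = U +>\<^bsub>?M\<^esub> (c \<odot>\<^bsub>L\<^esub> x0)" for v c
    using uniq[OF g(1)[OF that(1)] that(2)] g(2)[OF that(1)] that by (simp add: \<mu>_def)
  have cV: "c \<odot>\<^bsub>L\<^esub> v \<in> Vij" if "c \<in> carrier K" "v \<in> Vij" for c v
    using V_closed(4)[OF i j that(2,1)] .
  have x0L: "x0 \<in> carrier L" by (rule V_carrier[OF i j x0(1)])
  have "functional K (Vscal L e n i j) \<mu>"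
    unfolding functional_def
  proof (intro conjI ballI)
    fix v w assume "v \<in> carrier (Vscal L e n i j)" "w \<in> carrier (Vscal L e n i j)"
    then have v: "v \<in> Vij" and w: "w \<in> Vij" by auto
    have "U +>\<^bsub>?M\<^esub> (v \<oplus>\<^bsub>L\<^esub> w) = (U +>\<^bsub>?M\<^esub> (g v \<odot>\<^bsub>L\<^esub> x0)) <+>\<^bsub>?M\<^esub> (U +>\<^bsub>?M\<^esub> (g w \<odot>\<^bsub>L\<^esub> x0))"
      using Q.coset_add[of v w] v w g(2) by simp
    also have "\<dots> = U +>\<^bsub>?M\<^esub> ((g v \<oplus>\<^bsub>K\<^esub> g w) \<odot>\<^bsub>L\<^esub> x0)"
      using Q.coset_add[of "g v \<odot>\<^bsub>L\<^esub> x0" "g w \<odot>\<^bsub>L\<^esub> x0"] cV[OF g(1) x0(1)] v w g(1) x0L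
      by (simp add: smult_l_distr)
    finally have "\<mu> (v \<oplus>\<^bsub>L\<^esub> w) = g v \<oplus>\<^bsub>K\<^esub> g w"
      using \<mu>I[OF V_closed(1)[OF i j v w]] g(1) v w by simp
    then show "\<mu> (v \<oplus>\<^bsub>Vscal L e n i j\<^esub> w) = \<mu> v \<oplus>\<^bsub>K\<^esub> \<mu> w" using v w by (simp add: \<mu>_def)
  next
    fix c v assume c: "c \<in> carrier K" and "v \<in> carrier (Vscal L e n i j)"
    then have v: "v \<in> Vij" by simp
    have "U +>\<^bsub>?M\<^esub> (c \<odot>\<^bsub>L\<^esub> v) = U +>\<^bsub>?M\<^esub> (c \<odot>\<^bsub>L\<^esub> (g v \<odot>\<^bsub>L\<^esub> x0))"
      using act[OF c v] act[OF c cV[OF g(1)[OF v] x0(1)]] g(2)[OF v] by simp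
    then have "\<mu> (c \<odot>\<^bsub>L\<^esub> v) = c \<otimes>\<^bsub>K\<^esub> g v"
      using \<mu>I[OF cV[OF c v], of "c \<otimes>\<^bsub>K\<^esub> g v"] g(1)[OF v] c x0L by (simp add: smult_assoc1)
    then show "\<mu> (c \<odot>\<^bsub>Vscal L e n i j\<^esub> v) = c \<otimes>\<^bsub>K\<^esub> \<mu> v" using v by (simp add: \<mu>_def)
  qed (simp add: \<mu>_def g(1))
  moreover have "\<mu> \<in> Vij \<rightarrow>\<^sub>E carrier K" using g(1) by (auto simp: \<mu>_def)
  moreover have "\<mu> x0 = \<one>\<^bsub>K\<^esub>" using \<mu>I[OF x0(1), of "\<one>\<^bsub>K\<^esub>"] x0L by simp
  ultimately have nf: "\<mu> \<in> nonzero_functionals"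
    unfolding nonzero_functionals_def using x0(1) by (auto simp: Vdual_iff intro!: bexI[of _ x0])
  have zx: "\<zero>\<^bsub>K\<^esub> \<odot>\<^bsub>L\<^esub> x0 = \<zero>\<^bsub>L\<^esub>"
    using lmodule.smult_l_null[OF lmodule_KL x0L] .
  have "ker \<mu> = U"
  proof (intro equalityI subsetI)
    fix v assume "v \<in> ker \<mu>"
    then have v: "v \<in> Vij" "g v = \<zero>\<^bsub>K\<^esub>" by (auto simp: ker_def \<mu>_def)
    then have "U +>\<^bsub>?M\<^esub> v = U"
      using g(2)[OF v(1)] zx Q.coset_zero_iff[of "\<zero>\<^bsub>L\<^esub>"] Q.sub(2) zero_in_V[OF i j] by simp
    then show "v \<in> U" using Q.coset_zero_iff[of v] v by simp
  next
    fix v assume vU: "v \<in> U"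
    then have v: "v \<in> Vij" using Q.sub_carrier by auto
    then have "U +>\<^bsub>?M\<^esub> v = U +>\<^bsub>?M\<^esub> (\<zero>\<^bsub>K\<^esub> \<odot>\<^bsub>L\<^esub> x0)"
      using vU zx Q.coset_zero_iff[of v] Q.coset_zero_iff[of "\<zero>\<^bsub>L\<^esub>"] Q.sub(2) zero_in_V[OF i j] by simp
    then show "v \<in> ker \<mu>" using \<mu>I[OF v, of "\<zero>\<^bsub>K\<^esub>"] v by (simp add: ker_def)
  qed
  then show "U \<in> ker ` nonzero_functionals" using nf by blast
next
  let ?M = "Vleft L e n i j" and ?D = "Dres L e j"
  fix U assume "U \<in> ker ` nonzero_functionals"
  then obtain \<mu> where \<mu>: "\<mu> \<in> nonzero_functionals" "U = ker \<mu>" by auto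
  note V0 = nonzero_functionalsD(2)[OF \<mu>(1)] and d = VdualD[OF nonzero_functionalsD(1)[OF \<mu>(1)]]
  obtain x0 where x0: "x0 \<in> Vij" "\<mu> x0 \<noteq> \<zero>\<^bsub>K\<^esub>" using \<mu>(1) by (auto simp: nonzero_functionals_def)
  have scal: "c \<odot>\<^bsub>?D\<^esub> \<one>\<^bsub>?D\<^esub> \<in> carrier ?D" if "c \<in> carrier K" for c
    using that lmodule.smult_closed[OF Dres_lmodule[OF j]] ring.ring_simprules(6)[OF Dres_ring[OF j]] by blast
  have cV: "c \<odot>\<^bsub>L\<^esub> v \<in> Vij" if "c \<in> carrier K" "v \<in> Vij" for c v
    using V_closed(4)[OF i j that(2,1)] .
  have sub: "submodule U ?D ?M"
  proof (rule lmodule.submoduleI[OF Vleft_lmodule[OF i j]])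
    fix a v assume a: "a \<in> carrier ?D" and "v \<in> U"
    then have v: "v \<in> Vij" "\<mu> v = \<zero>\<^bsub>K\<^esub>" by (auto simp: \<mu>(2) ker_def)
    obtain c where c: "c \<in> carrier K" "a = c \<odot>\<^bsub>?D\<^esub> \<one>\<^bsub>?D\<^esub>" using Dres_scalar[OF V0 a] by auto
    show "a \<odot>\<^bsub>?M\<^esub> v \<in> U"
      using scalar_actions(2)[OF i j c(1) v(1)] cV[OF c(1) v(1)] d(3)[OF c(1) v(1)] v(2) c
      by (simp add: \<mu>(2) ker_def)
  qed (use d(2,4) V_closed(1)[OF i j] zero_in_V[OF i j] in \<open>auto simp: \<mu>(2) ker_def\<close>)
  interpret Q: quotient_module ?D ?M U
    by (intro quotient_module.intro quotient_module_axioms.intro Vleft_lmodule[OF i j] sub)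
  have act: "(c \<odot>\<^bsub>?D\<^esub> \<one>\<^bsub>?D\<^esub>) \<odot>\<^bsub>quot_mod ?M U\<^esub> (U +>\<^bsub>?M\<^esub> v) = U +>\<^bsub>?M\<^esub> (c \<odot>\<^bsub>L\<^esub> v)"
    if "c \<in> carrier K" "v \<in> Vij" for c v
    using Q.coset_smult[OF scal[OF that(1)], of v] that scalar_actions(2)[OF i j that] by simp
  have Q_lmod: "lmodule ?D (quot_mod ?M U)" by (rule Q.quot_lmodule)
  have x0Q: "U +>\<^bsub>?M\<^esub> x0 \<in> carrier (quot_mod ?M U)" using x0 by (auto simp: a_rcosets_eq)
  have "has_dim ?D (quot_mod ?M U) 1"
  proof (rule lmodule.has_dim_1I[OF Q_lmod x0Q])
    show "carrier (quot_mod ?M U) = {a \<odot>\<^bsub>quot_mod ?M U\<^esub> (U +>\<^bsub>?M\<^esub> x0) | a. a \<in> carrier ?D}"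
    proof (intro equalityI subsetI)
      fix X assume "X \<in> carrier (quot_mod ?M U)"
      then obtain v where v: "v \<in> Vij" "X = U +>\<^bsub>?M\<^esub> v" by (auto simp: a_rcosets_eq)
      \<comment> \<open>Chosen so that \<open>v - c x0\<close> lies in the kernel.\<close>
      let ?c = "\<mu> v \<otimes>\<^bsub>K\<^esub> inv\<^bsub>K\<^esub> (\<mu> x0)"
      have x0': "\<mu> x0 \<in> carrier K" "inv\<^bsub>K\<^esub> (\<mu> x0) \<in> carrier K" "inv\<^bsub>K\<^esub> (\<mu> x0) \<otimes>\<^bsub>K\<^esub> \<mu> x0 = \<one>\<^bsub>K\<^esub>"
        using division_ring_inv(1,2)[OF K.division_ring d(1)[OF x0(1)] x0(2)] d(1)[OF x0(1)] by auto
      have c: "?c \<in> carrier K" using x0' d(1)[OF v(1)] by simp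
      have m: "\<ominus>\<^bsub>L\<^esub> (?c \<odot>\<^bsub>L\<^esub> x0) = (\<ominus>\<^bsub>K\<^esub> ?c) \<odot>\<^bsub>L\<^esub> x0"
        using lmodule.smult_l_minus[OF lmodule_KL c V_carrier[OF i j x0(1)]] by simp
      have "\<mu> (v \<ominus>\<^bsub>L\<^esub> ?c \<odot>\<^bsub>L\<^esub> x0) = \<mu> v \<oplus>\<^bsub>K\<^esub> (\<ominus>\<^bsub>K\<^esub> ?c) \<otimes>\<^bsub>K\<^esub> \<mu> x0"
        unfolding a_minus_def m using d(2)[OF v(1) cV[of "\<ominus>\<^bsub>K\<^esub> ?c" x0]] d(3)[of "\<ominus>\<^bsub>K\<^esub> ?c" x0] c x0(1) by simp
      also have "\<dots> = \<zero>\<^bsub>K\<^esub>"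
        using x0' d(1)[OF v(1)] by (simp add: K.l_minus K.m_assoc K.r_neg)
      finally have "v \<ominus>\<^bsub>L\<^esub> ?c \<odot>\<^bsub>L\<^esub> x0 \<in> U"
        using V_closed(1)[OF i j v(1) V_closed(5)[OF i j cV[OF c x0(1)]]] by (simp add: \<mu>(2) ker_def a_minus_def)
      then have "X = U +>\<^bsub>?M\<^esub> (?c \<odot>\<^bsub>L\<^esub> x0)"
        using v cV[OF c x0(1)] Q.coset_eq_iff[of v "?c \<odot>\<^bsub>L\<^esub> x0"] Vleft_minus by simp
      then show "X \<in> {a \<odot>\<^bsub>quot_mod ?M U\<^esub> (U +>\<^bsub>?M\<^esub> x0) | a. a \<in> carrier ?D}"
        using act[OF c x0(1)] scal[OF c] by auto
    next
      fix X assume "X \<in> {a \<odot>\<^bsub>quot_mod ?M U\<^esub> (U +>\<^bsub>?M\<^esub> x0) | a. a \<in> carrier ?D}"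
      then show "X \<in> carrier (quot_mod ?M U)" using lmodule.smult_closed[OF Q_lmod _ x0Q] by auto
    qed
  next
    fix a assume a: "a \<in> carrier ?D" and z: "a \<odot>\<^bsub>quot_mod ?M U\<^esub> (U +>\<^bsub>?M\<^esub> x0) = \<zero>\<^bsub>quot_mod ?M U\<^esub>"
    obtain c where c: "c \<in> carrier K" "a = c \<odot>\<^bsub>?D\<^esub> \<one>\<^bsub>?D\<^esub>" using Dres_scalar[OF V0 a] by auto
    have "c \<odot>\<^bsub>L\<^esub> x0 \<in> U"
      using z act[OF c(1) x0(1)] c(2) Q.coset_zero_iff[of "c \<odot>\<^bsub>L\<^esub> x0"] cV[OF c(1) x0(1)] by simp
    then have "c \<otimes>\<^bsub>K\<^esub> \<mu> x0 = \<zero>\<^bsub>K\<^esub>" using d(3)[OF c(1) x0(1)] by (simp add: \<mu>(2) ker_def)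
    then have "c = \<zero>\<^bsub>K\<^esub>" using K.integral[OF _ c(1) d(1)[OF x0(1)]] x0(2) by auto
    then show "a = \<zero>\<^bsub>?D\<^esub>"
      using c(2) lmodule.smult_l_null[OF Dres_lmodule[OF j]] ring.ring_simprules(6)[OF Dres_ring[OF j]] by simp
  qed
  then show "U \<in> ?H" using V0 sub by simp
qed

abbreviation H where "H \<equiv> HomVD K L e n i j"

abbreviation D where "D \<equiv> Dres L e i"

definition line :: "('a \<Rightarrow> 'k) \<Rightarrow> ('a \<Rightarrow> 'a set \<Rightarrow> 'k) set" where
  "line \<mu> = cyclic_sub D H (functional_map L e n i j \<mu>)"

definition Mker :: "('a \<Rightarrow> 'k) \<Rightarrow> ('a, 'a set) module" where
  "Mker \<mu> = quot_mod (Pmod L (e i)) (Nsub (ker \<mu>))"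

lemma Mker_iso_iff:
  assumes "\<mu> \<in> nonzero_functionals" "\<nu> \<in> nonzero_functionals"
  shows "mod_isomorphic L (Mker \<mu>) (Mker \<nu>) \<longleftrightarrow> line \<mu> = line \<nu>"
  using Mquot_iso_iff[OF assms] assms
    right_vector_space.cyclic_sub_adjoint_eq_iff[OF V_right_vector_space[OF i j], of \<mu> \<nu>]
  by (simp add: Mker_def line_def HomVD_eq[OF i j] functional_map_eq[OF i j] nonzero_functionals_def Vdual_eq[OF i j])

lemma Mquots_eq: "Mquots L t e n i j = Mker ` nonzero_functionals"
proof -
  have "Mquots L t e n i j = Mquot L t e n i j ` {U. Vij \<noteq> {\<zero>\<^bsub>L\<^esub>} \<and> submodule U (Dres L e j) (Vleft L e n i j)
      \<and> has_dim (Dres L e j) (quot_mod (Vleft L e n i j) U) 1}"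
    by (auto simp: Mquots_def)
  also have "\<dots> = Mquot L t e n i j ` ker ` nonzero_functionals" by (simp only: hyperplanes_eq_kernels)
  also have "\<dots> = Mker ` nonzero_functionals"
    unfolding image_image by (intro image_cong refl) (simp add: Mquot_def Mker_def Nsub_eq ker_def)
  finally show ?thesis .
qed

lemma Misorel_class:
  assumes "\<mu> \<in> nonzero_functionals"
  shows "Misorel L t e n i j `` {Mker \<mu>} = Mker ` {\<nu> \<in> nonzero_functionals. line \<nu> = line \<mu>}"
  using Mker_iso_iff[OF assms] assms by (auto simp: Misorel_def Mquots_eq)

lemma Misorel_class_eq_iff:
  assumes "\<mu> \<in> nonzero_functionals" "\<nu> \<in> nonzero_functionals"
  shows "Misorel L t e n i j `` {Mker \<mu>} = Misorel L t e n i j `` {Mker \<nu>} \<longleftrightarrow> line \<mu> = line \<nu>"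
proof
  assume "Misorel L t e n i j `` {Mker \<mu>} = Misorel L t e n i j `` {Mker \<nu>}"
  moreover have "Mker \<mu> \<in> Misorel L t e n i j `` {Mker \<mu>}" using assms Misorel_class by auto
  ultimately have "(Mker \<nu>, Mker \<mu>) \<in> Misorel L t e n i j" by auto
  then show "line \<mu> = line \<nu>" using Mker_iso_iff[OF assms(2,1)] by (simp add: Misorel_def)
qed (simp add: Misorel_class assms)

lemma proj_points_lines: "proj_points D H = line ` nonzero_functionals"
proof -
  interpret H: left_vector_space D H
    unfolding HomVD_eq[OF i j] by (rule right_vector_space.HomD_left_vector_space[OF V_right_vector_space[OF i j]])
  note b = right_vector_space.adjoint_map_bij[OF V_right_vector_space[OF i j]]
  have "carrier H - {\<zero>\<^bsub>H\<^esub>} = functional_map L e n i j ` nonzero_functionals"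
    using right_vector_space.adjoint_map_eq_zero_iff[OF V_right_vector_space[OF i j]]
      bij_betw_imp_surj_on[OF b, symmetric]
    unfolding HomVD_eq[OF i j] functional_map_eq[OF i j] nonzero_functionals_def Vdual_eq[OF i j] by auto
  then show ?thesis unfolding H.proj_points_eq by (simp add: image_image line_def)
qed

lemma fibre_eq: "fibre L t e n i j = (\<lambda>\<mu>. Misorel L t e n i j `` {Mker \<mu>}) ` nonzero_functionals"
  by (auto simp: fibre_def quotient_def Mquots_eq)

lemma fibre_coord_eq:
  "fibre_coord K L t e n i j = (\<lambda>\<mu>. (Misorel L t e n i j `` {Mker \<mu>}, line \<mu>)) ` nonzero_functionals"
proof -
  have "Mquot L t e n i j {v \<in> Vij. \<mu> v = \<zero>\<^bsub>K\<^esub>} = Mker \<mu>" for \<mu>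
    by (simp add: Mquot_def Mker_def Nsub_eq ker_def)
  then show ?thesis unfolding fibre_coord_def nonzero_functionals_def line_def by auto
qed

lemma fibre_subspace_subset: "S \<in> snd (fibre_geom K L t e n i j) \<Longrightarrow> S \<subseteq> fst (fibre_geom K L t e n i j)"
  by (auto simp: fibre_geom_def fibre_coord_eq fibre_eq)

lemma H_left_vector_space: "left_vector_space D H"
  unfolding HomVD_eq[OF i j] by (rule right_vector_space.HomD_left_vector_space[OF V_right_vector_space[OF i j]])

text \<open>Blocks and cross-ratios of the fibre are defined by pulling back along the relation
  \<open>fibre_coord\<close>. Once this relation is seen to be the graph of a bijection, both
  structures transport exactly.\<close>

lemma fibre_coordinates:
  shows "\<exists>\<gamma> \<in> geom_isos (fibre_geom K L t e n i j) (PG D H). \<forall>c\<in>carrier K.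
    fibre_cross_ratio K L t e n i j c \<subseteq> fibre L t e n i j \<times> fibre L t e n i j \<times> fibre L t e n i j \<times> fibre L t e n i j
    \<and> (\<lambda>(p, q, r, s). (\<gamma> p, \<gamma> q, \<gamma> r, \<gamma> s)) ` fibre_cross_ratio K L t e n i j c = cross_ratio_rel D H c"
proof -
  let ?F = "fibre L t e n i j" and ?C = "fibre_coord K L t e n i j"
  obtain \<gamma> where bij: "bij_betw \<gamma> ?F (proj_points D H)"
    and \<gamma>: "\<And>\<mu>. \<mu> \<in> nonzero_functionals \<Longrightarrow> \<gamma> (Misorel L t e n i j `` {Mker \<mu>}) = line \<mu>"
    using ex_factor[of nonzero_functionals "\<lambda>\<mu>. Misorel L t e n i j `` {Mker \<mu>}" line] Misorel_class_eq_iff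
    unfolding fibre_eq proj_points_lines by blast
  \<comment> \<open>The relation \<open>fibre_coord\<close> is the graph of
    \<open>\<gamma>\<close>.\<close>
  have C: "?C = (\<lambda>p. (p, \<gamma> p)) ` ?F"
    unfolding fibre_coord_eq fibre_eq image_image by (intro image_cong refl) (simp add: \<gamma>)
  have C_iff: "(p, x) \<in> ?C \<longleftrightarrow> p \<in> ?F \<and> x = \<gamma> p" for p x unfolding C by blast
  have cr: "(p, q, r, s) \<in> fibre_cross_ratio K L t e n i j c \<longleftrightarrow> p \<in> ?F \<and> q \<in> ?F \<and> r \<in> ?F \<and> s \<in> ?F
    \<and> (\<gamma> p, \<gamma> q, \<gamma> r, \<gamma> s) \<in> cross_ratio_rel D H c" for p q r s c
    unfolding fibre_cross_ratio_def mem_Collect_eq case_prod_conv C_iff Bex_def split_paired_Ex by blast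
  have im: "\<gamma> ` ?F = proj_points D H" using bij by (simp add: bij_betw_def)
  have "\<gamma> ` (?C\<inverse> `` S) = S" if "S \<in> proj_subspaces D H" for S
  proof -
    have "?C\<inverse> `` S = {p \<in> ?F. \<gamma> p \<in> S}" by (auto simp: C)
    moreover have "S \<subseteq> \<gamma> ` ?F" using that unfolding im by (auto simp: proj_subspaces_def)
    ultimately show ?thesis by auto
  qed
  then have "(\<lambda>S. \<gamma> ` S) ` snd (fibre_geom K L t e n i j) = proj_subspaces D H"
    unfolding fibre_geom_def snd_conv Setcompr_eq_image image_image by simp
  then have g1: "\<gamma> \<in> geom_isos (fibre_geom K L t e n i j) (PG D H)"
    using bij by (simp add: geom_isos_def PG_def fibre_geom_def)
  have g2: "fibre_cross_ratio K L t e n i j c \<subseteq> ?F \<times> ?F \<times> ?F \<times> ?F" for c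
  proof
    fix z assume "z \<in> fibre_cross_ratio K L t e n i j c"
    then show "z \<in> ?F \<times> ?F \<times> ?F \<times> ?F" by (cases z) (simp add: cr)
  qed
  have g3: "(\<lambda>(p, q, r, s). (\<gamma> p, \<gamma> q, \<gamma> r, \<gamma> s)) ` fibre_cross_ratio K L t e n i j c = cross_ratio_rel D H c"
    if c: "c \<in> carrier K" for c
  proof (intro equalityI subsetI)
    fix z assume z: "z \<in> cross_ratio_rel D H c"
    \<comment> \<open>Each entry must be a genuine projective point to have a preimage in the
      fibre.\<close>
    then have "z \<in> \<gamma> ` ?F \<times> \<gamma> ` ?F \<times> \<gamma> ` ?F \<times> \<gamma> ` ?F"
      using cross_ratio_rel_points[OF H_left_vector_space, of c]
        right_vector_space.scalar_one_closed[OF V_right_vector_space[OF i j] c] unfolding im by blast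
    then obtain p q r s where pqrs: "p \<in> ?F" "q \<in> ?F" "r \<in> ?F" "s \<in> ?F" "z = (\<gamma> p, \<gamma> q, \<gamma> r, \<gamma> s)" by auto
    then have "(p, q, r, s) \<in> fibre_cross_ratio K L t e n i j c"
      using z by (simp add: cr)
    then show "z \<in> (\<lambda>(p, q, r, s). (\<gamma> p, \<gamma> q, \<gamma> r, \<gamma> s)) ` fibre_cross_ratio K L t e n i j c"
      using pqrs(5) by (intro image_eqI[of _ _ "(p, q, r, s)"]) auto
  next
    fix z assume "z \<in> (\<lambda>(p, q, r, s). (\<gamma> p, \<gamma> q, \<gamma> r, \<gamma> s)) ` fibre_cross_ratio K L t e n i j c"
    then obtain p q r s where "(p, q, r, s) \<in> fibre_cross_ratio K L t e n i j c" "z = (\<gamma> p, \<gamma> q, \<gamma> r, \<gamma> s)"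
      by auto
    then show "z \<in> cross_ratio_rel D H c" by (simp add: cr)
  qed
  show ?thesis by (intro bexI[OF _ g1] ballI conjI g2 g3)
qed

end

section \<open>Comparison of two algebras\<close>

lemma (in left_vector_space) list_basis_Nil_iff:
  assumes "list_basis R M xs"
  shows "xs = [] \<longleftrightarrow> carrier M = {\<zero>\<^bsub>M\<^esub>}"
proof
  assume "xs = []"
  then show "carrier M = {\<zero>\<^bsub>M\<^esub>}" using assms by (auto simp: list_basis_def lspan_def)
next
  assume M: "carrier M = {\<zero>\<^bsub>M\<^esub>}"
  show "xs = []"
  proof (cases xs)
    case (Cons x ys)
    then have "x \<notin> lspan R M ys" "x \<in> carrier M" "set ys \<subseteq> carrier M" using assms by (auto simp: list_basis_def)
    then show ?thesis using submoduleD(2)[OF lspan_submodule[of ys]] M by auto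
  qed
qed

text \<open>For a coordinatizing ring without any structure over the field, as required for an
  arbitrary \<open>E\<close> in \<open>recovered\<close>.\<close>

lemma collineation_ex_ring_iso:
  assumes "collineation D W D' W' \<beta>" "list_basis D W xs" "3 \<le> length xs"
  shows "ring_iso D D' \<noteq> {}"
proof -
  interpret collineation D W D' W' \<beta> by fact
  show ?thesis using D.list_basis_triple[OF assms(2,3)] fundamental_theorem by blast
qed

section \<open>Isomorphisms of geometries that respect quadruples\<close>

abbreviation quad :: "('x \<Rightarrow> 'y) \<Rightarrow> 'x \<times> 'x \<times> 'x \<times> 'x \<Rightarrow> 'y \<times> 'y \<times> 'y \<times> 'y" where
  "quad \<beta> \<equiv> \<lambda>(p, q, r, s). (\<beta> p, \<beta> q, \<beta> r, \<beta> s)"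

text \<open>
  Isomorphisms of geometries that carry a family of quadruples, indexed by \<open>C\<close>, to another one;
  \<open>C = {}\<close> gives plain isomorphisms and \<open>C = carrier K\<close> those preserving cross-ratios in \<open>k\<close>.
\<close>

definition quad_isos ::
  "'k set \<Rightarrow> 'p geometry \<Rightarrow> ('k \<Rightarrow> ('p \<times> 'p \<times> 'p \<times> 'p) set) \<Rightarrow> 'q geometry
    \<Rightarrow> ('k \<Rightarrow> ('q \<times> 'q \<times> 'q \<times> 'q) set) \<Rightarrow> ('p \<Rightarrow> 'q) set" where
  "quad_isos C G X H Y = {\<beta> \<in> geom_isos G H. \<forall>c\<in>C. quad \<beta> ` X c = Y c}"

lemma quad_isos_comp:
  assumes "\<beta> \<in> quad_isos C G X H Y" "\<gamma> \<in> quad_isos C H Y I Z"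
  shows "\<gamma> \<circ> \<beta> \<in> quad_isos C G X I Z"
proof -
  have "quad (\<gamma> \<circ> \<beta>) ` X c = quad \<gamma> ` (quad \<beta> ` X c)" for c by (force simp: image_image split_def)
  then show ?thesis using assms geom_isos_comp[of \<beta> G H \<gamma> I] by (simp add: quad_isos_def)
qed

lemma quad_isos_inv:
  assumes "\<beta> \<in> quad_isos C G X H Y" "\<And>S. S \<in> snd G \<Longrightarrow> S \<subseteq> fst G"
    "\<And>c. c \<in> C \<Longrightarrow> X c \<subseteq> fst G \<times> fst G \<times> fst G \<times> fst G"
  shows "inv_into (fst G) \<beta> \<in> quad_isos C H Y G X"
proof -
  let ?\<gamma> = "inv_into (fst G) \<beta>"
  have \<beta>: "\<beta> \<in> geom_isos G H" "\<And>c. c \<in> C \<Longrightarrow> quad \<beta> ` X c = Y c" using assms(1) by (auto simp: quad_isos_def)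
  have "inj_on \<beta> (fst G)" using \<beta>(1) by (auto simp: geom_isos_def bij_betw_def)
  then have i: "\<And>p. p \<in> fst G \<Longrightarrow> ?\<gamma> (\<beta> p) = p" by (rule inv_into_f_f)
  have "quad ?\<gamma> ` Y c = X c" if c: "c \<in> C" for c
  proof -
    have "quad ?\<gamma> ` Y c = (\<lambda>z. quad ?\<gamma> (quad \<beta> z)) ` X c"
      by (simp only: \<beta>(2)[OF c, symmetric] image_image)
    also have "\<dots> = (\<lambda>z. z) ` X c"
    proof (rule image_cong[OF refl])
      fix z assume "z \<in> X c"
      then show "quad ?\<gamma> (quad \<beta> z) = z" using assms(3)[OF c] i by (cases z) auto
    qed
    finally show ?thesis by simp
  qed
  then show ?thesis using geom_isos_inv[OF \<beta>(1) assms(2)] by (simp add: quad_isos_def)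
qed

text \<open>Cross-ratios are preserved as an equality of sets: the inclusion for \<open>f\<close> is
  combined with the one for its inverse.\<close>

lemma semilinear_iso_quad_isos:
  fixes R :: "('k, 'r, 'y) module_scheme" and R' :: "('k, 's, 'y2) module_scheme" and C :: "'k set"
  assumes "left_vector_space R M" "left_vector_space R' M'" "f \<in> semilinear_iso R \<sigma> M M'"
    "bij_betw \<sigma> (carrier R) (carrier R')" "\<And>c. c \<in> C \<Longrightarrow> c \<odot>\<^bsub>R\<^esub> \<one>\<^bsub>R\<^esub> \<in> carrier R"
    "\<And>c. c \<in> C \<Longrightarrow> \<sigma> (c \<odot>\<^bsub>R\<^esub> \<one>\<^bsub>R\<^esub>) = c \<odot>\<^bsub>R'\<^esub> \<one>\<^bsub>R'\<^esub>"
  shows "(`) f \<in> quad_isos C (PG R M) (cross_ratio_rel R M) (PG R' M') (cross_ratio_rel R' M')"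
proof -
  interpret M: left_vector_space R M by fact
  interpret M': left_vector_space R' M' by fact
  let ?g = "inv_into (carrier M) f" and ?s = "inv_into (carrier R) \<sigma>"
  have g: "?g \<in> semilinear_iso R' ?s M' M"
    using semilinear_iso_inv[OF M.lmodule_axioms M'.lmodule_axioms assms(3,4)] .
  have im: "f ` carrier M = carrier M'" using assms(3) by (simp add: semilinear_iso_def bij_betw_def)
  have "quad ((`) f) ` cross_ratio_rel R M c = cross_ratio_rel R' M' c" if c: "c \<in> C" for c
  proof
    note s = assms(5,6)[OF c]
    show "quad ((`) f) ` cross_ratio_rel R M c \<subseteq> cross_ratio_rel R' M' c"
      using semilinear_iso_cross_ratio_rel[OF M.lmodule_axioms M'.lmodule_axioms assms(3,4) s] .
    have s': "c \<odot>\<^bsub>R'\<^esub> \<one>\<^bsub>R'\<^esub> \<in> carrier R'" "?s (c \<odot>\<^bsub>R'\<^esub> \<one>\<^bsub>R'\<^esub>) = c \<odot>\<^bsub>R\<^esub> \<one>\<^bsub>R\<^esub>"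
      using bij_betw_apply[OF assms(4) s(1)] inv_into_f_f[OF bij_betw_imp_inj_on[OF assms(4)] s(1)] s(2) by simp_all
    have sub: "quad ((`) ?g) ` cross_ratio_rel R' M' c \<subseteq> cross_ratio_rel R M c"
      using semilinear_iso_cross_ratio_rel[OF M'.lmodule_axioms M.lmodule_axioms g bij_betw_inv_into[OF assms(4)] s'] .
    show "cross_ratio_rel R' M' c \<subseteq> quad ((`) f) ` cross_ratio_rel R M c"
    proof
      fix z assume z: "z \<in> cross_ratio_rel R' M' c"
      obtain p q r s where pqrs: "z = (p, q, r, s)" by (cases z)
      have "N \<subseteq> carrier M'" if "N \<in> proj_points R' M'" for N
        using that M'.submoduleD(1) by (auto simp: proj_points_def)
      then have "p \<subseteq> carrier M'" "q \<subseteq> carrier M'" "r \<subseteq> carrier M'" "s \<subseteq> carrier M'"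
        using cross_ratio_rel_points[OF assms(2) s'(1)] z pqrs by auto
      then have "z = quad ((`) f) (quad ((`) ?g) z)"
        using image_inv_into_cancel[OF im] by (simp add: pqrs)
      moreover have "quad ((`) ?g) z \<in> cross_ratio_rel R M c" using sub z by blast
      ultimately show "z \<in> quad ((`) f) ` cross_ratio_rel R M c" by blast
    qed
  qed
  then show ?thesis using semilinear_iso_PG[OF assms(1-4)] by (simp add: quad_isos_def)
qed

text \<open>The zero space has neither points nor blocks; this covers the pairs with vanishing
  \<open>V_ij\<close>.\<close>

lemma PG_trivial:
  assumes "left_vector_space R M" "carrier M = {\<zero>\<^bsub>M\<^esub>}"
  shows "PG R M = ({}, {})"
proof -
  interpret M: left_vector_space R M by fact
  have "proj_points R M = {}" by (simp add: M.proj_points_eq assms(2))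
  moreover have "U = {\<zero>\<^bsub>M\<^esub>}" if "submodule U R M" for U
    using M.submoduleD(1,2)[OF that] assms(2) by auto
  ultimately show ?thesis by (auto simp: PG_def proj_subspaces_def)
qed

section \<open>One algebra under the standing hypotheses\<close>

locale terminal_algebra = basic_algebra K L t e n
  for K :: "('k, 'p) ring_scheme" and L :: "('k, 'a) module" and t :: nat and e :: "nat \<Rightarrow> 'a" and n :: nat +
  assumes split_targets: "split_targets K L t e n" and rank_three_targets: "rank_three_targets L t e n"
begin

context
  fixes i j assumes i: "i \<in> {1..t}" and j: "j \<in> {1..t}"
begin

lemma terminal_pair: "terminal_pair K L t e n i j"
  using split_targets i j
  by (intro terminal_pair.intro terminal_pair_axioms.intro basic_algebra_axioms) (auto simp: split_targets_def)

lemma Vright_left_vector_space: "left_vector_space (opp (Dres L e i)) (Vright L e n i j)"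
  by (rule right_vector_space.right_space[OF V_right_vector_space[OF i j]])

lemma HomVD_list_basis:
  "list_basis (opp (Dres L e i)) (Vright L e n i j) xs \<Longrightarrow>
    \<exists>ts. list_basis (Dres L e i) (HomVD K L e n i j) ts \<and> length ts = length xs"
  using right_vector_space.HomD_list_basis[OF V_right_vector_space[OF i j]] by (simp add: HomVD_eq[OF i j])

lemma rank_is_list_basis:
  assumes "rank_is L e n i j r"
  shows "\<exists>xs. list_basis (opp (Dres L e i)) (Vright L e n i j) xs \<and> length xs = r"
  using lmodule.has_dim_list_basis[OF Vright_lmodule[OF i j]] assms
    division_ring_one_neq_zero[OF division_ring_opp[OF Dres_division[OF i]]]
  by (simp add: rank_is_def)

lemma source_terminal: "V L e n i j \<noteq> {\<zero>\<^bsub>L\<^esub>} \<Longrightarrow> i \<in> terminal_vertices L t e n"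
  using V_subset_JP[OF i j] zero_in_V[OF i j] i by (auto simp: terminal_vertices_def)

lemma target_terminal: "V L e n i j \<noteq> {\<zero>\<^bsub>L\<^esub>} \<Longrightarrow> j \<in> terminal_vertices L t e n"
  using i j by (auto simp: terminal_vertices_def)

lemma fibre_coordinates_quad:
  assumes "C \<subseteq> carrier K"
  shows "\<exists>\<gamma>. \<gamma> \<in> quad_isos C (fibre_geom K L t e n i j) (fibre_cross_ratio K L t e n i j)
      (PG (Dres L e i) (HomVD K L e n i j)) (cross_ratio_rel (Dres L e i) (HomVD K L e n i j))
    \<and> inv_into (fibre L t e n i j) \<gamma> \<in> quad_isos C (PG (Dres L e i) (HomVD K L e n i j))
      (cross_ratio_rel (Dres L e i) (HomVD K L e n i j)) (fibre_geom K L t e n i j) (fibre_cross_ratio K L t e n i j)"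
proof -
  interpret P: terminal_pair K L t e n i j by (rule terminal_pair)
  have F: "fst (fibre_geom K L t e n i j) = fibre L t e n i j" by (simp add: fibre_geom_def)
  obtain \<gamma> where \<gamma>0: "\<gamma> \<in> geom_isos (fibre_geom K L t e n i j) (PG (Dres L e i) (HomVD K L e n i j))"
    and \<gamma>1: "\<forall>c\<in>carrier K. fibre_cross_ratio K L t e n i j c \<subseteq>
      fibre L t e n i j \<times> fibre L t e n i j \<times> fibre L t e n i j \<times> fibre L t e n i j
      \<and> quad \<gamma> ` fibre_cross_ratio K L t e n i j c = cross_ratio_rel (Dres L e i) (HomVD K L e n i j) c"
    by (rule bexE[OF P.fibre_coordinates])
  have sub: "fibre_cross_ratio K L t e n i j c \<subseteq>
      fibre L t e n i j \<times> fibre L t e n i j \<times> fibre L t e n i j \<times> fibre L t e n i j" if "c \<in> C" for c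
    using conjunct1[OF bspec[OF \<gamma>1 subsetD[OF assms that]]] .
  have im: "quad \<gamma> ` fibre_cross_ratio K L t e n i j c = cross_ratio_rel (Dres L e i) (HomVD K L e n i j) c"
    if "c \<in> C" for c
    using conjunct2[OF bspec[OF \<gamma>1 subsetD[OF assms that]]] .
  have \<gamma>: "\<gamma> \<in> quad_isos C (fibre_geom K L t e n i j) (fibre_cross_ratio K L t e n i j)
      (PG (Dres L e i) (HomVD K L e n i j)) (cross_ratio_rel (Dres L e i) (HomVD K L e n i j))"
    unfolding quad_isos_def by (intro CollectI conjI ballI \<gamma>0 im)
  have "inv_into (fst (fibre_geom K L t e n i j)) \<gamma> \<in> quad_isos C (PG (Dres L e i) (HomVD K L e n i j))
      (cross_ratio_rel (Dres L e i) (HomVD K L e n i j)) (fibre_geom K L t e n i j) (fibre_cross_ratio K L t e n i j)"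
  proof (rule quad_isos_inv[OF \<gamma>])
    fix S assume "S \<in> snd (fibre_geom K L t e n i j)"
    then show "S \<subseteq> fst (fibre_geom K L t e n i j)" by (rule P.fibre_subspace_subset)
  next
    fix c assume "c \<in> C"
    from sub[OF this] show "fibre_cross_ratio K L t e n i j c \<subseteq> fst (fibre_geom K L t e n i j)
      \<times> fst (fibre_geom K L t e n i j) \<times> fst (fibre_geom K L t e n i j) \<times> fst (fibre_geom K L t e n i j)"
      unfolding F .
  qed
  with \<gamma> show ?thesis unfolding F by (intro exI conjI)
qed

end

lemma scalar_closed: "h \<in> {1..t} \<Longrightarrow> c \<in> carrier K \<Longrightarrow> c \<odot>\<^bsub>Dres L e h\<^esub> \<one>\<^bsub>Dres L e h\<^esub> \<in> carrier (Dres L e h)"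
  using right_vector_space.scalar_one_closed[OF V_right_vector_space, of h h c] by simp

lemma scalar_mult:
  assumes "h \<in> {1..t}" "c \<in> carrier K" "d \<in> carrier (Dres L e h)"
  shows "(c \<odot>\<^bsub>Dres L e h\<^esub> \<one>\<^bsub>Dres L e h\<^esub>) \<otimes>\<^bsub>Dres L e h\<^esub> d = c \<odot>\<^bsub>Dres L e h\<^esub> d"
    "d \<otimes>\<^bsub>Dres L e h\<^esub> (c \<odot>\<^bsub>Dres L e h\<^esub> \<one>\<^bsub>Dres L e h\<^esub>) = c \<odot>\<^bsub>Dres L e h\<^esub> d"
  using right_vector_space.scalar_commute[OF V_right_vector_space[OF assms(1,1)] assms(2,3)] .

text \<open>A coordinatization by \<open>E\<close> is composed with the one by \<open>D_i\<close>,
  and the rank makes the fundamental theorem applicable. The case of right modules is the same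
  statement for \<open>opp E\<close>, with the resulting isomorphism read between opposite
  rings.\<close>

lemma recovered:
  fixes E :: "'c ring" and W :: "('c, 'd) module"
  assumes "i \<in> {1..t}" "j \<in> {1..t}" "rank_is L e n i j r" "3 \<le> r" "division_ring E"
  shows "recovered_up_to_opp K L t e n i j E W"
proof -
  let ?H = "HomVD K L e n i j" and ?D = "Dres L e i" and ?G = "fibre_geom K L t e n i j"
  obtain ts where ts: "list_basis ?D ?H ts" "3 \<le> length ts"
    using rank_is_list_basis[OF assms(1-3)] HomVD_list_basis[OF assms(1,2)] assms(4) by metis
  obtain \<gamma> where \<gamma>: "\<gamma> \<in> geom_isos (PG ?D ?H) ?G"
    using fibre_coordinates_quad[OF assms(1,2), of "{}"] by (auto simp: quad_isos_def)
  have iso: "ring_iso ?D F \<noteq> {}"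
    if F: "division_ring F" "lmodule F W" "geom_isos ?G (PG F W) \<noteq> {}" for F :: "'c ring"
  proof -
    obtain \<beta> where "\<beta> \<in> geom_isos ?G (PG F W)" using F(3) by auto
    then have "collineation ?D ?H F W (\<beta> \<circ> \<gamma>)"
      using left_vector_space.intro[OF F(2) left_vector_space_axioms.intro[OF F(1)]]
      by (intro collineation.intro collineation_axioms.intro geom_isos_comp[OF \<gamma>]
          terminal_pair.H_left_vector_space[OF terminal_pair[OF assms(1,2)]])
    then show ?thesis by (rule collineation_ex_ring_iso[OF _ ts])
  qed
  have "?D \<simeq> E" if "lmodule E W" "geom_isos ?G (PG E W) \<noteq> {}"
    using iso[OF assms(5) that] by (simp add: is_ring_iso_def)
  moreover have "opp ?D \<simeq> E" if h: "lmodule (opp E) W" "geom_isos ?G (PG (opp E) W) \<noteq> {}"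
  proof -
    obtain \<sigma> where "\<sigma> \<in> ring_iso ?D (opp E)" using iso[OF division_ring_opp[OF assms(5)] h] by auto
    then have "\<sigma> \<in> ring_iso (opp ?D) (opp (opp E))" by (rule ring_iso_opp)
    then show ?thesis unfolding is_ring_iso_def opp_opp by blast
  qed
  ultimately show ?thesis by (simp add: recovered_up_to_opp_def)
qed

end

section \<open>Passing between geometry and species of two algebras\<close>

locale terminal_algebras = A: terminal_algebra K L t e n + B: terminal_algebra K L' t e' n
  for K :: "('k, 'p) ring_scheme" and L :: "('k, 'a) module" and L' :: "('k, 'b) module"
    and t :: nat and e :: "nat \<Rightarrow> 'a" and e' :: "nat \<Rightarrow> 'b" and n :: nat
begin

abbreviation coordinate_isos where
  "coordinate_isos C i j \<equiv> quad_isos C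
     (PG (Dres L e i) (HomVD K L e n i j)) (cross_ratio_rel (Dres L e i) (HomVD K L e n i j))
     (PG (Dres L' e' i) (HomVD K L' e' n i j)) (cross_ratio_rel (Dres L' e' i) (HomVD K L' e' n i j))"

text \<open>Conjugation with the coordinate bijections of both sides removes the fibres from the
  argument; only projective spaces remain to be compared.\<close>

lemma fibre_isos_iff:
  assumes i: "i \<in> {1..t}" and j: "j \<in> {1..t}" and C: "C \<subseteq> carrier K"
  shows "quad_isos C (fibre_geom K L t e n i j) (fibre_cross_ratio K L t e n i j)
      (fibre_geom K L' t e' n i j) (fibre_cross_ratio K L' t e' n i j) \<noteq> {} \<longleftrightarrow> coordinate_isos C i j \<noteq> {}"
proof -
  obtain \<gamma> where \<gamma>: "\<gamma> \<in> quad_isos C (fibre_geom K L t e n i j) (fibre_cross_ratio K L t e n i j)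
      (PG (Dres L e i) (HomVD K L e n i j)) (cross_ratio_rel (Dres L e i) (HomVD K L e n i j))"
    "inv_into (fibre L t e n i j) \<gamma> \<in> quad_isos C (PG (Dres L e i) (HomVD K L e n i j))
      (cross_ratio_rel (Dres L e i) (HomVD K L e n i j)) (fibre_geom K L t e n i j) (fibre_cross_ratio K L t e n i j)"
    using A.fibre_coordinates_quad[OF i j C] by (elim exE conjE)
  obtain \<gamma>' where \<gamma>': "\<gamma>' \<in> quad_isos C (fibre_geom K L' t e' n i j) (fibre_cross_ratio K L' t e' n i j)
      (PG (Dres L' e' i) (HomVD K L' e' n i j)) (cross_ratio_rel (Dres L' e' i) (HomVD K L' e' n i j))"
    "inv_into (fibre L' t e' n i j) \<gamma>' \<in> quad_isos C (PG (Dres L' e' i) (HomVD K L' e' n i j))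
      (cross_ratio_rel (Dres L' e' i) (HomVD K L' e' n i j)) (fibre_geom K L' t e' n i j) (fibre_cross_ratio K L' t e' n i j)"
    using B.fibre_coordinates_quad[OF i j C] by (elim exE conjE)
  show ?thesis
    using quad_isos_comp[OF quad_isos_comp[OF \<gamma>(2)] \<gamma>'(1)] quad_isos_comp[OF quad_isos_comp[OF \<gamma>(1)] \<gamma>'(2)]
    by auto
qed

lemma ambiguity_iso_iff:
  "ambiguity_iso K t n L e L' e' \<longleftrightarrow> (\<forall>i\<in>{1..t}. \<forall>j\<in>{1..t}. coordinate_isos {} i j \<noteq> {})"
  unfolding ambiguity_iso_def
  by (intro ball_cong refl) (subst fibre_isos_iff[symmetric], auto simp: quad_isos_def)

lemma ambiguity_iso_over_iff:
  "ambiguity_iso_over K t n L e L' e' \<longleftrightarrow> (\<forall>i\<in>{1..t}. \<forall>j\<in>{1..t}. coordinate_isos (carrier K) i j \<noteq> {})"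
  unfolding ambiguity_iso_over_def
  by (intro ball_cong refl) (subst fibre_isos_iff[symmetric], auto simp: quad_isos_def)

text \<open>Interpolates between ring isomorphisms, for empty \<open>C\<close>, and isomorphisms of
  algebras, for \<open>C\<close> the whole field (\<open>alg_iso_eq\<close>).\<close>

definition scalar_ring_isos :: "'k set \<Rightarrow> nat \<Rightarrow> ('a set \<Rightarrow> 'b set) set" where
  "scalar_ring_isos C h = {\<sigma> \<in> ring_iso (Dres L e h) (Dres L' e' h).
     \<forall>c\<in>C. \<sigma> (c \<odot>\<^bsub>Dres L e h\<^esub> \<one>\<^bsub>Dres L e h\<^esub>) = c \<odot>\<^bsub>Dres L' e' h\<^esub> \<one>\<^bsub>Dres L' e' h\<^esub>}"

definition right_isos where
  "right_isos \<sigma> i j = semilinear_iso (opp (Dres L e i)) \<sigma> (Vright L e n i j) (Vright L' e' n i j)"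

lemma alg_iso_eq:
  assumes h: "h \<in> {1..t}"
  shows "alg_iso K (Dres L e h) (Dres L' e' h) = scalar_ring_isos (carrier K) h"
proof (intro equalityI subsetI)
  fix \<sigma> assume \<sigma>: "\<sigma> \<in> alg_iso K (Dres L e h) (Dres L' e' h)"
  then have "\<sigma> \<one>\<^bsub>Dres L e h\<^esub> = \<one>\<^bsub>Dres L' e' h\<^esub>" by (auto simp: alg_iso_def ring_iso_memE(4))
  then show "\<sigma> \<in> scalar_ring_isos (carrier K) h"
    using \<sigma> ring.ring_simprules(6)[OF A.Dres_ring[OF h]] by (auto simp: alg_iso_def scalar_ring_isos_def)
next
  fix \<sigma> assume \<sigma>: "\<sigma> \<in> scalar_ring_isos (carrier K) h"
  then have iso: "\<sigma> \<in> ring_iso (Dres L e h) (Dres L' e' h)" by (simp add: scalar_ring_isos_def)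
  have "\<sigma> (c \<odot>\<^bsub>Dres L e h\<^esub> x) = c \<odot>\<^bsub>Dres L' e' h\<^esub> \<sigma> x" if c: "c \<in> carrier K" and x: "x \<in> carrier (Dres L e h)" for c x
    using ring_iso_memE(2)[OF iso A.scalar_closed[OF h c] x] A.scalar_mult(1)[OF h c x]
      B.scalar_mult(1)[OF h c ring_iso_memE(1)[OF iso x]] \<sigma> c by (simp add: scalar_ring_isos_def)
  then show "\<sigma> \<in> alg_iso K (Dres L e h) (Dres L' e' h)" using iso by (simp add: alg_iso_def)
qed

lemma terminal_vertices_index: "h \<in> terminal_vertices L t e n \<Longrightarrow> h \<in> {1..t}"
  by (simp add: terminal_vertices_def)

lemma V_zero_iff:
  assumes i: "i \<in> {1..t}" and j: "j \<in> {1..t}"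
    and "list_basis (opp (Dres L e i)) (Vright L e n i j) xs"
    and "list_basis (opp (Dres L' e' i)) (Vright L' e' n i j) ys" "length xs = length ys"
  shows "V L e n i j = {\<zero>\<^bsub>L\<^esub>} \<longleftrightarrow> V L' e' n i j = {\<zero>\<^bsub>L'\<^esub>}"
  using left_vector_space.list_basis_Nil_iff[OF A.Vright_left_vector_space[OF i j] assms(3)]
    left_vector_space.list_basis_Nil_iff[OF B.Vright_left_vector_space[OF i j] assms(4)] assms(5)
  by auto

lemma coordinate_collineation:
  assumes "i \<in> {1..t}" "j \<in> {1..t}" "\<delta> \<in> coordinate_isos C i j"
  shows "collineation (Dres L e i) (HomVD K L e n i j) (Dres L' e' i) (HomVD K L' e' n i j) \<delta>"
  using assms(3) terminal_pair.H_left_vector_space[OF A.terminal_pair[OF assms(1,2)]]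
    terminal_pair.H_left_vector_space[OF B.terminal_pair[OF assms(1,2)]]
  by (intro collineation.intro collineation_axioms.intro) (simp_all add: quad_isos_def)

text \<open>Ranks are dimensions of the coordinatizing spaces, and collineations preserve these at
  every pair, including those of rank below three.\<close>

lemma basis_lengths_of_collineation:
  assumes i: "i \<in> {1..t}" and j: "j \<in> {1..t}" and \<delta>: "\<delta> \<in> coordinate_isos C i j"
    and xs: "list_basis (opp (Dres L e i)) (Vright L e n i j) xs"
    and ys: "list_basis (opp (Dres L' e' i)) (Vright L' e' n i j) ys"
  shows "length xs = length ys"
proof -
  interpret c: collineation "Dres L e i" "HomVD K L e n i j" "Dres L' e' i" "HomVD K L' e' n i j" \<delta>
    by (rule coordinate_collineation[OF i j \<delta>])
  obtain ts us where "list_basis (Dres L e i) (HomVD K L e n i j) ts" "length ts = length xs"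
    and "list_basis (Dres L' e' i) (HomVD K L' e' n i j) us" "length us = length ys"
    using A.HomVD_list_basis[OF i j xs] B.HomVD_list_basis[OF i j ys] by auto
  then show ?thesis using c.list_basis_transfer c.D'.list_basis_length_unique by metis
qed

text \<open>
  At a vertex with a nonzero terminal layer the rank condition supplies a projective space of
  dimension at least two; every other terminal vertex is a target, where both algebras are \<open>k\<close>.
\<close>

lemma ex_scalar_ring_iso:
  assumes \<delta>: "\<And>i j. \<lbrakk>i \<in> {1..t}; j \<in> {1..t}\<rbrakk> \<Longrightarrow> coordinate_isos C i j \<noteq> {}" and C: "C \<subseteq> carrier K"
    and h: "h \<in> terminal_vertices L t e n"
  shows "scalar_ring_isos C h \<noteq> {}"
proof (cases "JP L e n h = {\<zero>\<^bsub>L\<^esub>}")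
  case False
  have ht: "h \<in> {1..t}" by (rule terminal_vertices_index[OF h])
  obtain j r where j: "j \<in> {1..t}" "rank_is L e n h j r" "3 \<le> r"
    using A.rank_three_targets ht False unfolding rank_three_targets_def by blast
  obtain ts where ts: "list_basis (Dres L e h) (HomVD K L e n h j) ts" "3 \<le> length ts"
    using A.rank_is_list_basis[OF ht j(1,2)] A.HomVD_list_basis[OF ht j(1)] j(3) by metis
  obtain d where d: "d \<in> coordinate_isos C h j" using \<delta>[OF ht j(1)] by auto
  obtain \<sigma> where \<sigma>: "\<sigma> \<in> ring_iso (Dres L e h) (Dres L' e' h)"
    and s: "\<forall>c. c \<odot>\<^bsub>Dres L e h\<^esub> \<one>\<^bsub>Dres L e h\<^esub> \<in> carrier (Dres L e h) \<longrightarrow> c \<odot>\<^bsub>Dres L' e' h\<^esub> \<one>\<^bsub>Dres L' e' h\<^esub> \<in> carrier (Dres L' e' h) \<longrightarrow>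
      (\<forall>x\<in>carrier (Dres L' e' h). (c \<odot>\<^bsub>Dres L' e' h\<^esub> \<one>\<^bsub>Dres L' e' h\<^esub>) \<otimes>\<^bsub>Dres L' e' h\<^esub> x
        = x \<otimes>\<^bsub>Dres L' e' h\<^esub> (c \<odot>\<^bsub>Dres L' e' h\<^esub> \<one>\<^bsub>Dres L' e' h\<^esub>)) \<longrightarrow>
      quad d ` cross_ratio_rel (Dres L e h) (HomVD K L e n h j) c \<subseteq> cross_ratio_rel (Dres L' e' h) (HomVD K L' e' n h j) c
      \<longrightarrow> \<sigma> (c \<odot>\<^bsub>Dres L e h\<^esub> \<one>\<^bsub>Dres L e h\<^esub>) = c \<odot>\<^bsub>Dres L' e' h\<^esub> \<one>\<^bsub>Dres L' e' h\<^esub>"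
    by (rule bexE[OF collineation_ring_iso[OF coordinate_collineation[OF ht j(1) d] ts]])
  have "\<sigma> (c \<odot>\<^bsub>Dres L e h\<^esub> \<one>\<^bsub>Dres L e h\<^esub>) = c \<odot>\<^bsub>Dres L' e' h\<^esub> \<one>\<^bsub>Dres L' e' h\<^esub>" if "c \<in> C" for c
  proof -
    have c: "c \<in> carrier K" using that C by auto
    have "quad d ` cross_ratio_rel (Dres L e h) (HomVD K L e n h j) c = cross_ratio_rel (Dres L' e' h) (HomVD K L' e' n h j) c"
      using d that unfolding quad_isos_def by blast
    then show ?thesis
      using s A.scalar_closed[OF ht c] B.scalar_closed[OF ht c] B.scalar_mult[OF ht c] by simp
  qed
  then show ?thesis using \<sigma> by (auto simp: scalar_ring_isos_def)
next
  case True
  have ht: "h \<in> {1..t}" by (rule terminal_vertices_index[OF h])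
  obtain i where i: "i \<in> {1..t}" "V L e n i h \<noteq> {\<zero>\<^bsub>L\<^esub>}"
    using h True unfolding terminal_vertices_def by blast
  obtain xs ys where b: "list_basis (opp (Dres L e i)) (Vright L e n i h) xs"
    "list_basis (opp (Dres L' e' i)) (Vright L' e' n i h) ys"
    using A.Vright_ex_basis[OF i(1) ht] B.Vright_ex_basis[OF i(1) ht] by auto
  obtain d where d: "d \<in> coordinate_isos C i h" using \<delta>[OF i(1) ht] by auto
  \<comment> \<open>Equality of ranks carries the nonvanishing over to the second algebra, so that
    its residue algebra at \<open>h\<close> is the field as well.\<close>
  have "V L' e' n i h \<noteq> {\<zero>\<^bsub>L'\<^esub>}"
    using V_zero_iff[OF i(1) ht b basis_lengths_of_collineation[OF i(1) ht d b]] i(2) by simp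
  then obtain \<phi> \<phi>' where \<phi>: "\<phi> \<in> alg_iso K (regular K) (Dres L e h)" "\<phi>' \<in> alg_iso K (regular K) (Dres L' e' h)"
    using A.split_targets B.split_targets i ht unfolding split_targets_def by blast
  have iso: "\<phi> \<in> ring_iso (regular K) (Dres L e h)" "\<phi>' \<in> ring_iso (regular K) (Dres L' e' h)"
    using \<phi> by (auto simp: alg_iso_def)
  have KR: "ring (regular K)"
  proof (rule ringI)
    show "abelian_group (regular K)" using A.K.regular_lmodule by (simp add: lmodule_def)
    show "monoid (regular K)" by (rule monoidI) (simp_all add: A.K.m_assoc)
  qed (simp_all add: A.K.l_distr A.K.r_distr)
  have sc: "\<phi> c = c \<odot>\<^bsub>Dres L e h\<^esub> \<one>\<^bsub>Dres L e h\<^esub>" "\<phi>' c = c \<odot>\<^bsub>Dres L' e' h\<^esub> \<one>\<^bsub>Dres L' e' h\<^esub>" if "c \<in> carrier K" for c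
  proof -
    have "\<And>x. x \<in> carrier K \<Longrightarrow> \<phi> (c \<otimes>\<^bsub>K\<^esub> x) = c \<odot>\<^bsub>Dres L e h\<^esub> \<phi> x"
      "\<And>x. x \<in> carrier K \<Longrightarrow> \<phi>' (c \<otimes>\<^bsub>K\<^esub> x) = c \<odot>\<^bsub>Dres L' e' h\<^esub> \<phi>' x"
      using \<phi> that unfolding alg_iso_def by simp_all
    from this[OF A.K.one_closed]
    show "\<phi> c = c \<odot>\<^bsub>Dres L e h\<^esub> \<one>\<^bsub>Dres L e h\<^esub>" "\<phi>' c = c \<odot>\<^bsub>Dres L' e' h\<^esub> \<one>\<^bsub>Dres L' e' h\<^esub>"
      using that ring_iso_memE(4)[OF iso(1)] ring_iso_memE(4)[OF iso(2)] by simp_all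
  qed
  \<comment> \<open>Both residue algebras are copies of the field, embedded by
    \<open>c \<mapsto> c 1\<close>, and are matched through it.\<close>
  let ?\<sigma> = "\<phi>' \<circ> inv_into (carrier K) \<phi>"
  have "?\<sigma> \<in> ring_iso (Dres L e h) (Dres L' e' h)"
    using ring_iso_set_trans[OF ring_iso_set_sym[OF KR iso(1)] iso(2)] by simp
  moreover have "?\<sigma> (c \<odot>\<^bsub>Dres L e h\<^esub> \<one>\<^bsub>Dres L e h\<^esub>) = c \<odot>\<^bsub>Dres L' e' h\<^esub> \<one>\<^bsub>Dres L' e' h\<^esub>" if "c \<in> C" for c
  proof -
    have c: "c \<in> carrier K" using that C by auto
    have "inj_on \<phi> (carrier K)" using ring_iso_memE(5)[OF iso(1)] by (simp add: bij_betw_def)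
    then have "inv_into (carrier K) \<phi> (\<phi> c) = c" using c by (rule inv_into_f_f)
    then show ?thesis using sc[OF c] by simp
  qed
  ultimately show ?thesis by (auto simp: scalar_ring_isos_def)
qed

text \<open>One \<open>\<sigma> h\<close> is fixed per vertex and then used for all targets. The
  right semilinear maps come from bases of equal length, so the collineation at a pair is needed
  only for its rank. The closure statement is kept for the comparison of left actions.\<close>

lemma species_of_ambiguity:
  assumes \<delta>: "\<And>i j. \<lbrakk>i \<in> {1..t}; j \<in> {1..t}\<rbrakk> \<Longrightarrow> coordinate_isos C i j \<noteq> {}" and C: "C \<subseteq> carrier K"
  shows "\<exists>\<sigma> f. (\<forall>h\<in>terminal_vertices L t e n. \<sigma> h \<in> scalar_ring_isos C h)
    \<and> (\<forall>h\<in>{1..t}. \<forall>a\<in>carrier (Dres L e h). \<sigma> h a \<in> carrier (Dres L' e' h))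
    \<and> (\<forall>i\<in>{1..t}. \<forall>j\<in>{1..t}. f i j \<in> right_isos (\<sigma> i) i j)"
proof -
  let ?T = "terminal_vertices L t e n"
  \<comment> \<open>At vertices off the terminal layer a constant in the target carrier serves as
    default, so that the action of \<open>\<sigma> h a\<close> on the zero module is still governed
    by the module laws.\<close>
  define \<sigma> where "\<sigma> h = (if h \<in> ?T then SOME s. s \<in> scalar_ring_isos C h else (\<lambda>_. \<zero>\<^bsub>Dres L' e' h\<^esub>))" for h
  have \<sigma>: "\<sigma> h \<in> scalar_ring_isos C h" if "h \<in> ?T" for h
    using some_in_eq[of "scalar_ring_isos C h"] ex_scalar_ring_iso[OF \<delta> C that] that by (simp add: \<sigma>_def)
  have \<sigma>c: "\<sigma> h a \<in> carrier (Dres L' e' h)" if h: "h \<in> {1..t}" and a: "a \<in> carrier (Dres L e h)" for h a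
  proof (cases "h \<in> ?T")
    case True
    then have "\<sigma> h \<in> ring_iso (Dres L e h) (Dres L' e' h)" using \<sigma> by (auto simp: scalar_ring_isos_def)
    then show ?thesis using a by (rule ring_iso_memE(1))
  next
    case False
    then show ?thesis using ring.ring_simprules(2)[OF B.Dres_ring[OF h]] by (simp add: \<sigma>_def)
  qed
  have "right_isos (\<sigma> i) i j \<noteq> {}" if i: "i \<in> {1..t}" and j: "j \<in> {1..t}" for i j
  proof -
    obtain xs ys where b: "list_basis (opp (Dres L e i)) (Vright L e n i j) xs"
      "list_basis (opp (Dres L' e' i)) (Vright L' e' n i j) ys"
      using A.Vright_ex_basis[OF i j] B.Vright_ex_basis[OF i j] by auto
    obtain d where d: "d \<in> coordinate_isos C i j" using \<delta>[OF i j] by auto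
    note len = basis_lengths_of_collineation[OF i j d b]
    show ?thesis
    proof (cases "i \<in> ?T")
      case True
      then have "\<sigma> i \<in> ring_iso (opp (Dres L e i)) (opp (Dres L' e' i))"
        using \<sigma> by (auto simp: scalar_ring_isos_def intro: ring_iso_opp)
      then show ?thesis unfolding right_isos_def
        using list_basis_semilinear_iso[OF A.Vright_left_vector_space[OF i j] B.Vright_left_vector_space[OF i j] _ b len]
        by blast
    next
      case False
      \<comment> \<open>No arrow starts at such an \<open>i\<close>; the modules vanish on both
        sides and the zero map is semilinear for the default.\<close>
      then have V: "V L e n i j = {\<zero>\<^bsub>L\<^esub>}" using A.source_terminal[OF i j] by blast
      then have V': "V L' e' n i j = {\<zero>\<^bsub>L'\<^esub>}" using V_zero_iff[OF i j b len] by simp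
      have "\<sigma> i a \<odot>\<^bsub>Vright L' e' n i j\<^esub> \<zero>\<^bsub>L'\<^esub> = \<zero>\<^bsub>L'\<^esub>" if "a \<in> carrier (Dres L e i)" for a
        using lmodule.smult_r_null[OF B.Vright_lmodule[OF i j], of "\<sigma> i a"] \<sigma>c[OF i that] by simp
      then have "(\<lambda>_. \<zero>\<^bsub>L'\<^esub>) \<in> right_isos (\<sigma> i) i j"
        unfolding right_isos_def semilinear_iso_def by (simp add: V V')
      then show ?thesis by blast
    qed
  qed
  then have "\<forall>i\<in>{1..t}. \<forall>j\<in>{1..t}. (SOME g. g \<in> right_isos (\<sigma> i) i j) \<in> right_isos (\<sigma> i) i j"
    by (simp add: some_in_eq)
  then show ?thesis using \<sigma> \<sigma>c
    by (intro exI[of _ \<sigma>] exI[of _ "\<lambda>i j. SOME g. g \<in> right_isos (\<sigma> i) i j"]) simp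
qed

text \<open>The given \<open>f i j\<close> is used for the equality of ranks. A semilinear map
  between the coordinatizing spaces is then built from their bases over \<open>\<sigma> i\<close>,
  and it induces the collineation, with cross-ratios preserved because \<open>\<sigma> i\<close>
  fixes the scalars from \<open>C\<close>.\<close>

lemma ambiguity_of_species:
  assumes C: "C \<subseteq> carrier K" and \<sigma>: "\<forall>h\<in>terminal_vertices L t e n. \<sigma> h \<in> scalar_ring_isos C h"
    and f: "\<forall>i\<in>{1..t}. \<forall>j\<in>{1..t}. f i j \<in> right_isos (\<sigma> i) i j"
    and i: "i \<in> {1..t}" and j: "j \<in> {1..t}"
  shows "coordinate_isos C i j \<noteq> {}"
proof -
  obtain xs ys where b: "list_basis (opp (Dres L e i)) (Vright L e n i j) xs"
    "list_basis (opp (Dres L' e' i)) (Vright L' e' n i j) ys"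
    using A.Vright_ex_basis[OF i j] B.Vright_ex_basis[OF i j] by auto
  obtain ts us where W: "list_basis (Dres L e i) (HomVD K L e n i j) ts" "length ts = length xs"
    "list_basis (Dres L' e' i) (HomVD K L' e' n i j) us" "length us = length ys"
    using A.HomVD_list_basis[OF i j b(1)] B.HomVD_list_basis[OF i j b(2)] by auto
  have fij: "f i j \<in> semilinear_iso (opp (Dres L e i)) (\<sigma> i) (Vright L e n i j) (Vright L' e' n i j)"
    using f i j by (simp add: right_isos_def)
  note vs = terminal_pair.H_left_vector_space[OF A.terminal_pair[OF i j]]
    terminal_pair.H_left_vector_space[OF B.terminal_pair[OF i j]]
  show ?thesis
  proof (cases "i \<in> terminal_vertices L t e n")
    case True
    then have iso: "\<sigma> i \<in> ring_iso (Dres L e i) (Dres L' e' i)"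
      and s: "\<And>c. c \<in> C \<Longrightarrow> \<sigma> i (c \<odot>\<^bsub>Dres L e i\<^esub> \<one>\<^bsub>Dres L e i\<^esub>) = c \<odot>\<^bsub>Dres L' e' i\<^esub> \<one>\<^bsub>Dres L' e' i\<^esub>"
      using \<sigma> by (auto simp: scalar_ring_isos_def)
    have bij: "bij_betw (\<sigma> i) (carrier (Dres L e i)) (carrier (Dres L' e' i))" by (rule ring_iso_memE(5)[OF iso])
    have "list_basis (opp (Dres L' e' i)) (Vright L' e' n i j) (map (f i j) xs)"
      using semilinear_iso_list_basis[OF A.Vright_left_vector_space[OF i j] B.Vright_left_vector_space[OF i j] fij _ b(1)] bij
      by simp
    then have "length (map (f i j) xs) = length ys"
      using left_vector_space.list_basis_length_unique[OF B.Vright_left_vector_space[OF i j] _ b(2)] by blast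
    then have "length ts = length us" using W by simp
    then obtain g where g: "g \<in> semilinear_iso (Dres L e i) (\<sigma> i) (HomVD K L e n i j) (HomVD K L' e' n i j)"
      using list_basis_semilinear_iso[OF vs iso W(1,3)] by auto
    have "c \<odot>\<^bsub>Dres L e i\<^esub> \<one>\<^bsub>Dres L e i\<^esub> \<in> carrier (Dres L e i)" if "c \<in> C" for c
      using A.scalar_closed[OF i] that C by auto
    then have "(`) g \<in> coordinate_isos C i j"
      using s by (rule semilinear_iso_quad_isos[OF vs g bij])
    then show ?thesis by blast
  next
    case False
    then have V: "V L e n i j = {\<zero>\<^bsub>L\<^esub>}" using A.source_terminal[OF i j] by blast
    then have "V L' e' n i j = f i j ` {\<zero>\<^bsub>L\<^esub>}" using fij by (simp add: semilinear_iso_def bij_betw_def)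
    then have V': "V L' e' n i j = {\<zero>\<^bsub>L'\<^esub>}" using B.zero_in_V[OF i j] by auto
    have "xs = []" "ys = []"
      using left_vector_space.list_basis_Nil_iff[OF A.Vright_left_vector_space[OF i j] b(1)]
        left_vector_space.list_basis_Nil_iff[OF B.Vright_left_vector_space[OF i j] b(2)] V V' by simp_all
    then have "carrier (HomVD K L e n i j) = {\<zero>\<^bsub>HomVD K L e n i j\<^esub>}" "carrier (HomVD K L' e' n i j) = {\<zero>\<^bsub>HomVD K L' e' n i j\<^esub>}"
      using left_vector_space.list_basis_Nil_iff[OF vs(1) W(1)] left_vector_space.list_basis_Nil_iff[OF vs(2) W(3)] W by auto
    note PG = PG_trivial[OF vs(1) this(1)] PG_trivial[OF vs(2) this(2)]
    have "cross_ratio_rel (Dres L e i) (HomVD K L e n i j) c = {}"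
      "cross_ratio_rel (Dres L' e' i) (HomVD K L' e' n i j) c = {}" if "c \<in> C" for c
      using cross_ratio_rel_points[OF vs(1) A.scalar_closed[OF i]] cross_ratio_rel_points[OF vs(2) B.scalar_closed[OF i]]
        PG that C by (auto simp: PG_def subset_iff)
    \<comment> \<open>Both geometries are empty, with no blocks and no quadruples, so any function
      is an isomorphism between them.\<close>
    then have "undefined \<in> coordinate_isos C i j" by (simp add: quad_isos_def geom_isos_def PG bij_betw_def)
    then show ?thesis by blast
  qed
qed

text \<open>
  A nonzero \<open>V\<^sub>i\<^sub>j\<close> forces \<open>D\<^sub>j = k\<close>, so left semilinearity only concerns scalars from \<open>k\<close>, and
  these act through \<open>D\<^sub>i\<close> as well.
\<close>

lemma right_isos_left_semilinear:
  assumes i: "i \<in> {1..t}" and j: "j \<in> {1..t}"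
    and \<sigma>: "\<And>h. h \<in> terminal_vertices L t e n \<Longrightarrow> \<sigma> h \<in> scalar_ring_isos (carrier K) h"
    and \<sigma>c: "\<And>a. a \<in> carrier (Dres L e j) \<Longrightarrow> \<sigma> j a \<in> carrier (Dres L' e' j)"
    and f: "f \<in> right_isos (\<sigma> i) i j"
  shows "f \<in> semilinear_iso (Dres L e j) (\<sigma> j) (Vleft L e n i j) (Vleft L' e' n i j)"
proof -
  have bij: "bij_betw f (V L e n i j) (V L' e' n i j)"
    and add: "\<And>x y. \<lbrakk>x \<in> V L e n i j; y \<in> V L e n i j\<rbrakk> \<Longrightarrow> f (x \<oplus>\<^bsub>L\<^esub> y) = f x \<oplus>\<^bsub>L'\<^esub> f y"
    and sm: "\<And>a x. \<lbrakk>a \<in> carrier (Dres L e i); x \<in> V L e n i j\<rbrakk> \<Longrightarrow>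
      f (a \<odot>\<^bsub>Vright L e n i j\<^esub> x) = \<sigma> i a \<odot>\<^bsub>Vright L' e' n i j\<^esub> f x"
    using f by (auto simp: right_isos_def semilinear_iso_def)
  have "f (a \<odot>\<^bsub>Vleft L e n i j\<^esub> x) = \<sigma> j a \<odot>\<^bsub>Vleft L' e' n i j\<^esub> f x"
    if a: "a \<in> carrier (Dres L e j)" and x: "x \<in> V L e n i j" for a x
  proof (cases "V L e n i j = {\<zero>\<^bsub>L\<^esub>}")
    case True
    have "V L' e' n i j = f ` {\<zero>\<^bsub>L\<^esub>}" using bij True by (simp add: bij_betw_def)
    then have V': "V L' e' n i j = {\<zero>\<^bsub>L'\<^esub>}" using B.zero_in_V[OF i j] by auto
    have f0: "f v = \<zero>\<^bsub>L'\<^esub>" if "v \<in> V L e n i j" for v using bij_betw_apply[OF bij that] V' by simp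
    have "a \<odot>\<^bsub>Vleft L e n i j\<^esub> x \<in> V L e n i j"
      using lmodule.smult_closed[OF A.Vleft_lmodule[OF i j], of a x] a x by simp
    then show ?thesis
      using f0 x lmodule.smult_r_null[OF B.Vleft_lmodule[OF i j], of "\<sigma> j a"] \<sigma>c[OF a] by simp
  next
    case False
    obtain c where c: "c \<in> carrier K" "a = c \<odot>\<^bsub>Dres L e j\<^esub> \<one>\<^bsub>Dres L e j\<^esub>"
      using terminal_pair.Dres_scalar[OF A.terminal_pair[OF i j] False a] by auto
    have "\<sigma> i (c \<odot>\<^bsub>Dres L e i\<^esub> \<one>\<^bsub>Dres L e i\<^esub>) = c \<odot>\<^bsub>Dres L' e' i\<^esub> \<one>\<^bsub>Dres L' e' i\<^esub>"
      "\<sigma> j a = c \<odot>\<^bsub>Dres L' e' j\<^esub> \<one>\<^bsub>Dres L' e' j\<^esub>"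
      using \<sigma>[OF A.source_terminal[OF i j False]] \<sigma>[OF A.target_terminal[OF i j False]] c
      by (auto simp: scalar_ring_isos_def)
    then show ?thesis
      using sm[OF A.scalar_closed[OF i c(1)] x] A.scalar_actions[OF i j c(1) x]
        B.scalar_actions[OF i j c(1) bij_betw_apply[OF bij x]] c(2) by simp
  qed
  then show ?thesis using bij add by (simp add: semilinear_iso_def)
qed

text \<open>The case of empty \<open>C\<close>: the residue algebras are compared as rings and the
  bimodules from the right.\<close>

theorem ambiguity_iso_iff_species: "ambiguity_iso K t n L e L' e' \<longleftrightarrow> species_ring_iso t n L e L' e'"
proof
  assume "ambiguity_iso K t n L e L' e'"
  then show "species_ring_iso t n L e L' e'"
    using species_of_ambiguity[of "{}"] unfolding ambiguity_iso_iff species_ring_iso_def right_isos_def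
      scalar_ring_isos_def by fastforce
next
  assume "species_ring_iso t n L e L' e'"
  then obtain \<sigma> f where "\<forall>h\<in>terminal_vertices L t e n. \<sigma> h \<in> scalar_ring_isos {} h"
    "\<forall>i\<in>{1..t}. \<forall>j\<in>{1..t}. f i j \<in> right_isos (\<sigma> i) i j"
    unfolding species_ring_iso_def right_isos_def scalar_ring_isos_def by auto
  then show "ambiguity_iso K t n L e L' e'"
    unfolding ambiguity_iso_iff using ambiguity_of_species[of "{}" \<sigma> f] by simp
qed

text \<open>The case where \<open>C\<close> is the whole field. Left semilinearity, which the
  geometry does not mention, is supplied by \<open>right_isos_left_semilinear\<close>; the converse
  direction discards it.\<close>

theorem ambiguity_iso_over_iff_species: "ambiguity_iso_over K t n L e L' e' \<longleftrightarrow> species_iso K t n L e L' e'"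
proof
  assume "ambiguity_iso_over K t n L e L' e'"
  then obtain \<sigma> f where \<sigma>: "\<forall>h\<in>terminal_vertices L t e n. \<sigma> h \<in> scalar_ring_isos (carrier K) h"
    and \<sigma>c: "\<forall>h\<in>{1..t}. \<forall>a\<in>carrier (Dres L e h). \<sigma> h a \<in> carrier (Dres L' e' h)"
    and f: "\<forall>i\<in>{1..t}. \<forall>j\<in>{1..t}. f i j \<in> right_isos (\<sigma> i) i j"
    using species_of_ambiguity[of "carrier K"] unfolding ambiguity_iso_over_iff by auto
  have "\<sigma> h \<in> alg_iso K (Dres L e h) (Dres L' e' h)" if "h \<in> terminal_vertices L t e n" for h
    using \<sigma> that alg_iso_eq[OF terminal_vertices_index[OF that]] by simp
  moreover have "f i j \<in> semilinear_iso (opp (Dres L e i)) (\<sigma> i) (Vright L e n i j) (Vright L' e' n i j)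
      \<and> f i j \<in> semilinear_iso (Dres L e j) (\<sigma> j) (Vleft L e n i j) (Vleft L' e' n i j)"
    if "i \<in> {1..t}" "j \<in> {1..t}" for i j
    using right_isos_left_semilinear[OF that, of \<sigma> "f i j"] \<sigma> \<sigma>c f that by (simp add: right_isos_def)
  ultimately show "species_iso K t n L e L' e'"
    unfolding species_iso_def by (intro exI[of _ \<sigma>] exI[of _ f]) simp
next
  assume "species_iso K t n L e L' e'"
  then obtain \<sigma> f where \<sigma>: "\<forall>h\<in>terminal_vertices L t e n. \<sigma> h \<in> alg_iso K (Dres L e h) (Dres L' e' h)"
    and f: "\<forall>i\<in>{1..t}. \<forall>j\<in>{1..t}. f i j \<in> right_isos (\<sigma> i) i j"
    unfolding species_iso_def right_isos_def by blast
  have "\<forall>h\<in>terminal_vertices L t e n. \<sigma> h \<in> scalar_ring_isos (carrier K) h"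
    using \<sigma> alg_iso_eq terminal_vertices_index by simp
  then show "ambiguity_iso_over K t n L e L' e'"
    unfolding ambiguity_iso_over_iff using ambiguity_of_species[OF subset_refl _ f] by simp
qed

end

text \<open>Collineations alone see the residue algebras only as rings, whence the first
  equivalence. Cross-ratios in the field add the missing linearity, whence the second. The last
  conjunct is the ambiguity by opposites: whether \<open>D_i\<close> or its opposite is recovered
  depends on the side on which the coordinatizing modules are taken.\<close>

theorem theorem10p2:
  fixes K :: "('k, 'p) ring_scheme"
    and L :: "('k, 'a) module" and e :: "nat \<Rightarrow> 'a"
    and L' :: "('k, 'b) module" and e' :: "nat \<Rightarrow> 'b"
    and t n :: nat
  assumes "basic_algebra K L t e n"
    and "split_targets K L t e n"
    and "rank_three_targets L t e n"
    and "basic_algebra K L' t e' n"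
    and "split_targets K L' t e' n"
    and "rank_three_targets L' t e' n"
  shows "(ambiguity_iso K t n L e L' e' \<longleftrightarrow> species_ring_iso t n L e L' e')
    \<and> (ambiguity_iso_over K t n L e L' e' \<longleftrightarrow> species_iso K t n L e L' e')
    \<and> (species_iso K t n L e L' e' \<longrightarrow> ambiguity_iso K t n L e L' e')
    \<and> (\<forall>i\<in>{1..t}. \<forall>j\<in>{1..t}. \<forall>r (E :: 'c ring) (W :: ('c, 'd) module).
         rank_is L e n i j r \<and> 3 \<le> r \<and> division_ring E
           \<longrightarrow> recovered_up_to_opp K L t e n i j E W)"
proof -
  interpret terminal_algebras K L L' t e e' n
    using assms by (simp add: terminal_algebras_def terminal_algebra_def terminal_algebra_axioms_def)
  \<comment> \<open>Forgetting the cross-ratios; with the second equivalence this yields the third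
    conjunct.\<close>
  have "ambiguity_iso_over K t n L e L' e' \<Longrightarrow> ambiguity_iso K t n L e L' e'"
    unfolding ambiguity_iso_over_def ambiguity_iso_def by blast
  then show ?thesis
    using ambiguity_iso_iff_species ambiguity_iso_over_iff_species A.recovered by blast
qed

end
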